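(* Let $\psi\in C(\overline{\Omega_T})$ with $0\le\psi\le L$. The least solution $w^*$ with obstacle $\psi$ is continuous up to the boundary of $\Omega_T$, satisfies $w^*=\psi$ on $\partial_p\Omega_T$, and is $p$-parabolic in the open set $\{w^*>\psi\}$.
   Context: Throughout, $p>2$, $\Omega\subset\mathbb R^n$ is a bounded domain with regular boundary, $T>0$, $\Omega_T=\Omega\times(0,T)$, and $\partial_p\Omega_T=(\overline\Omega\times\{0\})\cup(\partial\Omega\times[0,T])$ is the parabolic boundary. A function $u\in L^p_{loc}(0,T;W^{1,p}_{loc}(\Omega))$ is a weak supersolution in $\Omega_T$ if $\int\!\!\int_{\Omega_T}(|\nabla u|^{p-2}\nabla u\cdot\nabla\varphi-u\,\partial_t\varphi)\,dx\,dt\ge0$ for all $\varphi\in C_0^\infty(\Omega_T)$, $\varphi\ge0$; a weak solution if equality holds for all $\varphi\in C_0^\infty(\Omega_T)$; a $p$-parabolic function is a continuous weak solution. Let $Q_r(x,t)=B_r(x)\times(t-r^p,t+r^p)$; the ess liminf regularization of $f$ is $f^*(x,t)=\lim_{r\to0}\operatorname{ess\,inf}_{Q_r(x,t)\cap\Omega_T}f$, and $f$ is ess liminf-regularized if $f=f^*$. For a measurable obstacle $\psi$ with $0\le\psi\le L$, $\mathcal S_\psi$ is the class of ess liminf-regularized weak supersolutions $u$ in $\Omega_T$ with $u\ge\psi$ a.e.; with $w=\inf_{u\in\mathcal S_\psi}u$ (pointwise), the least solution with obstacle $\psi$ is $w^*$. *)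

theory Defs
  imports "HOL-Analysis.Analysis"
begin

type_synonym 'n pt = "(real^'n) \<times> real"

fun iter_dir :: "'a::real_normed_vector list \<Rightarrow> ('a \<Rightarrow> real) \<Rightarrow> 'a \<Rightarrow> real" where
  "iter_dir [] f = f"
| "iter_dir (v # vs) f = (\<lambda>z. frechet_derivative (iter_dir vs f) (at z) v)"

definition smooth_fun :: "('a::real_normed_vector \<Rightarrow> real) \<Rightarrow> bool" where
  "smooth_fun f \<longleftrightarrow> (\<forall>vs z. iter_dir vs f differentiable (at z))"

definition test_fun :: "'a::euclidean_space set \<Rightarrow> ('a \<Rightarrow> real) \<Rightarrow> bool" where
  "test_fun U \<phi> \<longleftrightarrow> smooth_fun \<phi> \<and> compact (closure {z. \<phi> z \<noteq> 0})
      \<and> closure {z. \<phi> z \<noteq> 0} \<subseteq> U"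

definition dx :: "'n::finite \<Rightarrow> ('n pt \<Rightarrow> real) \<Rightarrow> 'n pt \<Rightarrow> real" where
  "dx i \<phi> z = frechet_derivative \<phi> (at z) (axis i 1, 0)"

definition dt :: "('n::finite pt \<Rightarrow> real) \<Rightarrow> 'n pt \<Rightarrow> real" where
  "dt \<phi> z = frechet_derivative \<phi> (at z) (0, 1)"

definition grad_x :: "('n::finite pt \<Rightarrow> real) \<Rightarrow> 'n pt \<Rightarrow> real^'n" where
  "grad_x \<phi> z = (\<chi> i. dx i \<phi> z)"

text \<open>v is locally in L^p on U with weak spatial gradient g locally in L^p on U
  (for cylinders U = Omega_T this is L^p_loc(0,T;W^{1,p}_loc(Omega))).\<close>
definition sob_loc :: "real \<Rightarrow> 'n::finite pt set \<Rightarrow> ('n pt \<Rightarrow> real) \<Rightarrow> ('n pt \<Rightarrow> real^'n) \<Rightarrow> bool" where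
  "sob_loc p U v g \<longleftrightarrow>
     (\<lambda>z. indicator U z * v z) \<in> borel_measurable lborel \<and>
     (\<lambda>z. indicator U z *\<^sub>R g z) \<in> borel_measurable lborel \<and>
     (\<forall>K. compact K \<and> K \<subseteq> U \<longrightarrow>
        set_integrable lborel K (\<lambda>z. \<bar>v z\<bar> powr p) \<and>
        set_integrable lborel K (\<lambda>z. norm (g z) powr p)) \<and>
     (\<forall>\<phi> i. test_fun U \<phi> \<longrightarrow>
        (LINT z|lborel. v z * dx i \<phi> z) = - (LINT z|lborel. g z $ i * \<phi> z))"

definition plap_form :: "real \<Rightarrow> ('n::finite pt \<Rightarrow> real) \<Rightarrow> ('n pt \<Rightarrow> real^'n) \<Rightarrow> ('n pt \<Rightarrow> real) \<Rightarrow> real" where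
  "plap_form p v g \<phi> =
     (LINT z|lborel. norm (g z) powr (p - 2) * (g z \<bullet> grad_x \<phi> z) - v z * dt \<phi> z)"

definition weak_supersol :: "real \<Rightarrow> 'n::finite pt set \<Rightarrow> ('n pt \<Rightarrow> real) \<Rightarrow> bool" where
  "weak_supersol p U v \<longleftrightarrow> (\<exists>g. sob_loc p U v g \<and>
      (\<forall>\<phi>. test_fun U \<phi> \<and> (\<forall>z. \<phi> z \<ge> 0) \<longrightarrow> plap_form p v g \<phi> \<ge> 0))"

definition weak_sol :: "real \<Rightarrow> 'n::finite pt set \<Rightarrow> ('n pt \<Rightarrow> real) \<Rightarrow> bool" where
  "weak_sol p U v \<longleftrightarrow> (\<exists>g. sob_loc p U v g \<and>
      (\<forall>\<phi>. test_fun U \<phi> \<longrightarrow> plap_form p v g \<phi> = 0))"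

definition p_parabolic :: "real \<Rightarrow> 'n::finite pt set \<Rightarrow> ('n pt \<Rightarrow> real) \<Rightarrow> bool" where
  "p_parabolic p U v \<longleftrightarrow> continuous_on U v \<and> weak_sol p U v"

definition weak_supersol_e :: "real \<Rightarrow> 'n::finite pt set \<Rightarrow> ('n pt \<Rightarrow> ereal) \<Rightarrow> bool" where
  "weak_supersol_e p U u \<longleftrightarrow> (\<exists>v. (AE z in lborel. z \<in> U \<longrightarrow> u z = ereal (v z))
      \<and> weak_supersol p U v)"

definition cyl :: "(real^'n::finite) set \<Rightarrow> real \<Rightarrow> 'n pt set" where
  "cyl \<Omega> T = \<Omega> \<times> {0<..<T}"

definition par_bdry :: "(real^'n::finite) set \<Rightarrow> real \<Rightarrow> 'n pt set" where
  "par_bdry \<Omega> T = (closure \<Omega> \<times> {0}) \<union> (frontier \<Omega> \<times> {0..T})"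

definition Qcyl :: "real \<Rightarrow> real \<Rightarrow> 'n::finite pt \<Rightarrow> 'n pt set" where
  "Qcyl p r z = ball (fst z) r \<times> {snd z - r powr p <..< snd z + r powr p}"

text \<open>Essential infimum over a set A (w.r.t. Lebesgue measure; works for non-measurable f).\<close>
definition ess_inf_on :: "'a::euclidean_space set \<Rightarrow> ('a \<Rightarrow> ereal) \<Rightarrow> ereal" where
  "ess_inf_on A f = Sup {a. AE z in lborel. z \<in> A \<longrightarrow> a \<le> f z}"

text \<open>ess liminf regularization relative to D (= Omega_T): lim_{r->0} ess inf_{Q_r(z) \<inter> D} f;
  the ess inf is nonincreasing in r, so the limit is the supremum over r > 0.\<close>
definition ess_liminf_reg :: "real \<Rightarrow> 'n::finite pt set \<Rightarrow> ('n pt \<Rightarrow> ereal) \<Rightarrow> 'n pt \<Rightarrow> ereal" where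
  "ess_liminf_reg p D f z = (SUP r\<in>{0<..}. ess_inf_on (Qcyl p r z \<inter> D) f)"

definition S_obst :: "real \<Rightarrow> (real^'n::finite) set \<Rightarrow> real \<Rightarrow> ('n pt \<Rightarrow> real) \<Rightarrow> ('n pt \<Rightarrow> ereal) set" where
  "S_obst p \<Omega> T \<psi> = {u. weak_supersol_e p (cyl \<Omega> T) u
      \<and> (\<forall>z\<in>cyl \<Omega> T. u z = ess_liminf_reg p (cyl \<Omega> T) u z)
      \<and> (AE z in lborel. z \<in> cyl \<Omega> T \<longrightarrow> ereal (\<psi> z) \<le> u z)}"

definition least_sol :: "real \<Rightarrow> (real^'n::finite) set \<Rightarrow> real \<Rightarrow> ('n pt \<Rightarrow> real) \<Rightarrow> 'n pt \<Rightarrow> ereal" where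
  "least_sol p \<Omega> T \<psi> = ess_liminf_reg p (cyl \<Omega> T) (\<lambda>z. Inf {u z | u. u \<in> S_obst p \<Omega> T \<psi>})"

definition regular_cyl :: "real \<Rightarrow> (real^'n::finite) set \<Rightarrow> real \<Rightarrow> bool" where
  "regular_cyl p \<Omega> T \<longleftrightarrow> (\<forall>f. continuous_on (closure (cyl \<Omega> T)) f \<longrightarrow>
     (\<exists>h. continuous_on (closure (cyl \<Omega> T)) h \<and> p_parabolic p (cyl \<Omega> T) h
          \<and> (\<forall>z\<in>par_bdry \<Omega> T. h z = f z)))"

end

theory Submission
  imports Defs
begin

text \<open>
  Testing the mollified inequalities with smooth truncations of \<open>u\<^sub>1 - u\<^sub>2\<close> shows that the minimum of
  two weak supersolutions is a weak supersolution, and hence that supersolutions can be pasted.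
  Comparison follows: if \<open>v\<close> is a solution and \<open>u < v\<close> only in a compact set, then \<open>min u v\<close> is a
  supersolution that differs from \<open>v\<close> only there, and a test function depending on time alone
  on that set forces \<open>min u v = v\<close>.

  Let \<open>w\<close> be the infimum of the continuous supersolutions above \<open>\<psi>\<close>. Explicit barriers together with the
  regularity of the cylinder show that \<open>w\<close> attains \<open>\<psi>\<close> on the parabolic boundary. A translate of a
  competitor, raised by \<open>e\<close> and by a ramp that grows with time, can be pasted with a competitor that is
  close to \<open>\<psi>\<close> near the boundary; therefore \<open>w\<close> is uniformly continuous. Where \<open>w > \<psi>\<close>, the intrinsic
  scaling of the equation yields solvability in small homothetic copies of the cylinder itself, and
  replacing \<open>w\<close> by the solution there shows that \<open>w\<close> is a solution. Comparison on \<open>{w > \<psi>}\<close> gives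
  \<open>w \<le> u\<close> for every supersolution \<open>u \<ge> \<psi>\<close>, so that \<open>w\<close> is the least solution.
\<close>

section \<open>Smooth bump functions and mollifiers\<close>

definition exp_tail :: "nat \<Rightarrow> real \<Rightarrow> real" where
  "exp_tail k s = (if s > 0 then inverse s ^ k * exp (- inverse s) else 0)"

lemma exp_tail_nonneg: "exp_tail k s \<ge> 0"
  by (simp add: exp_tail_def)

lemma exp_tail_le: "exp_tail k s \<le> fact (k + 2) * s\<^sup>2"
proof (cases "s > 0")
  case True
  define x where "x = inverse s"
  have x: "x > 0" using True by (simp add: x_def)
  have "x ^ (k+2) / fact (k+2) \<le> exp x"
  proof -
    have "(\<lambda>n. x ^ n /\<^sub>R fact n) sums exp x" by (rule exp_converges)
    then have "sum (\<lambda>n. x ^ n /\<^sub>R fact n) {k+2} \<le> exp x"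
      using x sum_le_suminf[of "\<lambda>n. x ^ n /\<^sub>R fact n" "{k+2}"] by (auto simp: sums_iff)
    then show ?thesis by (simp add: divide_inverse mult.commute del: fact_Suc power_Suc add_2_eq_Suc')
  qed
  then have "x ^ (k+2) \<le> fact (k+2) * exp x"
    by (simp only: pos_divide_le_eq fact_gt_zero mult.commute)
  then have "x ^ (k+2) * exp (-x) \<le> fact (k+2)"
    by (simp only: exp_minus divide_inverse[symmetric] pos_divide_le_eq exp_gt_zero)
  then have "x ^ k * exp (-x) * x\<^sup>2 \<le> fact (k+2)"
    by (simp add: power_add algebra_simps power2_eq_square)
  then have "x ^ k * exp (-x) * x\<^sup>2 * s\<^sup>2 \<le> fact (k+2) * s\<^sup>2"
    by (intro mult_right_mono) auto
  moreover have "x\<^sup>2 * s\<^sup>2 = 1" using True by (simp add: x_def field_simps)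
  ultimately have "x ^ k * exp (-x) \<le> fact (k+2) * s\<^sup>2"
    by (simp only: mult.assoc mult_1_right)
  then show ?thesis using True
    by (simp only: exp_tail_def x_def if_True)
qed (simp add: exp_tail_def)

lemma DERIV_exp_tail:
  "(exp_tail k has_real_derivative exp_tail (k + 2) s - real k * exp_tail (k + 1) s) (at s)"
proof -
  consider "s > 0" | "s < 0" | "s = 0" by linarith
  then show ?thesis
  proof cases
    case 1
    have "((\<lambda>s. inverse s ^ k * exp (- inverse s)) has_real_derivative
            exp_tail (k + 2) s - real k * exp_tail (k + 1) s) (at s)"
    proof -
      let ?x = "inverse s"
      have "((\<lambda>x. x ^ k * exp (- x)) has_real_derivative real k * ?x ^ (k - 1) * exp (- ?x) - ?x ^ k * exp (- ?x)) (at ?x)"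
        by (auto intro!: derivative_eq_intros)
      from DERIV_chain2[OF this DERIV_inverse[of s]] 
      have "((\<lambda>s. inverse s ^ k * exp (- inverse s)) has_real_derivative
         (real k * ?x ^ (k - 1) * exp (- ?x) - ?x ^ k * exp (- ?x)) * - (?x ^ Suc (Suc 0))) (at s)"
        using 1 by simp
      moreover have "(real k * ?x ^ (k - 1) * exp (- ?x) - ?x ^ k * exp (- ?x)) * - (?x ^ Suc (Suc 0))
          = exp_tail (k + 2) s - real k * exp_tail (k + 1) s"
        using 1 by (cases k) (simp_all add: exp_tail_def algebra_simps)
      ultimately show ?thesis by simp
    qed
    then show ?thesis
      by (rule has_field_derivative_transform_within_open[where S="{0<..}"])
         (use 1 in \<open>auto simp: exp_tail_def\<close>)
  next
    case 2
    have "((\<lambda>s. 0) has_real_derivative 0) (at s)" by simp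
    then have "(exp_tail k has_real_derivative 0) (at s)"
      by (rule has_field_derivative_transform_within_open[where S="{..<0}"])
         (use 2 in \<open>auto simp: exp_tail_def\<close>)
    then show ?thesis using 2 by (simp add: exp_tail_def)
  next
    case 3
    have "((\<lambda>h. (exp_tail k (0 + h) - exp_tail k 0) / h) \<longlongrightarrow> 0) (at 0)"
    proof (rule tendsto_0_le[where K=1 and f="\<lambda>h. fact (k+2) * h"])
      show "((\<lambda>h. fact (k + 2) * h) \<longlongrightarrow> (0::real)) (at 0)"
        by (auto intro!: tendsto_eq_intros)
      show "\<forall>\<^sub>F h in at 0. norm ((exp_tail k (0 + h) - exp_tail k 0) / h) \<le> norm (fact (k + 2) * h) * 1"
      proof (rule always_eventually, rule allI)
        fix h :: real
        have "\<bar>exp_tail k h\<bar> \<le> fact (k + 2) * \<bar>h\<bar> * \<bar>h\<bar>"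
          using exp_tail_le[of k h] exp_tail_nonneg[of k h] by (simp add: power2_eq_square)
        then have "\<bar>exp_tail k h\<bar> / \<bar>h\<bar> \<le> fact (k + 2) * \<bar>h\<bar>"
          by (cases "h = 0") (simp_all add: pos_divide_le_eq del: fact_Suc add_2_eq_Suc')
        moreover have "\<bar>fact (k + 2) * h\<bar> = fact (k + 2) * \<bar>h\<bar>"
          by (simp only: abs_mult abs_of_nonneg fact_ge_zero)
        ultimately show "norm ((exp_tail k (0 + h) - exp_tail k 0) / h) \<le> norm (fact (k + 2) * h) * 1"
          by (simp add: exp_tail_def[of k 0] del: fact_Suc add_2_eq_Suc' abs_mult)
      qed
    qed
    then show ?thesis using 3 by (simp add: DERIV_def exp_tail_def)
  qed
qed

inductive_set bump_class :: "('a::euclidean_space \<Rightarrow> real) set" where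
  base: "(\<lambda>z. exp_tail k (1 - z \<bullet> z)) \<in> bump_class"
| add: "f \<in> bump_class \<Longrightarrow> g \<in> bump_class \<Longrightarrow> (\<lambda>z. f z + g z) \<in> bump_class"
| cmul: "f \<in> bump_class \<Longrightarrow> (\<lambda>z. c * f z) \<in> bump_class"
| linmul: "f \<in> bump_class \<Longrightarrow> (\<lambda>z. (z \<bullet> v) * f z) \<in> bump_class"

text \<open>The span of the functions \<open>exp_tail\<close> of \<open>1 - |z|\<^sup>2\<close> is closed under directional derivatives, which yields smoothness.\<close>
lemma bump_class_deriv:
  "f \<in> bump_class \<Longrightarrow> \<exists>f'. (\<forall>z. (f has_derivative (\<lambda>v. f' v z)) (at z)) \<and> (\<forall>v. f' v \<in> bump_class)"
proof (induction rule: bump_class.induct)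
  case (base k)
  let ?f' = "\<lambda>v z. (z \<bullet> v) * ((-2) * (exp_tail (k + 2) (1 - z \<bullet> z) + (- real k) * exp_tail (k + 1) (1 - z \<bullet> z)))"
  have "((\<lambda>z. exp_tail k (1 - z \<bullet> z)) has_derivative (\<lambda>v. ?f' v z)) (at z)" for z :: 'a
    by (rule has_derivative_eq_rhs, rule DERIV_compose_FDERIV[OF DERIV_exp_tail])
       (auto intro!: derivative_eq_intros simp: inner_commute algebra_simps)
  moreover have "?f' v \<in> bump_class" for v
    by (intro bump_class.linmul bump_class.cmul bump_class.add bump_class.base)
  ultimately show ?case by (intro exI[of _ ?f']) blast
next
  case (add f g)
  then obtain f' g' where "\<forall>z. (f has_derivative (\<lambda>v. f' v z)) (at z)" "\<forall>v. f' v \<in> bump_class"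
    "\<forall>z. (g has_derivative (\<lambda>v. g' v z)) (at z)" "\<forall>v. g' v \<in> bump_class" by blast
  then show ?case
    by (intro exI[of _ "\<lambda>v z. f' v z + g' v z"]) (auto intro: bump_class.add has_derivative_add)
next
  case (cmul f c)
  then obtain f' where "\<forall>z. (f has_derivative (\<lambda>v. f' v z)) (at z)" "\<forall>v. f' v \<in> bump_class" by blast
  then show ?case
    by (intro exI[of _ "\<lambda>v z. c * f' v z"]) (auto intro: bump_class.cmul has_derivative_mult_right)
next
  case (linmul f w)
  then obtain f' where f': "\<forall>z. (f has_derivative (\<lambda>v. f' v z)) (at z)" "\<forall>v. f' v \<in> bump_class" by blast
  have "((\<lambda>z. (z \<bullet> w) * f z) has_derivative (\<lambda>v. (z \<bullet> w) * f' v z + (v \<bullet> w) * f z)) (at z)" for z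
    using f'(1)[rule_format, of z] by (auto intro!: derivative_eq_intros)
  moreover have "(\<lambda>z. (z \<bullet> w) * f' v z + (v \<bullet> w) * f z) \<in> bump_class" for v
    by (rule bump_class.add[OF bump_class.linmul bump_class.cmul]) (use f' linmul.hyps in auto)
  ultimately show ?case
    by (intro exI[of _ "\<lambda>v z. (z \<bullet> w) * f' v z + (v \<bullet> w) * f z"]) blast
qed

lemma bump_class_iter_dir: "f \<in> bump_class \<Longrightarrow> iter_dir vs f \<in> bump_class"
proof (induction vs)
  case (Cons v vs)
  obtain f' where f': "\<forall>z. (iter_dir vs f has_derivative (\<lambda>v. f' v z)) (at z)" "\<forall>v. f' v \<in> bump_class"
    using bump_class_deriv[OF Cons.IH[OF Cons.prems]] by blast
  have "iter_dir (v # vs) f = f' v"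
    using frechet_derivative_at[OF f'(1)[rule_format], symmetric] by (simp add: fun_eq_iff)
  then show ?case using f' by simp
qed simp

lemma smooth_fun_bump_class: "f \<in> bump_class \<Longrightarrow> smooth_fun f"
  unfolding smooth_fun_def differentiable_def
  using bump_class_deriv[OF bump_class_iter_dir] by blast

lemma iter_dir_cmul:
  assumes "smooth_fun f" shows "iter_dir vs (\<lambda>z. c * f z) = (\<lambda>z. c * iter_dir vs f z)"
proof (induction vs)
  case (Cons v vs)
  have "((\<lambda>z. c * iter_dir vs f z) has_derivative (\<lambda>v. c * frechet_derivative (iter_dir vs f) (at z) v)) (at z)" for z
    using assms by (intro has_derivative_mult_right) (simp add: smooth_fun_def frechet_derivative_works[symmetric])
  from frechet_derivative_at[OF this, symmetric] show ?case by (simp add: Cons.IH fun_eq_iff)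
qed simp

lemma smooth_fun_cmul:
  assumes "smooth_fun f" shows "smooth_fun (\<lambda>z. c * f z)"
  using assms unfolding smooth_fun_def iter_dir_cmul[OF assms] by (auto intro: differentiable_mult)

lemma has_derivative_affine_comp:
  fixes f :: "'a::real_normed_vector \<Rightarrow> real"
  assumes "f differentiable (at (a + r *\<^sub>R z))"
  shows "((\<lambda>z. f (a + r *\<^sub>R z)) has_derivative (\<lambda>v. r * frechet_derivative f (at (a + r *\<^sub>R z)) v)) (at z)"
proof -
  have f: "(f has_derivative frechet_derivative f (at (a + r *\<^sub>R z))) (at (a + r *\<^sub>R z))"
    using assms by (simp add: frechet_derivative_works[symmetric])
  have "((\<lambda>z. f (a + r *\<^sub>R z)) has_derivative (\<lambda>v. frechet_derivative f (at (a + r *\<^sub>R z)) (r *\<^sub>R v))) (at z)"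
    by (rule has_derivative_compose[where f="\<lambda>z. a + r *\<^sub>R z" and g=f, OF _ f])
       (auto intro!: derivative_eq_intros)
  then show ?thesis
    using linear_cmul[OF has_derivative_linear[OF f]] by simp
qed

lemma iter_dir_affine:
  assumes "smooth_fun f"
  shows "iter_dir vs (\<lambda>z. f (a + r *\<^sub>R z)) = (\<lambda>z. r ^ length vs * iter_dir vs f (a + r *\<^sub>R z))"
proof (induction vs)
  case (Cons v vs)
  have "((\<lambda>z. r ^ length vs * iter_dir vs f (a + r *\<^sub>R z)) has_derivative
      (\<lambda>v. r ^ length vs * (r * frechet_derivative (iter_dir vs f) (at (a + r *\<^sub>R z)) v))) (at z)" for z
    using assms by (intro has_derivative_mult_right has_derivative_affine_comp) (simp add: smooth_fun_def)
  from frechet_derivative_at[OF this, symmetric] show ?case by (simp add: Cons.IH fun_eq_iff)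
qed simp

lemma smooth_fun_affine:
  assumes "smooth_fun f" shows "smooth_fun (\<lambda>z. f (a + r *\<^sub>R z))"
  unfolding smooth_fun_def iter_dir_affine[OF assms]
proof (intro allI)
  fix vs z
  have "iter_dir vs f differentiable at (a + r *\<^sub>R z)"
    using assms unfolding smooth_fun_def by blast
  from has_derivative_mult_right[OF has_derivative_affine_comp[OF this]]
  show "(\<lambda>z. r ^ length vs * iter_dir vs f (a + r *\<^sub>R z)) differentiable at z"
    unfolding differentiable_def by blast
qed

definition C1 :: "('a::euclidean_space \<Rightarrow> real) \<Rightarrow> ('a \<Rightarrow> 'a) \<Rightarrow> bool" where
  "C1 f df \<longleftrightarrow> (\<forall>z. GDERIV f z :> df z) \<and> continuous_on UNIV df"

definition grad :: "('a::euclidean_space \<Rightarrow> real) \<Rightarrow> 'a \<Rightarrow> 'a" where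
  "grad f z = (\<Sum>b\<in>Basis. frechet_derivative f (at z) b *\<^sub>R b)"

lemma GDERIV_frechet: "GDERIV f z :> d \<Longrightarrow> frechet_derivative f (at z) v = v \<bullet> d"
  unfolding gderiv_def by (drule frechet_derivative_at, drule fun_cong[where x=v]) (rule sym)

lemma GDERIV_grad:
  assumes "f differentiable (at z)" shows "GDERIV f z :> grad f z"
proof -
  have f: "(f has_derivative frechet_derivative f (at z)) (at z)"
    using assms by (simp add: frechet_derivative_works[symmetric])
  have "frechet_derivative f (at z) v = v \<bullet> grad f z" for v
  proof -
    have "frechet_derivative f (at z) v = frechet_derivative f (at z) (\<Sum>b\<in>Basis. (v \<bullet> b) *\<^sub>R b)"
      by (simp add: euclidean_representation)
    also have "\<dots> = (\<Sum>b\<in>Basis. (v \<bullet> b) * frechet_derivative f (at z) b)"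
      using has_derivative_linear[OF f] by (simp add: linear_sum linear_cmul)
    finally show ?thesis by (simp add: grad_def inner_sum_right mult.commute)
  qed
  then have "frechet_derivative f (at z) = (\<lambda>v. v \<bullet> grad f z)" by (rule ext)
  then show ?thesis using f by (simp add: gderiv_def)
qed

lemma GDERIV_unique:
  fixes d e :: "'a::euclidean_space"
  assumes "GDERIV f z :> d" "GDERIV f z :> e"
  shows "d = e"
proof (rule euclidean_eqI)
  fix b :: 'a
  show "d \<bullet> b = e \<bullet> b"
    using GDERIV_frechet[OF assms(1), of b] GDERIV_frechet[OF assms(2), of b] by (simp add: inner_commute)
qed

lemma C1_smooth_fun: 
  assumes "smooth_fun f" shows "C1 f (grad f)"
proof -
  have "iter_dir [] f differentiable (at z)" for z using assms unfolding smooth_fun_def by blast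
  moreover have "continuous_on UNIV (\<lambda>z. frechet_derivative f (at z) b)" for b
  proof -
    have "iter_dir [b] f differentiable (at z)" for z using assms unfolding smooth_fun_def by blast
    then show ?thesis by (simp add: continuous_at_imp_continuous_on differentiable_imp_continuous_within)
  qed
  ultimately show ?thesis unfolding C1_def
    by (simp add: GDERIV_grad) (unfold grad_def[abs_def], intro continuous_intros, simp)
qed

lemma C1_continuous: "C1 f df \<Longrightarrow> continuous_on S f"
  unfolding C1_def gderiv_def by (meson continuous_at_imp_continuous_on has_derivative_continuous)

lemma C1_support:
  assumes "C1 f df" "closed K" "\<And>z. z \<notin> K \<Longrightarrow> f z = 0" "z \<notin> K"
  shows "df z = 0"
proof -
  have "GDERIV f z :> df z" using assms by (simp add: C1_def)
  moreover have "GDERIV f z :> 0"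
  proof -
    have "((\<lambda>z. 0) has_derivative (\<lambda>h. h \<bullet> (0::'a))) (at z)" by simp
    then have "(f has_derivative (\<lambda>h. h \<bullet> (0::'a))) (at z)"
      by (rule has_derivative_transform_within_open[where s="-K"])
         (use assms in auto)
    then show ?thesis unfolding gderiv_def .
  qed
  ultimately show ?thesis by (rule GDERIV_unique)
qed

lemma C1_mult: "C1 f df \<Longrightarrow> C1 g dg \<Longrightarrow> C1 (\<lambda>z. f z * g z) (\<lambda>z. f z *\<^sub>R dg z + g z *\<^sub>R df z)"
  using C1_continuous[of f df UNIV] C1_continuous[of g dg UNIV]
  unfolding C1_def by (auto intro!: GDERIV_mult continuous_intros)

lemma C1_add: "C1 f df \<Longrightarrow> C1 g dg \<Longrightarrow> C1 (\<lambda>z. f z + g z) (\<lambda>z. df z + dg z)"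
  unfolding C1_def by (auto intro!: GDERIV_add continuous_intros)

lemma C1_diff: "C1 f df \<Longrightarrow> C1 g dg \<Longrightarrow> C1 (\<lambda>z. f z - g z) (\<lambda>z. df z - dg z)"
  unfolding C1_def by (auto intro!: GDERIV_diff continuous_intros)

lemma C1_const: "C1 (\<lambda>z. c) (\<lambda>z. 0)"
  unfolding C1_def by (auto intro!: GDERIV_const)

lemma C1_comp:
  assumes "C1 f df" "\<And>s. (h has_real_derivative h' s) (at s)" "continuous_on UNIV h'"
  shows "C1 (\<lambda>z. h (f z)) (\<lambda>z. h' (f z) *\<^sub>R df z)"
proof -
  have "GDERIV (\<lambda>z. h (f z)) z :> h' (f z) *\<^sub>R df z" for z
    by (rule GDERIV_DERIV_compose) (use assms in \<open>auto simp: C1_def\<close>)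
  moreover have "continuous_on UNIV (\<lambda>z. h' (f z))"
    using continuous_on_compose2[OF assms(3) C1_continuous[OF assms(1)]] by blast
  ultimately show ?thesis
    using assms(1) unfolding C1_def by (auto intro!: continuous_intros)
qed

definition moll :: "real \<Rightarrow> 'a::euclidean_space \<Rightarrow> real" where
  "moll \<sigma> z = exp_tail 0 (1 - (z /\<^sub>R \<sigma>) \<bullet> (z /\<^sub>R \<sigma>))
     / (LINT y|lborel. exp_tail 0 (1 - ((y::'a) /\<^sub>R \<sigma>) \<bullet> (y /\<^sub>R \<sigma>)))"

lemma smooth_fun_moll: "smooth_fun (moll \<sigma> :: 'a::euclidean_space \<Rightarrow> real)"
proof -
  let ?I = "LINT y|lborel. exp_tail 0 (1 - ((y::'a) /\<^sub>R \<sigma>) \<bullet> (y /\<^sub>R \<sigma>))"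
  have "smooth_fun (\<lambda>z::'a. inverse ?I * exp_tail 0 (1 - (0 + inverse \<sigma> *\<^sub>R z) \<bullet> (0 + inverse \<sigma> *\<^sub>R z)))"
    by (intro smooth_fun_cmul smooth_fun_affine[where f="\<lambda>z. exp_tail 0 (1 - z \<bullet> z)"]
         smooth_fun_bump_class bump_class.base)
  moreover have "(\<lambda>z::'a. inverse ?I * exp_tail 0 (1 - (0 + inverse \<sigma> *\<^sub>R z) \<bullet> (0 + inverse \<sigma> *\<^sub>R z))) = moll \<sigma>"
    by (simp add: fun_eq_iff moll_def field_simps)
  ultimately show ?thesis by simp
qed

lemma moll_eq_0:
  assumes "\<sigma> > 0" "norm z \<ge> \<sigma>" shows "moll \<sigma> z = 0"
proof -
  have "1 \<le> norm (z /\<^sub>R \<sigma>)" using assms by (simp add: field_simps)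
  then have "1 \<le> (z /\<^sub>R \<sigma>) \<bullet> (z /\<^sub>R \<sigma>)" 
    by (metis dot_square_norm one_le_power)
  then show ?thesis unfolding moll_def exp_tail_def by simp
qed

lemma continuous_on_moll: "continuous_on S (moll \<sigma>)"
  using C1_continuous[OF C1_smooth_fun[OF smooth_fun_moll]] .

lemma integrable_continuous_compact_support:
  fixes f :: "'a::euclidean_space \<Rightarrow> 'b::euclidean_space"
  assumes "continuous_on UNIV f" "compact K" "\<And>z. z \<notin> K \<Longrightarrow> f z = 0"
  shows "integrable lborel f"
proof -
  have "set_integrable lborel K f"
    unfolding set_integrable_def
    by (rule borel_integrable_compact) (use assms continuous_on_subset[of UNIV f K] in auto)
  moreover have "(\<lambda>x. indicator K x *\<^sub>R f x) = f" using assms(3) by (auto simp: indicator_def fun_eq_iff)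
  ultimately show ?thesis by (simp add: set_integrable_def)
qed

lemma bounded_continuous_compact_support:
  fixes f :: "'a::euclidean_space \<Rightarrow> 'b::euclidean_space"
  assumes "continuous_on UNIV f" "compact K" "\<And>z. z \<notin> K \<Longrightarrow> f z = 0"
  shows "\<exists>B. \<forall>z. norm (f z) \<le> B"
proof -
  have "bounded (f ` K)" using assms continuous_on_subset compact_continuous_image compact_imp_bounded by blast
  then obtain B where "\<And>z. z \<in> K \<Longrightarrow> norm (f z) \<le> B" unfolding bounded_iff by auto
  then have "norm (f z) \<le> max B 0" for z using assms(3)[of z] by (cases "z \<in> K") force+
  then show ?thesis by blast
qed

lemma moll_bump_integral_pos:
  assumes "\<sigma> > 0"
  shows "(LINT y|lborel. exp_tail 0 (1 - ((y::'a::euclidean_space) /\<^sub>R \<sigma>) \<bullet> (y /\<^sub>R \<sigma>))) > 0" (is "integral\<^sup>L _ ?f > 0")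
proof -
  have smooth: "smooth_fun ?f"
    using smooth_fun_affine[where f="\<lambda>z::'a. exp_tail 0 (1 - z \<bullet> z)" and a=0 and r="inverse \<sigma>"]
    by (simp add: smooth_fun_bump_class bump_class.base)
  then have cont: "continuous_on UNIV ?f" by (rule C1_continuous[OF C1_smooth_fun])
  have supp: "?f z = 0" if "z \<notin> cball 0 \<sigma>" for z
  proof -
    have "1 \<le> norm (z /\<^sub>R \<sigma>)" using assms that by (simp add: field_simps)
    then have "1 \<le> (z /\<^sub>R \<sigma>) \<bullet> (z /\<^sub>R \<sigma>)" by (metis dot_square_norm one_le_power)
    then show ?thesis unfolding exp_tail_def by simp
  qed
  have int: "integrable lborel ?f" by (rule integrable_continuous_compact_support[OF cont compact_cball supp])
  have pos: "?f z > 0" if "z \<in> ball 0 \<sigma>" for z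
  proof -
    have "norm (z /\<^sub>R \<sigma>) < 1" using assms that by (simp add: field_simps)
    then have "(z /\<^sub>R \<sigma>) \<bullet> (z /\<^sub>R \<sigma>) < 1" unfolding dot_square_norm by (simp add: power_less_one_iff)
    then show ?thesis unfolding exp_tail_def by simp
  qed
  have "integral\<^sup>L lborel ?f \<noteq> 0"
  proof
    assume "integral\<^sup>L lborel ?f = 0"
    then have "AE z in lborel. ?f z = 0"
      using integral_nonneg_eq_0_iff_AE[OF int] exp_tail_nonneg by auto
    then have "AE z in lborel. z \<notin> ball (0::'a) \<sigma>"
      by (rule eventually_mono) (use pos in \<open>metis less_irrefl\<close>)
    then have "emeasure lborel (ball (0::'a) \<sigma>) = 0"
      by (subst (asm) AE_iff_measurable[OF _ refl]) (auto simp: ball_def)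
    then show False using assms open_not_negligible[of "ball (0::'a) \<sigma>"]
      by (simp add: negligible_iff_emeasure0)
  qed
  moreover have "integral\<^sup>L lborel ?f \<ge> 0" by (intro Bochner_Integration.integral_nonneg exp_tail_nonneg)
  ultimately show ?thesis by linarith
qed

lemma moll_nonneg: "moll \<sigma> z \<ge> 0"
  unfolding moll_def by (intro divide_nonneg_nonneg Bochner_Integration.integral_nonneg exp_tail_nonneg)

lemma integral_moll: "\<sigma> > 0 \<Longrightarrow> (LINT z|lborel. moll \<sigma> (z::'a::euclidean_space)) = 1"
  using moll_bump_integral_pos[of \<sigma>, where 'a='a] unfolding moll_def integral_divide_zero
  by (metis divide_self less_irrefl)

section \<open>Convolution\<close>

lemma integral_norm_le_integral:
  fixes f :: "'a \<Rightarrow> 'b::{banach, second_countable_topology}"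
  assumes "integrable M f" "integrable M g" "\<And>x. norm (f x) \<le> g x"
  shows "norm (integral\<^sup>L M f) \<le> integral\<^sup>L M g"
proof -
  have "norm (integral\<^sup>L M f) \<le> (\<integral>x. norm (f x) \<partial>M)" by (rule integral_norm_bound)
  also have "\<dots> \<le> integral\<^sup>L M g" by (rule Bochner_Integration.integral_mono) (use assms in auto)
  finally show ?thesis .
qed

lemma uniformly_continuous_compact_support:
  fixes f :: "'a::euclidean_space \<Rightarrow> 'b::euclidean_space"
  assumes "continuous_on UNIV f" "compact K" "\<And>z. z \<notin> K \<Longrightarrow> f z = 0"
  shows "uniformly_continuous_on UNIV f"
proof -
  obtain R where R: "\<And>z. z \<in> K \<Longrightarrow> norm z \<le> R"
    using compact_imp_bounded[OF assms(2)] by (auto simp: bounded_iff)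
  have "uniformly_continuous_on (cball 0 (R + 1)) f"
    using assms(1) by (intro compact_uniformly_continuous) (auto intro: continuous_on_subset)
  show ?thesis unfolding uniformly_continuous_on_def
  proof (intro allI impI)
    fix e :: real assume "e > 0"
    obtain d where d: "d > 0" "\<And>x y. x \<in> cball 0 (R+1) \<Longrightarrow> y \<in> cball 0 (R+1) \<Longrightarrow> dist y x < d \<Longrightarrow> dist (f y) (f x) < e"
      using uniformly_continuous_onE[OF \<open>uniformly_continuous_on (cball 0 (R + 1)) f\<close> \<open>e > 0\<close>] by blast
    have "dist (f y) (f x) < e" if "dist y x < min d 1" for x y
    proof (cases "x \<in> K \<or> y \<in> K")
      case True
      then have "norm x \<le> R + 1 \<and> norm y \<le> R + 1"
        using R[of x] R[of y] that norm_triangle_ineq2[of x y] norm_triangle_ineq2[of y x] by (auto simp: dist_norm norm_minus_commute)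
      then show ?thesis using d(2)[of x y] that by auto
    next
      case False
      then show ?thesis using assms(3)[of x] assms(3)[of y] \<open>e > 0\<close> by simp
    qed
    then show "\<exists>d>0. \<forall>x\<in>UNIV. \<forall>y\<in>UNIV. dist y x < d \<longrightarrow> dist (f y) (f x) < e"
      using d(1) by (intro exI[of _ "min d 1"]) auto
  qed
qed

lemma uniformly_continuous_UNIVE:
  assumes "uniformly_continuous_on UNIV f" "e > 0"
  obtains d where "d > 0" "\<And>x y. dist y x < d \<Longrightarrow> dist (f y) (f x) < e"
  by (rule uniformly_continuous_onE[OF assms]) (rule that, auto)

lemma C1_uniform_expansion:
  assumes "C1 k dk" "compact K" "\<And>z. z \<notin> K \<Longrightarrow> k z = 0" "e > 0"
  shows "\<exists>d>0. \<forall>a h. norm h < d \<longrightarrow> \<bar>k (a + h) - k a - h \<bullet> dk a\<bar> \<le> e * norm h"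
proof -
  have "uniformly_continuous_on UNIV dk"
    using assms by (intro uniformly_continuous_compact_support[of dk K] C1_support[of k dk K])
      (auto simp: C1_def compact_imp_closed)
  from this assms(4) obtain d where d: "d > 0" "\<And>x y. dist y x < d \<Longrightarrow> dist (dk y) (dk x) < e"
    by (rule uniformly_continuous_UNIVE) blast
  have "\<bar>k (a + h) - k a - h \<bullet> dk a\<bar> \<le> e * norm h" if "norm h < d" for a h
  proof -
    have der: "((\<lambda>s. k s - s \<bullet> dk a) has_derivative (\<lambda>v. v \<bullet> dk x - v \<bullet> dk a)) (at x within ball a d)" for x
    proof (rule has_derivative_diff)
      have "(k has_derivative (\<lambda>v. v \<bullet> dk x)) (at x)"
        using assms(1) by (simp add: C1_def gderiv_def)
      then show "(k has_derivative (\<lambda>v. v \<bullet> dk x)) (at x within ball a d)"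
        by (rule has_derivative_at_withinI)
    qed (auto intro!: derivative_eq_intros)
    have "norm ((k (a+h) - (a+h) \<bullet> dk a) - (k a - a \<bullet> dk a)) \<le> e * norm ((a + h) - a)"
    proof (rule differentiable_bound[OF convex_ball der])
      fix x assume "x \<in> ball a d"
      then have "norm (dk x - dk a) \<le> e" using d(2)[of x a] by (simp add: dist_norm norm_minus_commute)
      moreover have "norm (v \<bullet> dk x - v \<bullet> dk a) \<le> norm v * norm (dk x - dk a)" for v
        unfolding inner_diff_right[symmetric] using Cauchy_Schwarz_ineq2 by simp
      ultimately have "norm (v \<bullet> dk x - v \<bullet> dk a) \<le> e * norm v" for v
        by (smt (verit) mult.commute mult_left_mono norm_ge_zero)
      then show "onorm (\<lambda>v. v \<bullet> dk x - v \<bullet> dk a) \<le> e" by (rule onorm_le)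
    qed (use that d in \<open>auto simp: dist_norm\<close>)
    then show ?thesis by (simp add: inner_add_left algebra_simps)
  qed
  then show ?thesis using d(1) by blast
qed

definition vconv :: "('a::euclidean_space \<Rightarrow> real) \<Rightarrow> ('a \<Rightarrow> 'b::euclidean_space) \<Rightarrow> 'a \<Rightarrow> 'b" where
  "vconv k f z = (LINT y|lborel. k (z - y) *\<^sub>R f y)"

lemma integrable_bounded_scaleR:
  fixes f :: "'a::euclidean_space \<Rightarrow> 'b::euclidean_space"
  assumes "integrable lborel f" "k \<in> borel_measurable lborel" "\<And>y. \<bar>k y\<bar> \<le> B"
  shows "integrable lborel (\<lambda>y. k y *\<^sub>R f y)"
proof (rule Bochner_Integration.integrable_bound[of lborel "\<lambda>y. B *\<^sub>R norm (f y)"])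
  show "AE y in lborel. norm (k y *\<^sub>R f y) \<le> norm (B *\<^sub>R norm (f y))"
    using assms(3) by (intro AE_I2) (auto simp: abs_mult intro!: mult_right_mono order_trans[OF assms(3)])
qed (use assms in \<open>auto intro: borel_measurable_scaleR\<close>)

lemma borel_measurable_reflect:
  fixes k :: "'a::euclidean_space \<Rightarrow> 'b::euclidean_space"
  assumes "continuous_on UNIV k" shows "(\<lambda>y. k (z - y)) \<in> borel_measurable lborel"
proof -
  have "continuous_on UNIV (\<lambda>y. k (z - y))"
    by (rule continuous_on_compose2[OF assms]) (auto intro!: continuous_intros)
  then show ?thesis by (simp add: borel_measurable_continuous_onI)
qed

lemma integrable_vconv_kernel:
  fixes f :: "'a::euclidean_space \<Rightarrow> 'b::euclidean_space"
  assumes "continuous_on UNIV k" "compact K" "\<And>z. z \<notin> K \<Longrightarrow> k z = 0" "integrable lborel f"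
  shows "integrable lborel (\<lambda>y. k (z - y) *\<^sub>R f y)"
proof -
  obtain B where "\<And>y. norm (k y) \<le> B" using bounded_continuous_compact_support[OF assms(1-3)] by blast
  then show ?thesis
    by (intro integrable_bounded_scaleR[where k="\<lambda>y. k (z - y)"] borel_measurable_reflect assms) auto
qed

lemma integrable_bounded_vector:
  fixes f :: "'a::euclidean_space \<Rightarrow> real" and k :: "'a \<Rightarrow> 'b::euclidean_space"
  assumes "integrable lborel f" "k \<in> borel_measurable lborel" "\<And>y. norm (k y) \<le> B"
  shows "integrable lborel (\<lambda>y. f y *\<^sub>R k y)"
proof (rule Bochner_Integration.integrable_bound[of lborel "\<lambda>y. B *\<^sub>R norm (f y)"])
  show "AE y in lborel. norm (f y *\<^sub>R k y) \<le> norm (B *\<^sub>R norm (f y))"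
    using assms(3) by (intro AE_I2) (auto simp: abs_mult mult.commute[of "\<bar>f _\<bar>"] intro!: mult_right_mono order_trans[OF assms(3)])
qed (use assms in \<open>auto intro: borel_measurable_scaleR\<close>)

lemma integrable_grad_kernel:
  fixes dk :: "'a::euclidean_space \<Rightarrow> 'a"
  assumes "continuous_on UNIV dk" "compact K" "\<And>z. z \<notin> K \<Longrightarrow> dk z = 0" "integrable lborel f"
  shows "integrable lborel (\<lambda>y. f y *\<^sub>R dk (z - y))"
proof -
  obtain B where "\<And>y. norm (dk y) \<le> B" using bounded_continuous_compact_support[OF assms(1-3)] by blast
  then show ?thesis
    by (intro integrable_bounded_vector[where k="\<lambda>y. dk (z - y)"] borel_measurable_reflect assms) auto
qed

lemma continuous_on_vconv:
  fixes f :: "'a::euclidean_space \<Rightarrow> 'b::euclidean_space"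
  assumes "continuous_on UNIV k" "compact K" "\<And>z. z \<notin> K \<Longrightarrow> k z = 0" "integrable lborel f"
  shows "continuous_on UNIV (vconv k f)"
proof (rule uniformly_continuous_imp_continuous, unfold uniformly_continuous_on_def, intro allI impI)
  fix e :: real assume "e > 0"
  define I where "I = (LINT y|lborel. norm (f y))"
  have I: "I \<ge> 0" unfolding I_def by (intro Bochner_Integration.integral_nonneg) auto
  have "uniformly_continuous_on UNIV k" by (rule uniformly_continuous_compact_support[OF assms(1-3)])
  moreover have "e / (I + 1) > 0" using \<open>e > 0\<close> I by simp
  ultimately obtain d where d: "d > 0" "\<And>x y. dist y x < d \<Longrightarrow> dist (k y) (k x) < e / (I+1)"
    by (rule uniformly_continuous_UNIVE) blast
  have "dist (vconv k f y) (vconv k f x) < e" if "dist y x < d" for x y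
  proof -
    have "vconv k f y - vconv k f x = (LINT u|lborel. k (y - u) *\<^sub>R f u - k (x - u) *\<^sub>R f u)"
      unfolding vconv_def using integrable_vconv_kernel[OF assms]
      by (intro Bochner_Integration.integral_diff[symmetric]) auto
    also have "norm \<dots> \<le> (LINT u|lborel. (e / (I+1)) * norm (f u))"
    proof (rule integral_norm_le_integral)
      fix u
      have "\<bar>k (y - u) - k (x - u)\<bar> \<le> e / (I+1)"
        using d(2)[of "y - u" "x - u"] that by (simp add: dist_norm)
      then show "norm (k (y - u) *\<^sub>R f u - k (x - u) *\<^sub>R f u) \<le> e / (I + 1) * norm (f u)"
        unfolding scaleR_diff_left[symmetric] norm_scaleR by (rule mult_right_mono) simp
    qed (use integrable_vconv_kernel[OF assms] assms(4) in auto)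
    also have "\<dots> = e / (I+1) * I" by (simp add: I_def)
    also have "\<dots> < e" using \<open>e > 0\<close> I by (simp add: field_simps)
    finally show ?thesis by (simp add: dist_norm)
  qed
  then show "\<exists>d>0. \<forall>x\<in>UNIV. \<forall>y\<in>UNIV. dist y x < d \<longrightarrow> dist (vconv k f y) (vconv k f x) < e"
    using d(1) by blast
qed

lemma C1_vconv:
  fixes f :: "'a::euclidean_space \<Rightarrow> real"
  assumes k: "C1 k dk" and K: "compact K" "\<And>z. z \<notin> K \<Longrightarrow> k z = 0" and f: "integrable lborel f"
  shows "C1 (vconv k f) (\<lambda>z. LINT y|lborel. f y *\<^sub>R dk (z - y))"
proof -
  define I where "I = (LINT y|lborel. norm (f y))"
  have I: "I \<ge> 0" unfolding I_def by (intro Bochner_Integration.integral_nonneg) auto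
  have dk: "continuous_on UNIV dk" "\<And>z. z \<notin> K \<Longrightarrow> dk z = 0"
    using k C1_support[OF k compact_imp_closed[OF K(1)] K(2)] by (auto simp: C1_def)
  note int1 = integrable_vconv_kernel[OF C1_continuous[OF k] K f]
  note int2 = integrable_grad_kernel[OF dk(1) K(1) dk(2) f]
  let ?G = "\<lambda>z. LINT y|lborel. f y *\<^sub>R dk (z - y)"
  have "GDERIV (vconv k f) z :> ?G z" for z
    unfolding gderiv_def has_derivative_at_alt
  proof (intro conjI allI impI)
    show "bounded_linear (\<lambda>h. h \<bullet> ?G z)" by (rule bounded_linear_inner_left)
    fix e :: real assume "e > 0"
    then obtain d where d: "d > 0" "\<And>a h. norm h < d \<Longrightarrow> \<bar>k (a + h) - k a - h \<bullet> dk a\<bar> \<le> e / (I+1) * norm h"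
      using C1_uniform_expansion[OF k K, of "e / (I+1)"] I by auto
    have "norm (vconv k f x - vconv k f z - (x - z) \<bullet> ?G z) \<le> e * norm (x - z)" if "norm (x - z) < d" for x
    proof -
      have "vconv k f x - vconv k f z - (x - z) \<bullet> ?G z
         = (LINT y|lborel. k (x - y) *\<^sub>R f y - k (z - y) *\<^sub>R f y - (x - z) \<bullet> (f y *\<^sub>R dk (z - y)))"
        unfolding vconv_def using int1 int2
        by (subst Bochner_Integration.integral_diff)
           (auto intro!: Bochner_Integration.integrable_diff integrable_inner_right simp del: inner_scaleR_right)
      also have "norm \<dots> \<le> (LINT y|lborel. (e / (I+1) * norm (x - z)) * norm (f y))"
      proof (rule integral_norm_le_integral)
        fix y
        have "\<bar>k (x - y) - k (z - y) - (x - z) \<bullet> dk (z - y)\<bar> \<le> e / (I+1) * norm (x - z)"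
          using d(2)[of "x - z" "z - y"] that by (simp add: algebra_simps)
        then have "\<bar>k (x - y) - k (z - y) - (x - z) \<bullet> dk (z - y)\<bar> * \<bar>f y\<bar> \<le> (e / (I+1) * norm (x - z)) * norm (f y)"
          unfolding real_norm_def by (rule mult_right_mono) simp
        then show "norm (k (x - y) *\<^sub>R f y - k (z - y) *\<^sub>R f y - (x - z) \<bullet> (f y *\<^sub>R dk (z - y))) \<le> (e / (I+1) * norm (x - z)) * norm (f y)"
          by (simp add: abs_mult[symmetric] algebra_simps)
      qed (use int1 int2 f in \<open>auto intro!: Bochner_Integration.integrable_diff integrable_inner_right simp del: inner_scaleR_right\<close>)
      also have "\<dots> = e / (I+1) * norm (x - z) * I" by (simp add: I_def)
      also have "\<dots> \<le> e * norm (x - z)"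
      proof -
        have "e / (I+1) * I \<le> e" using \<open>e > 0\<close> I by (simp add: field_simps)
        then have "e / (I+1) * I * norm (x - z) \<le> e * norm (x - z)" by (rule mult_right_mono) simp
        then show ?thesis by (simp add: mult.commute mult.left_commute)
      qed
      finally show ?thesis .
    qed
    then show "\<exists>d>0. \<forall>y. norm (y - z) < d \<longrightarrow> norm (vconv k f y - vconv k f z - (y - z) \<bullet> ?G z) \<le> e * norm (y - z)"
      using d(1) by blast
  qed
  moreover have "continuous_on UNIV ?G"
  proof (rule uniformly_continuous_imp_continuous, unfold uniformly_continuous_on_def, intro allI impI)
    fix e :: real assume "e > 0"
    have "uniformly_continuous_on UNIV dk" by (rule uniformly_continuous_compact_support[OF dk(1) K(1) dk(2)])
    moreover have "e / (I + 1) > 0" using \<open>e > 0\<close> I by simp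
    ultimately obtain d where d: "d > 0" "\<And>x y. dist y x < d \<Longrightarrow> dist (dk y) (dk x) < e / (I+1)"
      by (rule uniformly_continuous_UNIVE) blast
    have "dist (?G y) (?G x) < e" if "dist y x < d" for x y
    proof -
      have "?G y - ?G x = (LINT u|lborel. f u *\<^sub>R dk (y - u) - f u *\<^sub>R dk (x - u))"
        using int2 by (intro Bochner_Integration.integral_diff[symmetric]) auto
      also have "norm \<dots> \<le> (LINT u|lborel. (e / (I+1)) * norm (f u))"
      proof (rule integral_norm_le_integral)
        fix u
        have "norm (dk (y - u) - dk (x - u)) \<le> e / (I+1)"
          using d(2)[of "y - u" "x - u"] that by (simp add: dist_norm)
        then show "norm (f u *\<^sub>R dk (y - u) - f u *\<^sub>R dk (x - u)) \<le> e / (I + 1) * norm (f u)"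
          unfolding scaleR_diff_right[symmetric] norm_scaleR mult.commute[of "\<bar>f u\<bar>"] real_norm_def
          by (rule mult_right_mono) simp
      qed (use int2 f in auto)
      also have "\<dots> = e / (I+1) * I" by (simp add: I_def)
      also have "\<dots> < e" using \<open>e > 0\<close> I by (simp add: field_simps)
      finally show ?thesis by (simp add: dist_norm)
    qed
    then show "\<exists>d>0. \<forall>x\<in>UNIV. \<forall>y\<in>UNIV. dist y x < d \<longrightarrow> dist (?G y) (?G x) < e"
      using d(1) by blast
  qed
  ultimately show ?thesis by (simp add: C1_def)
qed

lemma integral_translate:
  fixes f :: "'a::euclidean_space \<Rightarrow> 'b::euclidean_space"
  assumes "f \<in> borel_measurable borel"
  shows "(LINT z|lborel. f (c + z)) = (LINT z|lborel. f z)"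
proof -
  have "(LINT z|lborel. f z) = (LINT z|distr lborel borel ((+) c). f z)" by (simp add: lborel_distr_plus)
  also have "\<dots> = (LINT z|lborel. f (c + z))" by (rule integral_distr) (use assms in auto)
  finally show ?thesis by simp
qed

lemma integral_GDERIV_eq_0:
  assumes \<phi>: "C1 \<phi> d\<phi>" and K: "compact K" "\<And>z. z \<notin> K \<Longrightarrow> \<phi> z = 0"
  shows "(LINT z|lborel. d\<phi> z \<bullet> v) = 0"
proof -
  obtain R where R: "\<And>z. z \<in> K \<Longrightarrow> norm z \<le> R"
    using compact_imp_bounded[OF K(1)] by (auto simp: bounded_iff)
  have d\<phi>: "continuous_on UNIV d\<phi>" "\<And>z. z \<notin> K \<Longrightarrow> d\<phi> z = 0"
    using \<phi> C1_support[OF \<phi> compact_imp_closed[OF K(1)] K(2)] by (auto simp: C1_def)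
  obtain B where B: "\<And>z. norm (d\<phi> z) \<le> B"
    using bounded_continuous_compact_support[OF d\<phi>(1) K(1) d\<phi>(2)] by blast
  have Blip: "\<bar>\<phi> x - \<phi> y\<bar> \<le> B * norm (x - y)" for x y
  proof -
    have "norm (\<phi> x - \<phi> y) \<le> B * norm (x - y)"
    proof (rule differentiable_bound[of UNIV])
      show "(\<phi> has_derivative (\<lambda>h. h \<bullet> d\<phi> x)) (at x within UNIV)" for x
        using \<phi> by (simp add: C1_def gderiv_def)
      show "onorm (\<lambda>h. h \<bullet> d\<phi> x) \<le> B" for x
      proof (rule onorm_le)
        fix h
        have "norm (h \<bullet> d\<phi> x) \<le> norm h * norm (d\<phi> x)" using Cauchy_Schwarz_ineq2 by simp
        also have "\<dots> \<le> norm h * B" by (intro mult_left_mono B) auto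
        finally show "norm (h \<bullet> d\<phi> x) \<le> B * norm h" by (simp add: mult.commute)
      qed
    qed auto
    then show ?thesis by simp
  qed
  define h :: "nat \<Rightarrow> real" where "h n = 1 / real (Suc n)" for n
  have h: "h n > 0" "h n \<le> 1" "h n \<noteq> 0" for n by (auto simp: h_def)
  have hlim: "h \<longlonglongrightarrow> 0" unfolding h_def by (rule LIMSEQ_Suc[OF lim_1_over_n])
  define D where "D n z = (\<phi> (h n *\<^sub>R v + z) - \<phi> z) / h n" for n z
  have cont: "continuous_on UNIV \<phi>" by (rule C1_continuous[OF \<phi>])
  then have meas: "\<phi> \<in> borel_measurable borel" by (rule borel_measurable_continuous_onI)
  have int\<phi>: "integrable lborel \<phi>" by (rule integrable_continuous_compact_support[OF cont K])
  have cont': "continuous_on UNIV (\<lambda>z. \<phi> (c + z))" for c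
    by (rule continuous_on_compose2[OF cont]) (auto intro!: continuous_intros)
  have int\<phi>': "integrable lborel (\<lambda>z. \<phi> (c + z))" for c
  proof (rule integrable_continuous_compact_support[OF cont', of "(\<lambda>z. z - c) ` K"])
    show "compact ((\<lambda>z. z - c) ` K)"
      using compact_translation[OF K(1), of "-c"] by simp
    show "\<phi> (c + z) = 0" if "z \<notin> (\<lambda>z. z - c) ` K" for z
      by (rule K(2)) (use that in \<open>force simp: image_iff\<close>)
  qed
  have "(LINT z|lborel. D n z) = 0" for n
    unfolding D_def using int\<phi> int\<phi>' by (simp add: Bochner_Integration.integral_diff integral_translate[OF meas])
  moreover have "(\<lambda>n. LINT z|lborel. D n z) \<longlonglongrightarrow> (LINT z|lborel. d\<phi> z \<bullet> v)"
  proof (rule integral_dominated_convergence)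
    let ?w = "\<lambda>z. indicator (cball 0 (R + norm v)) z * (B * norm v)"
    show "integrable lborel ?w"
      by (intro integrable_mult_left integrable_real_indicator) (auto intro!: emeasure_bounded_finite[unfolded infinity_ennreal_def])
    show "AE z in lborel. norm (D n z) \<le> ?w z" for n
    proof (intro AE_I2)
      fix z
      show "norm (D n z) \<le> ?w z"
      proof (cases "z \<in> cball 0 (R + norm v)")
        case True
        have "\<bar>\<phi> (h n *\<^sub>R v + z) - \<phi> z\<bar> \<le> B * (h n * norm v)"
          using Blip[of "h n *\<^sub>R v + z" z] h(1)[of n] by simp
        then show ?thesis using True h(1)[of n] by (simp add: D_def field_simps)
      next
        case False
        then have "norm z > R + norm v" by simp
        moreover have "norm (h n *\<^sub>R v) \<le> norm v" using h[of n] by (simp add: mult_left_le_one_le)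
        ultimately have "norm (h n *\<^sub>R v + z) > R" using norm_diff_ineq[of z "h n *\<^sub>R v"]
          by (simp add: add.commute)
        moreover have "norm z > R" using \<open>norm z > R + norm v\<close> norm_ge_zero[of v] by linarith
        ultimately have "\<phi> (h n *\<^sub>R v + z) = 0" "\<phi> z = 0" using R K(2) by force+
        then show ?thesis using False by (simp add: D_def)
      qed
    qed
    show "AE z in lborel. (\<lambda>n. D n z) \<longlonglongrightarrow> d\<phi> z \<bullet> v"
    proof (intro AE_I2)
      fix z
      have "GDERIV \<phi> z :> d\<phi> z" using \<phi> by (simp add: C1_def)
      then have "(\<phi> has_derivative (\<lambda>u. u \<bullet> d\<phi> z)) (at z)" by (simp add: gderiv_def)
      then have "((\<lambda>s. \<phi> (s *\<^sub>R v + z)) has_derivative (\<lambda>s. (s *\<^sub>R v) \<bullet> d\<phi> z)) (at 0)"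
        by (intro has_derivative_compose[where g=\<phi> and f="\<lambda>s. s *\<^sub>R v + z"])
           (auto intro!: derivative_eq_intros)
      then have "((\<lambda>s. \<phi> (s *\<^sub>R v + z)) has_real_derivative (d\<phi> z \<bullet> v)) (at 0)"
        by (simp add: has_field_derivative_def inner_commute mult.commute[of _ "_ \<bullet> _"] mult_commute_abs)
      then have "((\<lambda>s. (\<phi> (s *\<^sub>R v + z) - \<phi> z) / s) \<longlongrightarrow> d\<phi> z \<bullet> v) (at 0)"
        by (simp add: DERIV_def)
      moreover have "filterlim h (at 0) sequentially"
        using hlim h(3) by (simp add: filterlim_at)
      ultimately show "(\<lambda>n. D n z) \<longlonglongrightarrow> d\<phi> z \<bullet> v"
        unfolding D_def by (rule filterlim_compose)
    qed
    show "(\<lambda>z. d\<phi> z \<bullet> v) \<in> borel_measurable lborel"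
      using d\<phi>(1) by (simp add: borel_measurable_continuous_onI continuous_on_inner)
    show "D n \<in> borel_measurable lborel" for n
      unfolding D_def[abs_def] using cont cont'
      by (simp add: borel_measurable_continuous_onI continuous_on_diff continuous_on_divide h)
  qed
  ultimately show ?thesis by (simp add: LIMSEQ_const_iff)
qed

lemma integral_by_parts:
  assumes \<phi>: "C1 \<phi> d\<phi>" and K: "compact K" "\<And>z. z \<notin> K \<Longrightarrow> \<phi> z = 0" and g: "C1 g dg"
  shows "(LINT z|lborel. g z * (d\<phi> z \<bullet> v)) = - (LINT z|lborel. \<phi> z * (dg z \<bullet> v))"
proof -
  have d\<phi>: "continuous_on UNIV d\<phi>" "\<And>z. z \<notin> K \<Longrightarrow> d\<phi> z = 0"
    using \<phi> C1_support[OF \<phi> compact_imp_closed[OF K(1)] K(2)] by (auto simp: C1_def)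
  have dg: "continuous_on UNIV dg" using g by (simp add: C1_def)
  note c = C1_continuous[OF \<phi>, of UNIV] C1_continuous[OF g, of UNIV]
  have i1: "integrable lborel (\<lambda>z. g z * (d\<phi> z \<bullet> v))"
    by (rule integrable_continuous_compact_support[OF _ K(1)]) (use d\<phi> c in \<open>auto intro!: continuous_intros\<close>)
  have i2: "integrable lborel (\<lambda>z. \<phi> z * (dg z \<bullet> v))"
    by (rule integrable_continuous_compact_support[OF _ K(1)]) (use dg c K in \<open>auto intro!: continuous_intros\<close>)
  have "(LINT z|lborel. (\<phi> z *\<^sub>R dg z + g z *\<^sub>R d\<phi> z) \<bullet> v) = 0"
    by (rule integral_GDERIV_eq_0[OF C1_mult[OF \<phi> g] K(1)]) (simp add: K(2))
  then have "(LINT z|lborel. \<phi> z * (dg z \<bullet> v) + g z * (d\<phi> z \<bullet> v)) = 0"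
    by (simp add: inner_add_left)
  then show ?thesis using i1 i2 by (simp add: Bochner_Integration.integral_add)
qed

lemma moll_support: "\<sigma> > 0 \<Longrightarrow> z \<notin> cball 0 \<sigma> \<Longrightarrow> moll \<sigma> z = 0"
  by (simp add: moll_eq_0)

lemma continuous_on_vconv_moll:
  fixes f :: "'a::euclidean_space \<Rightarrow> 'b::euclidean_space"
  assumes "\<sigma> > 0" "integrable lborel f" shows "continuous_on UNIV (vconv (moll \<sigma>) f)"
  by (rule continuous_on_vconv[OF continuous_on_moll compact_cball moll_support[OF assms(1)] assms(2)])

lemma integrable_moll_kernel:
  fixes f :: "'a::euclidean_space \<Rightarrow> 'b::euclidean_space"
  assumes "\<sigma> > 0" "integrable lborel f" shows "integrable lborel (\<lambda>y. moll \<sigma> (z - y) *\<^sub>R f y)"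
  by (rule integrable_vconv_kernel[OF continuous_on_moll compact_cball moll_support[OF assms(1)] assms(2)])

lemma nn_integral_moll_translate:
  assumes "\<sigma> > 0" shows "(\<integral>\<^sup>+z. ennreal (moll \<sigma> (z - y)) \<partial>lborel) = 1"
proof -
  have m: "moll \<sigma> \<in> borel_measurable borel" by (rule borel_measurable_continuous_onI[OF continuous_on_moll])
  have "continuous_on UNIV (\<lambda>z. moll \<sigma> (z - y))"
    by (rule continuous_on_compose2[OF continuous_on_moll]) (auto intro!: continuous_intros)
  then have i: "integrable lborel (\<lambda>z. moll \<sigma> (z - y))"
    by (rule integrable_continuous_compact_support[OF _ compact_cball[of y \<sigma>]])
       (use assms in \<open>auto simp: dist_norm norm_minus_commute intro!: moll_eq_0\<close>)
  have "(\<integral>\<^sup>+z. ennreal (moll \<sigma> (z - y)) \<partial>lborel) = ennreal (LINT z|lborel. moll \<sigma> (z - y))"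
    by (rule nn_integral_eq_integral[OF i]) (simp add: moll_nonneg)
  also have "(LINT z|lborel. moll \<sigma> (z - y)) = 1"
    using integral_translate[OF m, of "- y"] integral_moll[OF assms, where 'a='a] by simp
  finally show ?thesis by simp
qed

lemma L1_vconv:
  fixes f :: "'a::euclidean_space \<Rightarrow> 'b::euclidean_space"
  assumes "\<sigma> > 0" and f: "integrable lborel f"
  shows "integrable lborel (vconv (moll \<sigma>) f)"
    and "(LINT z|lborel. norm (vconv (moll \<sigma>) f z)) \<le> (LINT z|lborel. norm (f z))"
proof -
  have meas: "vconv (moll \<sigma>) f \<in> borel_measurable borel"
    by (rule borel_measurable_continuous_onI[OF continuous_on_vconv_moll[OF assms]])
  have [measurable]: "moll \<sigma> \<in> borel_measurable (borel :: 'a measure)"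
    by (rule borel_measurable_continuous_onI[OF continuous_on_moll])
  have [measurable]: "f \<in> borel_measurable borel" using f by auto
  have "(\<integral>\<^sup>+z. ennreal (norm (vconv (moll \<sigma>) f z)) \<partial>lborel)
      \<le> (\<integral>\<^sup>+z. (\<integral>\<^sup>+y. ennreal (moll \<sigma> (z - y)) * ennreal (norm (f y)) \<partial>lborel) \<partial>lborel)"
  proof (rule nn_integral_mono)
    fix z :: 'a
    have "ennreal (norm (vconv (moll \<sigma>) f z)) \<le> (\<integral>\<^sup>+y. norm (moll \<sigma> (z - y) *\<^sub>R f y) \<partial>lborel)"
      unfolding vconv_def by (rule integral_norm_bound_ennreal[OF integrable_moll_kernel[OF assms]])
    then show "ennreal (norm (vconv (moll \<sigma>) f z)) \<le> (\<integral>\<^sup>+y. ennreal (moll \<sigma> (z - y)) * ennreal (norm (f y)) \<partial>lborel)"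
      by (simp add: moll_nonneg ennreal_mult)
  qed
  also have "\<dots> = (\<integral>\<^sup>+y. (\<integral>\<^sup>+z. ennreal (moll \<sigma> (z - y)) * ennreal (norm (f y)) \<partial>lborel) \<partial>lborel)"
    by (rule lborel_pair.Fubini') measurable
  also have "\<dots> = (\<integral>\<^sup>+y. ennreal (norm (f y)) \<partial>lborel)"
    by (subst nn_integral_multc) (simp_all add: nn_integral_moll_translate[OF assms(1)])
  finally have le: "(\<integral>\<^sup>+z. ennreal (norm (vconv (moll \<sigma>) f z)) \<partial>lborel) \<le> (\<integral>\<^sup>+y. ennreal (norm (f y)) \<partial>lborel)" .
  moreover have fin: "(\<integral>\<^sup>+y. ennreal (norm (f y)) \<partial>lborel) < \<infinity>"
    using f unfolding integrable_iff_bounded by auto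
  ultimately show i: "integrable lborel (vconv (moll \<sigma>) f)"
    unfolding integrable_iff_bounded using meas by auto
  have "ennreal (LINT z|lborel. norm (vconv (moll \<sigma>) f z)) \<le> ennreal (LINT z|lborel. norm (f z))"
    using le f i by (simp add: nn_integral_eq_integral)
  then show "(LINT z|lborel. norm (vconv (moll \<sigma>) f z)) \<le> (LINT z|lborel. norm (f z))"
    by (simp add: ennreal_le_iff)
qed

lemma integral_moll_reflect:
  assumes "\<sigma> > 0"
  shows "(LINT y|lborel. moll \<sigma> (z - y)) = 1" "integrable lborel (\<lambda>y. moll \<sigma> ((z::'a::euclidean_space) - y))"
proof -
  have sym: "moll \<sigma> (z - y) = moll \<sigma> (y - z)" for y :: 'a
    by (simp add: moll_def inner_diff_left inner_diff_right inner_commute algebra_simps)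
  have "continuous_on UNIV (\<lambda>y. moll \<sigma> (y - z))"
    by (rule continuous_on_compose2[OF continuous_on_moll]) (auto intro!: continuous_intros)
  then have i: "integrable lborel (\<lambda>y. moll \<sigma> (y - z))"
    by (rule integrable_continuous_compact_support[OF _ compact_cball[of z \<sigma>]])
       (use assms in \<open>auto simp: dist_norm norm_minus_commute intro!: moll_eq_0\<close>)
  then show "integrable lborel (\<lambda>y. moll \<sigma> (z - y))" by (simp add: sym)
  have m: "moll \<sigma> \<in> borel_measurable borel" by (rule borel_measurable_continuous_onI[OF continuous_on_moll])
  show "(LINT y|lborel. moll \<sigma> (z - y)) = 1"
    unfolding sym using integral_translate[OF m, of "- z"] integral_moll[OF assms, where 'a='a] by simp
qed

lemma vconv_moll_eq_0:
  assumes "\<sigma> > 0" "\<And>y. norm (z - y) < \<sigma> \<Longrightarrow> f y = 0"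
  shows "vconv (moll \<sigma>) f z = 0"
proof -
  have "moll \<sigma> (z - y) *\<^sub>R f y = 0" for y
    using assms moll_eq_0[of \<sigma> "z - y"] by (cases "norm (z - y) < \<sigma>") auto
  then have "(\<lambda>y. moll \<sigma> (z - y) *\<^sub>R f y) = (\<lambda>y. 0)" by blast
  then show ?thesis unfolding vconv_def by simp
qed

lemma vconv_moll_continuous_tendsto_L1:
  fixes \<phi> :: "'a::euclidean_space \<Rightarrow> 'b::euclidean_space"
  assumes \<phi>: "continuous_on UNIV \<phi>" and K: "compact K" "\<And>z. z \<notin> K \<Longrightarrow> \<phi> z = 0" and "e > 0"
  shows "\<exists>s0>0. \<forall>\<sigma>. 0 < \<sigma> \<and> \<sigma> < s0 \<longrightarrow> (LINT z|lborel. norm (vconv (moll \<sigma>) \<phi> z - \<phi> z)) < e"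
proof -
  obtain R where R: "\<And>z. z \<in> K \<Longrightarrow> norm z \<le> R"
    using compact_imp_bounded[OF K(1)] by (auto simp: bounded_iff)
  define V where "V = measure lborel (cball (0::'a) (R+1))"
  have V: "V \<ge> 0" by (simp add: V_def)
  have e': "e / (V + 1) > 0" using V \<open>e > 0\<close> by simp
  obtain d where d: "d > 0" "\<And>x y. dist y x < d \<Longrightarrow> dist (\<phi> y) (\<phi> x) < e / (V+1)"
    using uniformly_continuous_UNIVE[OF uniformly_continuous_compact_support[OF \<phi> K] e'] by auto
  have int\<phi>: "integrable lborel \<phi>" by (rule integrable_continuous_compact_support[OF \<phi> K])
  have "(LINT z|lborel. norm (vconv (moll \<sigma>) \<phi> z - \<phi> z)) < e" if \<sigma>: "0 < \<sigma>" "\<sigma> < min d 1" for \<sigma>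
  proof -
    have bound: "norm (vconv (moll \<sigma>) \<phi> z - \<phi> z) \<le> e / (V+1)" for z
    proof -
      have "vconv (moll \<sigma>) \<phi> z - \<phi> z = (LINT y|lborel. moll \<sigma> (z - y) *\<^sub>R \<phi> y) - (LINT y|lborel. moll \<sigma> (z - y) *\<^sub>R \<phi> z)"
        using integral_moll_reflect[OF \<sigma>(1), of z] by (simp add: vconv_def)
      also have "\<dots> = (LINT y|lborel. moll \<sigma> (z - y) *\<^sub>R \<phi> y - moll \<sigma> (z - y) *\<^sub>R \<phi> z)"
        by (rule Bochner_Integration.integral_diff[symmetric])
           (use integrable_moll_kernel[OF \<sigma>(1) int\<phi>] integral_moll_reflect[OF \<sigma>(1), of z] in auto)
      also have "norm \<dots> \<le> (LINT y|lborel. moll \<sigma> (z - y) * (e / (V+1)))"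
      proof (rule integral_norm_le_integral)
        fix y
        show "norm (moll \<sigma> (z - y) *\<^sub>R \<phi> y - moll \<sigma> (z - y) *\<^sub>R \<phi> z) \<le> moll \<sigma> (z - y) * (e / (V+1))"
        proof (cases "norm (z - y) < \<sigma>")
          case True
          then have "norm (\<phi> y - \<phi> z) \<le> e / (V+1)"
            using d(2)[of y z] \<sigma> by (simp add: dist_norm norm_minus_commute)
          then show ?thesis unfolding scaleR_diff_right[symmetric] norm_scaleR
            by (simp add: moll_nonneg mult_left_mono del: times_divide_eq_right)
        qed (use \<sigma> in \<open>simp add: moll_eq_0\<close>)
      qed (use integrable_moll_kernel[OF \<sigma>(1) int\<phi>] integral_moll_reflect[OF \<sigma>(1), of z] in auto)
      also have "\<dots> = e / (V+1)" using integral_moll_reflect[OF \<sigma>(1), of z] by simp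
      finally show ?thesis .
    qed
    have supp: "vconv (moll \<sigma>) \<phi> z - \<phi> z = 0" if "z \<notin> cball 0 (R+1)" for z
    proof -
      have "\<phi> y = 0" if "norm (z - y) < \<sigma>" for y
      proof (rule K(2))
        show "y \<notin> K" using R[of y] that \<open>z \<notin> cball 0 (R+1)\<close> \<sigma> norm_triangle_ineq2[of z y] by auto
      qed
      moreover from this[of z] have "\<phi> z = 0" using \<sigma> by simp
      ultimately show ?thesis using vconv_moll_eq_0[OF \<sigma>(1), of z \<phi>] by simp
    qed
    have "(LINT z|lborel. norm (vconv (moll \<sigma>) \<phi> z - \<phi> z)) \<le> (LINT z|lborel. indicator (cball (0::'a) (R+1)) z * (e / (V+1)))"
    proof (rule Bochner_Integration.integral_mono)
      show "integrable lborel (\<lambda>z. indicator (cball (0::'a) (R+1)) z * (e / (V+1)))"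
        by (intro integrable_mult_left integrable_real_indicator) (auto intro!: emeasure_bounded_finite[unfolded infinity_ennreal_def])
      show "norm (vconv (moll \<sigma>) \<phi> z - \<phi> z) \<le> indicator (cball (0::'a) (R+1)) z * (e / (V+1))" for z
        using bound[of z] supp[of z] by (cases "z \<in> cball 0 (R+1)") auto
    qed (use L1_vconv(1)[OF \<sigma>(1) int\<phi>] int\<phi> in auto)
    also have "\<dots> = V * (e / (V+1))" by (simp add: V_def)
    also have "\<dots> < e" using V \<open>e > 0\<close> by (simp add: field_simps)
    finally show ?thesis .
  qed
  then show ?thesis using d(1) by (intro exI[of _ "min d 1"]) auto
qed

lemma continuous_dense_L1:
  fixes f :: "'a::euclidean_space \<Rightarrow> 'b::euclidean_space"
  assumes f: "integrable lborel f" and "e > 0"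
  shows "\<exists>\<phi> K. continuous_on UNIV \<phi> \<and> compact K \<and> (\<forall>z. z \<notin> K \<longrightarrow> \<phi> z = 0) \<and> (LINT z|lborel. norm (f z - \<phi> z)) < e"
proof -
  have [measurable]: "f \<in> borel_measurable borel" using f by auto
  define A where "A n = {z. norm z \<le> real n \<and> norm (f z) \<le> real n}" for n
  have [measurable]: "A n \<in> sets borel" for n unfolding A_def by measurable
  define F where "F n z = indicator (A n) z *\<^sub>R f z" for n z
  have [measurable]: "F n \<in> borel_measurable borel" for n unfolding F_def by measurable
  have intF: "integrable lborel (F n)" for n
    unfolding F_def by (rule integrable_mult_indicator) (use f in auto)
  have "(\<lambda>n. LINT z|lborel. norm (f z - F n z)) \<longlonglongrightarrow> (LINT z|(lborel :: 'a measure). 0 :: real)"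
  proof (rule integral_dominated_convergence)
    show "integrable lborel (\<lambda>z. norm (f z))" using f by simp
    show "AE z in lborel. (\<lambda>n. norm (f z - F n z)) \<longlonglongrightarrow> 0"
    proof (intro AE_I2)
      fix z
      obtain N :: nat where N: "max (norm z) (norm (f z)) \<le> real N" using real_arch_simple by blast
      have "norm (f z - F n z) = 0" if "n \<ge> N" for n
        using N that unfolding F_def A_def by (auto simp: indicator_def)
      then show "(\<lambda>n. norm (f z - F n z)) \<longlonglongrightarrow> 0"
        by (intro tendsto_eventually eventually_sequentiallyI[of N]) auto
    qed
    show "AE z in lborel. norm (norm (f z - F n z)) \<le> norm (f z)" for n
      by (intro AE_I2) (auto simp: F_def indicator_def)
  qed auto
  then have "(\<lambda>n. LINT z|lborel. norm (f z - F n z)) \<longlonglongrightarrow> 0" by simp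
  then obtain n where n: "(LINT z|lborel. norm (f z - F n z)) < e / 2"
    using order_tendstoD(2)[of _ 0 sequentially "e/2"] \<open>e > 0\<close> by (force simp: eventually_sequentially)
  define M where "M = real n"
  have M: "M \<ge> 0" by (simp add: M_def)
  have FM: "norm (F n z) \<le> M" for z unfolding F_def A_def M_def by (auto simp: indicator_def)
  have F0: "F n z = 0" if "norm z > M" for z using that unfolding F_def A_def M_def by (auto simp: indicator_def)
  have "F n \<in> borel_measurable lebesgue" by (rule measurable_completion) simp
  then have "F n measurable_on UNIV" by (rule lebesgue_measurable_imp_measurable_on) simp
  then obtain N g where N: "negligible N" and gc: "\<And>k. continuous_on UNIV (g k)"
    and gl: "\<And>z. z \<notin> N \<Longrightarrow> (\<lambda>k. g k z) \<longlonglongrightarrow> F n z"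
    unfolding measurable_on_def by auto
  have "AE z in lebesgue. z \<notin> N" using N by (auto simp: negligible_iff_null_sets intro: AE_not_in)
  then have AEN: "AE z in lborel. z \<notin> N" by (simp add: AE_completion_iff)
  define \<eta> where "\<eta> z = max 0 (min 1 (M + 1 - norm z))" for z :: 'a
  define P where "P = closest_point (cball (0::'b) M)"
  define h where "h k z = \<eta> z *\<^sub>R P (g k z)" for k z
  have Pc: "continuous_on UNIV P" unfolding P_def
    by (rule continuous_on_closest_point) (use M in auto)
  have PM: "norm (P x) \<le> M" for x
    using closest_point_in_set[of "cball (0::'b) M" x] M unfolding P_def by auto
  have PF: "P (F n z) = F n z" for z
    unfolding P_def by (rule closest_point_self) (use FM in auto)
  have \<eta>c: "continuous_on UNIV \<eta>" unfolding \<eta>_def by (intro continuous_intros)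
  have \<eta>1: "\<bar>\<eta> z\<bar> \<le> 1" for z unfolding \<eta>_def by auto
  have hc: "continuous_on UNIV (h k)" for k unfolding h_def
    by (intro continuous_intros \<eta>c continuous_on_compose2[OF Pc gc]) auto
  have h0: "h k z = 0" if "z \<notin> cball 0 (M+1)" for k z using that by (auto simp: h_def \<eta>_def)
  have hM: "norm (h k z) \<le> M" for k z
    using mult_mono[OF \<eta>1[of z] PM[of "g k z"]] by (simp add: h_def)
  have "(\<lambda>k. LINT z|lborel. norm (F n z - h k z)) \<longlonglongrightarrow> (LINT z|(lborel :: 'a measure). 0 :: real)"
  proof (rule integral_dominated_convergence)
    let ?w = "\<lambda>z. indicator (cball (0::'a) (M+1)) z * (2 * M)"
    show "integrable lborel ?w"
      by (intro integrable_mult_left integrable_real_indicator) (auto intro!: emeasure_bounded_finite[unfolded infinity_ennreal_def])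
    show "AE z in lborel. (\<lambda>k. norm (F n z - h k z)) \<longlonglongrightarrow> 0"
      using AEN
    proof eventually_elim
      case (elim z)
      have "isCont P (F n z)" using Pc by (simp add: continuous_on_eq_continuous_at)
      then have "(\<lambda>k. P (g k z)) \<longlonglongrightarrow> P (F n z)" using gl[OF elim] by (rule isCont_tendsto_compose)
      then have "(\<lambda>k. h k z) \<longlonglongrightarrow> \<eta> z *\<^sub>R F n z" unfolding h_def PF by (intro tendsto_intros)
      moreover have "\<eta> z *\<^sub>R F n z = F n z" using F0[of z] by (cases "norm z > M") (auto simp: \<eta>_def min_def max_def)
      ultimately have "(\<lambda>k. norm (F n z - h k z)) \<longlonglongrightarrow> norm (F n z - F n z)" by (intro tendsto_intros) simp
      then show ?case by simp
    qed
    show "AE z in lborel. norm (norm (F n z - h k z)) \<le> ?w z" for k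
    proof (intro AE_I2)
      fix z
      show "norm (norm (F n z - h k z)) \<le> ?w z"
        using norm_triangle_ineq4[of "F n z" "h k z"] FM[of z] hM[of k z] F0[of z] h0[of z k]
        by (cases "z \<in> cball 0 (M+1)") auto
    qed
    show "(\<lambda>z. norm (F n z - h k z)) \<in> borel_measurable lborel" for k
      using borel_measurable_continuous_onI[OF hc[of k]] by simp
  qed auto
  then have "(\<lambda>k. LINT z|lborel. norm (F n z - h k z)) \<longlonglongrightarrow> 0" by simp
  then obtain k where k: "(LINT z|lborel. norm (F n z - h k z)) < e / 2"
    using order_tendstoD(2)[of _ 0 sequentially "e/2"] \<open>e > 0\<close> by (force simp: eventually_sequentially)
  have inth: "integrable lborel (h k)" by (rule integrable_continuous_compact_support[OF hc compact_cball h0])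
  have "(LINT z|lborel. norm (f z - h k z)) \<le> (LINT z|lborel. norm (f z - F n z) + norm (F n z - h k z))"
  proof (rule Bochner_Integration.integral_mono)
    show "norm (f z - h k z) \<le> norm (f z - F n z) + norm (F n z - h k z)" for z
      using norm_triangle_ineq[of "f z - F n z" "F n z - h k z"] by simp
  qed (use f intF inth in auto)
  also have "\<dots> = (LINT z|lborel. norm (f z - F n z)) + (LINT z|lborel. norm (F n z - h k z))"
    using f intF inth by (intro Bochner_Integration.integral_add) auto
  also have "\<dots> < e" using n k by simp
  finally show ?thesis using hc[of k] h0[of _ k] compact_cball by blast
qed

lemma vconv_diff:
  fixes f g :: "'a::euclidean_space \<Rightarrow> 'b::euclidean_space"
  assumes "\<sigma> > 0" "integrable lborel f" "integrable lborel g"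
  shows "vconv (moll \<sigma>) (\<lambda>z. f z - g z) z = vconv (moll \<sigma>) f z - vconv (moll \<sigma>) g z"
  unfolding vconv_def scaleR_diff_right
  by (rule Bochner_Integration.integral_diff) (use integrable_moll_kernel assms in auto)

lemma vconv_moll_tendsto_L1:
  fixes f :: "'a::euclidean_space \<Rightarrow> 'b::euclidean_space"
  assumes f: "integrable lborel f" and "e > 0"
  shows "\<exists>s0>0. \<forall>\<sigma>. 0 < \<sigma> \<and> \<sigma> < s0 \<longrightarrow> (LINT z|lborel. norm (vconv (moll \<sigma>) f z - f z)) < e"
proof -
  obtain \<phi> K where \<phi>: "continuous_on UNIV \<phi>" "compact K" "\<And>z. z \<notin> K \<Longrightarrow> \<phi> z = 0" "(LINT z|lborel. norm (f z - \<phi> z)) < e / 3"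
    using continuous_dense_L1[OF f, of "e/3"] \<open>e > 0\<close> by auto
  obtain s0 where s0: "s0 > 0" "\<And>\<sigma>. 0 < \<sigma> \<Longrightarrow> \<sigma> < s0 \<Longrightarrow> (LINT z|lborel. norm (vconv (moll \<sigma>) \<phi> z - \<phi> z)) < e / 3"
    using vconv_moll_continuous_tendsto_L1[OF \<phi>(1-3), of "e/3"] \<open>e > 0\<close> by auto
  have int\<phi>: "integrable lborel \<phi>" by (rule integrable_continuous_compact_support[OF \<phi>(1-3)])
  have "(LINT z|lborel. norm (vconv (moll \<sigma>) f z - f z)) < e" if \<sigma>: "0 < \<sigma>" "\<sigma> < s0" for \<sigma>
  proof -
    let ?a = "\<lambda>z. norm (vconv (moll \<sigma>) (\<lambda>z. f z - \<phi> z) z)"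
    let ?b = "\<lambda>z. norm (vconv (moll \<sigma>) \<phi> z - \<phi> z)"
    let ?c = "\<lambda>z. norm (f z - \<phi> z)"
    have i: "integrable lborel ?a" "integrable lborel ?b" "integrable lborel ?c"
      using L1_vconv(1)[OF \<sigma>(1), of "\<lambda>z. f z - \<phi> z"] L1_vconv(1)[OF \<sigma>(1) int\<phi>] f int\<phi> by auto
    have "(LINT z|lborel. norm (vconv (moll \<sigma>) f z - f z)) \<le> (LINT z|lborel. (?a z + ?b z) + ?c z)"
    proof (rule Bochner_Integration.integral_mono)
      show "norm (vconv (moll \<sigma>) f z - f z) \<le> (?a z + ?b z) + ?c z" for z
      proof -
        have "vconv (moll \<sigma>) f z - f z = vconv (moll \<sigma>) (\<lambda>z. f z - \<phi> z) z + (vconv (moll \<sigma>) \<phi> z - \<phi> z) - (f z - \<phi> z)"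
          using vconv_diff[OF \<sigma>(1) f int\<phi>, of z] by simp
        then show ?thesis
          by (metis (no_types, lifting) add_right_mono norm_triangle_ineq norm_triangle_ineq4 order_trans)
      qed
    qed (use i L1_vconv(1)[OF \<sigma>(1) f] f in auto)
    also have "\<dots> = integral\<^sup>L lborel ?a + integral\<^sup>L lborel ?b + integral\<^sup>L lborel ?c"
      using i by (simp add: Bochner_Integration.integral_add)
    also have "integral\<^sup>L lborel ?a \<le> integral\<^sup>L lborel ?c"
      by (rule L1_vconv(2)[OF \<sigma>(1)]) (use f int\<phi> in auto)
    finally show ?thesis using \<phi>(4) s0(2)[OF \<sigma>] by linarith
  qed
  then show ?thesis using s0(1) by blast
qed

lemma mollify_dominated:
  fixes F :: "'a::euclidean_space \<Rightarrow> 'b::euclidean_space"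
  assumes F: "integrable lborel F" and "s0 > 0"
  obtains \<sigma> :: "nat \<Rightarrow> real" and G :: "'a \<Rightarrow> real"
  where "\<And>n. 0 < \<sigma> n" "\<And>n. \<sigma> n < s0" "integrable lborel G"
    "AE z in lborel. (\<lambda>n. vconv (moll (\<sigma> n)) F z) \<longlonglongrightarrow> F z"
    "AE z in lborel. \<forall>n. norm (vconv (moll (\<sigma> n)) F z) \<le> G z"
proof -
  have "\<exists>\<sigma>. 0 < \<sigma> \<and> \<sigma> < s0 \<and> (LINT z|lborel. norm (vconv (moll \<sigma>) F z - F z)) < (1/2) ^ n" for n :: nat
  proof -
    obtain s where s: "s > 0" "\<And>\<sigma>. 0 < \<sigma> \<Longrightarrow> \<sigma> < s \<Longrightarrow> (LINT z|lborel. norm (vconv (moll \<sigma>) F z - F z)) < (1/2)^n"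
      using vconv_moll_tendsto_L1[OF F, of "(1/2)^n"] by auto
    show ?thesis using s \<open>s0 > 0\<close> by (intro exI[of _ "min s s0 / 2"]) (auto simp: min_def)
  qed
  then obtain \<sigma> where \<sigma>: "\<And>n::nat. 0 < \<sigma> n" "\<And>n. \<sigma> n < s0"
    "\<And>n. (LINT z|lborel. norm (vconv (moll (\<sigma> n)) F z - F z)) < (1/2) ^ n" by metis
  define a where "a n z = norm (vconv (moll (\<sigma> n)) F z - F z)" for n z
  have ia: "integrable lborel (a n)" for n
    unfolding a_def using L1_vconv(1)[OF \<sigma>(1) F] F by auto
  have [measurable]: "a n \<in> borel_measurable borel" for n using ia[of n] by auto
  have a0: "a n z \<ge> 0" for n z by (simp add: a_def)
  have sumI: "summable (\<lambda>n. LINT z|lborel. norm (a n z))"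
  proof (rule summable_comparison_test'[where g="\<lambda>n. (1/2)^n" and N=0])
    show "summable (\<lambda>n. (1/2 :: real)^n)" by (rule summable_geometric) simp
    show "norm (LINT z|lborel. norm (a n z)) \<le> (1/2)^n" for n
      using \<sigma>(3)[of n] by (simp add: a_def Bochner_Integration.integral_nonneg less_imp_le)
  qed
  have AEs: "AE z in lborel. summable (\<lambda>n. a n z)"
  proof -
    have "(\<integral>\<^sup>+z. (\<Sum>n. ennreal (a n z)) \<partial>lborel) = (\<Sum>n. (\<integral>\<^sup>+z. ennreal (a n z) \<partial>lborel))"
      by (rule nn_integral_suminf) simp
    also have "\<dots> = (\<Sum>n. ennreal (LINT z|lborel. norm (a n z)))"
      using ia a0 by (simp add: nn_integral_eq_integral)
    also have "\<dots> = ennreal (\<Sum>n. LINT z|lborel. norm (a n z))"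
      by (rule suminf_ennreal2[OF _ sumI]) (simp add: Bochner_Integration.integral_nonneg)
    finally have "(\<integral>\<^sup>+z. (\<Sum>n. ennreal (a n z)) \<partial>lborel) \<noteq> \<infinity>" by simp
    then have "AE z in lborel. (\<Sum>n. ennreal (a n z)) \<noteq> \<infinity>"
      by (intro nn_integral_noteq_infinite) auto
    then show ?thesis
      by eventually_elim (auto intro: summable_suminf_not_top a0)
  qed
  define G where "G z = norm (F z) + (\<Sum>n. a n z)" for z
  have "integrable lborel (\<lambda>z. \<Sum>n. a n z)"
    by (rule integrable_suminf[OF ia _ sumI]) (use AEs a0 in auto)
  then have G: "integrable lborel G" unfolding G_def using F by auto
  have "AE z in lborel. (\<lambda>n. vconv (moll (\<sigma> n)) F z) \<longlonglongrightarrow> F z"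
    using AEs
  proof eventually_elim
    case (elim z)
    then have "(\<lambda>n. norm (vconv (moll (\<sigma> n)) F z - F z)) \<longlonglongrightarrow> 0"
      unfolding a_def by (rule summable_LIMSEQ_zero)
    then show ?case using Lim_null tendsto_norm_zero_iff by blast
  qed
  moreover have "AE z in lborel. \<forall>n. norm (vconv (moll (\<sigma> n)) F z) \<le> G z"
    using AEs
  proof eventually_elim
    case (elim z)
    have "a n z \<le> (\<Sum>n. a n z)" for n
      using sum_le_suminf[OF elim, of "{n}"] a0 by simp
    then show ?case unfolding G_def a_def
      using norm_triangle_sub[of "vconv (moll (\<sigma> _)) F z" "F z"] by (meson add_left_mono order_trans)
  qed
  ultimately show ?thesis using that \<sigma> G by blast
qed

section \<open>Mollified weak inequalities\<close>

lemma vconv_inner: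
  fixes F :: "'a::euclidean_space \<Rightarrow> 'b::euclidean_space"
  assumes "\<sigma> > 0" "integrable lborel F"
  shows "vconv (moll \<sigma>) F z \<bullet> b = vconv (moll \<sigma>) (\<lambda>y. F y \<bullet> b) z"
  unfolding vconv_def using integrable_moll_kernel[OF assms, of z]
  by (subst integral_inner_left[symmetric]) auto

definition Qmoll :: "real \<Rightarrow> ('a::euclidean_space \<Rightarrow> 'a) \<Rightarrow> ('a \<Rightarrow> real) \<Rightarrow> 'a \<Rightarrow> real" where
  "Qmoll \<sigma> F f0 z = (LINT y|lborel. F y \<bullet> (- grad (moll \<sigma>) (z - y)) + f0 y * moll \<sigma> (z - y))"

lemma C1_moll: "C1 (moll \<sigma>) (grad (moll \<sigma>))"
  by (rule C1_smooth_fun[OF smooth_fun_moll])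

lemma grad_moll_support: "\<sigma> > 0 \<Longrightarrow> z \<notin> cball 0 \<sigma> \<Longrightarrow> grad (moll \<sigma>) z = 0"
  by (rule C1_support[OF C1_moll closed_cball moll_support])

lemma C1_vconv_moll:
  assumes "\<sigma> > 0" "integrable lborel f"
  shows "C1 (vconv (moll \<sigma>) f) (\<lambda>z. LINT y|lborel. f y *\<^sub>R grad (moll \<sigma>) (z - y))"
  by (rule C1_vconv[OF C1_moll compact_cball moll_support[OF assms(1)] assms(2)])

lemma integrable_grad_moll:
  assumes "\<sigma> > 0" "integrable lborel f"
  shows "integrable lborel (\<lambda>y. f y *\<^sub>R grad (moll \<sigma>) (z - y))"
  by (rule integrable_grad_kernel[OF conjunct2[OF C1_moll[unfolded C1_def]] compact_cball grad_moll_support[OF assms(1)] assms(2)])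

lemma Qmoll_eq:
  fixes F :: "'a::euclidean_space \<Rightarrow> 'a"
  assumes \<sigma>: "\<sigma> > 0" and F: "integrable lborel F" and f0: "integrable lborel f0"
  shows "Qmoll \<sigma> F f0 z = - (\<Sum>b\<in>Basis. (LINT y|lborel. (F y \<bullet> b) *\<^sub>R grad (moll \<sigma>) (z - y)) \<bullet> b) + vconv (moll \<sigma>) f0 z"
proof -
  let ?dm = "grad (moll \<sigma>)"
  have Fb: "integrable lborel (\<lambda>y. F y \<bullet> b)" for b using F by simp
  have i: "integrable lborel (\<lambda>y. ((F y \<bullet> b) *\<^sub>R ?dm (z - y)) \<bullet> b)" for b
    by (rule integrable_inner_left[OF integrable_grad_moll[OF \<sigma> Fb]])
  have eq: "F y \<bullet> (- ?dm (z - y)) = - (\<Sum>b\<in>Basis. ((F y \<bullet> b) *\<^sub>R ?dm (z - y)) \<bullet> b)" for y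
    by (subst euclidean_inner) (simp add: sum_negf)
  have "Qmoll \<sigma> F f0 z = (LINT y|lborel. - (\<Sum>b\<in>Basis. ((F y \<bullet> b) *\<^sub>R ?dm (z - y)) \<bullet> b) + moll \<sigma> (z - y) *\<^sub>R f0 y)"
    unfolding Qmoll_def eq by (simp add: mult.commute)
  also have "\<dots> = (LINT y|lborel. - (\<Sum>b\<in>Basis. ((F y \<bullet> b) *\<^sub>R ?dm (z - y)) \<bullet> b)) + vconv (moll \<sigma>) f0 z"
    unfolding vconv_def
    by (rule Bochner_Integration.integral_add) (use i integrable_moll_kernel[OF \<sigma> f0] in \<open>auto simp del: inner_scaleR_left\<close>)
  also have "(LINT y|lborel. - (\<Sum>b\<in>Basis. ((F y \<bullet> b) *\<^sub>R ?dm (z - y)) \<bullet> b))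
     = - (\<Sum>b\<in>Basis. (LINT y|lborel. ((F y \<bullet> b) *\<^sub>R ?dm (z - y)) \<bullet> b))"
    using i by (simp add: Bochner_Integration.integral_sum del: inner_scaleR_left)
  also have "(\<lambda>b. LINT y|lborel. ((F y \<bullet> b) *\<^sub>R ?dm (z - y)) \<bullet> b) = (\<lambda>b. (LINT y|lborel. (F y \<bullet> b) *\<^sub>R ?dm (z - y)) \<bullet> b)"
    using integrable_grad_moll[OF \<sigma> Fb] by (auto simp del: inner_scaleR_left)
  finally show ?thesis .
qed

lemma mollified_identity:
  fixes F :: "'a::euclidean_space \<Rightarrow> 'a"
  assumes \<sigma>: "\<sigma> > 0" and F: "integrable lborel F" and f0: "integrable lborel f0"
    and \<phi>: "C1 \<phi> d\<phi>" and K: "compact K" "\<And>z. z \<notin> K \<Longrightarrow> \<phi> z = 0"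
  shows "(LINT z|lborel. vconv (moll \<sigma>) F z \<bullet> d\<phi> z + vconv (moll \<sigma>) f0 z * \<phi> z)
       = (LINT z|lborel. \<phi> z * Qmoll \<sigma> F f0 z)"
    and "integrable lborel (\<lambda>z. vconv (moll \<sigma>) F z \<bullet> d\<phi> z + vconv (moll \<sigma>) f0 z * \<phi> z)"
proof -
  let ?G = "\<lambda>b z. LINT y|lborel. (F y \<bullet> b) *\<^sub>R grad (moll \<sigma>) (z - y)"
  let ?v = "\<lambda>b. vconv (moll \<sigma>) (\<lambda>y. F y \<bullet> b)"
  have Fb: "integrable lborel (\<lambda>y. F y \<bullet> b)" for b using F by simp
  have C: "C1 (?v b) (?G b)" for b by (rule C1_vconv_moll[OF \<sigma> Fb])
  have d\<phi>: "continuous_on UNIV d\<phi>" "\<And>z. z \<notin> K \<Longrightarrow> d\<phi> z = 0"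
    using \<phi> C1_support[OF \<phi> compact_imp_closed[OF K(1)] K(2)] by (auto simp: C1_def)
  have c: "continuous_on UNIV \<phi>" "continuous_on UNIV (?v b)" "continuous_on UNIV (?G b)" for b
    using C1_continuous[OF \<phi>] C1_continuous[OF C] C[of b] by (auto simp: C1_def)
  have cf0: "continuous_on UNIV (vconv (moll \<sigma>) f0)" by (rule continuous_on_vconv_moll[OF \<sigma> f0])
  have i1: "integrable lborel (\<lambda>z. ?v b z * (d\<phi> z \<bullet> b))" for b
    by (rule integrable_continuous_compact_support[OF _ K(1)]) (use d\<phi> c in \<open>auto intro!: continuous_intros\<close>)
  have i2: "integrable lborel (\<lambda>z. \<phi> z * (?G b z \<bullet> b))" for b
    by (rule integrable_continuous_compact_support[OF _ K(1)]) (use c K in \<open>auto intro!: continuous_intros\<close>)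
  have i3: "integrable lborel (\<lambda>z. vconv (moll \<sigma>) f0 z * \<phi> z)"
    by (rule integrable_continuous_compact_support[OF _ K(1)]) (use c cf0 K in \<open>auto intro!: continuous_intros\<close>)
  have eq: "vconv (moll \<sigma>) F z \<bullet> d\<phi> z = (\<Sum>b\<in>Basis. ?v b z * (d\<phi> z \<bullet> b))" for z
    by (subst euclidean_inner) (simp add: vconv_inner[OF \<sigma> F])
  have i4: "integrable lborel (\<lambda>z. \<Sum>b\<in>Basis. ?v b z * (d\<phi> z \<bullet> b))"
    by (rule Bochner_Integration.integrable_sum) (rule i1)
  show "integrable lborel (\<lambda>z. vconv (moll \<sigma>) F z \<bullet> d\<phi> z + vconv (moll \<sigma>) f0 z * \<phi> z)"
    unfolding eq by (rule Bochner_Integration.integrable_add[OF i4 i3])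
  have "(LINT z|lborel. vconv (moll \<sigma>) F z \<bullet> d\<phi> z + vconv (moll \<sigma>) f0 z * \<phi> z)
     = (\<Sum>b\<in>Basis. LINT z|lborel. ?v b z * (d\<phi> z \<bullet> b)) + (LINT z|lborel. vconv (moll \<sigma>) f0 z * \<phi> z)"
    unfolding eq by (subst Bochner_Integration.integral_add[OF i4 i3]) (simp add: Bochner_Integration.integral_sum i1)
  also have "(\<lambda>b. LINT z|lborel. ?v b z * (d\<phi> z \<bullet> b)) = (\<lambda>b. - (LINT z|lborel. \<phi> z * (?G b z \<bullet> b)))"
    using integral_by_parts[OF \<phi> K C] by simp
  also have "(\<Sum>b\<in>Basis. - (LINT z|lborel. \<phi> z * (?G b z \<bullet> b))) = (LINT z|lborel. - (\<Sum>b\<in>Basis. \<phi> z * (?G b z \<bullet> b)))"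
    using i2 by (simp add: Bochner_Integration.integral_sum sum_negf)
  also have "\<dots> + (LINT z|lborel. vconv (moll \<sigma>) f0 z * \<phi> z)
      = (LINT z|lborel. - (\<Sum>b\<in>Basis. \<phi> z * (?G b z \<bullet> b)) + vconv (moll \<sigma>) f0 z * \<phi> z)"
    by (rule Bochner_Integration.integral_add[symmetric]) (use i2 i3 in auto)
  also have "\<dots> = (LINT z|lborel. \<phi> z * Qmoll \<sigma> F f0 z)"
    unfolding Qmoll_eq[OF \<sigma> F f0] by (intro Bochner_Integration.integral_cong) (auto simp: sum_distrib_left algebra_simps)
  finally show "(LINT z|lborel. vconv (moll \<sigma>) F z \<bullet> d\<phi> z + vconv (moll \<sigma>) f0 z * \<phi> z)
       = (LINT z|lborel. \<phi> z * Qmoll \<sigma> F f0 z)" .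
qed

definition wineq :: "'a::euclidean_space set \<Rightarrow> ('a \<Rightarrow> 'a) \<Rightarrow> ('a \<Rightarrow> real) \<Rightarrow> bool" where
  "wineq U F f0 \<longleftrightarrow> (\<forall>\<phi>. test_fun U \<phi> \<and> (\<forall>z. 0 \<le> \<phi> z) \<longrightarrow>
      0 \<le> (LINT z|lborel. F z \<bullet> grad \<phi> z + f0 z * \<phi> z))"

definition locint :: "'a::euclidean_space set \<Rightarrow> ('a \<Rightarrow> 'b::euclidean_space) \<Rightarrow> bool" where
  "locint U F \<longleftrightarrow> (\<forall>K. compact K \<and> K \<subseteq> U \<longrightarrow> integrable lborel (\<lambda>z. indicator K z *\<^sub>R F z))"

lemma grad_affine:
  assumes "smooth_fun f"
  shows "grad (\<lambda>z. f (a + r *\<^sub>R z)) z = r *\<^sub>R grad f (a + r *\<^sub>R z)"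
proof -
  have "frechet_derivative (\<lambda>z. f (a + r *\<^sub>R z)) (at z) b = r * frechet_derivative f (at (a + r *\<^sub>R z)) b" for b
    using fun_cong[OF iter_dir_affine[OF assms, of "[b]" a r], of z] by simp
  then show ?thesis by (simp add: grad_def scaleR_sum_right)
qed

lemma moll_reflect_support:
  assumes "\<sigma> > 0" "y \<notin> cball z \<sigma>" shows "moll \<sigma> (z - y) = 0" "grad (moll \<sigma>) (z - y) = 0"
proof -
  have "z - y \<notin> cball 0 \<sigma>" using assms(2) by (simp add: dist_norm norm_minus_commute)
  then show "moll \<sigma> (z - y) = 0" "grad (moll \<sigma>) (z - y) = 0"
    by (rule moll_support[OF assms(1)], rule grad_moll_support[OF assms(1)])
qed

lemma test_fun_moll:
  assumes "\<sigma> > 0" "cball z \<sigma> \<subseteq> N"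
  shows "test_fun N (\<lambda>y. moll \<sigma> (z - y))"
proof -
  have "smooth_fun (\<lambda>y. moll \<sigma> (z + (-1) *\<^sub>R y))" by (rule smooth_fun_affine[OF smooth_fun_moll])
  moreover have sub: "closure {y. moll \<sigma> (z - y) \<noteq> 0} \<subseteq> cball z \<sigma>"
    by (rule closure_minimal) (use moll_reflect_support(1)[OF assms(1)] in blast, simp)
  moreover from sub have "compact (closure {y. moll \<sigma> (z - y) \<noteq> 0})"
    by (meson bounded_cball bounded_subset closed_closure compact_eq_bounded_closed)
  ultimately show ?thesis using assms(2) by (simp add: test_fun_def) 
qed

lemma Qmoll_nonneg:
  assumes w: "wineq N F f0" and \<sigma>: "\<sigma> > 0" "cball z \<sigma> \<subseteq> N" "cball z \<sigma> \<subseteq> K'"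
  shows "0 \<le> Qmoll \<sigma> (\<lambda>y. indicator K' y *\<^sub>R F y) (\<lambda>y. indicator K' y *\<^sub>R f0 y) z"
proof -
  let ?\<phi> = "\<lambda>y. moll \<sigma> (z - y)"
  have "0 \<le> (LINT y|lborel. F y \<bullet> grad ?\<phi> y + f0 y * ?\<phi> y)"
    using w test_fun_moll[OF \<sigma>(1,2)] moll_nonneg unfolding wineq_def by blast
  also have "grad ?\<phi> = (\<lambda>y. - grad (moll \<sigma>) (z - y))"
    using grad_affine[OF smooth_fun_moll[of \<sigma>], of z "-1"] by auto
  also have "(LINT y|lborel. F y \<bullet> (- grad (moll \<sigma>) (z - y)) + f0 y * ?\<phi> y)
     = Qmoll \<sigma> (\<lambda>y. indicator K' y *\<^sub>R F y) (\<lambda>y. indicator K' y *\<^sub>R f0 y) z"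
    unfolding Qmoll_def
  proof (rule Bochner_Integration.integral_cong[OF refl])
    fix y
    show "F y \<bullet> - grad (moll \<sigma>) (z - y) + f0 y * moll \<sigma> (z - y) =
         indicator K' y *\<^sub>R F y \<bullet> - grad (moll \<sigma>) (z - y) + indicator K' y *\<^sub>R f0 y * moll \<sigma> (z - y)"
    proof (cases "y \<in> cball z \<sigma>")
      case True
      then show ?thesis using \<sigma>(3) by auto
    next
      case False
      then show ?thesis by (simp add: moll_reflect_support[OF \<sigma>(1)])
    qed
  qed
  finally show ?thesis .
qed

lemma Qmoll_uminus: "Qmoll \<sigma> (\<lambda>y. - F y) (\<lambda>y. - f0 y) z = - Qmoll \<sigma> F f0 z"
proof -
  have "(\<lambda>y. - F y \<bullet> - grad (moll \<sigma>) (z - y) + - f0 y * moll \<sigma> (z - y))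
      = (\<lambda>y. - (F y \<bullet> (- grad (moll \<sigma>) (z - y)) + f0 y * moll \<sigma> (z - y)))" by auto
  then show ?thesis unfolding Qmoll_def by (simp only: integral_minus)
qed

lemma compact_neighbourhood:
  fixes K :: "'a::euclidean_space set"
  assumes "compact K" "open U" "K \<subseteq> U"
  obtains K' s where "compact K'" "K' \<subseteq> U" "K \<subseteq> K'" "s > 0" "\<And>z. z \<in> K \<Longrightarrow> cball z s \<subseteq> K'"
proof -
  obtain e where e: "e > 0" "(\<Union>x\<in>K. cball x e) \<subseteq> U"
    by (rule compact_subset_open_imp_cball_epsilon_subset[OF assms])
  let ?K' = "{x + y | x y. x \<in> K \<and> y \<in> cball 0 e}"
  have eq: "?K' = (\<Union>x\<in>K. cball x e)"
  proof (intro equalityI subsetI)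
    fix z assume "z \<in> (\<Union>x\<in>K. cball x e)"
    then obtain x where "x \<in> K" "dist x z \<le> e" by auto
    then show "z \<in> ?K'" by (intro CollectI exI[of _ x] exI[of _ "z - x"]) (auto simp: dist_norm norm_minus_commute)
  next
    fix z assume "z \<in> ?K'"
    then obtain x y where "z = x + y" "x \<in> K" "norm y \<le> e" by auto
    then show "z \<in> (\<Union>x\<in>K. cball x e)" by (intro UN_I[of x]) (auto simp: dist_norm)
  qed
  have "compact ?K'" by (rule compact_sums[OF assms(1) compact_cball])
  then show ?thesis using that[of ?K' e] e unfolding eq by force
qed

lemma C1_limit:
  fixes F :: "'a::euclidean_space \<Rightarrow> 'a"
  assumes F: "integrable lborel F" and f0: "integrable lborel f0"
    and \<phi>: "C1 \<phi> d\<phi>" and K: "compact K" "\<And>z. z \<notin> K \<Longrightarrow> \<phi> z = 0"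
    and s: "s > 0" and Q: "\<And>\<sigma>. 0 < \<sigma> \<Longrightarrow> \<sigma> < s \<Longrightarrow> 0 \<le> (LINT z|lborel. \<phi> z * Qmoll \<sigma> F f0 z)"
  shows "0 \<le> (LINT z|lborel. F z \<bullet> d\<phi> z + f0 z * \<phi> z)"
proof -
  have d\<phi>: "continuous_on UNIV d\<phi>" "\<And>z. z \<notin> K \<Longrightarrow> d\<phi> z = 0"
    using \<phi> C1_support[OF \<phi> compact_imp_closed[OF K(1)] K(2)] by (auto simp: C1_def)
  note c\<phi> = C1_continuous[OF \<phi>, of UNIV]
  obtain B1 where B1: "\<And>z. norm (d\<phi> z) \<le> B1" using bounded_continuous_compact_support[OF d\<phi>(1) K(1) d\<phi>(2)] by blast
  obtain B2 where B2: "\<And>z. norm (\<phi> z) \<le> B2" using bounded_continuous_compact_support[OF c\<phi> K] by blast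
  define B where "B = max B1 B2"
  have B: "norm (d\<phi> z) \<le> B" "\<bar>\<phi> z\<bar> \<le> B" for z using B1[of z] B2[of z] by (auto simp: B_def)
  then have B0: "B \<ge> 0" using norm_ge_zero order_trans by blast
  have bd: "\<bar>X \<bullet> d\<phi> z + x * \<phi> z\<bar> \<le> B * norm X + B * \<bar>x\<bar>" for X x z
  proof -
    have "\<bar>X \<bullet> d\<phi> z\<bar> \<le> norm X * norm (d\<phi> z)" by (rule Cauchy_Schwarz_ineq2)
    also have "\<dots> \<le> norm X * B" by (intro mult_left_mono B) auto
    moreover have "\<bar>x * \<phi> z\<bar> \<le> \<bar>x\<bar> * B" unfolding abs_mult by (intro mult_left_mono B) auto
    ultimately show ?thesis by (simp add: mult.commute)
  qed
  have [measurable]: "d\<phi> \<in> borel_measurable borel" "\<phi> \<in> borel_measurable borel"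
    using d\<phi>(1) c\<phi> by (auto intro: borel_measurable_continuous_onI)
  have iL: "integrable lborel (\<lambda>z. F z \<bullet> d\<phi> z + f0 z * \<phi> z)"
  proof (rule Bochner_Integration.integrable_bound)
    show "integrable lborel (\<lambda>z. B * norm (F z) + B * \<bar>f0 z\<bar>)" using F f0 by auto
    show "(\<lambda>z. F z \<bullet> d\<phi> z + f0 z * \<phi> z) \<in> borel_measurable lborel" using F f0 by auto
    show "AE z in lborel. norm (F z \<bullet> d\<phi> z + f0 z * \<phi> z) \<le> norm (B * norm (F z) + B * \<bar>f0 z\<bar>)"
      using bd B0 by (intro AE_I2) (smt (verit) real_norm_def)
  qed
  define L where "L = (LINT z|lborel. F z \<bullet> d\<phi> z + f0 z * \<phi> z)"
  have "L \<ge> - e" if "e > 0" for e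
  proof -
    define c where "c = e / 2"
    define e' where "e' = c / (B + 1)"
    have e': "e' > 0" using that B0 by (simp add: e'_def c_def)
    obtain s1 where s1: "s1 > 0" "\<And>\<sigma>. 0 < \<sigma> \<Longrightarrow> \<sigma> < s1 \<Longrightarrow> (LINT z|lborel. norm (vconv (moll \<sigma>) F z - F z)) < e'"
      using vconv_moll_tendsto_L1[OF F e'] by auto
    obtain s2 where s2: "s2 > 0" "\<And>\<sigma>. 0 < \<sigma> \<Longrightarrow> \<sigma> < s2 \<Longrightarrow> (LINT z|lborel. norm (vconv (moll \<sigma>) f0 z - f0 z)) < e'"
      using vconv_moll_tendsto_L1[OF f0 e'] by auto
    define \<sigma> where "\<sigma> = min s (min s1 s2) / 2"
    have \<sigma>: "0 < \<sigma>" "\<sigma> < s" "\<sigma> < s1" "\<sigma> < s2" using s s1 s2 by (auto simp: \<sigma>_def)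
    define L' where "L' = (LINT z|lborel. vconv (moll \<sigma>) F z \<bullet> d\<phi> z + vconv (moll \<sigma>) f0 z * \<phi> z)"
    note id = mollified_identity[OF \<sigma>(1) F f0 \<phi> K]
    have "L' \<ge> 0" unfolding L'_def using id(1) Q[OF \<sigma>(1,2)] by simp
    have iF: "integrable lborel (\<lambda>z. norm (vconv (moll \<sigma>) F z - F z))" "integrable lborel (\<lambda>z. norm (vconv (moll \<sigma>) f0 z - f0 z))"
      using L1_vconv(1)[OF \<sigma>(1) F] L1_vconv(1)[OF \<sigma>(1) f0] F f0 by auto
    have "L' - L = (LINT z|lborel. (vconv (moll \<sigma>) F z \<bullet> d\<phi> z + vconv (moll \<sigma>) f0 z * \<phi> z) - (F z \<bullet> d\<phi> z + f0 z * \<phi> z))"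
      unfolding L'_def L_def using id(2) iL by simp
    also have "norm \<dots> \<le> (LINT z|lborel. B * norm (vconv (moll \<sigma>) F z - F z) + B * norm (vconv (moll \<sigma>) f0 z - f0 z))"
    proof (rule integral_norm_le_integral)
      fix z
      have eq: "(vconv (moll \<sigma>) F z \<bullet> d\<phi> z + vconv (moll \<sigma>) f0 z * \<phi> z) - (F z \<bullet> d\<phi> z + f0 z * \<phi> z)
         = (vconv (moll \<sigma>) F z - F z) \<bullet> d\<phi> z + (vconv (moll \<sigma>) f0 z - f0 z) * \<phi> z"
        by (simp add: inner_diff_left algebra_simps)
      show "norm ((vconv (moll \<sigma>) F z \<bullet> d\<phi> z + vconv (moll \<sigma>) f0 z * \<phi> z) - (F z \<bullet> d\<phi> z + f0 z * \<phi> z))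
         \<le> B * norm (vconv (moll \<sigma>) F z - F z) + B * norm (vconv (moll \<sigma>) f0 z - f0 z)"
        unfolding eq using bd by simp
    qed (use id(2) iL iF in auto)
    also have "\<dots> = B * (LINT z|lborel. norm (vconv (moll \<sigma>) F z - F z)) + B * (LINT z|lborel. norm (vconv (moll \<sigma>) f0 z - f0 z))"
      using iF by simp
    also have "\<dots> \<le> B * e' + B * e'"
      using s1(2)[OF \<sigma>(1,3)] s2(2)[OF \<sigma>(1,4)] B0 by (intro add_mono mult_left_mono) auto
    also have "\<dots> \<le> e"
    proof -
      have "B + 1 \<noteq> 0" using B0 by linarith
      then have "(B + 1) * e' = c" by (simp add: e'_def)
      then show ?thesis using e' by (simp add: algebra_simps c_def)
    qed
    finally show ?thesis using \<open>L' \<ge> 0\<close> by simp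
  qed
  then have "0 \<le> L + e" if "e > 0" for e using that by force
  then have "L \<ge> 0" by (rule field_le_epsilon)
  then show ?thesis by (simp add: L_def)
qed

lemma local_Qmoll:
  fixes F :: "'a::euclidean_space \<Rightarrow> 'a"
  assumes loc: "\<And>z. z \<in> W \<Longrightarrow> \<exists>N. open N \<and> z \<in> N \<and> N \<subseteq> W \<and> wineq N F f0"
    and K: "compact K" "K \<subseteq> W"
  obtains s where "s > 0"
    "\<And>\<sigma> z A. 0 < \<sigma> \<Longrightarrow> \<sigma> < s \<Longrightarrow> z \<in> K \<Longrightarrow> cball z \<sigma> \<subseteq> A \<Longrightarrow>
       0 \<le> Qmoll \<sigma> (\<lambda>y. indicator A y *\<^sub>R F y) (\<lambda>y. indicator A y *\<^sub>R f0 y) z"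
proof -
  let ?C = "{N. open N \<and> N \<subseteq> W \<and> wineq N F f0}"
  have "K \<subseteq> \<Union>?C" using loc K(2) by blast
  then obtain s2 where s2: "s2 > 0" "\<And>z. z \<in> K \<Longrightarrow> \<exists>N\<in>?C. ball z s2 \<subseteq> N"
    using Heine_Borel_lemma[OF K(1), of ?C] by blast
  show ?thesis
  proof (rule that[OF s2(1)])
    fix \<sigma> z A assume \<sigma>: "0 < \<sigma>" "\<sigma> < s2" "z \<in> K" "cball z \<sigma> \<subseteq> A"
    obtain N where N: "wineq N F f0" "ball z s2 \<subseteq> N" using s2(2)[OF \<sigma>(3)] by blast
    have "cball z \<sigma> \<subseteq> N" using N(2) \<sigma>(2) by (force simp: subset_eq)
    then show "0 \<le> Qmoll \<sigma> (\<lambda>y. indicator A y *\<^sub>R F y) (\<lambda>y. indicator A y *\<^sub>R f0 y) z"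
      using Qmoll_nonneg[OF N(1) \<sigma>(1) _ \<sigma>(4)] by blast
  qed
qed

lemma open_local:
  assumes "\<And>z. z \<in> W \<Longrightarrow> \<exists>N. open N \<and> z \<in> N \<and> N \<subseteq> W \<and> P N"
  shows "open W"
  by (subst open_subopen) (use assms in blast)

lemma integral_indicator_test:
  fixes F :: "'a::euclidean_space \<Rightarrow> 'a"
  assumes \<phi>: "C1 \<phi> d\<phi>" and K: "compact K" "\<And>z. z \<notin> K \<Longrightarrow> \<phi> z = 0" and "K \<subseteq> K'"
  shows "(LINT z|lborel. (indicator K' z *\<^sub>R F z) \<bullet> d\<phi> z + (indicator K' z *\<^sub>R f0 z) * \<phi> z)
       = (LINT z|lborel. F z \<bullet> d\<phi> z + f0 z * \<phi> z)"
proof (rule Bochner_Integration.integral_cong[OF refl])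
  fix z
  have "d\<phi> z = 0" if "z \<notin> K" using C1_support[OF \<phi> compact_imp_closed[OF K(1)] K(2) that] .
  then show "(indicator K' z *\<^sub>R F z) \<bullet> d\<phi> z + (indicator K' z *\<^sub>R f0 z) * \<phi> z = F z \<bullet> d\<phi> z + f0 z * \<phi> z"
    using assms(4) K(2)[of z] by (cases "z \<in> K") auto
qed

lemma wineq_C1_local:
  fixes F :: "'a::euclidean_space \<Rightarrow> 'a"
  assumes loc: "\<And>z. z \<in> W \<Longrightarrow> \<exists>N. open N \<and> z \<in> N \<and> N \<subseteq> W \<and> wineq N F f0"
    and int: "locint W F" "locint W f0"
    and \<phi>: "C1 \<phi> d\<phi>" and K: "compact K" "\<And>z. z \<notin> K \<Longrightarrow> \<phi> z = 0" "K \<subseteq> W" and nn: "\<And>z. 0 \<le> \<phi> z"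
  shows "0 \<le> (LINT z|lborel. F z \<bullet> d\<phi> z + f0 z * \<phi> z)"
proof -
  obtain s where s: "s > 0" and Q: "\<And>\<sigma> z A. 0 < \<sigma> \<Longrightarrow> \<sigma> < s \<Longrightarrow> z \<in> K \<Longrightarrow> cball z \<sigma> \<subseteq> A \<Longrightarrow>
       0 \<le> Qmoll \<sigma> (\<lambda>y. indicator A y *\<^sub>R F y) (\<lambda>y. indicator A y *\<^sub>R f0 y) z"
    using local_Qmoll[OF loc K(1,3)] by blast
  obtain K' s' where K': "compact K'" "K' \<subseteq> W" "K \<subseteq> K'" "s' > 0" "\<And>z. z \<in> K \<Longrightarrow> cball z s' \<subseteq> K'"
    using compact_neighbourhood[OF K(1) open_local[OF loc] K(3)] by blast
  have "0 \<le> (LINT z|lborel. (indicator K' z *\<^sub>R F z) \<bullet> d\<phi> z + (indicator K' z *\<^sub>R f0 z) * \<phi> z)"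
  proof (rule C1_limit[OF _ _ \<phi> K(1,2), where s="min s s'"])
    show "integrable lborel (\<lambda>z. indicator K' z *\<^sub>R F z)" "integrable lborel (\<lambda>z. indicator K' z *\<^sub>R f0 z)"
      using int K' by (auto simp: locint_def)
    fix \<sigma> assume \<sigma>: "0 < \<sigma>" "\<sigma> < min s s'"
    have "0 \<le> \<phi> z * Qmoll \<sigma> (\<lambda>y. indicator K' y *\<^sub>R F y) (\<lambda>y. indicator K' y *\<^sub>R f0 y) z" for z
    proof (cases "z \<in> K")
      case True
      have "cball z \<sigma> \<subseteq> cball z s'" using \<sigma> by auto
      then have "cball z \<sigma> \<subseteq> K'" using K'(5)[OF True] by blast
      then show ?thesis using Q[of \<sigma> z K'] \<sigma> True nn[of z] by simp
    qed (use K(2) in simp)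
    then show "0 \<le> (LINT z|lborel. \<phi> z * Qmoll \<sigma> (\<lambda>y. indicator K' y *\<^sub>R F y) (\<lambda>y. indicator K' y *\<^sub>R f0 y) z)"
      by (rule Bochner_Integration.integral_nonneg)
  next
    show "0 < min s s'" using s K'(4) by linarith
  qed
  moreover have "(LINT z|lborel. (indicator K' z *\<^sub>R F z) \<bullet> d\<phi> z + (indicator K' z *\<^sub>R f0 z) * \<phi> z)
       = (LINT z|lborel. F z \<bullet> d\<phi> z + f0 z * \<phi> z)"
    by (rule integral_indicator_test[OF \<phi> K(1) _ K'(3)]) (rule K(2))
  ultimately show ?thesis by simp
qed

lemma weq_C1_local:
  fixes F :: "'a::euclidean_space \<Rightarrow> 'a"
  assumes loc: "\<And>z. z \<in> W \<Longrightarrow> \<exists>N. open N \<and> z \<in> N \<and> N \<subseteq> W \<and> wineq N F f0"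
    and loc': "\<And>z. z \<in> W \<Longrightarrow> \<exists>N. open N \<and> z \<in> N \<and> N \<subseteq> W \<and> wineq N (\<lambda>z. - F z) (\<lambda>z. - f0 z)"
    and int: "locint W F" "locint W f0"
    and \<phi>: "C1 \<phi> d\<phi>" and K: "compact K" "\<And>z. z \<notin> K \<Longrightarrow> \<phi> z = 0" "K \<subseteq> W"
  shows "(LINT z|lborel. F z \<bullet> d\<phi> z + f0 z * \<phi> z) = 0"
proof -
  obtain s where s: "s > 0" and Q: "\<And>\<sigma> z A. 0 < \<sigma> \<Longrightarrow> \<sigma> < s \<Longrightarrow> z \<in> K \<Longrightarrow> cball z \<sigma> \<subseteq> A \<Longrightarrow>
       0 \<le> Qmoll \<sigma> (\<lambda>y. indicator A y *\<^sub>R F y) (\<lambda>y. indicator A y *\<^sub>R f0 y) z"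
    using local_Qmoll[OF loc K(1,3)] by blast
  obtain s2 where s2: "s2 > 0" and Q2: "\<And>\<sigma> z A. 0 < \<sigma> \<Longrightarrow> \<sigma> < s2 \<Longrightarrow> z \<in> K \<Longrightarrow> cball z \<sigma> \<subseteq> A \<Longrightarrow>
       0 \<le> Qmoll \<sigma> (\<lambda>y. indicator A y *\<^sub>R - F y) (\<lambda>y. indicator A y *\<^sub>R - f0 y) z"
    using local_Qmoll[OF loc' K(1,3)] by blast
  obtain K' s' where K': "compact K'" "K' \<subseteq> W" "K \<subseteq> K'" "s' > 0" "\<And>z. z \<in> K \<Longrightarrow> cball z s' \<subseteq> K'"
    using compact_neighbourhood[OF K(1) open_local[OF loc] K(3)] by blast
  let ?F = "\<lambda>y. indicator K' y *\<^sub>R F y" and ?f0 = "\<lambda>y. indicator K' y *\<^sub>R f0 y"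
  have i: "integrable lborel ?F" "integrable lborel ?f0" using int K' by (auto simp: locint_def)
  have Q0: "Qmoll \<sigma> ?F ?f0 z = 0" if \<sigma>: "0 < \<sigma>" "\<sigma> < min s (min s2 s')" and z: "z \<in> K" for \<sigma> z
  proof -
    have "cball z \<sigma> \<subseteq> cball z s'" using \<sigma> by auto
    then have "cball z \<sigma> \<subseteq> K'" using K'(5)[OF z] by blast
    then show ?thesis using Q[of \<sigma> z K'] Q2[of \<sigma> z K'] \<sigma> z Qmoll_uminus[of \<sigma> ?F ?f0 z] by simp
  qed
  have ge: "0 \<le> (LINT z|lborel. ?F z \<bullet> d\<theta> z + ?f0 z * \<theta> z)" if \<theta>: "C1 \<theta> d\<theta>" "\<And>z. z \<notin> K \<Longrightarrow> \<theta> z = 0" for \<theta> d\<theta>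
  proof (rule C1_limit[OF i \<theta>(1) K(1) \<theta>(2), where s="min s (min s2 s')"])
    fix \<sigma> assume "0 < \<sigma>" "\<sigma> < min s (min s2 s')"
    then have "\<theta> z * Qmoll \<sigma> ?F ?f0 z = 0" for z using Q0[of \<sigma> z] \<theta>(2)[of z] by (cases "z \<in> K") auto
    then have "(\<lambda>z. \<theta> z * Qmoll \<sigma> ?F ?f0 z) = (\<lambda>z. 0)" by blast
    then show "0 \<le> (LINT z|lborel. \<theta> z * Qmoll \<sigma> ?F ?f0 z)" by simp
  qed (use s s2 K'(4) in auto)
  have "C1 (\<lambda>z. - \<phi> z) (\<lambda>z. - d\<phi> z)" using C1_diff[OF C1_const[of 0] \<phi>] by simp
  from ge[OF this] K(2) have "0 \<le> (LINT z|lborel. - (?F z \<bullet> d\<phi> z + ?f0 z * \<phi> z))" by simp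
  then have "(LINT z|lborel. ?F z \<bullet> d\<phi> z + ?f0 z * \<phi> z) \<le> 0" by (simp only: integral_minus neg_0_le_iff_le)
  with ge[OF \<phi> K(2)] have "(LINT z|lborel. ?F z \<bullet> d\<phi> z + ?f0 z * \<phi> z) = 0" by linarith
  moreover have "(LINT z|lborel. (indicator K' z *\<^sub>R F z) \<bullet> d\<phi> z + (indicator K' z *\<^sub>R f0 z) * \<phi> z)
       = (LINT z|lborel. F z \<bullet> d\<phi> z + f0 z * \<phi> z)"
    by (rule integral_indicator_test[OF \<phi> K(1) _ K'(3)]) (rule K(2))
  ultimately show ?thesis by simp
qed

lemma test_fun_C1:
  assumes "test_fun U \<phi>"
  obtains K where "C1 \<phi> (grad \<phi>)" "compact K" "K \<subseteq> U" "\<And>z. z \<notin> K \<Longrightarrow> \<phi> z = 0"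
proof (rule that)
  show "C1 \<phi> (grad \<phi>)" using assms by (auto simp: test_fun_def intro: C1_smooth_fun)
  show "compact (closure {z. \<phi> z \<noteq> 0})" "closure {z. \<phi> z \<noteq> 0} \<subseteq> U"
    using assms by (auto simp: test_fun_def)
  show "\<phi> z = 0" if "z \<notin> closure {z. \<phi> z \<noteq> 0}" for z
    using that closure_subset[of "{z. \<phi> z \<noteq> 0}"] by blast
qed

lemma AE_eq_0_if_weq:
  fixes d :: "'a::euclidean_space \<Rightarrow> real"
  assumes N: "open N" and d: "locint N d" and w: "wineq N (\<lambda>z. 0) d" "wineq N (\<lambda>z. 0) (\<lambda>z. - d z)"
  shows "AE z in lborel. z \<in> N \<longrightarrow> d z = 0"
proof -
  have AEK: "AE z in lborel. z \<in> K \<longrightarrow> d z = 0" if K: "compact K" "K \<subseteq> N" for K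
  proof -
    obtain K' s where K': "compact K'" "K' \<subseteq> N" "K \<subseteq> K'" "s > 0" "\<And>z. z \<in> K \<Longrightarrow> cball z s \<subseteq> K'"
      using compact_neighbourhood[OF K(1) N K(2)] by blast
    let ?d = "\<lambda>y. indicator K' y *\<^sub>R d y"
    have i: "integrable lborel ?d" using d K' by (auto simp: locint_def)
    obtain \<sigma> G where \<sigma>: "\<And>n. 0 < \<sigma> n" "\<And>n. \<sigma> n < s" "integrable lborel G"
      and lim: "AE z in lborel. (\<lambda>n. vconv (moll (\<sigma> n)) ?d z) \<longlonglongrightarrow> ?d z"
        "AE z in lborel. \<forall>n. norm (vconv (moll (\<sigma> n)) ?d z) \<le> G z"
      by (rule mollify_dominated[OF i K'(4)]) (rule that)
    have 0: "vconv (moll (\<sigma> n)) ?d z = 0" if "z \<in> K" for n z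
    proof -
      have sub: "cball z (\<sigma> n) \<subseteq> K'" using K'(5)[OF that] \<sigma>(2)[of n] by force
      then have sub': "cball z (\<sigma> n) \<subseteq> N" using K'(2) by blast
      have eq: "Qmoll (\<sigma> n) (\<lambda>y. indicator K' y *\<^sub>R 0) ?d z = vconv (moll (\<sigma> n)) ?d z"
        by (simp add: Qmoll_def vconv_def mult.commute)
      show ?thesis
        using Qmoll_nonneg[OF w(1) \<sigma>(1) sub' sub] Qmoll_nonneg[OF w(2) \<sigma>(1) sub' sub]
          Qmoll_uminus[of "\<sigma> n" "\<lambda>y. indicator K' y *\<^sub>R 0" ?d z] unfolding eq by simp
    qed
    show ?thesis using lim(1)
    proof eventually_elim
      case (elim z)
      show ?case
      proof
        assume "z \<in> K"
        then have "?d z = 0" using elim 0[OF \<open>z \<in> K\<close>] by (simp add: LIMSEQ_const_iff)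
        then show "d z = 0" using \<open>z \<in> K\<close> K'(3) by auto
      qed
    qed
  qed
  obtain C :: "nat \<Rightarrow> 'a set" where C: "\<And>n. compact (C n)" "\<And>n. C n \<subseteq> N" "\<Union>(range C) = N"
    by (rule open_Union_compact_subsets[OF N]) (rule that)
  have "AE z in lborel. \<forall>n. z \<in> C n \<longrightarrow> d z = 0" 
    unfolding AE_all_countable by (intro allI AEK C)
  then show ?thesis by (rule eventually_mono) (use C(3) in auto)
qed

lemma integrable_Pair:
  fixes f :: "'a \<Rightarrow> 'b::euclidean_space" and g :: "'a \<Rightarrow> 'c::euclidean_space"
  assumes "integrable M f" "integrable M g" shows "integrable M (\<lambda>x. (f x, g x))"
proof -
  have "bounded_linear (\<lambda>x::'b. (x, 0::'c))" "bounded_linear (\<lambda>x::'c. (0::'b, x))"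
    by (auto intro!: bounded_linear_Pair bounded_linear_ident bounded_linear_zero)
  then have "integrable M (\<lambda>x. (f x, 0::'c))" "integrable M (\<lambda>x. (0::'b, g x))"
    using integrable_bounded_linear assms by blast+
  from Bochner_Integration.integrable_add[OF this] show ?thesis by simp
qed

lemma vconv_Pair:
  fixes f :: "'a::euclidean_space \<Rightarrow> 'b::euclidean_space" and g :: "'a \<Rightarrow> 'c::euclidean_space"
  assumes "\<sigma> > 0" "integrable lborel f" "integrable lborel g"
  shows "vconv (moll \<sigma>) (\<lambda>y. (f y, g y)) z = (vconv (moll \<sigma>) f z, vconv (moll \<sigma>) g z)"
proof (rule prod_eqI)
  have i: "integrable lborel (\<lambda>y. moll \<sigma> (z - y) *\<^sub>R (f y, g y))"
    by (rule integrable_moll_kernel[OF assms(1) integrable_Pair[OF assms(2,3)]])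
  show "fst (vconv (moll \<sigma>) (\<lambda>y. (f y, g y)) z) = fst (vconv (moll \<sigma>) f z, vconv (moll \<sigma>) g z)"
    unfolding vconv_def by (subst integral_fst[OF i, symmetric]) simp
  show "snd (vconv (moll \<sigma>) (\<lambda>y. (f y, g y)) z) = snd (vconv (moll \<sigma>) f z, vconv (moll \<sigma>) g z)"
    unfolding vconv_def by (subst integral_snd[OF i, symmetric]) simp
qed

lemma vconv_uminus: "vconv k (\<lambda>y. - f y) z = - vconv k f z"
  by (simp add: vconv_def)

lemma norm_vconv_le:
  fixes f :: "'a::euclidean_space \<Rightarrow> 'b::euclidean_space"
  assumes "\<sigma> > 0" "integrable lborel f" "integrable lborel g" "\<And>y. norm (f y) \<le> g y"
  shows "norm (vconv (moll \<sigma>) f z) \<le> vconv (moll \<sigma>) g z"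
  unfolding vconv_def
  by (rule integral_norm_le_integral[OF integrable_moll_kernel[OF assms(1,2)] integrable_moll_kernel[OF assms(1,3)]])
     (use assms(4) in \<open>auto simp: moll_nonneg intro: mult_left_mono\<close>)

lemma vconv_affine_bound:
  fixes f g :: "'a::euclidean_space \<Rightarrow> real"
  assumes \<sigma>: "\<sigma> > 0" and i: "integrable lborel f" "integrable lborel g" and le: "\<And>y. a * f y \<le> b * g y + c"
  shows "a * vconv (moll \<sigma>) f z \<le> b * vconv (moll \<sigma>) g z + c"
proof -
  note k = integrable_moll_kernel[OF \<sigma> i(1), of z] integrable_moll_kernel[OF \<sigma> i(2), of z]
  have "a * vconv (moll \<sigma>) f z = (LINT y|lborel. a * (moll \<sigma> (z - y) *\<^sub>R f y))" unfolding vconv_def by simp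
  also have "\<dots> \<le> (LINT y|lborel. b * (moll \<sigma> (z - y) *\<^sub>R g y) + moll \<sigma> (z - y) * c)"
  proof (rule Bochner_Integration.integral_mono)
    show "integrable lborel (\<lambda>y. a * (moll \<sigma> (z - y) *\<^sub>R f y))" using k by (intro integrable_mult_right)
    show "integrable lborel (\<lambda>y. b * (moll \<sigma> (z - y) *\<^sub>R g y) + moll \<sigma> (z - y) * c)"
      using k integral_moll_reflect(2)[OF \<sigma>, of z]
      by (intro Bochner_Integration.integrable_add integrable_mult_right integrable_mult_left)
    show "a * (moll \<sigma> (z - y) *\<^sub>R f y) \<le> b * (moll \<sigma> (z - y) *\<^sub>R g y) + moll \<sigma> (z - y) * c" for y
      using mult_left_mono[OF le[of y] moll_nonneg[of \<sigma> "z - y"]] by (simp add: algebra_simps)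
  qed
  also have "\<dots> = (LINT y|lborel. b * (moll \<sigma> (z - y) *\<^sub>R g y)) + (LINT y|lborel. moll \<sigma> (z - y) * c)"
    using k integral_moll_reflect(2)[OF \<sigma>, of z]
    by (intro Bochner_Integration.integral_add integrable_mult_right integrable_mult_left)
  also have "\<dots> = b * vconv (moll \<sigma>) g z + c"
    using integral_moll_reflect[OF \<sigma>, of z] by (simp add: vconv_def)
  finally show ?thesis .
qed

lemma vconv_product_bound:
  fixes A :: "'a::euclidean_space \<Rightarrow> 'b::euclidean_space" and g :: "'a \<Rightarrow> 'b"
  assumes \<sigma>: "\<sigma> > 0" and p: "p > 1"
    and i: "integrable lborel A" "integrable lborel g" "integrable lborel N"
      "integrable lborel (\<lambda>y. N y powr (p - 1))" "integrable lborel (\<lambda>y. N y powr p)"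
    and N0: "\<And>y. N y \<ge> 0"
    and A: "\<And>y. norm (A y) \<le> N y powr (p - 1)" and g: "\<And>y. norm (g y) \<le> N y"
  shows "norm (vconv (moll \<sigma>) A z) * norm (vconv (moll \<sigma>) g z) \<le> (1 + 2 powr p) * vconv (moll \<sigma>) (\<lambda>y. N y powr p) z"
proof -
  define m where "m = vconv (moll \<sigma>) N z"
  define a where "a = vconv (moll \<sigma>) (\<lambda>y. N y powr (p - 1)) z"
  define V where "V = vconv (moll \<sigma>) (\<lambda>y. N y powr p) z"
  have nA: "norm (vconv (moll \<sigma>) A z) \<le> a" unfolding a_def by (rule norm_vconv_le[OF \<sigma> i(1,4) A])
  have ng: "norm (vconv (moll \<sigma>) g z) \<le> m" unfolding m_def by (rule norm_vconv_le[OF \<sigma> i(2,3) g])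
  have m0: "m \<ge> 0" using ng norm_ge_zero order_trans by blast
  have a0: "a \<ge> 0" using nA norm_ge_zero order_trans by blast
  have V0: "V \<ge> 0"
  proof -
    have "norm (vconv (moll \<sigma>) (\<lambda>y. N y powr p) z) \<le> V"
      unfolding V_def by (rule norm_vconv_le[OF \<sigma> i(5) i(5)]) simp
    then show ?thesis using norm_ge_zero order_trans by blast
  qed
  have "norm (vconv (moll \<sigma>) A z) * norm (vconv (moll \<sigma>) g z) \<le> a * m"
    by (intro mult_mono nA ng a0) auto
  also have "a * m \<le> (1 + 2 powr p) * V"
  proof (cases "m = 0")
    case True
    then show ?thesis using V0 by (simp add: mult_nonneg_nonneg)
  next
    case False
    then have mp: "m > 0" using m0 by simp
    have pw: "x powr (p - 1) * x = x powr p" if "x > 0" for x :: real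
      using that powr_add[of x "p - 1" 1] by simp
    have "m * a \<le> 1 * V + m powr p"
      unfolding a_def V_def
    proof (rule vconv_affine_bound[OF \<sigma> i(4,5)])
      fix y
      show "m * N y powr (p - 1) \<le> 1 * N y powr p + m powr p"
      proof (cases "m \<le> N y")
        case True
        then have "m * N y powr (p - 1) \<le> N y * N y powr (p - 1)" by (intro mult_right_mono) auto
        also have "\<dots> = N y powr p" using pw[of "N y"] True mp by (simp add: mult.commute)
        finally show ?thesis using powr_ge_zero[of m p] by linarith
      next
        case False
        then have "N y powr (p - 1) \<le> m powr (p - 1)" using N0 p by (intro powr_mono2) auto
        then have "m * N y powr (p - 1) \<le> m * m powr (p - 1)" using mp by simp
        also have "\<dots> = m powr p" using pw[OF mp] by (simp add: mult.commute)
        finally show ?thesis using powr_ge_zero[of "N y" p] by linarith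
      qed
    qed
    moreover have "m powr p \<le> 2 powr p * V"
    proof -
      have "1 * m \<le> (m/2) powr (1 - p) * V + m / 2"
        unfolding V_def m_def[symmetric]
      proof (subst m_def, rule vconv_affine_bound[OF \<sigma> i(3,5)])
        fix y
        show "1 * N y \<le> (m/2) powr (1 - p) * N y powr p + m / 2"
        proof (cases "N y \<le> m / 2")
          case True
          then show ?thesis using powr_ge_zero[of "m/2" "1-p"] powr_ge_zero[of "N y" p] by (smt (verit) mult_nonneg_nonneg)
        next
          case False
          then have Ny: "N y > 0" "m / 2 \<le> N y" using mp by auto
          have "N y = N y powr (1 - p) * N y powr p" using Ny(1) by (simp add: powr_add[symmetric])
          also have "\<dots> \<le> (m/2) powr (1 - p) * N y powr p"
            using Ny mp p by (intro mult_right_mono powr_mono2') auto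
          finally show ?thesis using mp by simp
        qed
      qed
      then have "m / 2 \<le> (m/2) powr (1 - p) * V" by simp
      then have "(m/2) powr (p - 1) * (m / 2) \<le> (m/2) powr (p - 1) * ((m/2) powr (1 - p) * V)"
        by (rule mult_left_mono) simp
      also have "\<dots> = V" using mp by (simp add: powr_add[symmetric] mult.assoc[symmetric])
      also have "(m/2) powr (p - 1) * (m / 2) = (m/2) powr p" using pw[of "m/2"] mp by simp
      also have "\<dots> = m powr p / 2 powr p" using mp by (simp add: powr_divide)
      finally show ?thesis by (simp add: field_simps)
    qed
    ultimately show ?thesis by (simp add: algebra_simps)
  qed
  finally show ?thesis by (simp add: V_def)
qed

section \<open>The minimum of two supersolutions\<close>

lemma p_flux_monotone:
  fixes a b :: "'a::real_inner"
  assumes p: "p > 2"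
  shows "(norm a powr (p - 2) *\<^sub>R a - norm b powr (p - 2) *\<^sub>R b) \<bullet> (a - b) \<ge> 0"
proof -
  define x y where "x = norm a" and "y = norm b"
  have nn: "x \<ge> 0" "y \<ge> 0" by (auto simp: x_def y_def)
  have pw: "s powr (p - 2) * s\<^sup>2 = s powr (p - 1) * s" if "s \<ge> 0" for s :: real
  proof (cases "s = 0")
    case False
    then show ?thesis using that powr_add[of s "p - 2" 1] by (simp add: power2_eq_square algebra_simps)
  qed simp
  have pw1: "s powr (p - 2) * s = s powr (p - 1)" if "s \<ge> 0" for s :: real
    using that powr_add[of s "p - 2" 1] by (cases "s = 0") auto
  have ab: "a \<bullet> b \<le> x * y" unfolding x_def y_def by (rule norm_cauchy_schwarz)
  have "(norm a powr (p - 2) *\<^sub>R a - norm b powr (p - 2) *\<^sub>R b) \<bullet> (a - b)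
      = x powr (p - 2) * x\<^sup>2 + y powr (p - 2) * y\<^sup>2 - (x powr (p - 2) + y powr (p - 2)) * (a \<bullet> b)"
    by (simp add: inner_diff_left inner_diff_right inner_commute dot_square_norm x_def y_def algebra_simps)
  also have "\<dots> \<ge> x powr (p - 1) * x + y powr (p - 1) * y - (x powr (p - 2) + y powr (p - 2)) * (x * y)"
    using mult_left_mono[OF ab, of "x powr (p - 2) + y powr (p - 2)"] pw nn by simp
  also have "x powr (p - 1) * x + y powr (p - 1) * y - (x powr (p - 2) + y powr (p - 2)) * (x * y)
      = x powr (p - 1) * x + y powr (p - 1) * y - ((x powr (p - 2) * x) * y + (y powr (p - 2) * y) * x)"
    by (simp add: algebra_simps)
  also have "\<dots> = (x powr (p - 1) - y powr (p - 1)) * (x - y)"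
    unfolding pw1[OF nn(1)] pw1[OF nn(2)] by (simp add: algebra_simps)
  finally have ge: "(norm a powr (p - 2) *\<^sub>R a - norm b powr (p - 2) *\<^sub>R b) \<bullet> (a - b) \<ge> (x powr (p - 1) - y powr (p - 1)) * (x - y)" .
  have "(x powr (p - 1) - y powr (p - 1)) * (x - y) \<ge> 0"
  proof (cases "x \<le> y")
    case True
    then have "x powr (p - 1) \<le> y powr (p - 1)" using nn p by (intro powr_mono2) auto
    then show ?thesis using True by (simp add: mult_nonpos_nonpos)
  next
    case False
    then have "y powr (p - 1) \<le> x powr (p - 1)" using nn p by (intro powr_mono2) auto
    then show ?thesis using False by simp
  qed
  then show ?thesis using ge by linarith
qed

definition pos_smooth :: "real \<Rightarrow> real \<Rightarrow> real \<Rightarrow> real" where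
  "pos_smooth d e s = (s + sqrt (e\<^sup>2 + (s - d)\<^sup>2)) / 2"

definition step_smooth :: "real \<Rightarrow> real \<Rightarrow> real \<Rightarrow> real" where
  "step_smooth d e s = (1 + (s - d) / sqrt (e\<^sup>2 + (s - d)\<^sup>2)) / 2"

definition bump_smooth :: "real \<Rightarrow> real \<Rightarrow> real \<Rightarrow> real" where
  "bump_smooth d e s = e\<^sup>2 / (2 * sqrt (e\<^sup>2 + (s - d)\<^sup>2) ^ 3)"

lemma sum_squares_pos: "(e::real) > 0 \<Longrightarrow> e\<^sup>2 + x\<^sup>2 > 0"
  by (simp add: add_pos_nonneg)

lemma sqrt_sum_pos: "e > 0 \<Longrightarrow> sqrt (e\<^sup>2 + x\<^sup>2) > 0"
  by (simp add: sum_squares_pos)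

lemma DERIV_pos_smooth: "e > 0 \<Longrightarrow> (pos_smooth d e has_real_derivative step_smooth d e s) (at s)"
  unfolding pos_smooth_def[abs_def] step_smooth_def using sum_squares_pos[of e "s - d"]
  by (auto intro!: derivative_eq_intros simp: field_simps)

lemma DERIV_step_smooth:
  assumes "e > 0" shows "(step_smooth d e has_real_derivative bump_smooth d e s) (at s)"
proof -
  let ?r = "sqrt (e\<^sup>2 + (s - d)\<^sup>2)"
  have r: "?r > 0" by (rule sqrt_sum_pos[OF assms])
  have r2: "?r * ?r = e\<^sup>2 + (s - d)\<^sup>2" by simp
  have dr: "((\<lambda>s. sqrt (e\<^sup>2 + (s - d)\<^sup>2)) has_real_derivative (s - d) / ?r) (at s)"
  proof -
    have "((\<lambda>s. e\<^sup>2 + (s - d)\<^sup>2) has_real_derivative 2 * (s - d)) (at s)"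
      by (auto intro!: derivative_eq_intros)
    then have "((\<lambda>s. sqrt (e\<^sup>2 + (s - d)\<^sup>2)) has_real_derivative inverse ?r / 2 * (2 * (s - d))) (at s)"
      by (rule DERIV_chain2[where f=sqrt and g="\<lambda>s. e\<^sup>2 + (s - d)\<^sup>2" and x=s and Da="inverse ?r / 2", rotated])
         (rule DERIV_real_sqrt[OF sum_squares_pos[OF assms]])
    then show ?thesis
    proof (rule DERIV_cong)
      have "inverse r / 2 * (2 * (s - d)) = (s - d) / r" for r :: real by (cases "r = 0") (auto simp: field_simps)
      then show "inverse ?r / 2 * (2 * (s - d)) = (s - d) / ?r" .
    qed
  qed
  have "((\<lambda>s. (1 + (s - d) / sqrt (e\<^sup>2 + (s - d)\<^sup>2)) / 2) has_real_derivative
      ((1 * ?r - (s - d) * ((s - d) / ?r)) / (?r * ?r)) / 2) (at s)"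
    by (rule DERIV_cdivide, rule DERIV_add[OF DERIV_const DERIV_divide[OF _ dr], simplified add_0])
       (use r in \<open>auto intro!: derivative_eq_intros\<close>)
  moreover have "((1 * ?r - (s - d) * ((s - d) / ?r)) / (?r * ?r)) / 2 = bump_smooth d e s"
  proof -
    have "1 * ?r - (s - d) * ((s - d) / ?r) = (?r * ?r - (s - d)\<^sup>2) / ?r"
      using r by (simp add: field_simps power2_eq_square)
    also have "\<dots> = e\<^sup>2 / ?r" unfolding r2 by simp
    finally show ?thesis unfolding bump_smooth_def using r by (simp add: power3_eq_cube)
  qed
  ultimately show ?thesis unfolding step_smooth_def[abs_def] by simp
qed

lemma continuous_bump_smooth: "e > 0 \<Longrightarrow> continuous_on UNIV (bump_smooth d e)"
  unfolding bump_smooth_def[abs_def] using sqrt_sum_pos[of e]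
  by (intro continuous_intros) (auto simp: less_imp_neq[symmetric])

lemma step_smooth_bounds: assumes "e > 0" shows "0 \<le> step_smooth d e s" "step_smooth d e s \<le> 1"
proof -
  have "\<bar>s - d\<bar> \<le> sqrt (e\<^sup>2 + (s - d)\<^sup>2)" by (rule real_le_rsqrt) simp
  then have "\<bar>(s - d) / sqrt (e\<^sup>2 + (s - d)\<^sup>2)\<bar> \<le> 1"
    using sqrt_sum_pos[OF assms, of "s - d"] by (simp add: abs_divide)
  moreover define q where "q = (s - d) / sqrt (e\<^sup>2 + (s - d)\<^sup>2)"
  ultimately have "\<bar>q\<bar> \<le> 1" by simp
  then have "0 \<le> (1 + q) / 2" "(1 + q) / 2 \<le> 1" by (simp_all add: abs_le_iff)
  then show "0 \<le> step_smooth d e s" "step_smooth d e s \<le> 1" by (simp_all only: step_smooth_def q_def)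
qed

lemma bump_smooth_bounds: assumes "e > 0" shows "0 \<le> bump_smooth d e s" "bump_smooth d e s \<le> 1 / (2 * e)"
proof -
  let ?r = "sqrt (e\<^sup>2 + (s - d)\<^sup>2)"
  have r: "?r \<ge> e" by (rule real_le_rsqrt) simp
  show "0 \<le> bump_smooth d e s" unfolding bump_smooth_def using sqrt_sum_pos[OF assms, of "s - d"] by simp
  have "e ^ 3 \<le> ?r ^ 3" using r assms by (intro power_mono) auto
  then have "e\<^sup>2 / (2 * ?r ^ 3) \<le> e\<^sup>2 / (2 * e ^ 3)" using assms by (intro divide_left_mono) (auto intro!: mult_pos_pos simp: sum_squares_pos)
  also have "\<dots> = 1 / (2 * e)" using assms by (simp add: power2_eq_square power3_eq_cube)
  finally show "bump_smooth d e s \<le> 1 / (2 * e)" unfolding bump_smooth_def .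
qed

lemma pos_smooth_bound: assumes "e > 0" "d > 0" shows "\<bar>pos_smooth d e s\<bar> \<le> \<bar>s\<bar> + e + d"
proof -
  have "sqrt (e\<^sup>2 + (s - d)\<^sup>2) \<le> e + \<bar>s - d\<bar>" using assms sqrt_sum_squares_le_sum_abs[of e "s - d"] by simp
  moreover define r where "r = sqrt (e\<^sup>2 + (s - d)\<^sup>2)"
  ultimately have "r \<le> e + \<bar>s - d\<bar>" "r \<ge> 0" by auto
  then have "r \<le> e + \<bar>s\<bar> + d" using assms by (simp add: abs_if split: if_splits)
  moreover have "\<bar>s + r\<bar> \<le> \<bar>s\<bar> + r" using \<open>r \<ge> 0\<close> by (simp add: abs_if)
  ultimately have "\<bar>s + r\<bar> / 2 \<le> \<bar>s\<bar> + e + d" using assms by (simp add: field_simps)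
  then have "\<bar>(s + r) / 2\<bar> \<le> \<bar>s\<bar> + e + d" by simp
  then show ?thesis by (simp add: pos_smooth_def r_def)
qed

lemma pos_smooth_lim: "(\<lambda>n. pos_smooth (1 / real (Suc n)) ((1 / real (Suc n))\<^sup>2) s) \<longlonglongrightarrow> max 0 s"
proof -
  have "(\<lambda>n. pos_smooth (1 / real (Suc n)) ((1 / real (Suc n))\<^sup>2) s) \<longlonglongrightarrow> (s + sqrt ((0\<^sup>2)\<^sup>2 + (s - 0)\<^sup>2)) / 2"
    unfolding pos_smooth_def by (intro tendsto_intros LIMSEQ_Suc[OF lim_1_over_n]) simp
  then show ?thesis by (simp add: max_def abs_if split: if_splits)
qed

lemma step_smooth_lim: "(\<lambda>n. step_smooth (1 / real (Suc n)) ((1 / real (Suc n))\<^sup>2) s) \<longlonglongrightarrow> (if s > 0 then 1 else 0)"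
proof (cases "s = 0")
  case False
  have "(\<lambda>n. step_smooth (1 / real (Suc n)) ((1 / real (Suc n))\<^sup>2) s) \<longlonglongrightarrow> (1 + (s - 0) / sqrt ((0\<^sup>2)\<^sup>2 + (s - 0)\<^sup>2)) / 2"
    unfolding step_smooth_def by (intro tendsto_intros LIMSEQ_Suc[OF lim_1_over_n]) (use False in auto)
  then show ?thesis using False by (auto simp: abs_if split: if_splits)
next
  case True
  have eq: "step_smooth (1 / real (Suc n)) ((1 / real (Suc n))\<^sup>2) 0 = (1 - 1 / sqrt ((1 / real (Suc n))\<^sup>2 + 1)) / 2" for n
  proof -
    define d where "d = 1 / real (Suc n)"
    have d: "d > 0" by (simp add: d_def)
    have "(d\<^sup>2)\<^sup>2 + (0 - d)\<^sup>2 = d\<^sup>2 * (d\<^sup>2 + 1)" by (simp add: power2_eq_square algebra_simps)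
    then have "sqrt ((d\<^sup>2)\<^sup>2 + (0 - d)\<^sup>2) = d * sqrt (d\<^sup>2 + 1)" using d by (simp add: real_sqrt_mult)
    then have "step_smooth d (d\<^sup>2) 0 = (1 - 1 / sqrt (d\<^sup>2 + 1)) / 2" unfolding step_smooth_def using d by simp
    then show ?thesis by (simp add: d_def)
  qed
  have "(\<lambda>n. (1 - 1 / sqrt ((1 / real (Suc n))\<^sup>2 + 1)) / 2) \<longlonglongrightarrow> (1 - 1 / sqrt (0\<^sup>2 + 1)) / 2"
    by (intro tendsto_intros LIMSEQ_Suc[OF lim_1_over_n]) auto
  then show ?thesis using True by (simp only: eq) simp
qed

definition flux :: "real \<Rightarrow> real^'n::finite \<Rightarrow> real^'n" where
  "flux p g = norm g powr (p - 2) *\<^sub>R g"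

lemma norm_flux: "p > 2 \<Longrightarrow> norm (flux p g) = norm g powr (p - 1)"
  using powr_add[of "norm g" "p - 2" 1] by (cases "g = 0") (auto simp: flux_def)

lemma grad_pt:
  fixes \<phi> :: "'n::finite pt \<Rightarrow> real"
  assumes "\<phi> differentiable (at z)" shows "grad \<phi> z = (grad_x \<phi> z, dt \<phi> z)"
proof (rule prod_eqI)
  note G = GDERIV_frechet[OF GDERIV_grad[OF assms]]
  show "fst (grad \<phi> z) = fst (grad_x \<phi> z, dt \<phi> z)"
    by (simp add: vec_eq_iff grad_x_def dx_def G inner_prod_def inner_axis')
  show "snd (grad \<phi> z) = snd (grad_x \<phi> z, dt \<phi> z)"
    by (simp add: dt_def G inner_prod_def)
qed

lemma test_fun_differentiable: "test_fun U \<phi> \<Longrightarrow> \<phi> differentiable (at z)"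
  unfolding test_fun_def smooth_fun_def using iter_dir.simps(1) by metis

lemma plap_form_eq:
  assumes "test_fun U \<phi>"
  shows "plap_form p v g \<phi> = (LINT z|lborel. (flux p (g z), - v z) \<bullet> grad \<phi> z + 0 * \<phi> z)"
  unfolding plap_form_def grad_pt[OF test_fun_differentiable[OF assms]]
  by (simp add: inner_prod_def flux_def)

abbreviation (input) ex :: "'n::finite \<Rightarrow> 'n pt" where "ex i \<equiv> (axis i 1, 0)"

lemma dx_eq: assumes "test_fun U \<phi>" shows "dx i \<phi> z = grad \<phi> z \<bullet> ex i"
  unfolding grad_pt[OF test_fun_differentiable[OF assms]]
  by (simp add: inner_prod_def grad_x_def inner_axis)

lemma integrable_locint_mult:
  fixes f :: "'a::euclidean_space \<Rightarrow> real"
  assumes f: "locint U f" and \<theta>: "continuous_on UNIV \<theta>" and K: "compact K" "K \<subseteq> U" "\<And>z. z \<notin> K \<Longrightarrow> \<theta> z = 0"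
  shows "integrable lborel (\<lambda>z. f z * \<theta> z)"
proof -
  obtain B where B: "\<And>z. norm (\<theta> z) \<le> B" using bounded_continuous_compact_support[OF \<theta> K(1,3)] by blast
  have "integrable lborel (\<lambda>z. \<theta> z *\<^sub>R (indicator K z *\<^sub>R f z))"
    by (rule integrable_bounded_scaleR[where B=B])
       (use f K B \<theta> in \<open>auto simp: locint_def intro: borel_measurable_continuous_onI\<close>)
  moreover have "(\<lambda>z. \<theta> z *\<^sub>R (indicator K z *\<^sub>R f z)) = (\<lambda>z. f z * \<theta> z)"
    using K(3) by (auto simp: fun_eq_iff indicator_def)
  ultimately show ?thesis by simp
qed

lemma locint_bound:
  fixes f :: "'a::euclidean_space \<Rightarrow> 'b::euclidean_space"
  assumes m: "(\<lambda>z. indicator U z *\<^sub>R f z) \<in> borel_measurable lborel"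
    and h: "\<And>K. compact K \<Longrightarrow> K \<subseteq> U \<Longrightarrow> set_integrable lborel K h"
    and le: "\<And>z. norm (f z) \<le> 1 + h z"
  shows "locint U f"
  unfolding locint_def
proof (intro allI impI)
  fix K :: "'a set" assume K: "compact K \<and> K \<subseteq> U"
  then have [measurable]: "K \<in> sets borel" by (simp add: compact_imp_closed)
  have "(\<lambda>z. indicator K z *\<^sub>R (indicator U z *\<^sub>R f z)) \<in> borel_measurable lborel" using m by measurable
  moreover have "(\<lambda>z. indicator K z *\<^sub>R (indicator U z *\<^sub>R f z)) = (\<lambda>z. indicator K z *\<^sub>R f z)"
    using K by (auto simp: fun_eq_iff indicator_def)
  ultimately have mK: "(\<lambda>z. indicator K z *\<^sub>R f z) \<in> borel_measurable lborel" by simp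
  show "integrable lborel (\<lambda>z. indicator K z *\<^sub>R f z)"
  proof (rule Bochner_Integration.integrable_bound[OF _ mK])
    have "integrable lborel (\<lambda>z. indicator K z *\<^sub>R (h z))" using h K by (auto simp: set_integrable_def)
    moreover have "integrable lborel (indicator K :: 'a \<Rightarrow> real)"
      using K emeasure_bounded_finite[of K] by (intro integrable_real_indicator) (auto simp: compact_imp_bounded)
    ultimately show "integrable lborel (\<lambda>z. indicator K z + indicator K z *\<^sub>R (h z))" by (rule Bochner_Integration.integrable_add[rotated])
    show "AE z in lborel. norm (indicator K z *\<^sub>R f z) \<le> norm (indicator K z + indicator K z *\<^sub>R (h z))"
      using le by (intro AE_I2) (auto simp: indicator_def intro: order_trans[OF _ abs_ge_self])
  qed
qed

lemma powr_le_1_plus: "0 \<le> x \<Longrightarrow> 0 \<le> a \<Longrightarrow> a \<le> p \<Longrightarrow> x powr a \<le> 1 + x powr (p::real)"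
  using powr_mono[of a p x] powr_mono2[of a x 1] powr_ge_zero[of x p]
  by (cases "x \<le> 1") (auto simp: add_increasing2 add_increasing)

lemma inner_scaleR_swap: "(c *\<^sub>R w) \<bullet> x = c * (x \<bullet> w)"
  by (simp add: inner_commute)

lemma sob_locD:
  assumes s: "sob_loc p U v g" and p: "p > 2" and U: "open U"
  shows "locint U v" "locint U g" "locint U (\<lambda>z. flux p (g z))" "locint U (\<lambda>z. norm (g z) powr p)"
    "wineq U (\<lambda>z. v z *\<^sub>R ex i) (\<lambda>z. g z $ i)" "wineq U (\<lambda>z. - (v z *\<^sub>R ex i)) (\<lambda>z. - g z $ i)"
    "test_fun U \<phi> \<Longrightarrow> (LINT z|lborel. (v z *\<^sub>R ex i) \<bullet> grad \<phi> z + g z $ i * \<phi> z) = 0"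
proof -
  have [measurable]: "U \<in> sets borel" using U by simp
  have mv: "(\<lambda>z. indicator U z *\<^sub>R v z) \<in> borel_measurable lborel" and
    mg: "(\<lambda>z. indicator U z *\<^sub>R g z) \<in> borel_measurable lborel"
    and iv: "\<And>K. compact K \<Longrightarrow> K \<subseteq> U \<Longrightarrow> set_integrable lborel K (\<lambda>z. \<bar>v z\<bar> powr p)"
    and ig: "\<And>K. compact K \<Longrightarrow> K \<subseteq> U \<Longrightarrow> set_integrable lborel K (\<lambda>z. norm (g z) powr p)"
    and eq: "\<And>\<phi> i. test_fun U \<phi> \<Longrightarrow> (LINT z|lborel. v z * dx i \<phi> z) = - (LINT z|lborel. g z $ i * \<phi> z)"
    using s by (auto simp: sob_loc_def)
  show lv: "locint U v"
    by (rule locint_bound[OF mv iv]) (use powr_le_1_plus[of "\<bar>v _\<bar>" 1 p] p in auto)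
  show lg: "locint U g"
    by (rule locint_bound[OF mg ig]) (use powr_le_1_plus[of "norm (g _)" 1 p] p in auto)
  have [measurable]: "flux p \<in> borel_measurable borel" unfolding flux_def[abs_def] by measurable
  have f0: "flux p 0 = 0" by (simp add: flux_def)
  have "(\<lambda>z. indicator U z *\<^sub>R flux p (g z)) = (\<lambda>z. flux p (indicator U z *\<^sub>R g z))"
    by (auto simp: fun_eq_iff indicator_def f0)
  then have "(\<lambda>z. indicator U z *\<^sub>R flux p (g z)) \<in> borel_measurable lborel" using mg by simp
  then show "locint U (\<lambda>z. flux p (g z))"
    by (rule locint_bound[OF _ ig]) (use powr_le_1_plus[of "norm (g _)" "p-1" p] p in \<open>auto simp: norm_flux\<close>)
  show "locint U (\<lambda>z. norm (g z) powr p)" using ig by (auto simp: locint_def set_integrable_def)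
  have lgi: "locint U (\<lambda>z. g z $ i)" for i
  proof -
    have "integrable lborel (\<lambda>z. (indicator K z *\<^sub>R g z) \<bullet> axis i 1)" if "compact K" "K \<subseteq> U" for K
      using lg that by (intro integrable_inner_left) (auto simp: locint_def)
    then show ?thesis by (auto simp: locint_def inner_axis)
  qed
  have main: "(LINT z|lborel. (v z *\<^sub>R ex i) \<bullet> grad \<phi> z + g z $ i * \<phi> z) = 0" if \<phi>: "test_fun U \<phi>" for \<phi> i
  proof -
    obtain K where K: "C1 \<phi> (grad \<phi>)" "compact K" "K \<subseteq> U" "\<And>z. z \<notin> K \<Longrightarrow> \<phi> z = 0" by (rule test_fun_C1[OF \<phi>]) (rule that)
    have c: "continuous_on UNIV (\<lambda>z. grad \<phi> z \<bullet> ex i)" "continuous_on UNIV \<phi>"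
      using K(1) C1_continuous[OF K(1)] by (auto simp: C1_def intro!: continuous_intros)
    have gz: "grad \<phi> z = 0" if "z \<notin> K" for z
      by (rule C1_support[OF K(1) compact_imp_closed[OF K(2)] K(4) that])
    have i1: "integrable lborel (\<lambda>z. v z * (grad \<phi> z \<bullet> ex i))"
      by (rule integrable_locint_mult[OF lv c(1) K(2,3)]) (simp add: gz)
    have i2: "integrable lborel (\<lambda>z. g z $ i * \<phi> z)"
      by (rule integrable_locint_mult[OF lgi c(2) K(2,3)]) (simp add: K(4))
    have "(LINT z|lborel. (v z *\<^sub>R ex i) \<bullet> grad \<phi> z + g z $ i * \<phi> z)
       = (LINT z|lborel. v z * (grad \<phi> z \<bullet> ex i) + g z $ i * \<phi> z)"
      by (simp only: inner_scaleR_swap)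
    also have "\<dots> = 0" using eq[OF \<phi>, of i] i1 i2 by (simp add: dx_eq[OF \<phi>])
    finally show ?thesis .
  qed
  show "test_fun U \<phi> \<Longrightarrow> (LINT z|lborel. (v z *\<^sub>R ex i) \<bullet> grad \<phi> z + g z $ i * \<phi> z) = 0" by (rule main)
  show "wineq U (\<lambda>z. v z *\<^sub>R ex i) (\<lambda>z. g z $ i)" unfolding wineq_def using main by simp
  have "(LINT z|lborel. - (v z *\<^sub>R ex i) \<bullet> grad \<phi> z + - g z $ i * \<phi> z) = 0" if \<phi>: "test_fun U \<phi>" for \<phi>
  proof -
    have "(\<lambda>z. - (v z *\<^sub>R ex i) \<bullet> grad \<phi> z + - g z $ i * \<phi> z) = (\<lambda>z. - ((v z *\<^sub>R ex i) \<bullet> grad \<phi> z + g z $ i * \<phi> z))"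
      by (rule ext) (simp only: inner_minus_left mult_minus_left minus_add_distrib)
    then show ?thesis using main[OF \<phi>, of i] by (simp only: integral_minus)
  qed
  then show "wineq U (\<lambda>z. - (v z *\<^sub>R ex i)) (\<lambda>z. - g z $ i)" unfolding wineq_def by simp
qed

lemma sob_locI:
  assumes p: "p > 2" and U: "open U"
    and mv: "(\<lambda>z. indicator U z * v z) \<in> borel_measurable lborel"
    and mg: "(\<lambda>z. indicator U z *\<^sub>R g z) \<in> borel_measurable lborel"
    and iv: "\<And>K. compact K \<Longrightarrow> K \<subseteq> U \<Longrightarrow> set_integrable lborel K (\<lambda>z. \<bar>v z\<bar> powr p)"
    and ig: "\<And>K. compact K \<Longrightarrow> K \<subseteq> U \<Longrightarrow> set_integrable lborel K (\<lambda>z. norm (g z) powr p)"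
    and main: "\<And>\<phi> i. test_fun U \<phi> \<Longrightarrow> (LINT z|lborel. (v z *\<^sub>R ex i) \<bullet> grad \<phi> z + g z $ i * \<phi> z) = 0"
  shows "sob_loc p U v g"
proof -
  have lv: "locint U v"
    by (rule locint_bound[OF _ iv]) (use mv powr_le_1_plus[of "\<bar>v _\<bar>" 1 p] p in auto)
  have lg: "locint U g"
    by (rule locint_bound[OF mg ig]) (use powr_le_1_plus[of "norm (g _)" 1 p] p in auto)
  have lgi: "locint U (\<lambda>z. g z $ i)" for i
  proof -
    have "integrable lborel (\<lambda>z. (indicator K z *\<^sub>R g z) \<bullet> axis i 1)" if "compact K" "K \<subseteq> U" for K
      using lg that by (intro integrable_inner_left) (auto simp: locint_def)
    then show ?thesis by (auto simp: locint_def inner_axis)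
  qed
  have "(LINT z|lborel. v z * dx i \<phi> z) = - (LINT z|lborel. g z $ i * \<phi> z)" if \<phi>: "test_fun U \<phi>" for \<phi> i
  proof -
    obtain K where K: "C1 \<phi> (grad \<phi>)" "compact K" "K \<subseteq> U" "\<And>z. z \<notin> K \<Longrightarrow> \<phi> z = 0" by (rule test_fun_C1[OF \<phi>]) (rule that)
    have c: "continuous_on UNIV (\<lambda>z. grad \<phi> z \<bullet> ex i)" "continuous_on UNIV \<phi>"
      using K(1) C1_continuous[OF K(1)] by (auto simp: C1_def intro!: continuous_intros)
    have gz: "grad \<phi> z = 0" if "z \<notin> K" for z
      by (rule C1_support[OF K(1) compact_imp_closed[OF K(2)] K(4) that])
    have i1: "integrable lborel (\<lambda>z. v z * (grad \<phi> z \<bullet> ex i))"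
      by (rule integrable_locint_mult[OF lv c(1) K(2,3)]) (simp add: gz)
    have i2: "integrable lborel (\<lambda>z. g z $ i * \<phi> z)"
      by (rule integrable_locint_mult[OF lgi c(2) K(2,3)]) (simp add: K(4))
    have "(LINT z|lborel. v z * (grad \<phi> z \<bullet> ex i) + g z $ i * \<phi> z) = 0"
      using main[OF \<phi>, of i] by (simp only: inner_scaleR_swap)
    then show ?thesis using i1 i2 by (simp add: dx_eq[OF \<phi>])
  qed
  then show ?thesis unfolding sob_loc_def using mv mg iv ig by blast
qed

lemma Qmoll_direction:
  assumes "\<sigma> > 0" "integrable lborel f" "integrable lborel f0"
  shows "Qmoll \<sigma> (\<lambda>y. f y *\<^sub>R w) f0 z = - ((LINT y|lborel. f y *\<^sub>R grad (moll \<sigma>) (z - y)) \<bullet> w) + vconv (moll \<sigma>) f0 z"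
proof -
  note i = integrable_grad_moll[OF assms(1,2), of z] integrable_moll_kernel[OF assms(1,3), of z]
  have "Qmoll \<sigma> (\<lambda>y. f y *\<^sub>R w) f0 z = (LINT y|lborel. - ((f y *\<^sub>R grad (moll \<sigma>) (z - y)) \<bullet> w) + moll \<sigma> (z - y) *\<^sub>R f0 y)"
    unfolding Qmoll_def by (simp add: inner_commute mult.commute)
  also have "\<dots> = (LINT y|lborel. - ((f y *\<^sub>R grad (moll \<sigma>) (z - y)) \<bullet> w)) + vconv (moll \<sigma>) f0 z"
    unfolding vconv_def using i(2) integrable_inner_left[OF i(1), of w]
    by (intro Bochner_Integration.integral_add Bochner_Integration.integrable_minus)
  also have "(LINT y|lborel. - ((f y *\<^sub>R grad (moll \<sigma>) (z - y)) \<bullet> w)) = - ((LINT y|lborel. f y *\<^sub>R grad (moll \<sigma>) (z - y)) \<bullet> w)"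
    using i(1) by (simp only: integral_minus integral_inner_left)
  finally show ?thesis .
qed

lemma mollified_min:
  fixes U1 U2 :: "'n::finite pt \<Rightarrow> real" and G1 G2 A1 A2 :: "'n pt \<Rightarrow> real^'n"
  assumes \<sigma>: "\<sigma> > 0" and e: "e > 0"
    and int: "integrable lborel U1" "integrable lborel U2" "integrable lborel G1" "integrable lborel G2"
      "integrable lborel A1" "integrable lborel A2"
    and S1: "\<And>z. z \<in> K \<Longrightarrow> 0 \<le> Qmoll \<sigma> (\<lambda>y. (A1 y, - U1 y)) (\<lambda>y. 0) z"
    and S2: "\<And>z. z \<in> K \<Longrightarrow> 0 \<le> Qmoll \<sigma> (\<lambda>y. (A2 y, - U2 y)) (\<lambda>y. 0) z"
    and D1: "\<And>z i. z \<in> K \<Longrightarrow> Qmoll \<sigma> (\<lambda>y. U1 y *\<^sub>R ex i) (\<lambda>y. G1 y $ i) z = 0"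
    and D2: "\<And>z i. z \<in> K \<Longrightarrow> Qmoll \<sigma> (\<lambda>y. U2 y *\<^sub>R ex i) (\<lambda>y. G2 y $ i) z = 0"
    and \<phi>: "C1 \<phi> d\<phi>" and K: "compact K" "\<And>z. z \<notin> K \<Longrightarrow> \<phi> z = 0"
  defines "u1 \<equiv> vconv (moll \<sigma>) U1" and "u2 \<equiv> vconv (moll \<sigma>) U2"
    and "g1 \<equiv> vconv (moll \<sigma>) G1" and "g2 \<equiv> vconv (moll \<sigma>) G2"
    and "a1 \<equiv> vconv (moll \<sigma>) A1" and "a2 \<equiv> vconv (moll \<sigma>) A2"
  defines "v \<equiv> (\<lambda>z. u2 z - u1 z)"
  shows "(\<And>z. 0 \<le> \<phi> z) \<Longrightarrow> 0 \<le> (LINT z|lborel. (step_smooth d e (v z) *\<^sub>R a1 z + (1 - step_smooth d e (v z)) *\<^sub>R a2 z) \<bullet> fst (d\<phi> z)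
       + \<phi> z * bump_smooth d e (v z) * ((a1 z - a2 z) \<bullet> (g2 z - g1 z)) - snd (d\<phi> z) * (u2 z - pos_smooth d e (v z)))"
    and "(LINT z|lborel. (u2 z - pos_smooth d e (v z)) * (d\<phi> z \<bullet> ex i)
       + \<phi> z * ((g2 z - step_smooth d e (v z) *\<^sub>R (g2 z - g1 z)) $ i)) = 0"
proof -
  let ?H = "\<lambda>z. step_smooth d e (v z)" and ?B = "\<lambda>z. bump_smooth d e (v z)" and ?P = "\<lambda>z. pos_smooth d e (v z)"
  let ?du1 = "\<lambda>z. LINT y|lborel. U1 y *\<^sub>R grad (moll \<sigma>) (z - y)"
  let ?du2 = "\<lambda>z. LINT y|lborel. U2 y *\<^sub>R grad (moll \<sigma>) (z - y)"
  define dv where "dv z = ?du2 z - ?du1 z" for z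
  have C1u: "C1 u1 ?du1" "C1 u2 ?du2" unfolding u1_def u2_def by (rule C1_vconv_moll[OF \<sigma>]; rule int)+
  have C1v: "C1 v dv" unfolding v_def dv_def by (rule C1_diff[OF C1u(2,1)])
  have gi: "vconv (moll \<sigma>) (\<lambda>y. G y $ i) z = vconv (moll \<sigma>) G z $ i" if "integrable lborel G" for G :: "'n pt \<Rightarrow> real^'n" and i z
    using vconv_inner[OF \<sigma> that, of z "axis i 1"] by (simp add: inner_axis)
  have iGi: "integrable lborel (\<lambda>y. G y $ i)" if "integrable lborel G" for G :: "'n pt \<Rightarrow> real^'n" and i
    using integrable_inner_left[OF that, of "axis i 1"] by (simp add: inner_axis)
  have fdu1: "fst (?du1 z) = g1 z" if "z \<in> K" for z
  proof -
    have "?du1 z \<bullet> ex i = g1 z $ i" for i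
      using D1[OF that, of i] Qmoll_direction[OF \<sigma> int(1) iGi[OF int(3)], of "ex i" i z] gi[OF int(3)] by (simp add: g1_def)
    then show ?thesis by (simp add: vec_eq_iff inner_prod_def inner_axis)
  qed
  have fdu2: "fst (?du2 z) = g2 z" if "z \<in> K" for z
  proof -
    have "?du2 z \<bullet> ex i = g2 z $ i" for i
      using D2[OF that, of i] Qmoll_direction[OF \<sigma> int(2) iGi[OF int(4)], of "ex i" i z] gi[OF int(4)] by (simp add: g2_def)
    then show ?thesis by (simp add: vec_eq_iff inner_prod_def inner_axis)
  qed
  have fdv: "fst (dv z) = g2 z - g1 z" if "z \<in> K" for z using fdu1[OF that] fdu2[OF that] by (simp add: dv_def)
  have CH: "C1 ?H (\<lambda>z. ?B z *\<^sub>R dv z)"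
    by (rule C1_comp[OF C1v DERIV_step_smooth[OF e] continuous_bump_smooth[OF e]])
  have cstep: "continuous_on UNIV (step_smooth d e)"
    using DERIV_step_smooth[OF e] by (meson DERIV_isCont continuous_at_imp_continuous_on)
  have CP: "C1 ?P (\<lambda>z. ?H z *\<^sub>R dv z)"
    by (rule C1_comp[OF C1v DERIV_pos_smooth[OF e] cstep])
  have CJ: "C1 (\<lambda>z. v z * ?H z - ?P z) (\<lambda>z. v z *\<^sub>R (?B z *\<^sub>R dv z) + ?H z *\<^sub>R dv z - ?H z *\<^sub>R dv z)"
    by (rule C1_diff[OF C1_mult[OF C1v CH] CP])
  have d\<phi>0: "d\<phi> z = 0" if "z \<notin> K" for z
    by (rule C1_support[OF \<phi> compact_imp_closed[OF K(1)] K(2) that])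
  have cd\<phi>: "continuous_on UNIV d\<phi>" "continuous_on UNIV dv" using \<phi> C1v by (auto simp: C1_def)
  note cc = C1_continuous[OF \<phi>, of UNIV] C1_continuous[OF C1v, of UNIV] C1_continuous[OF CH, of UNIV] C1_continuous[OF CP, of UNIV] C1_continuous[OF CJ, of UNIV]
  have cB: "continuous_on UNIV ?B" using continuous_on_compose2[OF continuous_bump_smooth[OF e] C1_continuous[OF C1v]] by blast
  {
    assume nn: "\<And>z. 0 \<le> \<phi> z"
    define X1 where "X1 z = (a1 z, - u1 z) \<bullet> (\<phi> z *\<^sub>R (?B z *\<^sub>R dv z) + ?H z *\<^sub>R d\<phi> z)" for z
    define X2 where "X2 z = (a2 z, - u2 z) \<bullet> (\<phi> z *\<^sub>R (0 - ?B z *\<^sub>R dv z) + (1 - ?H z) *\<^sub>R d\<phi> z)" for z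
    define Y1 where "Y1 z = (v z * ?H z - ?P z) * (d\<phi> z \<bullet> (0, 1))" for z
    define Y2 where "Y2 z = \<phi> z * ((v z *\<^sub>R (?B z *\<^sub>R dv z) + ?H z *\<^sub>R dv z - ?H z *\<^sub>R dv z) \<bullet> (0, 1))" for z
    have iF: "integrable lborel (\<lambda>y. (A1 y, - U1 y))" "integrable lborel (\<lambda>y. (A2 y, - U2 y))"
      using int by (auto intro: integrable_Pair)
    have vF: "vconv (moll \<sigma>) (\<lambda>y. (A1 y, - U1 y)) z = (a1 z, - u1 z)" "vconv (moll \<sigma>) (\<lambda>y. (A2 y, - U2 y)) z = (a2 z, - u2 z)" for z
      using int by (auto simp: vconv_Pair[OF \<sigma>] vconv_uminus a1_def u1_def a2_def u2_def)
    have v0: "vconv (moll \<sigma>) (\<lambda>y. 0::real) z = 0" for z by (simp add: vconv_def)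
    have z0: "integrable lborel (\<lambda>y::'n pt. 0::real)" by simp
    have \<Phi>1: "C1 (\<lambda>z. \<phi> z * ?H z) (\<lambda>z. \<phi> z *\<^sub>R (?B z *\<^sub>R dv z) + ?H z *\<^sub>R d\<phi> z)" by (rule C1_mult[OF \<phi> CH])
    have \<Phi>2: "C1 (\<lambda>z. \<phi> z * (1 - ?H z)) (\<lambda>z. \<phi> z *\<^sub>R (0 - ?B z *\<^sub>R dv z) + (1 - ?H z) *\<^sub>R d\<phi> z)"
      by (rule C1_mult[OF \<phi> C1_diff[OF C1_const CH]])
    have \<Phi>K: "\<phi> z * ?H z = 0" "\<phi> z * (1 - ?H z) = 0" if "z \<notin> K" for z using K(2)[OF that] by auto
    note id1 = mollified_identity[OF \<sigma> iF(1) z0 \<Phi>1 K(1) \<Phi>K(1), unfolded vF v0 mult_zero_left add_0_right]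
    note id2 = mollified_identity[OF \<sigma> iF(2) z0 \<Phi>2 K(1) \<Phi>K(2), unfolded vF v0 mult_zero_left add_0_right]
    have iX: "integrable lborel X1" "integrable lborel X2" unfolding X1_def X2_def using id1(2) id2(2) by simp_all
    have X1: "0 \<le> integral\<^sup>L lborel X1"
    proof -
      have "0 \<le> (\<phi> z * ?H z) * Qmoll \<sigma> (\<lambda>y. (A1 y, - U1 y)) (\<lambda>y. 0) z" for z
        using S1[of z] nn[of z] step_smooth_bounds[OF e, of d "v z"] K(2)[of z] by (cases "z \<in> K") auto
      then have "0 \<le> (LINT z|lborel. (\<phi> z * ?H z) * Qmoll \<sigma> (\<lambda>y. (A1 y, - U1 y)) (\<lambda>y. 0) z)"
        by (rule Bochner_Integration.integral_nonneg)
      then show ?thesis unfolding X1_def using id1(1) by simp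
    qed
    have X2: "0 \<le> integral\<^sup>L lborel X2"
    proof -
      have "0 \<le> (\<phi> z * (1 - ?H z)) * Qmoll \<sigma> (\<lambda>y. (A2 y, - U2 y)) (\<lambda>y. 0) z" for z
        using S2[of z] nn[of z] step_smooth_bounds[OF e, of d "v z"] K(2)[of z] by (cases "z \<in> K") auto
      then have "0 \<le> (LINT z|lborel. (\<phi> z * (1 - ?H z)) * Qmoll \<sigma> (\<lambda>y. (A2 y, - U2 y)) (\<lambda>y. 0) z)"
        by (rule Bochner_Integration.integral_nonneg)
      then show ?thesis unfolding X2_def using id2(1) by simp
    qed
    have iY1: "integrable lborel Y1" unfolding Y1_def
      by (rule integrable_continuous_compact_support[OF _ K(1)]) (use cc cd\<phi> d\<phi>0 in \<open>auto intro!: continuous_intros\<close>)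
    have iY2: "integrable lborel Y2" unfolding Y2_def
      by (rule integrable_continuous_compact_support[OF _ K(1)]) (use cc cd\<phi> cB K(2) in \<open>auto intro!: continuous_intros\<close>)
    have Y: "integral\<^sup>L lborel Y1 = - integral\<^sup>L lborel Y2"
      unfolding Y1_def Y2_def by (rule integral_by_parts[OF \<phi> K(1) _ CJ]) (rule K(2))
    have "0 \<le> integral\<^sup>L lborel X1 + integral\<^sup>L lborel X2 - integral\<^sup>L lborel Y1 - integral\<^sup>L lborel Y2"
      using X1 X2 Y by simp
    also have "\<dots> = (LINT z|lborel. X1 z + X2 z - Y1 z - Y2 z)" using iX iY1 iY2 by simp
    also have "\<dots> = (LINT z|lborel. (?H z *\<^sub>R a1 z + (1 - ?H z) *\<^sub>R a2 z) \<bullet> fst (d\<phi> z)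
       + \<phi> z * ?B z * ((a1 z - a2 z) \<bullet> (g2 z - g1 z)) - snd (d\<phi> z) * (u2 z - ?P z))"
    proof (rule Bochner_Integration.integral_cong[OF refl])
      fix z
      show "X1 z + X2 z - Y1 z - Y2 z = (?H z *\<^sub>R a1 z + (1 - ?H z) *\<^sub>R a2 z) \<bullet> fst (d\<phi> z)
       + \<phi> z * ?B z * ((a1 z - a2 z) \<bullet> (g2 z - g1 z)) - snd (d\<phi> z) * (u2 z - ?P z)"
      proof (cases "z \<in> K")
        case True
        obtain px pt where p: "d\<phi> z = (px, pt)" by fastforce
        obtain t where t: "dv z = (g2 z - g1 z, t)" using fdv[OF True] by (metis prod.collapse)
        define hh bb pp where "hh = ?H z" and "bb = ?B z" and "pp = ?P z"
        have vz: "v z = u2 z - u1 z" by (simp add: v_def)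
        show ?thesis unfolding X1_def X2_def Y1_def Y2_def hh_def[symmetric] bb_def[symmetric] pp_def[symmetric] p t
          unfolding vz by (simp add: inner_add_left inner_add_right inner_diff_left inner_diff_right algebra_simps)
      next
        case False
        then show ?thesis by (simp add: X1_def X2_def Y1_def Y2_def K(2) d\<phi>0)
      qed
    qed
    finally show "0 \<le> (LINT z|lborel. (?H z *\<^sub>R a1 z + (1 - ?H z) *\<^sub>R a2 z) \<bullet> fst (d\<phi> z)
       + \<phi> z * ?B z * ((a1 z - a2 z) \<bullet> (g2 z - g1 z)) - snd (d\<phi> z) * (u2 z - ?P z))" .
  }
  have CM: "C1 (\<lambda>z. u2 z - ?P z) (\<lambda>z. ?du2 z - ?H z *\<^sub>R dv z)" by (rule C1_diff[OF C1u(2) CP])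
  have cM: "continuous_on UNIV (\<lambda>z. u2 z - ?P z)" "continuous_on UNIV (\<lambda>z. ?du2 z - ?H z *\<^sub>R dv z)"
    using C1_continuous[OF CM] CM by (auto simp: C1_def)
  have i1: "integrable lborel (\<lambda>z. (u2 z - ?P z) * (d\<phi> z \<bullet> ex i))"
    by (rule integrable_continuous_compact_support[OF _ K(1)]) (use cM cd\<phi> d\<phi>0 in \<open>auto intro!: continuous_intros\<close>)
  have i2: "integrable lborel (\<lambda>z. \<phi> z * ((?du2 z - ?H z *\<^sub>R dv z) \<bullet> ex i))"
    by (rule integrable_continuous_compact_support[OF _ K(1)]) (use cM cc K(2) in \<open>auto intro!: continuous_intros\<close>)
  have ibp: "(LINT z|lborel. (u2 z - ?P z) * (d\<phi> z \<bullet> ex i)) = - (LINT z|lborel. \<phi> z * ((?du2 z - ?H z *\<^sub>R dv z) \<bullet> ex i))"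
    by (rule integral_by_parts[OF \<phi> K(1) _ CM]) (rule K(2))
  have "(LINT z|lborel. (u2 z - ?P z) * (d\<phi> z \<bullet> ex i) + \<phi> z * ((g2 z - ?H z *\<^sub>R (g2 z - g1 z)) $ i))
      = (LINT z|lborel. (u2 z - ?P z) * (d\<phi> z \<bullet> ex i) + \<phi> z * ((?du2 z - ?H z *\<^sub>R dv z) \<bullet> ex i))"
  proof (rule Bochner_Integration.integral_cong[OF refl])
    fix z
    show "(u2 z - ?P z) * (d\<phi> z \<bullet> ex i) + \<phi> z * ((g2 z - ?H z *\<^sub>R (g2 z - g1 z)) $ i)
        = (u2 z - ?P z) * (d\<phi> z \<bullet> ex i) + \<phi> z * ((?du2 z - ?H z *\<^sub>R dv z) \<bullet> ex i)"
    proof (cases "z \<in> K")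
      case True
      have "(?du2 z - ?H z *\<^sub>R dv z) \<bullet> ex i = fst (?du2 z - ?H z *\<^sub>R dv z) $ i"
        by (simp only: inner_prod_def inner_axis fst_conv snd_conv inner_zero_right add_0_right inner_real_def mult_1_right)
      also have "fst (?du2 z - ?H z *\<^sub>R dv z) = g2 z - ?H z *\<^sub>R (g2 z - g1 z)"
        by (simp only: fst_diff fst_scaleR fdu2[OF True] fdv[OF True])
      finally show ?thesis by simp
    qed (simp add: K(2))
  qed
  also have "\<dots> = (LINT z|lborel. (u2 z - ?P z) * (d\<phi> z \<bullet> ex i)) + (LINT z|lborel. \<phi> z * ((?du2 z - ?H z *\<^sub>R dv z) \<bullet> ex i))"
    by (rule Bochner_Integration.integral_add[OF i1 i2])
  also have "\<dots> = 0" using ibp by simp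
  finally show "(LINT z|lborel. (u2 z - ?P z) * (d\<phi> z \<bullet> ex i) + \<phi> z * ((g2 z - ?H z *\<^sub>R (g2 z - g1 z)) $ i)) = 0" .
qed

lemma powr_add_le:
  fixes a b p :: real assumes "a \<ge> 0" "b \<ge> 0" "p > 0"
  shows "(a + b) powr p \<le> 2 powr p * (a powr p + b powr p)"
proof -
  have "(a + b) powr p \<le> (2 * max a b) powr p" using assms by (intro powr_mono2) auto
  also have "\<dots> = 2 powr p * (max a b) powr p" using assms by (simp add: powr_mult)
  also have "(max a b) powr p \<le> a powr p + b powr p" by (simp add: max_def)
  finally show ?thesis by simp
qed

lemma locintD: "locint U F \<Longrightarrow> compact K \<Longrightarrow> K \<subseteq> U \<Longrightarrow> integrable lborel (\<lambda>z. indicator K z *\<^sub>R F z)"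
  by (simp add: locint_def)

lemma abs_inner_ex_le: "\<bar>x \<bullet> ex i\<bar> \<le> norm x"
proof -
  have "\<bar>x \<bullet> ex i\<bar> = \<bar>fst x $ i\<bar>" by (simp add: inner_prod_def inner_axis)
  also have "\<dots> \<le> norm (fst x)" by (rule component_le_norm_cart)
  also have "\<dots> \<le> norm x" using norm_fst_le[of "fst x" "snd x"] by simp
  finally show ?thesis .
qed

lemma norm_Pair_leD:
  fixes x :: "'a::real_normed_vector" and y :: "'b::real_normed_vector"
  shows "norm (x, y) \<le> c \<Longrightarrow> norm y \<le> c \<and> norm x \<le> c"
  using norm_fst_le[of x y] norm_snd_le[of y x] by auto

lemma norm_convex_le:
  fixes a b :: "'a::real_normed_vector"
  assumes "0 \<le> h" "h \<le> 1" shows "norm (h *\<^sub>R a + (1 - h) *\<^sub>R b) \<le> norm a + norm b"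
proof -
  have "norm (h *\<^sub>R a + (1 - h) *\<^sub>R b) \<le> norm (h *\<^sub>R a) + norm ((1 - h) *\<^sub>R b)" by (rule norm_triangle_ineq)
  also have "\<dots> \<le> norm a + norm b" using assms by (intro add_mono) (auto simp: mult_left_le_one_le)
  finally show ?thesis .
qed

lemma min_limit:
  fixes v1 v2 :: "'n::finite pt \<Rightarrow> real" and g1 g2 :: "'n pt \<Rightarrow> real^'n"
  assumes p: "p > 2" and U: "open U" and sob: "sob_loc p U v1 g1" "sob_loc p U v2 g2"
    and W: "wineq U (\<lambda>z. (flux p (g1 z), - v1 z)) (\<lambda>z. 0)" "wineq U (\<lambda>z. (flux p (g2 z), - v2 z)) (\<lambda>z. 0)"
    and \<phi>: "C1 \<phi> d\<phi>" and K: "compact K" "K \<subseteq> U" "\<And>z. z \<notin> K \<Longrightarrow> \<phi> z = 0"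
  defines "m \<equiv> (\<lambda>z. min (v1 z) (v2 z))" and "g \<equiv> (\<lambda>z. if v1 z < v2 z then g1 z else g2 z)"
  shows "(\<And>z. 0 \<le> \<phi> z) \<Longrightarrow> 0 \<le> (LINT z|lborel. (flux p (g z), - m z) \<bullet> d\<phi> z + 0 * \<phi> z)"
    and "(LINT z|lborel. (m z *\<^sub>R ex i) \<bullet> d\<phi> z + g z $ i * \<phi> z) = 0"
proof -
  obtain K' s where K': "compact K'" "K' \<subseteq> U" "K \<subseteq> K'" "s > 0" "\<And>z. z \<in> K \<Longrightarrow> cball z s \<subseteq> K'"
    by (rule compact_neighbourhood[OF K(1) U K(2)]) (rule that)
  define U1 U2 G1 G2 A1 A2 where "U1 y = indicator K' y *\<^sub>R v1 y" and "U2 y = indicator K' y *\<^sub>R v2 y"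
    and "G1 y = indicator K' y *\<^sub>R g1 y" and "G2 y = indicator K' y *\<^sub>R g2 y"
    and "A1 y = indicator K' y *\<^sub>R flux p (g1 y)" and "A2 y = indicator K' y *\<^sub>R flux p (g2 y)" for y
  note defs = U1_def U2_def G1_def G2_def A1_def A2_def
  note L1 = sob_locD[OF sob(1) p U] and L2 = sob_locD[OF sob(2) p U]
  have int: "integrable lborel U1" "integrable lborel U2" "integrable lborel G1" "integrable lborel G2"
      "integrable lborel A1" "integrable lborel A2"
    unfolding defs[abs_def]
    by (rule locintD[OF L1(1) K'(1,2)], rule locintD[OF L2(1) K'(1,2)], rule locintD[OF L1(2) K'(1,2)],
        rule locintD[OF L2(2) K'(1,2)], rule locintD[OF L1(3) K'(1,2)], rule locintD[OF L2(3) K'(1,2)])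
  have intp: "integrable lborel (\<lambda>y. indicator K' y *\<^sub>R norm (g1 y) powr p)" "integrable lborel (\<lambda>y. indicator K' y *\<^sub>R norm (g2 y) powr p)"
    by (rule locintD[OF L1(4) K'(1,2)], rule locintD[OF L2(4) K'(1,2)])
  have [measurable]: "U1 \<in> borel_measurable borel" "U2 \<in> borel_measurable borel" "G1 \<in> borel_measurable borel"
    "G2 \<in> borel_measurable borel" "A1 \<in> borel_measurable borel" "A2 \<in> borel_measurable borel"
    using int by auto
  define N where "N y = norm (G1 y) + norm (G2 y)" for y
  have [measurable]: "N \<in> borel_measurable borel" unfolding N_def[abs_def] by measurable
  have N0: "N y \<ge> 0" for y by (simp add: N_def)
  have iN: "integrable lborel N" unfolding N_def[abs_def] using int by auto
  have iNp: "integrable lborel (\<lambda>y. N y powr p)"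
  proof (rule Bochner_Integration.integrable_bound)
    show "integrable lborel (\<lambda>y. 2 powr p * (indicator K' y *\<^sub>R norm (g1 y) powr p + indicator K' y *\<^sub>R norm (g2 y) powr p))"
      using intp by (intro integrable_mult_right Bochner_Integration.integrable_add)
    show "AE y in lborel. norm (N y powr p) \<le> norm (2 powr p * (indicator K' y *\<^sub>R norm (g1 y) powr p + indicator K' y *\<^sub>R norm (g2 y) powr p))"
      using powr_add_le[of "norm (g1 _)" "norm (g2 _)" p] p
      by (intro AE_I2) (auto simp: N_def defs indicator_def abs_mult intro: order_trans[OF _ abs_ge_self])
  qed measurable
  have iNp1: "integrable lborel (\<lambda>y. N y powr (p - 1))"
  proof (rule Bochner_Integration.integrable_bound)
    show "integrable lborel (\<lambda>y. indicator K' y + N y powr p)"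
      using iNp K'(1) emeasure_bounded_finite[of K'] compact_imp_closed[OF K'(1)]
      by (intro Bochner_Integration.integrable_add integrable_real_indicator) (auto simp: compact_imp_bounded)
    show "AE y in lborel. norm (N y powr (p - 1)) \<le> norm (indicator K' y + N y powr p)"
    proof (intro AE_I2)
      fix y
      show "norm (N y powr (p - 1)) \<le> norm (indicator K' y + N y powr p)"
      proof (cases "y \<in> K'")
        case True
        then show ?thesis using powr_le_1_plus[of "N y" "p - 1" p] N0[of y] p by simp
      qed (simp add: N_def defs)
    qed
  qed measurable
  define Mp where "Mp y = N y powr p" for y
  have iM: "integrable lborel Mp" unfolding Mp_def[abs_def] by (rule iNp)
  define T where "T y = (U1 y, U2 y, G1 y, G2 y, A1 y, A2 y, Mp y)" for y
  have iT: "integrable lborel T" unfolding T_def[abs_def] by (intro integrable_Pair int iM)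
  obtain \<sigma> G where \<sigma>: "\<And>n. 0 < \<sigma> n" "\<And>n. \<sigma> n < s" and G: "integrable lborel G"
    and lim: "AE z in lborel. (\<lambda>n. vconv (moll (\<sigma> n)) T z) \<longlonglongrightarrow> T z"
    and dom: "AE z in lborel. \<forall>n. norm (vconv (moll (\<sigma> n)) T z) \<le> G z"
    by (rule mollify_dominated[OF iT K'(4)]) (rule that)
  define u1 u2 h1 h2 a1 a2 M where "u1 n = vconv (moll (\<sigma> n)) U1" and "u2 n = vconv (moll (\<sigma> n)) U2"
    and "h1 n = vconv (moll (\<sigma> n)) G1" and "h2 n = vconv (moll (\<sigma> n)) G2"
    and "a1 n = vconv (moll (\<sigma> n)) A1" and "a2 n = vconv (moll (\<sigma> n)) A2" and "M n = vconv (moll (\<sigma> n)) Mp" for n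
  note vdefs = u1_def u2_def h1_def h2_def a1_def a2_def M_def
  have vT: "vconv (moll (\<sigma> n)) T z = (u1 n z, u2 n z, h1 n z, h2 n z, a1 n z, a2 n z, M n z)" for n z
    unfolding T_def[abs_def] vdefs by (simp add: vconv_Pair[OF \<sigma>(1)] int iM integrable_Pair)
  have [measurable]: "u1 n \<in> borel_measurable borel" "u2 n \<in> borel_measurable borel" "h1 n \<in> borel_measurable borel"
    "h2 n \<in> borel_measurable borel" "a1 n \<in> borel_measurable borel" "a2 n \<in> borel_measurable borel" for n
    unfolding vdefs by (intro borel_measurable_continuous_onI continuous_on_vconv_moll \<sigma> int)+
  have lims: "AE z in lborel. (\<lambda>n. u1 n z) \<longlonglongrightarrow> U1 z \<and> (\<lambda>n. u2 n z) \<longlonglongrightarrow> U2 z \<and> (\<lambda>n. h1 n z) \<longlonglongrightarrow> G1 z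
     \<and> (\<lambda>n. h2 n z) \<longlonglongrightarrow> G2 z \<and> (\<lambda>n. a1 n z) \<longlonglongrightarrow> A1 z \<and> (\<lambda>n. a2 n z) \<longlonglongrightarrow> A2 z"
    using lim
  proof eventually_elim
    case (elim z)
    note t0 = elim[unfolded vT T_def]
    note t1 = tendsto_snd[OF t0, simplified] note t2 = tendsto_snd[OF t1, simplified]
    note t3 = tendsto_snd[OF t2, simplified] note t4 = tendsto_snd[OF t3, simplified]
    note t5 = tendsto_snd[OF t4, simplified]
    show ?case
      using tendsto_fst[OF t0] tendsto_fst[OF t1] tendsto_fst[OF t2] tendsto_fst[OF t3] tendsto_fst[OF t4] tendsto_fst[OF t5] by simp
  qed
  have doms: "AE z in lborel. \<forall>n. \<bar>u1 n z\<bar> \<le> G z \<and> \<bar>u2 n z\<bar> \<le> G z \<and> norm (h1 n z) \<le> G z \<and> norm (h2 n z) \<le> G z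
     \<and> norm (a1 n z) \<le> G z \<and> norm (a2 n z) \<le> G z \<and> \<bar>M n z\<bar> \<le> G z"
    using dom
  proof eventually_elim
    case (elim z)
    note sn = norm_Pair_leD
    show ?case
    proof
      fix n
      have t0: "norm (u1 n z, u2 n z, h1 n z, h2 n z, a1 n z, a2 n z, M n z) \<le> G z" using elim vT by metis
      note t1 = sn[OF t0] note t2 = sn[OF conjunct1[OF t1]] note t3 = sn[OF conjunct1[OF t2]] note t4 = sn[OF conjunct1[OF t3]]
      note t5 = sn[OF conjunct1[OF t4]] note t6 = sn[OF conjunct1[OF t5]]
      show "\<bar>u1 n z\<bar> \<le> G z \<and> \<bar>u2 n z\<bar> \<le> G z \<and> norm (h1 n z) \<le> G z \<and> norm (h2 n z) \<le> G z
     \<and> norm (a1 n z) \<le> G z \<and> norm (a2 n z) \<le> G z \<and> \<bar>M n z\<bar> \<le> G z"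
        using t1 t2 t3 t4 t5 t6 by simp
    qed
  qed
  define C0 where "C0 = 1 + 2 powr p"
  have C0: "C0 > 0" by (simp add: C0_def add_pos_nonneg)
  have prodb: "\<bar>(a1 n z - a2 n z) \<bullet> (h2 n z - h1 n z)\<bar> \<le> 2 * (C0 * M n z)" for n z
  proof -
    have hd: "h2 n z - h1 n z = vconv (moll (\<sigma> n)) (\<lambda>y. G2 y - G1 y) z"
      unfolding vdefs by (rule vconv_diff[OF \<sigma>(1) int(4,3), symmetric])
    have gN: "norm (G2 y - G1 y) \<le> N y" for y using norm_triangle_ineq4[of "G2 y" "G1 y"] by (simp add: N_def)
    have AN: "norm (A1 y) \<le> N y powr (p - 1)" "norm (A2 y) \<le> N y powr (p - 1)" for y
      using p by (auto simp: N_def defs indicator_def norm_flux intro!: powr_mono2)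
    have b: "norm (vconv (moll (\<sigma> n)) A z) * norm (h2 n z - h1 n z) \<le> C0 * M n z"
      if "integrable lborel A" "\<And>y. norm (A y) \<le> N y powr (p - 1)" for A :: "'n pt \<Rightarrow> real^'n"
      unfolding hd C0_def M_def Mp_def[abs_def]
      by (rule vconv_product_bound[OF \<sigma>(1) _ that(1) _ iN iNp1 iNp N0 that(2) gN]) (use p int in auto)
    have "\<bar>(a1 n z - a2 n z) \<bullet> (h2 n z - h1 n z)\<bar> \<le> norm (a1 n z - a2 n z) * norm (h2 n z - h1 n z)" by (rule Cauchy_Schwarz_ineq2)
    also have "\<dots> \<le> (norm (a1 n z) + norm (a2 n z)) * norm (h2 n z - h1 n z)"
      by (intro mult_right_mono norm_triangle_ineq4) auto
    also have "\<dots> \<le> 2 * (C0 * M n z)"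
      using b[OF int(5) AN(1)] b[OF int(6) AN(2)] unfolding distrib_right a1_def a2_def by linarith
    finally show ?thesis .
  qed
  have d\<phi>0: "d\<phi> z = 0" if "z \<notin> K" for z
    by (rule C1_support[OF \<phi> compact_imp_closed[OF K(1)] K(3) that])
  have cd: "continuous_on UNIV d\<phi>" using \<phi> by (simp add: C1_def)
  note c\<phi> = C1_continuous[OF \<phi>, of UNIV]
  have [measurable]: "d\<phi> \<in> borel_measurable borel" "\<phi> \<in> borel_measurable borel"
    using cd c\<phi> by (auto intro: borel_measurable_continuous_onI)
  have [measurable]: "(\<lambda>z. fst (d\<phi> z)) \<in> borel_measurable borel" "(\<lambda>z. snd (d\<phi> z)) \<in> borel_measurable borel"
    using cd by (auto intro!: borel_measurable_continuous_onI continuous_on_fst continuous_on_snd)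
  obtain B1 where B1: "\<And>z. norm (d\<phi> z) \<le> B1" using bounded_continuous_compact_support[OF cd K(1) d\<phi>0] by blast
  obtain B2 where B2: "\<And>z. norm (\<phi> z) \<le> B2" using bounded_continuous_compact_support[OF c\<phi> K(1,3)] by blast
  define B where "B = max B1 B2"
  have B: "norm (d\<phi> z) \<le> B" "\<bar>\<phi> z\<bar> \<le> B" for z using B1[of z] B2[of z] by (auto simp: B_def)
  have Bf: "norm (fst (d\<phi> z)) \<le> B" "\<bar>snd (d\<phi> z)\<bar> \<le> B" "\<bar>d\<phi> z \<bullet> ex i\<bar> \<le> B" for z i
  proof -
    show "norm (fst (d\<phi> z)) \<le> B" using norm_fst_le[of "fst (d\<phi> z)" "snd (d\<phi> z)"] B(1)[of z] by simp
    show "\<bar>snd (d\<phi> z)\<bar> \<le> B" using norm_snd_le[of "snd (d\<phi> z)" "fst (d\<phi> z)"] B(1)[of z] by simp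
    show "\<bar>d\<phi> z \<bullet> ex i\<bar> \<le> B" by (rule order_trans[OF abs_inner_ex_le B(1)])
  qed
  have B0: "B \<ge> 0" using B(2) abs_ge_zero order_trans by blast
  have Km[measurable]: "K \<in> sets borel" using K(1) by (simp add: compact_imp_closed)
  have Kfin: "integrable lborel (indicator K :: 'n pt \<Rightarrow> real)"
    using K(1) emeasure_bounded_finite[of K] compact_imp_closed[OF K(1)] by (intro integrable_real_indicator) (auto simp: compact_imp_bounded)
  have stepc: "step_smooth d e \<in> borel_measurable borel" "continuous_on UNIV (step_smooth d e)"
     "bump_smooth d e \<in> borel_measurable borel" "pos_smooth d e \<in> borel_measurable borel" "continuous_on UNIV (pos_smooth d e)"
    if "e > 0" for d e
  proof -
    show c: "continuous_on UNIV (step_smooth d e)" "continuous_on UNIV (pos_smooth d e)"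
      using DERIV_step_smooth[OF that] DERIV_pos_smooth[OF that] by (meson DERIV_isCont continuous_at_imp_continuous_on)+
    then show "step_smooth d e \<in> borel_measurable borel" "pos_smooth d e \<in> borel_measurable borel" by (auto intro: borel_measurable_continuous_onI)
    show "bump_smooth d e \<in> borel_measurable borel" using continuous_bump_smooth[OF that] by (rule borel_measurable_continuous_onI)
  qed
  define V where "V z = U2 z - U1 z" for z
  have [measurable]: "V \<in> borel_measurable borel" unfolding V_def[abs_def] by measurable
  have sub: "cball z (\<sigma> n) \<subseteq> K'" "cball z (\<sigma> n) \<subseteq> U" if "z \<in> K" for z n
  proof -
    have "cball z (\<sigma> n) \<subseteq> cball z s" using \<sigma>(2)[of n] by auto
    then show "cball z (\<sigma> n) \<subseteq> K'" "cball z (\<sigma> n) \<subseteq> U" using K'(5)[OF that] K'(2) by auto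
  qed
  have eqS: "(\<lambda>y. indicator K' y *\<^sub>R (flux p (g1 y), - v1 y)) = (\<lambda>y. (A1 y, - U1 y))" "(\<lambda>y. indicator K' y *\<^sub>R (flux p (g2 y), - v2 y)) = (\<lambda>y. (A2 y, - U2 y))"
    by (auto simp: defs)
  have S: "0 \<le> Qmoll (\<sigma> n) (\<lambda>y. (A1 y, - U1 y)) (\<lambda>y. 0) z" "0 \<le> Qmoll (\<sigma> n) (\<lambda>y. (A2 y, - U2 y)) (\<lambda>y. 0) z" if "z \<in> K" for z n
    using Qmoll_nonneg[OF W(1) \<sigma>(1) sub(2,1)[OF that]] Qmoll_nonneg[OF W(2) \<sigma>(1) sub(2,1)[OF that]] unfolding eqS by simp_all
  have eqD: "(\<lambda>y. indicator K' y *\<^sub>R (v1 y *\<^sub>R ex i)) = (\<lambda>y. U1 y *\<^sub>R ex i)" "(\<lambda>y. indicator K' y *\<^sub>R (v2 y *\<^sub>R ex i)) = (\<lambda>y. U2 y *\<^sub>R ex i)"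
     "(\<lambda>y. indicator K' y *\<^sub>R (g1 y $ i)) = (\<lambda>y. G1 y $ i)" "(\<lambda>y. indicator K' y *\<^sub>R (g2 y $ i)) = (\<lambda>y. G2 y $ i)" for i
    by (auto simp: defs)
  have eqD': "(\<lambda>y. indicator K' y *\<^sub>R - (v1 y *\<^sub>R ex i)) = (\<lambda>y. - (U1 y *\<^sub>R ex i))" "(\<lambda>y. indicator K' y *\<^sub>R - (v2 y *\<^sub>R ex i)) = (\<lambda>y. - (U2 y *\<^sub>R ex i))"
     "(\<lambda>y. indicator K' y *\<^sub>R (- g1 y $ i)) = (\<lambda>y. - G1 y $ i)" "(\<lambda>y. indicator K' y *\<^sub>R (- g2 y $ i)) = (\<lambda>y. - G2 y $ i)" for i
    by (auto simp: defs)
  have D: "Qmoll (\<sigma> n) (\<lambda>y. U1 y *\<^sub>R ex i) (\<lambda>y. G1 y $ i) z = 0" "Qmoll (\<sigma> n) (\<lambda>y. U2 y *\<^sub>R ex i) (\<lambda>y. G2 y $ i) z = 0" if "z \<in> K" for z n i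
  proof -
    have "0 \<le> Qmoll (\<sigma> n) (\<lambda>y. U1 y *\<^sub>R ex i) (\<lambda>y. G1 y $ i) z" "0 \<le> Qmoll (\<sigma> n) (\<lambda>y. - (U1 y *\<^sub>R ex i)) (\<lambda>y. - G1 y $ i) z"
      using Qmoll_nonneg[OF L1(5)[of i] \<sigma>(1) sub(2,1)[OF that]] Qmoll_nonneg[OF L1(6)[of i] \<sigma>(1) sub(2,1)[OF that]] unfolding eqD eqD' .
    then show "Qmoll (\<sigma> n) (\<lambda>y. U1 y *\<^sub>R ex i) (\<lambda>y. G1 y $ i) z = 0"
      using Qmoll_uminus[of "\<sigma> n" "\<lambda>y. U1 y *\<^sub>R ex i" "\<lambda>y. G1 y $ i" z] by linarith
    have "0 \<le> Qmoll (\<sigma> n) (\<lambda>y. U2 y *\<^sub>R ex i) (\<lambda>y. G2 y $ i) z" "0 \<le> Qmoll (\<sigma> n) (\<lambda>y. - (U2 y *\<^sub>R ex i)) (\<lambda>y. - G2 y $ i) z"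
      using Qmoll_nonneg[OF L2(5)[of i] \<sigma>(1) sub(2,1)[OF that]] Qmoll_nonneg[OF L2(6)[of i] \<sigma>(1) sub(2,1)[OF that]] unfolding eqD eqD' .
    then show "Qmoll (\<sigma> n) (\<lambda>y. U2 y *\<^sub>R ex i) (\<lambda>y. G2 y $ i) z = 0"
      using Qmoll_uminus[of "\<sigma> n" "\<lambda>y. U2 y *\<^sub>R ex i" "\<lambda>y. G2 y $ i" z] by linarith
  qed
  define dd ee where "dd k = 1 / real (Suc k)" and "ee k = (1 / real (Suc k))\<^sup>2" for k
  have de: "dd k > 0" "ee k > 0" "dd k \<le> 1" "ee k \<le> 1" for k by (auto simp: dd_def ee_def power_le_one)
  have mK: "U2 z - max 0 (V z) = m z" "(if V z > 0 then A1 z else A2 z) = flux p (g z)" "(if V z > 0 then G1 z else G2 z) = g z" if "z \<in> K" for z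
    using that K'(3) by (auto simp: V_def defs m_def g_def indicator_def)
  {
    assume nn: "\<And>z. 0 \<le> \<phi> z"
    define Z where "Z d e z = (step_smooth d e (V z) *\<^sub>R A1 z + (1 - step_smooth d e (V z)) *\<^sub>R A2 z) \<bullet> fst (d\<phi> z)
        - snd (d\<phi> z) * (U2 z - pos_smooth d e (V z))" for d e z
    define w where "w z = B * (norm (A1 z) + norm (A2 z)) + B * (2 * \<bar>U2 z\<bar> + \<bar>U1 z\<bar> + 2 * indicator K z)" for z
    have Zb: "\<bar>Z d e z\<bar> \<le> w z" if "0 < d" "0 < e" "d \<le> 1" "e \<le> 1" for d e z
    proof (cases "z \<in> K")
      case True
      have "\<bar>(step_smooth d e (V z) *\<^sub>R A1 z + (1 - step_smooth d e (V z)) *\<^sub>R A2 z) \<bullet> fst (d\<phi> z)\<bar> \<le> (norm (A1 z) + norm (A2 z)) * B"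
        by (rule order_trans[OF Cauchy_Schwarz_ineq2]) (intro mult_mono norm_convex_le step_smooth_bounds that Bf; simp)
      moreover have "\<bar>snd (d\<phi> z) * (U2 z - pos_smooth d e (V z))\<bar> \<le> B * (2 * \<bar>U2 z\<bar> + \<bar>U1 z\<bar> + 2)"
        unfolding abs_mult
      proof (intro mult_mono Bf B0)
        have "\<bar>pos_smooth d e (V z)\<bar> \<le> \<bar>V z\<bar> + 2" using pos_smooth_bound[OF that(2,1), of "V z"] that by linarith
        then show "\<bar>U2 z - pos_smooth d e (V z)\<bar> \<le> 2 * \<bar>U2 z\<bar> + \<bar>U1 z\<bar> + 2" unfolding V_def by linarith
      qed simp
      ultimately show ?thesis using True unfolding Z_def w_def by (simp add: mult.commute)
    next
      case False
      then show ?thesis using B0 by (simp add: Z_def w_def d\<phi>0)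
    qed
    have iw: "integrable lborel w" unfolding w_def[abs_def]
      by (intro Bochner_Integration.integrable_add integrable_mult_right integrable_norm integrable_abs int Kfin)
    have mZ: "Z d e \<in> borel_measurable borel" if "e > 0" for d e
    proof -
      note [measurable] = stepc(1,3,4)[OF that]
      show ?thesis unfolding Z_def[abs_def] by measurable
    qed
    have iZ: "integrable lborel (Z d e)" if "0 < d" "0 < e" "d \<le> 1" "e \<le> 1" for d e
      by (rule Bochner_Integration.integrable_bound[OF iw]) (use mZ[OF that(2)] Zb[OF that] in \<open>auto intro!: AE_I2 order_trans[OF Zb[OF that] abs_ge_self]\<close>)
    have stage1: "0 \<le> (LINT z|lborel. Z d e z)" if de: "0 < d" "0 < e" "d \<le> 1" "e \<le> 1" for d e
    proof -
      note [measurable] = stepc(1,3,4)[OF de(2)]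
      let ?v = "\<lambda>n z. u2 n z - u1 n z"
      define X where "X n z = (step_smooth d e (?v n z) *\<^sub>R a1 n z + (1 - step_smooth d e (?v n z)) *\<^sub>R a2 n z) \<bullet> fst (d\<phi> z)
       + \<phi> z * bump_smooth d e (?v n z) * ((a1 n z - a2 n z) \<bullet> (h2 n z - h1 n z)) - snd (d\<phi> z) * (u2 n z - pos_smooth d e (?v n z))" for n z
      define Xi where "Xi z = (step_smooth d e (V z) *\<^sub>R A1 z + (1 - step_smooth d e (V z)) *\<^sub>R A2 z) \<bullet> fst (d\<phi> z)
       + \<phi> z * bump_smooth d e (V z) * ((A1 z - A2 z) \<bullet> (G2 z - G1 z)) - snd (d\<phi> z) * (U2 z - pos_smooth d e (V z))" for z
      define C where "C = B * (5 + C0 / e + e + d)"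
      define wX where "wX z = C * (indicator K z + G z)" for z
      have X0: "0 \<le> integral\<^sup>L lborel (X n)" for n
        unfolding X_def[abs_def] vdefs
        by (rule mollified_min(1)[OF \<sigma>(1) de(2) int S(1) S(2) D(1) D(2) \<phi> K(1) K(3) nn])
      have mX: "X n \<in> borel_measurable lborel" for n unfolding X_def[abs_def] by measurable
      have mXi: "Xi \<in> borel_measurable lborel" unfolding Xi_def[abs_def] by measurable
      have iwX: "integrable lborel wX" unfolding wX_def[abs_def] using G Kfin by (intro integrable_mult_right Bochner_Integration.integrable_add)
      have limX: "AE z in lborel. (\<lambda>n. X n z) \<longlonglongrightarrow> Xi z"
        using lims
      proof eventually_elim
        case (elim z)
        have v: "(\<lambda>n. ?v n z) \<longlonglongrightarrow> V z" unfolding V_def using elim by (intro tendsto_intros) auto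
        have c: "isCont (step_smooth d e) (V z)" "isCont (bump_smooth d e) (V z)" "isCont (pos_smooth d e) (V z)"
          using stepc(2,5)[OF de(2), of d] continuous_bump_smooth[OF de(2), of d] by (auto simp: continuous_on_eq_continuous_at)
        show ?case unfolding X_def Xi_def
          by (intro tendsto_intros isCont_tendsto_compose[OF c(1) v] isCont_tendsto_compose[OF c(2) v] isCont_tendsto_compose[OF c(3) v])
             (use elim in auto)
      qed
      have bX: "AE z in lborel. norm (X n z) \<le> wX z" for n
        using doms
      proof eventually_elim
        case (elim z)
        then have b: "\<bar>u1 n z\<bar> \<le> G z" "\<bar>u2 n z\<bar> \<le> G z" "norm (a1 n z) \<le> G z" "norm (a2 n z) \<le> G z" "\<bar>M n z\<bar> \<le> G z" by auto
        then have G0: "G z \<ge> 0" by linarith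
        show ?case
        proof (cases "z \<in> K")
          case True
          have "\<bar>(step_smooth d e (?v n z) *\<^sub>R a1 n z + (1 - step_smooth d e (?v n z)) *\<^sub>R a2 n z) \<bullet> fst (d\<phi> z)\<bar> \<le> (norm (a1 n z) + norm (a2 n z)) * B"
            by (rule order_trans[OF Cauchy_Schwarz_ineq2]) (intro mult_mono norm_convex_le step_smooth_bounds de Bf; simp)
          also have "\<dots> \<le> (G z + G z) * B" using b B0 by (intro mult_right_mono add_mono) auto
          finally have t1: "\<bar>(step_smooth d e (?v n z) *\<^sub>R a1 n z + (1 - step_smooth d e (?v n z)) *\<^sub>R a2 n z) \<bullet> fst (d\<phi> z)\<bar> \<le> 2 * (G z * B)" by (simp add: algebra_simps)
          have "\<bar>\<phi> z * bump_smooth d e (?v n z) * ((a1 n z - a2 n z) \<bullet> (h2 n z - h1 n z))\<bar> \<le> B * (1 / (2 * e)) * (2 * (C0 * G z))"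
            unfolding abs_mult
          proof (intro mult_mono B)
            show "\<bar>bump_smooth d e (?v n z)\<bar> \<le> 1 / (2 * e)" using bump_smooth_bounds[OF de(2), of d "?v n z"] by simp
            have "C0 * M n z \<le> C0 * G z" using b(5) C0 by (intro mult_left_mono) auto
            then show "\<bar>(a1 n z - a2 n z) \<bullet> (h2 n z - h1 n z)\<bar> \<le> 2 * (C0 * G z)" using prodb[of n z] by linarith
          qed (use B0 de in auto)
          also have "\<dots> = C0 / e * (G z * B)" using de by (simp add: field_simps)
          finally have t2: "\<bar>\<phi> z * bump_smooth d e (?v n z) * ((a1 n z - a2 n z) \<bullet> (h2 n z - h1 n z))\<bar> \<le> C0 / e * (G z * B)" .
          have t3: "\<bar>snd (d\<phi> z) * (u2 n z - pos_smooth d e (?v n z))\<bar> \<le> B * (3 * G z + e + d)"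
            unfolding abs_mult
          proof (intro mult_mono Bf B0)
            show "\<bar>u2 n z - pos_smooth d e (?v n z)\<bar> \<le> 3 * G z + e + d"
              using pos_smooth_bound[OF de(2,1), of "?v n z"] b by linarith
          qed simp
          have "\<bar>X n z\<bar> \<le> 2 * (G z * B) + C0 / e * (G z * B) + B * (3 * G z + e + d)"
            unfolding X_def using t1 t2 t3 by linarith
          also have "\<dots> \<le> C * (1 + G z)"
          proof -
            have "C * (1 + G z) - (2 * (G z * B) + C0 / e * (G z * B) + B * (3 * G z + e + d)) = B * (5 + C0 / e) + B * (e + d) * G z"
              unfolding C_def by (simp add: algebra_simps add_divide_distrib)
            moreover have "\<dots> \<ge> 0" using B0 G0 de C0 by (intro add_nonneg_nonneg mult_nonneg_nonneg) auto
            ultimately show ?thesis by linarith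
          qed
          finally show ?thesis using True by (simp add: wX_def)
        next
          case False
          have "C \<ge> 0" unfolding C_def using B0 de C0 by (intro mult_nonneg_nonneg add_nonneg_nonneg) auto
          then show ?thesis using False G0 by (simp add: X_def wX_def d\<phi>0 K(3))
        qed
      qed
      have "(\<lambda>n. integral\<^sup>L lborel (X n)) \<longlonglongrightarrow> integral\<^sup>L lborel Xi"
        by (rule integral_dominated_convergence[OF mXi mX iwX limX bX])
      then have "0 \<le> integral\<^sup>L lborel Xi" by (rule LIMSEQ_le_const) (use X0 in auto)
      also have "\<dots> \<le> integral\<^sup>L lborel (Z d e)"
      proof (rule Bochner_Integration.integral_mono)
        show "integrable lborel Xi" by (rule integrable_dominated_convergence[OF mXi mX iwX limX bX])
        show "integrable lborel (Z d e)" by (rule iZ[OF de])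
        fix z
        have "\<phi> z * bump_smooth d e (V z) * ((A1 z - A2 z) \<bullet> (G2 z - G1 z)) \<le> 0"
        proof (cases "z \<in> K")
          case True
          then have "z \<in> K'" using K'(3) by blast
          then have "(A1 z - A2 z) \<bullet> (G2 z - G1 z) = - ((flux p (g1 z) - flux p (g2 z)) \<bullet> (g1 z - g2 z))"
            by (simp add: defs inner_diff_right)
          also have "\<dots> \<le> 0" using p_flux_monotone[OF p, of "g1 z" "g2 z"] by (simp add: flux_def)
          finally show ?thesis using nn[of z] bump_smooth_bounds(1)[OF de(2)] by (simp add: mult_nonneg_nonpos)
        qed (simp add: K(3))
        then show "Xi z \<le> Z d e z" unfolding Xi_def Z_def by linarith
      qed
      finally show ?thesis .
    qed
    have "(\<lambda>k. integral\<^sup>L lborel (Z (dd k) (ee k))) \<longlonglongrightarrow> (LINT z|lborel. (flux p (g z), - m z) \<bullet> d\<phi> z + 0 * \<phi> z)"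
    proof (rule integral_dominated_convergence[OF _ _ iw])
      define Zi where "Zi z = (if V z > 0 then A1 z else A2 z) \<bullet> fst (d\<phi> z) - snd (d\<phi> z) * (U2 z - max 0 (V z))" for z
      have Zi: "(flux p (g z), - m z) \<bullet> d\<phi> z + 0 * \<phi> z = Zi z" for z
      proof (cases "z \<in> K")
        case True
        show ?thesis unfolding Zi_def mK[OF True] by (simp add: inner_prod_def mult.commute)
      qed (simp add: Zi_def d\<phi>0)
      show "(\<lambda>z. (flux p (g z), - m z) \<bullet> d\<phi> z + 0 * \<phi> z) \<in> borel_measurable lborel"
        unfolding Zi unfolding Zi_def[abs_def] by measurable
      show "Z (dd k) (ee k) \<in> borel_measurable lborel" for k using mZ[OF de(2)] by simp
      show "AE z in lborel. norm (Z (dd k) (ee k) z) \<le> w z" for k using Zb[OF de] by simp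
      show "AE z in lborel. (\<lambda>k. Z (dd k) (ee k) z) \<longlonglongrightarrow> (flux p (g z), - m z) \<bullet> d\<phi> z + 0 * \<phi> z"
      proof (rule AE_I2)
        fix z
        have "(\<lambda>k. Z (dd k) (ee k) z) \<longlonglongrightarrow> ((if V z > 0 then 1 else 0) *\<^sub>R A1 z + (1 - (if V z > 0 then 1 else 0)) *\<^sub>R A2 z) \<bullet> fst (d\<phi> z)
          - snd (d\<phi> z) * (U2 z - max 0 (V z))"
          unfolding Z_def dd_def ee_def by (intro tendsto_intros step_smooth_lim pos_smooth_lim)
        also have "((if V z > 0 then 1 else 0) *\<^sub>R A1 z + (1 - (if V z > 0 then 1 else 0)) *\<^sub>R A2 z) = (if V z > 0 then A1 z else A2 z)" by simp
        finally show "(\<lambda>k. Z (dd k) (ee k) z) \<longlonglongrightarrow> (flux p (g z), - m z) \<bullet> d\<phi> z + 0 * \<phi> z" unfolding Zi Zi_def .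
      qed
    qed
    then have "0 \<le> (LINT z|lborel. (flux p (g z), - m z) \<bullet> d\<phi> z + 0 * \<phi> z)"
      by (rule LIMSEQ_le_const) (use stage1[OF de] in auto)
  }
  then show "(\<And>z. 0 \<le> \<phi> z) \<Longrightarrow> 0 \<le> (LINT z|lborel. (flux p (g z), - m z) \<bullet> d\<phi> z + 0 * \<phi> z)" by blast
  define Z where "Z d e z = (U2 z - pos_smooth d e (V z)) * (d\<phi> z \<bullet> ex i)
     + \<phi> z * ((G2 z - step_smooth d e (V z) *\<^sub>R (G2 z - G1 z)) $ i)" for d e z
  define w where "w z = B * (2 * norm (G2 z) + norm (G1 z)) + B * (2 * \<bar>U2 z\<bar> + \<bar>U1 z\<bar> + 2 * indicator K z)" for z
  have iw: "integrable lborel w" unfolding w_def[abs_def]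
    by (intro Bochner_Integration.integrable_add integrable_mult_right integrable_norm integrable_abs int Kfin)
  have cb: "\<bar>(y - c *\<^sub>R (y - x)) $ i\<bar> \<le> 2 * norm y + norm x" if "0 \<le> c" "c \<le> 1" for c and x y :: "real^'n"
  proof -
    have "\<bar>(y - c *\<^sub>R (y - x)) $ i\<bar> \<le> norm (y - c *\<^sub>R (y - x))" by (rule component_le_norm_cart)
    also have "\<dots> \<le> norm y + norm (c *\<^sub>R (y - x))" by (rule norm_triangle_ineq4)
    also have "norm (c *\<^sub>R (y - x)) \<le> norm (y - x)" using that by (simp add: mult_left_le_one_le)
    also have "norm (y - x) \<le> norm y + norm x" by (rule norm_triangle_ineq4)
    finally show ?thesis by simp
  qed
  have mZ: "Z d e \<in> borel_measurable borel" if "e > 0" for d e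
  proof -
    note [measurable] = stepc(1,3,4)[OF that]
    have "Z d e = (\<lambda>z. (U2 z - pos_smooth d e (V z)) * (d\<phi> z \<bullet> ex i) + \<phi> z * ((G2 z - step_smooth d e (V z) *\<^sub>R (G2 z - G1 z)) \<bullet> axis i 1))"
      by (simp add: Z_def fun_eq_iff inner_axis)
    then show ?thesis by simp
  qed
  have Zb: "\<bar>Z d e z\<bar> \<le> w z" if "0 < d" "0 < e" "d \<le> 1" "e \<le> 1" for d e z
  proof (cases "z \<in> K")
    case True
    have "\<bar>(U2 z - pos_smooth d e (V z)) * (d\<phi> z \<bullet> ex i)\<bar> \<le> (2 * \<bar>U2 z\<bar> + \<bar>U1 z\<bar> + 2) * B"
      unfolding abs_mult
    proof (intro mult_mono Bf B0)
      have "\<bar>pos_smooth d e (V z)\<bar> \<le> \<bar>V z\<bar> + 2" using pos_smooth_bound[OF that(2,1), of "V z"] that by linarith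
      then show "\<bar>U2 z - pos_smooth d e (V z)\<bar> \<le> 2 * \<bar>U2 z\<bar> + \<bar>U1 z\<bar> + 2" unfolding V_def by linarith
    qed simp_all
    moreover have "\<bar>\<phi> z * ((G2 z - step_smooth d e (V z) *\<^sub>R (G2 z - G1 z)) $ i)\<bar> \<le> B * (2 * norm (G2 z) + norm (G1 z))"
      unfolding abs_mult by (intro mult_mono B B0 cb step_smooth_bounds that) simp
    ultimately show ?thesis using True unfolding Z_def w_def by (simp add: mult.commute)
  next
    case False
    then show ?thesis using B0 by (simp add: Z_def w_def d\<phi>0 K(3))
  qed
  have stage1: "(LINT z|lborel. Z d e z) = 0" if de: "0 < d" "0 < e" "d \<le> 1" "e \<le> 1" for d e
  proof -
    note [measurable] = stepc(1,3,4)[OF de(2)]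
    let ?v = "\<lambda>n z. u2 n z - u1 n z"
    define X where "X n z = (u2 n z - pos_smooth d e (?v n z)) * (d\<phi> z \<bullet> ex i)
       + \<phi> z * ((h2 n z - step_smooth d e (?v n z) *\<^sub>R (h2 n z - h1 n z)) $ i)" for n z
    define wX where "wX z = B * (6 * G z + 2 * indicator K z)" for z
    have X0: "integral\<^sup>L lborel (X n) = 0" for n
      unfolding X_def[abs_def] vdefs
      by (rule mollified_min(2)[OF \<sigma>(1) de(2) int S(1) S(2) D(1) D(2) \<phi> K(1) K(3)])
    have mX: "X n \<in> borel_measurable lborel" for n
    proof -
      have "X n = (\<lambda>z. (u2 n z - pos_smooth d e (?v n z)) * (d\<phi> z \<bullet> ex i)
       + \<phi> z * ((h2 n z - step_smooth d e (?v n z) *\<^sub>R (h2 n z - h1 n z)) \<bullet> axis i 1))"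
        by (simp add: X_def fun_eq_iff inner_axis)
      then show ?thesis by simp
    qed
    have iwX: "integrable lborel wX" unfolding wX_def[abs_def] using G Kfin by (intro integrable_mult_right Bochner_Integration.integrable_add)
    have limX: "AE z in lborel. (\<lambda>n. X n z) \<longlonglongrightarrow> Z d e z"
      using lims
    proof eventually_elim
      case (elim z)
      have v: "(\<lambda>n. ?v n z) \<longlonglongrightarrow> V z" unfolding V_def using elim by (intro tendsto_intros) auto
      have c: "isCont (step_smooth d e) (V z)" "isCont (pos_smooth d e) (V z)"
        using stepc(2,5)[OF de(2), of d] by (auto simp: continuous_on_eq_continuous_at)
      show ?case unfolding X_def Z_def
        by (intro tendsto_intros isCont_tendsto_compose[OF c(1) v] isCont_tendsto_compose[OF c(2) v]) (use elim in auto)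
    qed
    have bX: "AE z in lborel. norm (X n z) \<le> wX z" for n
      using doms
    proof eventually_elim
      case (elim z)
      then have b: "\<bar>u1 n z\<bar> \<le> G z" "\<bar>u2 n z\<bar> \<le> G z" "norm (h1 n z) \<le> G z" "norm (h2 n z) \<le> G z" by auto
      then have G0: "G z \<ge> 0" by linarith
      show ?case
      proof (cases "z \<in> K")
        case True
        have t1: "\<bar>(u2 n z - pos_smooth d e (?v n z)) * (d\<phi> z \<bullet> ex i)\<bar> \<le> (3 * G z + 2) * B"
          unfolding abs_mult
        proof (intro mult_mono Bf B0)
          show "\<bar>u2 n z - pos_smooth d e (?v n z)\<bar> \<le> 3 * G z + 2"
            using pos_smooth_bound[OF de(2,1), of "?v n z"] b de by linarith
        qed (use G0 in auto)
        have t2: "\<bar>\<phi> z * ((h2 n z - step_smooth d e (?v n z) *\<^sub>R (h2 n z - h1 n z)) $ i)\<bar> \<le> B * (3 * G z)"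
          unfolding abs_mult
        proof (intro mult_mono B B0)
          show "\<bar>(h2 n z - step_smooth d e (?v n z) *\<^sub>R (h2 n z - h1 n z)) $ i\<bar> \<le> 3 * G z"
            using cb[OF step_smooth_bounds[OF de(2)], of "h2 n z" d "?v n z" "h1 n z"] b by linarith
        qed simp
        have "\<bar>X n z\<bar> \<le> (3 * G z + 2) * B + B * (3 * G z)" unfolding X_def using t1 t2 by linarith
        then show ?thesis using True by (simp add: wX_def algebra_simps)
      next
        case False
        then show ?thesis using G0 B0 by (simp add: X_def wX_def d\<phi>0 K(3))
      qed
    qed
    have "(\<lambda>n. integral\<^sup>L lborel (X n)) \<longlonglongrightarrow> integral\<^sup>L lborel (Z d e)"
      by (rule integral_dominated_convergence[OF _ mX iwX limX bX]) (use mZ[OF de(2)] in simp)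
    then show ?thesis unfolding X0 by (simp add: LIMSEQ_const_iff)
  qed
  have "(\<lambda>k. integral\<^sup>L lborel (Z (dd k) (ee k))) \<longlonglongrightarrow> (LINT z|lborel. (m z *\<^sub>R ex i) \<bullet> d\<phi> z + g z $ i * \<phi> z)"
  proof (rule integral_dominated_convergence[OF _ _ iw])
    define Zi where "Zi z = (U2 z - max 0 (V z)) * (d\<phi> z \<bullet> ex i) + \<phi> z * ((if V z > 0 then G1 z else G2 z) \<bullet> axis i 1)" for z
    have Zi: "(m z *\<^sub>R ex i) \<bullet> d\<phi> z + g z $ i * \<phi> z = Zi z" for z
    proof (cases "z \<in> K")
      case True
      show ?thesis unfolding Zi_def mK[OF True] inner_scaleR_swap by (simp add: inner_axis)
    qed (simp add: Zi_def d\<phi>0 K(3))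
    show "(\<lambda>z. (m z *\<^sub>R ex i) \<bullet> d\<phi> z + g z $ i * \<phi> z) \<in> borel_measurable lborel"
      unfolding Zi unfolding Zi_def[abs_def] by measurable
    show "Z (dd k) (ee k) \<in> borel_measurable lborel" for k using mZ[OF de(2)] by simp
    show "AE z in lborel. norm (Z (dd k) (ee k) z) \<le> w z" for k using Zb[OF de] by simp
    show "AE z in lborel. (\<lambda>k. Z (dd k) (ee k) z) \<longlonglongrightarrow> (m z *\<^sub>R ex i) \<bullet> d\<phi> z + g z $ i * \<phi> z"
    proof (rule AE_I2)
      fix z
      have "(\<lambda>k. Z (dd k) (ee k) z) \<longlonglongrightarrow> (U2 z - max 0 (V z)) * (d\<phi> z \<bullet> ex i)
         + \<phi> z * ((G2 z - (if V z > 0 then 1 else 0) *\<^sub>R (G2 z - G1 z)) $ i)"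
        unfolding Z_def dd_def ee_def by (intro tendsto_intros step_smooth_lim pos_smooth_lim)
      also have "(G2 z - (if V z > 0 then 1 else 0) *\<^sub>R (G2 z - G1 z)) $ i = (if V z > 0 then G1 z else G2 z) \<bullet> axis i 1" by (simp add: inner_axis)
      finally show "(\<lambda>k. Z (dd k) (ee k) z) \<longlonglongrightarrow> (m z *\<^sub>R ex i) \<bullet> d\<phi> z + g z $ i * \<phi> z" unfolding Zi Zi_def .
    qed
  qed
  then show "(LINT z|lborel. (m z *\<^sub>R ex i) \<bullet> d\<phi> z + g z $ i * \<phi> z) = 0"
    unfolding stage1[OF de] by (simp add: LIMSEQ_const_iff)
qed

theorem supersol_min:
  fixes v1 v2 :: "'n::finite pt \<Rightarrow> real" and g1 g2 :: "'n pt \<Rightarrow> real^'n"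
  assumes p: "p > 2" and U: "open U" and sob: "sob_loc p U v1 g1" "sob_loc p U v2 g2"
    and W: "wineq U (\<lambda>z. (flux p (g1 z), - v1 z)) (\<lambda>z. 0)" "wineq U (\<lambda>z. (flux p (g2 z), - v2 z)) (\<lambda>z. 0)"
  defines "m \<equiv> (\<lambda>z. min (v1 z) (v2 z))" and "g \<equiv> (\<lambda>z. if v1 z < v2 z then g1 z else g2 z)"
  shows "sob_loc p U m g" "wineq U (\<lambda>z. (flux p (g z), - m z)) (\<lambda>z. 0)"
proof -
  have mv: "(\<lambda>z. indicator U z * v1 z) \<in> borel_measurable borel" "(\<lambda>z. indicator U z * v2 z) \<in> borel_measurable borel"
     "(\<lambda>z. indicator U z *\<^sub>R g1 z) \<in> borel_measurable borel" "(\<lambda>z. indicator U z *\<^sub>R g2 z) \<in> borel_measurable borel"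
    and iv: "\<And>K. compact K \<Longrightarrow> K \<subseteq> U \<Longrightarrow> set_integrable lborel K (\<lambda>z. \<bar>v1 z\<bar> powr p)" "\<And>K. compact K \<Longrightarrow> K \<subseteq> U \<Longrightarrow> set_integrable lborel K (\<lambda>z. \<bar>v2 z\<bar> powr p)"
      "\<And>K. compact K \<Longrightarrow> K \<subseteq> U \<Longrightarrow> set_integrable lborel K (\<lambda>z. norm (g1 z) powr p)" "\<And>K. compact K \<Longrightarrow> K \<subseteq> U \<Longrightarrow> set_integrable lborel K (\<lambda>z. norm (g2 z) powr p)"
    using sob by (auto simp: sob_loc_def)
  note [measurable] = mv
  have eqm: "(\<lambda>z. indicator U z * m z) = (\<lambda>z. min (indicator U z * v1 z) (indicator U z * v2 z))"
    by (auto simp: m_def fun_eq_iff indicator_def)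
  have eqg: "(\<lambda>z. indicator U z *\<^sub>R g z) = (\<lambda>z. if indicator U z * v1 z < indicator U z * v2 z then indicator U z *\<^sub>R g1 z else indicator U z *\<^sub>R g2 z)"
    by (auto simp: g_def fun_eq_iff indicator_def)
  have mm: "(\<lambda>z. indicator U z * m z) \<in> borel_measurable borel" "(\<lambda>z. indicator U z *\<^sub>R g z) \<in> borel_measurable borel"
    unfolding eqm eqg by measurable
  have bd: "set_integrable lborel K f" if K: "compact K" "K \<subseteq> U" and f: "(\<lambda>z. indicator U z * f z) \<in> borel_measurable borel"
    and i: "set_integrable lborel K f1" "set_integrable lborel K f2" and le: "\<And>z. 0 \<le> f z" "\<And>z. f z \<le> f1 z + f2 z" for K f and f1 f2 :: "'n pt \<Rightarrow> real"
    unfolding set_integrable_def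
  proof (rule Bochner_Integration.integrable_bound)
    have [measurable]: "K \<in> sets borel" using K by (simp add: compact_imp_closed)
    show "integrable lborel (\<lambda>z. indicator K z *\<^sub>R f1 z + indicator K z *\<^sub>R f2 z)" using i by (auto simp: set_integrable_def)
    have "(\<lambda>z. indicator K z *\<^sub>R (indicator U z * f z)) \<in> borel_measurable lborel" using f by measurable
    moreover have "(\<lambda>z. indicator K z *\<^sub>R (indicator U z * f z)) = (\<lambda>z. indicator K z *\<^sub>R f z)"
      using K by (auto simp: fun_eq_iff indicator_def)
    ultimately show "(\<lambda>z. indicator K z *\<^sub>R f z) \<in> borel_measurable lborel" by simp
    show "AE z in lborel. norm (indicator K z *\<^sub>R f z) \<le> norm (indicator K z *\<^sub>R f1 z + indicator K z *\<^sub>R f2 z)"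
      using le by (intro AE_I2) (auto simp: indicator_def intro: order_trans[OF _ abs_ge_self])
  qed
  show "sob_loc p U m g"
  proof (rule sob_locI[OF p U])
    show "(\<lambda>z. indicator U z * m z) \<in> borel_measurable lborel" "(\<lambda>z. indicator U z *\<^sub>R g z) \<in> borel_measurable lborel"
      using mm by auto
    fix K assume K: "compact K" "K \<subseteq> U"
    have "(\<lambda>z. indicator U z * \<bar>m z\<bar> powr p) = (\<lambda>z. \<bar>indicator U z * m z\<bar> powr p)" using p by (auto simp: indicator_def fun_eq_iff)
    moreover have "(\<lambda>z. \<bar>indicator U z * m z\<bar> powr p) \<in> borel_measurable borel" using mm(1) by measurable
    ultimately show "set_integrable lborel K (\<lambda>z. \<bar>m z\<bar> powr p)"
      by (intro bd[OF K _ iv(1,2)[OF K]]) (auto simp: m_def min_def)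
    have "(\<lambda>z. indicator U z * norm (g z) powr p) = (\<lambda>z. norm (indicator U z *\<^sub>R g z) powr p)" using p by (auto simp: indicator_def fun_eq_iff)
    moreover have "(\<lambda>z. norm (indicator U z *\<^sub>R g z) powr p) \<in> borel_measurable borel" using mm(2) by measurable
    ultimately show "set_integrable lborel K (\<lambda>z. norm (g z) powr p)"
      by (intro bd[OF K _ iv(3,4)[OF K]]) (auto simp: g_def)
  next
    fix \<phi> i assume t: "test_fun U \<phi>"
    obtain K where K: "C1 \<phi> (grad \<phi>)" "compact K" "K \<subseteq> U" "\<And>z. z \<notin> K \<Longrightarrow> \<phi> z = 0" by (rule test_fun_C1[OF t]) (rule that)
    show "(LINT z|lborel. (m z *\<^sub>R ex i) \<bullet> grad \<phi> z + g z $ i * \<phi> z) = 0"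
      unfolding m_def g_def by (rule min_limit(2)[OF p U sob W K])
  qed
  show "wineq U (\<lambda>z. (flux p (g z), - m z)) (\<lambda>z. 0)"
    unfolding wineq_def
  proof (intro allI impI)
    fix \<phi> assume t: "test_fun U \<phi> \<and> (\<forall>z. 0 \<le> \<phi> z)"
    obtain K where K: "C1 \<phi> (grad \<phi>)" "compact K" "K \<subseteq> U" "\<And>z. z \<notin> K \<Longrightarrow> \<phi> z = 0" by (rule test_fun_C1[OF conjunct1[OF t]]) (rule that)
    show "0 \<le> (LINT z|lborel. (flux p (g z), - m z) \<bullet> grad \<phi> z + 0 * \<phi> z)"
      unfolding m_def g_def by (rule min_limit(1)[OF p U sob W K]) (use t in auto)
  qed
qed

section \<open>Localisation and comparison\<close>

lemma weak_supersol_iff: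
  "weak_supersol p U v \<longleftrightarrow> (\<exists>g. sob_loc p U v g \<and> wineq U (\<lambda>z. (flux p (g z), - v z)) (\<lambda>z. 0))"
  unfolding weak_supersol_def wineq_def by (simp add: plap_form_eq[of U])

lemma weak_sol_iff:
  "weak_sol p U v \<longleftrightarrow> (\<exists>g. sob_loc p U v g \<and>
     (\<forall>\<phi>. test_fun U \<phi> \<longrightarrow> (LINT z|lborel. (flux p (g z), - v z) \<bullet> grad \<phi> z + 0 * \<phi> z) = 0))"
  unfolding weak_sol_def by (simp add: plap_form_eq[of U])

lemma weak_sol_imp_supersol: "weak_sol p U v \<Longrightarrow> weak_supersol p U v"
  unfolding weak_sol_def weak_supersol_def by fastforce

lemma integrable_locint_inner:
  fixes F :: "'a::euclidean_space \<Rightarrow> 'b::euclidean_space"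
  assumes F: "locint U F" and \<theta>: "continuous_on UNIV \<theta>" and K: "compact K" "K \<subseteq> U" "\<And>z. z \<notin> K \<Longrightarrow> \<theta> z = 0"
  shows "integrable lborel (\<lambda>z. F z \<bullet> \<theta> z)"
proof -
  have "integrable lborel (\<lambda>z. (F z \<bullet> b) * (\<theta> z \<bullet> b))" for b
  proof (rule integrable_locint_mult[OF _ _ K(1,2)])
    show "locint U (\<lambda>z. F z \<bullet> b)"
      unfolding locint_def
    proof (intro allI impI)
      fix K assume "compact K \<and> K \<subseteq> U"
      then have "integrable lborel (\<lambda>z. (indicator K z *\<^sub>R F z) \<bullet> b)"
        using F by (intro integrable_inner_left) (auto simp: locint_def)
      then show "integrable lborel (\<lambda>z. indicator K z *\<^sub>R (F z \<bullet> b))" by simp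
    qed
    show "continuous_on UNIV (\<lambda>z. \<theta> z \<bullet> b)" using \<theta> by (intro continuous_intros)
  qed (simp add: K(3))
  then have "integrable lborel (\<lambda>z. \<Sum>b\<in>Basis. (F z \<bullet> b) * (\<theta> z \<bullet> b))" by (intro Bochner_Integration.integrable_sum)
  then show ?thesis by (subst euclidean_inner)
qed

lemma integrable_test:
  fixes F :: "'a::euclidean_space \<Rightarrow> 'a"
  assumes "locint U F" "locint U f0" and \<phi>: "C1 \<phi> d\<phi>" and K: "compact K" "K \<subseteq> U" "\<And>z. z \<notin> K \<Longrightarrow> \<phi> z = 0"
  shows "integrable lborel (\<lambda>z. F z \<bullet> d\<phi> z + f0 z * \<phi> z)"
proof (rule Bochner_Integration.integrable_add)
  have "continuous_on UNIV d\<phi>" using \<phi> by (simp add: C1_def)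
  then show "integrable lborel (\<lambda>z. F z \<bullet> d\<phi> z)"
    by (rule integrable_locint_inner[OF assms(1) _ K(1,2)]) (rule C1_support[OF \<phi> compact_imp_closed[OF K(1)] K(3)])
  show "integrable lborel (\<lambda>z. f0 z * \<phi> z)"
    by (rule integrable_locint_mult[OF assms(2) C1_continuous[OF \<phi>] K(1,2)]) (rule K(3))
qed

lemma locint_Pair:
  assumes "locint U f" "locint U g" shows "locint U (\<lambda>z. (f z, g z))"
  unfolding locint_def scaleR_Pair
proof (intro allI impI integrable_Pair)
  fix K assume "compact K \<and> K \<subseteq> U"
  then show "integrable lborel (\<lambda>z. indicator K z *\<^sub>R f z)" "integrable lborel (\<lambda>z. indicator K z *\<^sub>R g z)"
    using assms by (auto simp: locint_def)
qed

lemma locint_uminus: "locint U f \<Longrightarrow> locint U (\<lambda>z. - f z)"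
  unfolding locint_def by simp

lemma locint_0: "locint U (\<lambda>z. 0)"
  unfolding locint_def by simp

lemma locint_scaleR_right: "locint U f \<Longrightarrow> locint U (\<lambda>z. f z *\<^sub>R w)"
  unfolding locint_def
proof (intro allI impI)
  fix K assume f: "\<forall>K. compact K \<and> K \<subseteq> U \<longrightarrow> integrable lborel (\<lambda>z. indicator K z *\<^sub>R f z)" and K: "compact K \<and> K \<subseteq> U"
  then have "integrable lborel (\<lambda>z. (indicator K z *\<^sub>R f z) *\<^sub>R w)" by (intro integrable_scaleR_left) auto
  then show "integrable lborel (\<lambda>z. indicator K z *\<^sub>R (f z *\<^sub>R w))" by simp
qed

lemma locint_component: "locint U (g :: _ \<Rightarrow> real^'n::finite) \<Longrightarrow> locint U (\<lambda>z. g z $ i)"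
proof -
  assume g: "locint U g"
  have "integrable lborel (\<lambda>z. (indicator K z *\<^sub>R g z) \<bullet> axis i 1)" if "compact K" "K \<subseteq> U" for K
    using g that by (intro integrable_inner_left) (auto simp: locint_def)
  then show ?thesis by (auto simp: locint_def inner_axis)
qed

lemma test_fun_mono: "test_fun A \<phi> \<Longrightarrow> A \<subseteq> B \<Longrightarrow> test_fun B \<phi>"
  unfolding test_fun_def by blast

lemma wineq_mono: "wineq B F f0 \<Longrightarrow> A \<subseteq> B \<Longrightarrow> wineq A F f0"
  unfolding wineq_def using test_fun_mono by blast

lemma sob_loc_subset:
  assumes "sob_loc p B v g" "A \<subseteq> B" "open A" shows "sob_loc p A v g"
proof -
  have [measurable]: "A \<in> sets borel" using assms(3) by simp
  have mA: "(indicator A :: _ \<Rightarrow> real) \<in> borel_measurable lborel" by simp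
  have mB: "(\<lambda>z. indicator B z * v z) \<in> borel_measurable lborel" "(\<lambda>z. indicator B z *\<^sub>R g z) \<in> borel_measurable lborel"
    using assms(1) unfolding sob_loc_def by auto
  have "(\<lambda>z. indicator A z * (indicator B z * v z)) \<in> borel_measurable lborel" "(\<lambda>z. indicator A z *\<^sub>R (indicator B z *\<^sub>R g z)) \<in> borel_measurable lborel"
    by (rule borel_measurable_times[OF mA mB(1)], rule borel_measurable_scaleR[OF mA mB(2)])
  moreover have "(\<lambda>z. indicator A z * (indicator B z * v z)) = (\<lambda>z. indicator A z * v z)" "(\<lambda>z. indicator A z *\<^sub>R (indicator B z *\<^sub>R g z)) = (\<lambda>z. indicator A z *\<^sub>R g z)"
    using assms(2) by (auto simp: fun_eq_iff indicator_def)
  ultimately have m: "(\<lambda>z. indicator A z * v z) \<in> borel_measurable lborel" "(\<lambda>z. indicator A z *\<^sub>R g z) \<in> borel_measurable lborel" by simp_all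
  have "\<forall>K. compact K \<and> K \<subseteq> A \<longrightarrow> set_integrable lborel K (\<lambda>z. \<bar>v z\<bar> powr p) \<and> set_integrable lborel K (\<lambda>z. norm (g z) powr p)"
    using assms(1,2) unfolding sob_loc_def by (meson order_trans)
  moreover have "\<forall>\<phi> i. test_fun A \<phi> \<longrightarrow> (LINT z|lborel. v z * dx i \<phi> z) = - (LINT z|lborel. g z $ i * \<phi> z)"
    using assms(1) test_fun_mono[OF _ assms(2)] unfolding sob_loc_def by blast
  ultimately show ?thesis using m unfolding sob_loc_def by blast
qed

lemma wineq_cong_AE:
  fixes F F' :: "'a::euclidean_space \<Rightarrow> 'a"
  assumes U: "open U" and w: "wineq U F f0" and eq: "AE z in lborel. z \<in> U \<longrightarrow> F z = F' z \<and> f0 z = f0' z"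
    and l: "locint U F" "locint U f0" "locint U F'" "locint U f0'"
  shows "wineq U F' f0'"
  unfolding wineq_def
proof (intro allI impI)
  fix \<phi> assume t: "test_fun U \<phi> \<and> (\<forall>z. 0 \<le> \<phi> z)"
  obtain K where K: "C1 \<phi> (grad \<phi>)" "compact K" "K \<subseteq> U" "\<And>z. z \<notin> K \<Longrightarrow> \<phi> z = 0" by (rule test_fun_C1[OF conjunct1[OF t]]) (rule that)
  have i: "integrable lborel (\<lambda>z. F z \<bullet> grad \<phi> z + f0 z * \<phi> z)" "integrable lborel (\<lambda>z. F' z \<bullet> grad \<phi> z + f0' z * \<phi> z)"
    by (rule integrable_test[OF l(1,2) K]; assumption) (rule integrable_test[OF l(3,4) K]; assumption)
  have "0 \<le> (LINT z|lborel. F z \<bullet> grad \<phi> z + f0 z * \<phi> z)" using w t unfolding wineq_def by blast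
  also have "\<dots> = (LINT z|lborel. F' z \<bullet> grad \<phi> z + f0' z * \<phi> z)"
  proof (rule integral_cong_AE)
    show "AE z in lborel. F z \<bullet> grad \<phi> z + f0 z * \<phi> z = F' z \<bullet> grad \<phi> z + f0' z * \<phi> z"
      using eq
    proof eventually_elim
      case (elim z)
      then show ?case using K(3) K(4)[of z] C1_support[OF K(1) compact_imp_closed[OF K(2)] K(4), of z] by (cases "z \<in> K") auto
    qed
  qed (use i in auto)
  finally show "0 \<le> (LINT z|lborel. F' z \<bullet> grad \<phi> z + f0' z * \<phi> z)" .
qed

lemma sob_gradient_unique:
  fixes v :: "'n::finite pt \<Rightarrow> real"
  assumes p: "p > 2" and N: "open N" and s: "sob_loc p N v g" "sob_loc p N v h"
  shows "AE z in lborel. z \<in> N \<longrightarrow> g z = h z"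
proof -
  note L1 = sob_locD[OF s(1) p N] and L2 = sob_locD[OF s(2) p N]
  have main: "(LINT z|lborel. (0::'n pt) \<bullet> grad \<phi> z + (g z $ i - h z $ i) * \<phi> z) = 0" if t: "test_fun N \<phi>" for \<phi> i
  proof -
    obtain K where K: "C1 \<phi> (grad \<phi>)" "compact K" "K \<subseteq> N" "\<And>z. z \<notin> K \<Longrightarrow> \<phi> z = 0" by (rule test_fun_C1[OF t]) (rule that)
    have "integrable lborel (\<lambda>z. (v z *\<^sub>R ex i) \<bullet> grad \<phi> z + g z $ i * \<phi> z)" "integrable lborel (\<lambda>z. (v z *\<^sub>R ex i) \<bullet> grad \<phi> z + h z $ i * \<phi> z)"
      by (rule integrable_test[OF locint_scaleR_right[OF L1(1)] locint_component[OF L1(2)] K]; assumption)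
         (rule integrable_test[OF locint_scaleR_right[OF L1(1)] locint_component[OF L2(2)] K]; assumption)
    then have "(LINT z|lborel. ((v z *\<^sub>R ex i) \<bullet> grad \<phi> z + g z $ i * \<phi> z) - ((v z *\<^sub>R ex i) \<bullet> grad \<phi> z + h z $ i * \<phi> z)) = 0"
      using L1(7)[OF t, of i] L2(7)[OF t, of i] by (subst Bochner_Integration.integral_diff) auto
    moreover have "(\<lambda>z. ((v z *\<^sub>R ex i) \<bullet> grad \<phi> z + g z $ i * \<phi> z) - ((v z *\<^sub>R ex i) \<bullet> grad \<phi> z + h z $ i * \<phi> z))
      = (\<lambda>z. (0::'n pt) \<bullet> grad \<phi> z + (g z $ i - h z $ i) * \<phi> z)" by (simp add: fun_eq_iff algebra_simps)
    ultimately show ?thesis by simp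
  qed
  have "AE z in lborel. z \<in> N \<longrightarrow> g z $ i - h z $ i = 0" for i
  proof (rule AE_eq_0_if_weq[OF N])
    show "locint N (\<lambda>z. g z $ i - h z $ i)"
      using locint_component[OF L1(2), of i] locint_component[OF L2(2), of i] unfolding locint_def by (auto simp: right_diff_distrib)
    show "wineq N (\<lambda>z. 0) (\<lambda>z. g z $ i - h z $ i)" unfolding wineq_def using main by simp
    have "(LINT z|lborel. (0::'n pt) \<bullet> grad \<phi> z + - (g z $ i - h z $ i) * \<phi> z) = - (LINT z|lborel. (0::'n pt) \<bullet> grad \<phi> z + (g z $ i - h z $ i) * \<phi> z)" for \<phi>
      by (subst integral_minus[symmetric]) (simp add: algebra_simps)
    then show "wineq N (\<lambda>z. 0) (\<lambda>z. - (g z $ i - h z $ i))" unfolding wineq_def using main by simp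
  qed
  then have "AE z in lborel. \<forall>i\<in>UNIV. z \<in> N \<longrightarrow> g z $ i - h z $ i = 0" by (intro AE_finite_allI) auto
  then show ?thesis by (rule eventually_mono) (auto simp: vec_eq_iff)
qed

lemma set_integrable_locally:
  fixes h :: "'a::euclidean_space \<Rightarrow> real"
  assumes K: "compact K" and loc: "\<And>z. z \<in> K \<Longrightarrow> \<exists>B. open B \<and> z \<in> B \<and> set_integrable lborel (K \<inter> closure B) h"
  shows "set_integrable lborel K h"
proof -
  let ?C = "{B. open B \<and> set_integrable lborel (K \<inter> closure B) h}"
  have "K \<subseteq> \<Union>?C" using loc by blast
  then obtain D where D: "D \<subseteq> ?C" "finite D" "K \<subseteq> \<Union>D"
    by (rule compactE[OF K]) auto
  have "set_integrable lborel (\<Union>B\<in>D. K \<inter> closure B) h" using D(2,1)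
  proof (induction D rule: finite_induct)
    case empty
    then show ?case by (simp add: set_integrable_def)
  next
    case (insert B D)
    have "(\<Union>B\<in>insert B D. K \<inter> closure B) = (K \<inter> closure B) \<union> (\<Union>B\<in>D. K \<inter> closure B)" by auto
    moreover have cl: "K \<inter> closure B \<in> sets lborel" for B
      using closed_Int[OF compact_imp_closed[OF K] closed_closure[of B]] by simp
    moreover have "(\<Union>B\<in>D. K \<inter> closure B) \<in> sets lborel"
      by (rule sets.finite_UN[OF insert.hyps(1) cl])
    moreover have "set_integrable lborel (K \<inter> closure B) h" "set_integrable lborel (\<Union>B\<in>D. K \<inter> closure B) h"
      using insert.prems insert.IH by auto
    ultimately show ?case using set_integrable_Un by metis
  qed
  moreover have "K = (\<Union>B\<in>D. K \<inter> closure B)" using D(3) closure_subset by blast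
  ultimately show ?thesis by simp
qed

lemma sob_glue:
  fixes v :: "'n::finite pt \<Rightarrow> real" and N :: "nat \<Rightarrow> 'n pt set"
  assumes p: "p > 2" and N: "\<And>i. open (N i)" and s: "\<And>i. sob_loc p (N i) v (gg i)"
  defines "W \<equiv> \<Union>i. N i"
  obtains g where "sob_loc p W v g" "\<And>i. AE z in lborel. z \<in> N i \<longrightarrow> g z = gg i z"
proof -
  have W: "open W" unfolding W_def using N by blast
  define ix where "ix z = (LEAST i. z \<in> N i)" for z
  define g where "g z = gg (ix z) z" for z
  have ixN: "z \<in> N (ix z)" if "z \<in> W" for z using that unfolding W_def ix_def by (auto intro: LeastI)
  have AE1: "AE z in lborel. \<forall>i j. z \<in> N i \<inter> N j \<longrightarrow> gg i z = gg j z"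
  proof -
    have "AE z in lborel. z \<in> N i \<inter> N j \<longrightarrow> gg i z = gg j z" for i j
    proof (rule sob_gradient_unique[OF p, where v=v])
      show "open (N i \<inter> N j)" using N by auto
      then show "sob_loc p (N i \<inter> N j) v (gg i)" "sob_loc p (N i \<inter> N j) v (gg j)"
        by (auto intro: sob_loc_subset[OF s[of i]] sob_loc_subset[OF s[of j]])
    qed
    then show ?thesis by (simp add: AE_all_countable)
  qed
  have AEg: "AE z in lborel. z \<in> N i \<longrightarrow> g z = gg i z" for i
    using AE1
  proof eventually_elim
    case (elim z)
    show ?case
    proof
      assume z: "z \<in> N i"
      then have "z \<in> N (ix z)" by (intro ixN) (auto simp: W_def)
      then show "g z = gg i z" using elim z unfolding g_def by blast
    qed
  qed
  have [measurable]: "N i \<in> sets borel" "W \<in> sets borel" for i using N W by auto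
  have ixm[measurable]: "ix \<in> measurable borel (count_space UNIV)" unfolding ix_def[abs_def] by measurable
  have mi: "(\<lambda>z. indicator (N i) z * v z) \<in> borel_measurable borel" "(\<lambda>z. indicator (N i) z *\<^sub>R gg i z) \<in> borel_measurable borel" for i
    using s[of i] by (auto simp: sob_loc_def)
  have "(\<lambda>z. indicator (N (ix z)) z * v z) \<in> borel_measurable borel" "(\<lambda>z. indicator (N (ix z)) z *\<^sub>R gg (ix z) z) \<in> borel_measurable borel"
    by (rule measurable_compose_countable[OF mi(1) ixm]) (rule measurable_compose_countable[OF mi(2) ixm])
  then have "(\<lambda>z. indicator W z * (indicator (N (ix z)) z * v z)) \<in> borel_measurable borel" "(\<lambda>z. indicator W z *\<^sub>R (indicator (N (ix z)) z *\<^sub>R gg (ix z) z)) \<in> borel_measurable borel"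
    by measurable
  moreover have "(\<lambda>z. indicator W z * (indicator (N (ix z)) z * v z)) = (\<lambda>z. indicator W z * v z)" "(\<lambda>z. indicator W z *\<^sub>R (indicator (N (ix z)) z *\<^sub>R gg (ix z) z)) = (\<lambda>z. indicator W z *\<^sub>R g z)"
    using ixN by (auto simp: fun_eq_iff indicator_def g_def)
  ultimately have mW: "(\<lambda>z. indicator W z * v z) \<in> borel_measurable borel" "(\<lambda>z. indicator W z *\<^sub>R g z) \<in> borel_measurable borel" by simp_all
  have iv: "set_integrable lborel K (\<lambda>z. \<bar>v z\<bar> powr p)" and ig: "set_integrable lborel K (\<lambda>z. norm (g z) powr p)" if K: "compact K" "K \<subseteq> W" for K
  proof -
    have ball: "\<exists>B i. open B \<and> z \<in> B \<and> compact (K \<inter> closure B) \<and> K \<inter> closure B \<subseteq> N i" if zK: "z \<in> K" for z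
    proof -
      obtain i where "z \<in> N i" using zK K(2) by (auto simp: W_def)
      then obtain e where "e > 0" "cball z e \<subseteq> N i" using N open_contains_cball by blast
      then show ?thesis using K(1) by (intro exI[of _ "ball z e"] exI[of _ i]) (auto intro: compact_Int_closed)
    qed
    show "set_integrable lborel K (\<lambda>z. \<bar>v z\<bar> powr p)"
    proof (rule set_integrable_locally[OF K(1)])
      fix z assume "z \<in> K"
      then obtain B i where B: "open B" "z \<in> B" "compact (K \<inter> closure B)" "K \<inter> closure B \<subseteq> N i" using ball by blast
      then show "\<exists>B. open B \<and> z \<in> B \<and> set_integrable lborel (K \<inter> closure B) (\<lambda>z. \<bar>v z\<bar> powr p)"
        using s[of i] unfolding sob_loc_def by blast
    qed
    show "set_integrable lborel K (\<lambda>z. norm (g z) powr p)"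
    proof (rule set_integrable_locally[OF K(1)])
      fix z assume "z \<in> K"
      then obtain B i where B: "open B" "z \<in> B" "compact (K \<inter> closure B)" "K \<inter> closure B \<subseteq> N i" using ball by blast
      let ?A = "K \<inter> closure B"
      have i1: "integrable lborel (\<lambda>z. indicator ?A z *\<^sub>R norm (gg i z) powr p)" using s[of i] B(3,4) unfolding sob_loc_def set_integrable_def by blast
      have [measurable]: "?A \<in> sets borel" using B(3) by (simp add: compact_imp_closed)
      have "(\<lambda>z. indicator ?A z *\<^sub>R (norm (indicator W z *\<^sub>R g z) powr p)) \<in> borel_measurable borel" using mW(2) by measurable
      moreover have "(\<lambda>z. indicator ?A z *\<^sub>R (norm (indicator W z *\<^sub>R g z) powr p)) = (\<lambda>z. indicator ?A z *\<^sub>R norm (g z) powr p)"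
        using K(2) by (auto simp: fun_eq_iff indicator_def)
      ultimately have m: "(\<lambda>z. indicator ?A z *\<^sub>R norm (g z) powr p) \<in> borel_measurable lborel" by simp
      have "AE z in lborel. indicator ?A z *\<^sub>R norm (gg i z) powr p = indicator ?A z *\<^sub>R norm (g z) powr p"
        using AEg[of i]
      proof eventually_elim
        case (elim z)
        then show ?case using B(4) by (cases "z \<in> ?A") auto
      qed
      then have "integrable lborel (\<lambda>z. indicator ?A z *\<^sub>R norm (g z) powr p)"
        using integrable_cong_AE[OF _ m] i1 by blast
      then show "\<exists>B. open B \<and> z \<in> B \<and> set_integrable lborel (K \<inter> closure B) (\<lambda>z. norm (g z) powr p)"
        using B(1,2) by (auto simp: set_integrable_def)
    qed
  qed
  have "sob_loc p W v g"
  proof (rule sob_locI[OF p W])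
    show "(\<lambda>z. indicator W z * v z) \<in> borel_measurable lborel" "(\<lambda>z. indicator W z *\<^sub>R g z) \<in> borel_measurable lborel" using mW by auto
    fix K assume K: "compact K" "K \<subseteq> W"
    show "set_integrable lborel K (\<lambda>z. \<bar>v z\<bar> powr p)" "set_integrable lborel K (\<lambda>z. norm (g z) powr p)" by (rule iv[OF K], rule ig[OF K])
  next
    fix \<phi> :: "'n pt \<Rightarrow> real" and i :: 'n assume t: "test_fun W \<phi>"
    obtain K where K: "C1 \<phi> (grad \<phi>)" "compact K" "K \<subseteq> W" "\<And>z. z \<notin> K \<Longrightarrow> \<phi> z = 0" by (rule test_fun_C1[OF t]) (rule that)
    have lv: "locint W v" by (rule locint_bound[OF _ iv]) (use mW powr_le_1_plus[of "\<bar>v _\<bar>" 1 p] p in auto)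
    have lg: "locint W g" by (rule locint_bound[OF _ ig]) (use mW powr_le_1_plus[of "norm (g _)" 1 p] p in auto)
    have lv': "locint W (\<lambda>z. v z *\<^sub>R ex i)" by (rule locint_scaleR_right[OF lv])
    have lg': "locint W (\<lambda>z. g z $ i)" by (rule locint_component[OF lg])
    have lvN: "locint (N j) v" "locint (N j) (gg j)" for j using sob_locD(1,2)[OF s p N] by auto
    have w1: "wineq (N j) (\<lambda>z. v z *\<^sub>R ex i) (\<lambda>z. g z $ i)" for j
    proof (rule wineq_cong_AE[OF N sob_locD(5)[OF s p N]])
      show "AE z in lborel. z \<in> N j \<longrightarrow> v z *\<^sub>R ex i = v z *\<^sub>R ex i \<and> gg j z $ i = g z $ i" using AEg[of j] by eventually_elim auto
      show "locint (N j) (\<lambda>z. v z *\<^sub>R ex i)" by (rule locint_scaleR_right[OF lvN(1)])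
      then show "locint (N j) (\<lambda>z. v z *\<^sub>R ex i)" .
      show "locint (N j) (\<lambda>z. gg j z $ i)" by (rule locint_component[OF lvN(2)])
      show "locint (N j) (\<lambda>z. g z $ i)" using lg' unfolding locint_def W_def by blast
    qed
    have w2: "wineq (N j) (\<lambda>z. - (v z *\<^sub>R ex i)) (\<lambda>z. - g z $ i)" for j
    proof (rule wineq_cong_AE[OF N sob_locD(6)[OF s p N]])
      show "AE z in lborel. z \<in> N j \<longrightarrow> - (v z *\<^sub>R ex i) = - (v z *\<^sub>R ex i) \<and> - gg j z $ i = - g z $ i" using AEg[of j] by eventually_elim auto
      show "locint (N j) (\<lambda>z. - (v z *\<^sub>R ex i))" by (rule locint_uminus[OF locint_scaleR_right[OF lvN(1)]])
      then show "locint (N j) (\<lambda>z. - (v z *\<^sub>R ex i))" .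
      show "locint (N j) (\<lambda>z. - gg j z $ i)" by (rule locint_uminus[OF locint_component[OF lvN(2)]])
      show "locint (N j) (\<lambda>z. - g z $ i)" using locint_uminus[OF lg'] unfolding locint_def W_def by blast
    qed
    show "(LINT z|lborel. (v z *\<^sub>R ex i) \<bullet> grad \<phi> z + g z $ i * \<phi> z) = 0"
    proof (rule weq_C1_local[OF _ _ lv' lg' K(1,2) _ K(3)])
      fix z assume "z \<in> W"
      then obtain j where "z \<in> N j" by (auto simp: W_def)
      then show "\<exists>N. open N \<and> z \<in> N \<and> N \<subseteq> W \<and> wineq N (\<lambda>z. v z *\<^sub>R ex i) (\<lambda>z. g z $ i)" using w1[of j] N[of j] by (intro exI[of _ "N j"]) (auto simp: W_def)
      show "\<exists>N. open N \<and> z \<in> N \<and> N \<subseteq> W \<and> wineq N (\<lambda>z. - (v z *\<^sub>R ex i)) (\<lambda>z. - g z $ i)" using w2[of j] N[of j] \<open>z \<in> N j\<close> by (intro exI[of _ "N j"]) (auto simp: W_def)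
    qed (rule K(4))
  qed
  then show ?thesis using that[of g] AEg by blast
qed

lemma countable_local_cover:
  fixes W :: "'a::euclidean_space set"
  assumes loc: "\<And>z. z \<in> W \<Longrightarrow> \<exists>N. open N \<and> z \<in> N \<and> N \<subseteq> W \<and> P N" and P0: "P {}"
  obtains N :: "nat \<Rightarrow> 'a set" where "\<And>i. open (N i)" "\<And>i. P (N i)" "(\<Union>i. N i) = W"
proof -
  let ?F = "{N. open N \<and> N \<subseteq> W \<and> P N}"
  have "\<Union>?F = W" using loc by blast
  obtain F' where F': "F' \<subseteq> ?F" "countable F'" "\<Union>F' = \<Union>?F"
    by (rule Lindelof[of ?F]) auto
  let ?G = "insert {} F'"
  have G: "countable ?G" "?G \<noteq> {}" using F'(2) by auto
  define N where "N = from_nat_into ?G"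
  have rg: "range N = ?G" unfolding N_def by (rule range_from_nat_into[OF G(2,1)])
  have "open (N i) \<and> P (N i)" for i
  proof -
    have "N i \<in> ?G" using rg by blast
    then show ?thesis using F'(1) P0 by auto
  qed
  moreover have "(\<Union>i. N i) = W"
    unfolding rg using F'(3) \<open>\<Union>?F = W\<close> by simp
  ultimately show ?thesis using that[of N] by blast
qed

lemma test_fun_empty: "test_fun {} \<phi> \<Longrightarrow> \<phi> = (\<lambda>z. 0)"
proof -
  assume "test_fun {} \<phi>"
  then have "{z. \<phi> z \<noteq> 0} = {}" using closure_subset[of "{z. \<phi> z \<noteq> 0}"] unfolding test_fun_def by blast
  then show ?thesis by auto
qed

lemma grad_zero: "grad (\<lambda>z. 0) z = 0"
  by (rule GDERIV_unique[OF GDERIV_grad GDERIV_const]) simp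

lemma sob_loc_empty: "sob_loc p {} v g"
  unfolding sob_loc_def by (auto simp: set_integrable_def dx_def dest!: test_fun_empty)

lemma wineq_empty: "wineq {} F f0"
  unfolding wineq_def by (auto dest!: test_fun_empty simp: grad_zero)

lemma locint_flux:
  assumes "sob_loc p U v g" "p > 2" "open U" shows "locint U (\<lambda>z. (flux p (g z), - v z))"
  by (rule locint_Pair[OF sob_locD(3)[OF assms] locint_uminus[OF sob_locD(1)[OF assms]]])

lemma weak_supersol_local:
  fixes v :: "'n::finite pt \<Rightarrow> real"
  assumes p: "p > 2" and loc: "\<And>z. z \<in> W \<Longrightarrow> \<exists>N. open N \<and> z \<in> N \<and> N \<subseteq> W \<and> weak_supersol p N v"
  shows "weak_supersol p W v"
proof -
  have "weak_supersol p {} v" unfolding weak_supersol_iff using sob_loc_empty wineq_empty by blast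
  then obtain N :: "nat \<Rightarrow> 'n pt set" where N: "\<And>i. open (N i)" "\<And>i. weak_supersol p (N i) v" "(\<Union>i. N i) = W"
    by (rule countable_local_cover[OF loc, rotated]) (rule that)
  have "\<forall>i. \<exists>g. sob_loc p (N i) v g \<and> wineq (N i) (\<lambda>z. (flux p (g z), - v z)) (\<lambda>z. 0)"
    using N(2) unfolding weak_supersol_iff by blast
  then obtain gg where gg: "\<And>i. sob_loc p (N i) v (gg i)" "\<And>i. wineq (N i) (\<lambda>z. (flux p (gg i z), - v z)) (\<lambda>z. 0)"
    by (auto dest!: choice)
  obtain g where g: "sob_loc p (\<Union>i. N i) v g" "\<And>i. AE z in lborel. z \<in> N i \<longrightarrow> g z = gg i z"
    by (rule sob_glue[OF p N(1) gg(1)]) (rule that)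
  have W: "open W" using N by auto
  have sub: "N i \<subseteq> W" for i using N(3) by auto
  note gW = g(1)[unfolded N(3)]
  have w: "wineq (N i) (\<lambda>z. (flux p (g z), - v z)) (\<lambda>z. 0)" for i
  proof (rule wineq_cong_AE[OF N(1) gg(2)])
    show "AE z in lborel. z \<in> N i \<longrightarrow> (flux p (gg i z), - v z) = (flux p (g z), - v z) \<and> (0::real) = 0"
      using g(2)[of i] by eventually_elim auto
  qed (rule locint_flux[OF gg(1) p N(1)] locint_0 locint_flux[OF sob_loc_subset[OF gW sub N(1)] p N(1)])+
  have "wineq W (\<lambda>z. (flux p (g z), - v z)) (\<lambda>z. 0)"
    unfolding wineq_def
  proof (intro allI impI)
    fix \<phi> assume t: "test_fun W \<phi> \<and> (\<forall>z. 0 \<le> \<phi> z)"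
    obtain K where K: "C1 \<phi> (grad \<phi>)" "compact K" "K \<subseteq> W" "\<And>z. z \<notin> K \<Longrightarrow> \<phi> z = 0" by (rule test_fun_C1[OF conjunct1[OF t]]) (rule that)
    show "0 \<le> (LINT z|lborel. (flux p (g z), - v z) \<bullet> grad \<phi> z + 0 * \<phi> z)"
    proof (rule wineq_C1_local[OF _ locint_flux[OF gW p W] locint_0 K(1,2) _ K(3)])
      fix z assume "z \<in> W"
      then obtain i where "z \<in> N i" using N(3) by auto
      then show "\<exists>N. open N \<and> z \<in> N \<and> N \<subseteq> W \<and> wineq N (\<lambda>z. (flux p (g z), - v z)) (\<lambda>z. 0)"
        using w[of i] N(1)[of i] sub[of i] by blast
    qed (use K(4) t in auto)
  qed
  then show ?thesis unfolding weak_supersol_iff using gW by blast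
qed

lemma weak_solD:
  assumes "weak_sol p U v" obtains g where "sob_loc p U v g" "wineq U (\<lambda>z. (flux p (g z), - v z)) (\<lambda>z. 0)"
    "wineq U (\<lambda>z. - (flux p (g z), - v z)) (\<lambda>z. - 0)"
proof -
  obtain g where g: "sob_loc p U v g" "\<And>\<phi>. test_fun U \<phi> \<Longrightarrow> (LINT z|lborel. (flux p (g z), - v z) \<bullet> grad \<phi> z + 0 * \<phi> z) = 0"
    using assms unfolding weak_sol_iff by blast
  have "wineq U (\<lambda>z. (flux p (g z), - v z)) (\<lambda>z. 0)" unfolding wineq_def using g(2) by simp
  moreover have "(LINT z|lborel. (- (flux p (g z), - v z)) \<bullet> grad \<phi> z + - 0 * \<phi> z) = - (LINT z|lborel. (flux p (g z), - v z) \<bullet> grad \<phi> z + 0 * \<phi> z)" for \<phi>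
    by (subst integral_minus[symmetric]) (simp only: inner_minus_left mult_zero_left minus_zero add_0_right)
  then have "wineq U (\<lambda>z. - (flux p (g z), - v z)) (\<lambda>z. - 0)" unfolding wineq_def using g(2) by (simp only: minus_zero) simp
  ultimately show ?thesis using that g(1) by blast
qed

lemma weak_sol_local:
  fixes v :: "'n::finite pt \<Rightarrow> real"
  assumes p: "p > 2" and loc: "\<And>z. z \<in> W \<Longrightarrow> \<exists>N. open N \<and> z \<in> N \<and> N \<subseteq> W \<and> weak_sol p N v"
  shows "weak_sol p W v"
proof -
  have "weak_sol p {} v" unfolding weak_sol_iff using sob_loc_empty[of p v] by (auto dest!: test_fun_empty simp: grad_zero)
  then obtain N :: "nat \<Rightarrow> 'n pt set" where N: "\<And>i. open (N i)" "\<And>i. weak_sol p (N i) v" "(\<Union>i. N i) = W"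
    by (rule countable_local_cover[OF loc, rotated]) (rule that)
  have "\<forall>i. \<exists>g. sob_loc p (N i) v g \<and> wineq (N i) (\<lambda>z. (flux p (g z), - v z)) (\<lambda>z. 0) \<and> wineq (N i) (\<lambda>z. - (flux p (g z), - v z)) (\<lambda>z. - 0)"
  proof
    fix i
    obtain g where "sob_loc p (N i) v g" "wineq (N i) (\<lambda>z. (flux p (g z), - v z)) (\<lambda>z. 0)"
      "wineq (N i) (\<lambda>z. - (flux p (g z), - v z)) (\<lambda>z. - 0)" by (rule weak_solD[OF N(2)]) (rule that)
    then show "\<exists>g. sob_loc p (N i) v g \<and> wineq (N i) (\<lambda>z. (flux p (g z), - v z)) (\<lambda>z. 0) \<and> wineq (N i) (\<lambda>z. - (flux p (g z), - v z)) (\<lambda>z. - 0)"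
      by blast
  qed
  then obtain gg where gg: "\<And>i. sob_loc p (N i) v (gg i)" "\<And>i. wineq (N i) (\<lambda>z. (flux p (gg i z), - v z)) (\<lambda>z. 0)"
    "\<And>i. wineq (N i) (\<lambda>z. - (flux p (gg i z), - v z)) (\<lambda>z. - 0)" by (auto dest!: choice)
  obtain g where g: "sob_loc p (\<Union>i. N i) v g" "\<And>i. AE z in lborel. z \<in> N i \<longrightarrow> g z = gg i z"
    by (rule sob_glue[OF p N(1) gg(1)]) (rule that)
  have W: "open W" using N by auto
  have sub: "N i \<subseteq> W" for i using N(3) by auto
  note gW = g(1)[unfolded N(3)]
  have w: "wineq (N i) (\<lambda>z. (flux p (g z), - v z)) (\<lambda>z. 0)" for i
  proof (rule wineq_cong_AE[OF N(1) gg(2)])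
    show "AE z in lborel. z \<in> N i \<longrightarrow> (flux p (gg i z), - v z) = (flux p (g z), - v z) \<and> (0::real) = 0"
      using g(2)[of i] by eventually_elim auto
  qed (rule locint_flux[OF gg(1) p N(1)] locint_0 locint_flux[OF sob_loc_subset[OF gW sub N(1)] p N(1)])+
  have w': "wineq (N i) (\<lambda>z. - (flux p (g z), - v z)) (\<lambda>z. - 0)" for i
  proof (rule wineq_cong_AE[OF N(1) gg(3)])
    show "AE z in lborel. z \<in> N i \<longrightarrow> - (flux p (gg i z), - v z) = - (flux p (g z), - v z) \<and> (- 0::real) = - 0"
      using g(2)[of i] by eventually_elim auto
  qed (rule locint_uminus[OF locint_flux[OF gg(1) p N(1)]] locint_uminus[OF locint_0] locint_uminus[OF locint_flux[OF sob_loc_subset[OF gW sub N(1)] p N(1)]])+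
  have "(LINT z|lborel. (flux p (g z), - v z) \<bullet> grad \<phi> z + 0 * \<phi> z) = 0" if t: "test_fun W \<phi>" for \<phi>
  proof -
    obtain K where K: "C1 \<phi> (grad \<phi>)" "compact K" "K \<subseteq> W" "\<And>z. z \<notin> K \<Longrightarrow> \<phi> z = 0" by (rule test_fun_C1[OF t]) (rule that)
    show ?thesis
    proof (rule weq_C1_local[OF _ _ locint_flux[OF gW p W] locint_0 K(1,2) _ K(3)])
      fix z assume "z \<in> W"
      then obtain i where "z \<in> N i" using N(3) by auto
      then show "\<exists>N. open N \<and> z \<in> N \<and> N \<subseteq> W \<and> wineq N (\<lambda>z. (flux p (g z), - v z)) (\<lambda>z. 0)"
        "\<exists>N. open N \<and> z \<in> N \<and> N \<subseteq> W \<and> wineq N (\<lambda>z. - (flux p (g z), - v z)) (\<lambda>z. - 0)"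
        using w[of i] w'[of i] N(1)[of i] sub[of i] by blast+
    qed (rule K(4))
  qed
  then show ?thesis unfolding weak_sol_iff using gW by blast
qed

lemma C1_cutoff:
  fixes F :: "'a::euclidean_space set"
  assumes F: "compact F" "F \<subseteq> U" and U: "open U"
  obtains \<eta> d\<eta> K O' where "C1 \<eta> d\<eta>" "compact K" "K \<subseteq> U" "\<And>z. z \<notin> K \<Longrightarrow> \<eta> z = 0" "open O'" "F \<subseteq> O'"
    "\<And>z. z \<in> O' \<Longrightarrow> \<eta> z = 1" "\<And>z. 0 \<le> \<eta> z"
proof -
  obtain K1 s1 where K1: "compact K1" "K1 \<subseteq> U" "F \<subseteq> K1" "s1 > 0" "\<And>z. z \<in> F \<Longrightarrow> cball z s1 \<subseteq> K1"
    by (rule compact_neighbourhood[OF F(1) U F(2)]) (rule that)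
  obtain K2 s2 where K2: "compact K2" "K2 \<subseteq> U" "K1 \<subseteq> K2" "s2 > 0" "\<And>z. z \<in> K1 \<Longrightarrow> cball z s2 \<subseteq> K2"
    by (rule compact_neighbourhood[OF K1(1) U K1(2)]) (rule that)
  define \<sigma> where "\<sigma> = min (s1/2) s2"
  have \<sigma>: "\<sigma> > 0" "\<sigma> \<le> s1 / 2" "\<sigma> \<le> s2" using K1 K2 by (auto simp: \<sigma>_def)
  let ?f = "indicator K1 :: 'a \<Rightarrow> real"
  have i: "integrable lborel ?f"
    using K1(1) emeasure_bounded_finite[of K1] compact_imp_closed[OF K1(1)] by (intro integrable_real_indicator) (auto simp: compact_imp_bounded)
  let ?O = "\<Union>x\<in>F. ball x (s1/2)"
  show ?thesis
  proof (rule that[OF C1_vconv_moll[OF \<sigma>(1) i] K2(1,2)])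
    show "vconv (moll \<sigma>) ?f z = 0" if "z \<notin> K2" for z
    proof (rule vconv_moll_eq_0[OF \<sigma>(1)])
      fix y assume y: "norm (z - y) < \<sigma>"
      have "y \<notin> K1"
      proof
        assume "y \<in> K1"
        moreover have "z \<in> cball y s2" using y \<sigma>(3) by (simp add: dist_norm norm_minus_commute)
        ultimately show False using K2(5) that by blast
      qed
      then show "?f y = 0" by simp
    qed
    show "open ?O" by auto
    show "F \<subseteq> ?O" using K1(4) by auto
    show "vconv (moll \<sigma>) ?f z = 1" if zO: "z \<in> ?O" for z
    proof -
      obtain x where x: "x \<in> F" "dist x z < s1 / 2" using zO by auto
      have "moll \<sigma> (z - y) *\<^sub>R ?f y = moll \<sigma> (z - y)" for y
      proof (cases "y \<in> cball z \<sigma>")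
        case True
        then have "dist x y \<le> s1" using x(2) \<sigma>(2) dist_triangle[of x y z] by simp
        then have "y \<in> K1" using K1(5)[OF x(1)] by auto
        then show ?thesis by simp
      qed (simp add: moll_reflect_support[OF \<sigma>(1)])
      then have "(\<lambda>y. moll \<sigma> (z - y) *\<^sub>R ?f y) = (\<lambda>y. moll \<sigma> (z - y))" by (rule ext)
      then show ?thesis unfolding vconv_def using integral_moll_reflect(1)[OF \<sigma>(1), of z] by (simp only:)
    qed
    show "0 \<le> vconv (moll \<sigma>) ?f z" for z
      unfolding vconv_def by (rule Bochner_Integration.integral_nonneg) (simp add: moll_nonneg)
  qed
qed

lemma DERIV_max_sq: "((\<lambda>s::real. (max 0 s)\<^sup>2) has_real_derivative 2 * max 0 s) (at s)"
proof -
  consider "s > 0" | "s < 0" | "s = 0" by linarith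
  then show ?thesis
  proof cases
    case 1
    have "((\<lambda>s::real. s\<^sup>2) has_real_derivative 2 * max 0 s) (at s)" using 1 by (auto intro!: derivative_eq_intros)
    then show ?thesis by (rule has_field_derivative_transform_within_open[where S="{0<..}"]) (use 1 in auto)
  next
    case 2
    have "((\<lambda>s::real. 0) has_real_derivative 2 * max 0 s) (at s)" using 2 by (auto intro!: derivative_eq_intros)
    then show ?thesis by (rule has_field_derivative_transform_within_open[where S="{..<0}"]) (use 2 in auto)
  next
    case 3
    have "((\<lambda>h::real. ((max 0 (0 + h))\<^sup>2 - (max 0 0)\<^sup>2) / h) \<longlongrightarrow> 0) (at 0)"
    proof (rule tendsto_0_le[where K=1 and f="\<lambda>h. h"])
      show "\<forall>\<^sub>F h in at 0. norm (((max 0 (0 + h))\<^sup>2 - (max 0 0)\<^sup>2) / h) \<le> norm (h::real) * 1"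
        by (rule always_eventually) (auto simp: max_def power2_eq_square)
    qed (auto intro!: tendsto_eq_intros)
    then show ?thesis using 3 by (simp add: DERIV_def)
  qed
qed

lemma C1_snd: "C1 (\<lambda>z::'n::finite pt. snd z) (\<lambda>z. (0, 1))"
  unfolding C1_def gderiv_def by (auto intro!: derivative_eq_intros continuous_intros simp: inner_prod_def)

theorem comparison:
  fixes u v :: "'n::finite pt \<Rightarrow> real"
  assumes p: "p > 2" and U: "open U" and v: "weak_sol p U v" and u: "weak_supersol p U u"
    and F: "compact F" "F \<subseteq> U" and uF: "AE z in lborel. z \<in> U \<and> snd z \<le> s \<and> u z < v z \<longrightarrow> z \<in> F"
  shows "AE z in lborel. z \<in> U \<and> snd z < s \<longrightarrow> v z \<le> u z"
proof -
  obtain gv where gv: "sob_loc p U v gv" "wineq U (\<lambda>z. (flux p (gv z), - v z)) (\<lambda>z. 0)"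
    "wineq U (\<lambda>z. - (flux p (gv z), - v z)) (\<lambda>z. - 0)" by (rule weak_solD[OF v]) (rule that)
  obtain gu where gu: "sob_loc p U u gu" "wineq U (\<lambda>z. (flux p (gu z), - u z)) (\<lambda>z. 0)"
    using u unfolding weak_supersol_iff by blast
  define m g where "m z = min (u z) (v z)" and "g z = (if u z < v z then gu z else gv z)" for z
  have m: "sob_loc p U m g" "wineq U (\<lambda>z. (flux p (g z), - m z)) (\<lambda>z. 0)"
    using supersol_min[OF p U gu(1) gv(1) gu(2) gv(2)] unfolding m_def[abs_def] g_def[abs_def] by auto
  obtain \<eta> d\<eta> K O' where \<eta>: "C1 \<eta> d\<eta>" "compact K" "K \<subseteq> U" "\<And>z. z \<notin> K \<Longrightarrow> \<eta> z = 0" "open O'" "F \<subseteq> O'"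
    "\<And>z. z \<in> O' \<Longrightarrow> \<eta> z = 1" "\<And>z. 0 \<le> \<eta> z" by (rule C1_cutoff[OF F U]) (rule that)
  have d\<eta>0: "d\<eta> z = 0" if "z \<in> O'" for z
  proof (rule GDERIV_unique)
    show "GDERIV \<eta> z :> d\<eta> z" using \<eta>(1) unfolding C1_def by blast
    have "((\<lambda>z. 1) has_derivative (\<lambda>h. h \<bullet> (0::'n pt))) (at z)" by simp
    then have "(\<eta> has_derivative (\<lambda>h. h \<bullet> (0::'n pt))) (at z)"
      by (rule has_derivative_transform_within_open[OF _ \<eta>(5) that]) (simp add: \<eta>(7))
    then show "GDERIV \<eta> z :> 0" unfolding gderiv_def .
  qed
  let ?c = "\<lambda>z::'n pt. (max 0 (s - snd z))\<^sup>2" and ?dc = "\<lambda>z::'n pt. (2 * max 0 (s - snd z)) *\<^sub>R (0 - (0, 1) :: 'n pt)"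
  have "continuous_on UNIV (\<lambda>r::real. 2 * max 0 r)" by (intro continuous_intros)
  from C1_comp[OF C1_diff[OF C1_const[of s] C1_snd] DERIV_max_sq this]
  have C\<chi>: "C1 ?c ?dc" .
  define \<phi> d\<phi> where "\<phi> z = \<eta> z * ?c z" and "d\<phi> z = \<eta> z *\<^sub>R ?dc z + ?c z *\<^sub>R d\<eta> z" for z
  have \<phi>: "C1 \<phi> d\<phi>" unfolding \<phi>_def[abs_def] d\<phi>_def[abs_def] by (rule C1_mult[OF \<eta>(1) C\<chi>])
  have \<phi>K: "\<phi> z = 0" if "z \<notin> K" for z using \<eta>(4)[OF that] by (simp add: \<phi>_def)
  have \<phi>0: "0 \<le> \<phi> z" for z using \<eta>(8)[of z] by (simp add: \<phi>_def)
  have lm: "locint U (\<lambda>z. (flux p (g z), - m z))" and lv: "locint U (\<lambda>z. (flux p (gv z), - v z))"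
    by (rule locint_flux[OF m(1) p U], rule locint_flux[OF gv(1) p U])
  have loc: "\<exists>N. open N \<and> z \<in> N \<and> N \<subseteq> U \<and> wineq N F f0" if "wineq U F f0" "z \<in> U" for F f0 z using that U by blast
  have ge: "0 \<le> (LINT z|lborel. (flux p (g z), - m z) \<bullet> d\<phi> z + 0 * \<phi> z)"
    by (rule wineq_C1_local[OF loc[OF m(2)] lm locint_0 \<phi> \<eta>(2) \<phi>K \<eta>(3) \<phi>0])
  have eq: "(LINT z|lborel. (flux p (gv z), - v z) \<bullet> d\<phi> z + 0 * \<phi> z) = 0"
    by (rule weq_C1_local[OF loc[OF gv(2)] loc[OF gv(3)] lv locint_0 \<phi> \<eta>(2) \<phi>K \<eta>(3)])
  have i1: "integrable lborel (\<lambda>z. (flux p (g z), - m z) \<bullet> d\<phi> z + 0 * \<phi> z)" by (rule integrable_test[OF lm locint_0 \<phi> \<eta>(2,3) \<phi>K])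
  have i2: "integrable lborel (\<lambda>z. (flux p (gv z), - v z) \<bullet> d\<phi> z + 0 * \<phi> z)" by (rule integrable_test[OF lv locint_0 \<phi> \<eta>(2,3) \<phi>K])
  define X where "X z = ((flux p (gv z), - v z) \<bullet> d\<phi> z + 0 * \<phi> z) - ((flux p (g z), - m z) \<bullet> d\<phi> z + 0 * \<phi> z)" for z
  have iX: "integrable lborel X" unfolding X_def[abs_def] using i1 i2 by (rule Bochner_Integration.integrable_diff[rotated])
  have "integral\<^sup>L lborel X \<le> 0" unfolding X_def[abs_def] using i1 i2 ge eq by (subst Bochner_Integration.integral_diff) auto
  have Xval: "AE z in lborel. 0 \<le> X z \<and> (z \<in> U \<and> snd z < s \<and> u z < v z \<longrightarrow> X z > 0)"
    using uF
  proof eventually_elim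
    case (elim z)
    show ?case
    proof (cases "z \<in> U \<and> u z < v z")
      case False
      then show ?thesis
      proof (cases "z \<in> U")
        case True
        then have "m z = v z" "g z = gv z" using False by (auto simp: m_def g_def)
        then show ?thesis using False True by (simp add: X_def)
      next
        case z: False
        then have "z \<notin> K" using \<eta>(3) by blast
        then have "d\<phi> z = 0" using C1_support[OF \<phi> compact_imp_closed[OF \<eta>(2)] \<phi>K] by blast
        then show ?thesis using z by (simp add: X_def)
      qed
    next
      case True
      show ?thesis
      proof (cases "snd z \<le> s")
        case le: True
        then have "z \<in> O'" using elim True \<eta>(6) by blast
        then have "d\<phi> z = ?dc z" by (simp add: d\<phi>_def d\<eta>0 \<eta>(7))
        then have "X z = (v z - m z) * (2 * (s - snd z))" using le by (simp add: X_def inner_prod_def algebra_simps)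
        moreover have "v z - m z > 0" using True by (simp add: m_def)
        ultimately show ?thesis using le by (auto intro: mult_nonneg_nonneg)
      next
        case False
        then have "d\<phi> z = 0" by (simp add: d\<phi>_def zero_prod_def)
        then show ?thesis using False by (simp add: X_def)
      qed
    qed
  qed
  then have X0: "AE z in lborel. 0 \<le> X z" by eventually_elim auto
  have "integral\<^sup>L lborel X = 0" using \<open>integral\<^sup>L lborel X \<le> 0\<close> integral_nonneg_AE[OF X0] by linarith
  then have "AE z in lborel. X z = 0" using integral_nonneg_eq_0_iff_AE[OF iX X0] by simp
  then show ?thesis using Xval by eventually_elim force
qed

section \<open>Pasting and scaling\<close>

lemma sob_loc_cong:
  assumes p: "p > 2" and U: "open U" and s: "sob_loc p U v g" and eq: "\<And>z. z \<in> U \<Longrightarrow> v z = v' z"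
  shows "sob_loc p U v' g"
proof (rule sob_locI[OF p U])
  have "(\<lambda>z. indicator U z * v z) = (\<lambda>z. indicator U z * v' z)" using eq by (auto simp: fun_eq_iff indicator_def)
  then show "(\<lambda>z. indicator U z * v' z) \<in> borel_measurable lborel" using s by (auto simp: sob_loc_def)
  show "(\<lambda>z. indicator U z *\<^sub>R g z) \<in> borel_measurable lborel" using s by (auto simp: sob_loc_def)
  fix K assume K: "compact K" "K \<subseteq> U"
  have "(\<lambda>z. indicator K z *\<^sub>R \<bar>v' z\<bar> powr p) = (\<lambda>z. indicator K z *\<^sub>R \<bar>v z\<bar> powr p)" using eq K by (auto simp: fun_eq_iff indicator_def)
  moreover have "integrable lborel (\<lambda>z. indicator K z *\<^sub>R \<bar>v z\<bar> powr p)" using s K unfolding sob_loc_def set_integrable_def by blast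
  ultimately show "set_integrable lborel K (\<lambda>z. \<bar>v' z\<bar> powr p)" unfolding set_integrable_def by (simp only:)
  show "set_integrable lborel K (\<lambda>z. norm (g z) powr p)" using s K unfolding sob_loc_def by blast
next
  fix \<phi> i assume t: "test_fun U \<phi>"
  obtain K where K: "C1 \<phi> (grad \<phi>)" "compact K" "K \<subseteq> U" "\<And>z. z \<notin> K \<Longrightarrow> \<phi> z = 0" by (rule test_fun_C1[OF t]) (rule that)
  have "(v z *\<^sub>R ex i) \<bullet> grad \<phi> z = (v' z *\<^sub>R ex i) \<bullet> grad \<phi> z" for z
    using eq[of z] K(3) C1_support[OF K(1) compact_imp_closed[OF K(2)] K(4), of z] by (cases "z \<in> K") auto
  then show "(LINT z|lborel. (v' z *\<^sub>R ex i) \<bullet> grad \<phi> z + g z $ i * \<phi> z) = 0" using sob_locD(7)[OF s p U t, of i] by simp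
qed

lemma weak_supersol_cong:
  assumes p: "p > 2" and U: "open U" and s: "weak_supersol p U v" and eq: "\<And>z. z \<in> U \<Longrightarrow> v z = v' z"
  shows "weak_supersol p U v'"
proof -
  obtain g where g: "sob_loc p U v g" "wineq U (\<lambda>z. (flux p (g z), - v z)) (\<lambda>z. 0)" using s unfolding weak_supersol_iff by blast
  have s': "sob_loc p U v' g" by (rule sob_loc_cong[OF p U g(1) eq])
  have "wineq U (\<lambda>z. (flux p (g z), - v' z)) (\<lambda>z. 0)"
    by (rule wineq_cong_AE[OF U g(2) _ locint_flux[OF g(1) p U] locint_0 locint_flux[OF s' p U] locint_0]) (simp add: eq)
  then show ?thesis using s' unfolding weak_supersol_iff by blast
qed

lemma weak_supersol_subset: "weak_supersol p B v \<Longrightarrow> A \<subseteq> B \<Longrightarrow> open A \<Longrightarrow> weak_supersol p A v"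
  unfolding weak_supersol_iff using sob_loc_subset wineq_mono by blast

lemma weak_sol_cong:
  assumes p: "p > 2" and U: "open U" and s: "weak_sol p U v" and eq: "\<And>z. z \<in> U \<Longrightarrow> v z = v' z"
  shows "weak_sol p U v'"
proof -
  obtain g where g: "sob_loc p U v g" "\<And>\<phi>. test_fun U \<phi> \<Longrightarrow> (LINT z|lborel. (flux p (g z), - v z) \<bullet> grad \<phi> z + 0 * \<phi> z) = 0"
    using s unfolding weak_sol_iff by blast
  have "(LINT z|lborel. (flux p (g z), - v' z) \<bullet> grad \<phi> z + 0 * \<phi> z) = 0" if t: "test_fun U \<phi>" for \<phi>
  proof -
    obtain K where K: "C1 \<phi> (grad \<phi>)" "compact K" "K \<subseteq> U" "\<And>z. z \<notin> K \<Longrightarrow> \<phi> z = 0" by (rule test_fun_C1[OF t]) (rule that)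
    have "(flux p (g z), - v z) \<bullet> grad \<phi> z = (flux p (g z), - v' z) \<bullet> grad \<phi> z" for z
      using eq[of z] K(3) C1_support[OF K(1) compact_imp_closed[OF K(2)] K(4), of z] by (cases "z \<in> K") auto
    then show ?thesis using g(2)[OF t] by simp
  qed
  then show ?thesis using sob_loc_cong[OF p U g(1) eq] unfolding weak_sol_iff by blast
qed

lemma weak_supersol_min:
  assumes "p > 2" "open U" "weak_supersol p U u1" "weak_supersol p U u2"
  shows "weak_supersol p U (\<lambda>z. min (u1 z) (u2 z))"
proof -
  obtain g1 g2 where g: "sob_loc p U u1 g1" "wineq U (\<lambda>z. (flux p (g1 z), - u1 z)) (\<lambda>z. 0)"
    "sob_loc p U u2 g2" "wineq U (\<lambda>z. (flux p (g2 z), - u2 z)) (\<lambda>z. 0)" using assms(3,4) unfolding weak_supersol_iff by blast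
  show ?thesis unfolding weak_supersol_iff using supersol_min[OF assms(1,2) g(1,3,2,4)] by blast
qed

theorem supersol_paste:
  fixes u1 u2 :: "'n::finite pt \<Rightarrow> real"
  assumes p: "p > 2" and U: "open U" and V: "open V" "V \<subseteq> U"
    and u: "weak_supersol p U u1" "weak_supersol p V u2" and c: "continuous_on U u1" "continuous_on V u2"
    and C: "closedin (top_of_set U) {z \<in> V. u2 z \<le> u1 z}"
  defines "m \<equiv> (\<lambda>z. if z \<in> V then min (u1 z) (u2 z) else u1 z)"
  shows "weak_supersol p U m" "continuous_on U m"
proof -
  let ?C = "{z \<in> V. u2 z \<le> u1 z}"
  obtain D where D: "closed D" "?C = U \<inter> D" using C by (auto simp: closedin_closed)
  define O' where "O' = U - D"
  have O': "open O'" "O' \<subseteq> U" using U D(1) by (auto simp: O'_def open_Diff)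
  have UVO: "U = V \<union> O'" using V(2) D(2) by (auto simp: O'_def)
  have mO: "m z = u1 z" if "z \<in> O'" for z
  proof -
    have "z \<notin> ?C" using that D(2) by (auto simp: O'_def)
    then show ?thesis by (auto simp: m_def)
  qed
  have mV: "m z = min (u1 z) (u2 z)" if "z \<in> V" for z using that by (simp add: m_def)
  have 1: "weak_supersol p V m"
    by (rule weak_supersol_cong[OF p V(1) weak_supersol_min[OF p V(1) weak_supersol_subset[OF u(1) V(2,1)] u(2)]]) (simp add: mV)
  have 2: "weak_supersol p O' m"
    by (rule weak_supersol_cong[OF p O'(1) weak_supersol_subset[OF u(1) O'(2,1)]]) (simp add: mO)
  show "weak_supersol p U m"
  proof (rule weak_supersol_local[OF p])
    fix z assume "z \<in> U"
    then have "z \<in> V \<or> z \<in> O'" using UVO by blast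
    then show "\<exists>N. open N \<and> z \<in> N \<and> N \<subseteq> U \<and> weak_supersol p N m" using 1 2 V O' by blast
  qed
  have "continuous_on V (\<lambda>z. min (u1 z) (u2 z))" using continuous_on_subset[OF c(1) V(2)] c(2) by (rule continuous_on_min)
  then have "continuous_on V m" by (rule continuous_on_eq) (simp add: mV)
  moreover have "continuous_on O' m" using continuous_on_subset[OF c(1) O'(2)] by (rule continuous_on_eq) (simp add: mO)
  ultimately show "continuous_on U m" unfolding UVO using V(1) O'(1) by (rule continuous_on_open_Un[rotated 2])
qed

lemma integral_affine:
  fixes f :: "'a::euclidean_space \<Rightarrow> real"
  assumes f: "integrable lborel f" and r: "r > 0"
  shows "integrable lborel (\<lambda>z. f (a + r *\<^sub>R z))" "(LINT z|lborel. f (a + r *\<^sub>R z)) = (LINT z|lborel. f z) / r ^ DIM('a)"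
proof -
  let ?T = "\<lambda>x::'a. a + r *\<^sub>R x"
  have m: "f \<in> borel_measurable borel" using f by auto
  have eq: "lborel = density (distr lborel borel ?T) (\<lambda>_. ennreal (r ^ DIM('a)))"
    using lborel_affine[of r a] r by simp
  have r0: "0 \<le> r ^ DIM('a)" "r ^ DIM('a) \<noteq> 0" using r by auto
  have "integrable (density (distr lborel borel ?T) (\<lambda>_. ennreal (r ^ DIM('a)))) f" using f eq by simp
  then have "integrable (distr lborel borel ?T) (\<lambda>x. r ^ DIM('a) *\<^sub>R f x)"
    by (subst (asm) integrable_density) (use m r0 in auto)
  then have "integrable (distr lborel borel ?T) f" using r0 by simp
  then show "integrable lborel (\<lambda>z. f (a + r *\<^sub>R z))" by (subst (asm) integrable_distr_eq) (use m in auto)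
  have "(LINT z|lborel. f z) = integral\<^sup>L (density (distr lborel borel ?T) (\<lambda>_. ennreal (r ^ DIM('a)))) f" using eq by simp
  also have "\<dots> = (LINT x|distr lborel borel ?T. r ^ DIM('a) *\<^sub>R f x)"
    by (rule integral_density) (use m r0 in auto)
  also have "\<dots> = r ^ DIM('a) * (LINT x|distr lborel borel ?T. f x)" by simp
  also have "(LINT x|distr lborel borel ?T. f x) = (LINT z|lborel. f (a + r *\<^sub>R z))" by (rule integral_distr) (use m in auto)
  finally show "(LINT z|lborel. f (a + r *\<^sub>R z)) = (LINT z|lborel. f z) / r ^ DIM('a)" using r0 by simp
qed

lemma flux_scale: "t > 0 \<Longrightarrow> flux p (t *\<^sub>R x) = t powr (p - 1) *\<^sub>R flux p x"
  using powr_add[of t "p - 2" 1] by (simp add: flux_def powr_mult)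

lemma test_fun_affine:
  fixes \<phi> :: "'a::euclidean_space \<Rightarrow> real"
  assumes t: "test_fun {z. a + r *\<^sub>R z \<in> U} \<phi>" and r: "r > 0"
  obtains \<Phi> where "test_fun U \<Phi>" "\<And>z. \<phi> z = \<Phi> (a + r *\<^sub>R z)" "\<And>z. grad \<phi> z = r *\<^sub>R grad \<Phi> (a + r *\<^sub>R z)"
proof -
  define \<Phi> where "\<Phi> y = \<phi> (- (a /\<^sub>R r) + inverse r *\<^sub>R y)" for y
  have sm: "smooth_fun \<Phi>" unfolding \<Phi>_def by (rule smooth_fun_affine) (use t in \<open>auto simp: test_fun_def\<close>)
  have eq: "\<phi> z = \<Phi> (a + r *\<^sub>R z)" for z using r by (simp add: \<Phi>_def scaleR_add_right)
  let ?S = "closure {z. \<phi> z \<noteq> 0}"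
  have S: "compact ?S" "?S \<subseteq> {z. a + r *\<^sub>R z \<in> U}" using t by (auto simp: test_fun_def)
  have cI: "compact ((\<lambda>z. a + r *\<^sub>R z) ` ?S)" by (rule compact_continuous_image[OF _ S(1)]) (intro continuous_intros)
  have "{y. \<Phi> y \<noteq> 0} \<subseteq> (\<lambda>z. a + r *\<^sub>R z) ` ?S"
  proof
    fix y assume "y \<in> {y. \<Phi> y \<noteq> 0}"
    then have "- (a /\<^sub>R r) + inverse r *\<^sub>R y \<in> ?S" using closure_subset[of "{z. \<phi> z \<noteq> 0}"] by (auto simp: \<Phi>_def)
    moreover have "y = a + r *\<^sub>R (- (a /\<^sub>R r) + inverse r *\<^sub>R y)" using r by (simp add: scaleR_diff_right)
    ultimately show "y \<in> (\<lambda>z. a + r *\<^sub>R z) ` ?S" by (rule rev_image_eqI)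
  qed
  then have "closure {y. \<Phi> y \<noteq> 0} \<subseteq> (\<lambda>z. a + r *\<^sub>R z) ` ?S" by (rule closure_minimal) (rule compact_imp_closed[OF cI])
  moreover from this have "compact (closure {y. \<Phi> y \<noteq> 0})" using cI by (meson bounded_subset closed_closure compact_eq_bounded_closed)
  ultimately have "test_fun U \<Phi>" using sm S(2) unfolding test_fun_def by blast
  moreover have "grad \<phi> z = r *\<^sub>R grad \<Phi> (a + r *\<^sub>R z)" for z
  proof -
    have "\<phi> = (\<lambda>z. \<Phi> (a + r *\<^sub>R z))" using eq by (rule ext)
    then show ?thesis by (simp only: grad_affine[OF sm])
  qed
  ultimately show ?thesis using that eq by blast
qed

lemma sob_loc_affine:
  fixes v :: "'n::finite pt \<Rightarrow> real"
  assumes p: "p > 2" and U: "open U" and r: "r > 0" and c: "c > 0" and s: "sob_loc p U v g"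
  shows "sob_loc p {z. a + r *\<^sub>R z \<in> U} (\<lambda>z. c * v (a + r *\<^sub>R z)) (\<lambda>z. (c * r) *\<^sub>R g (a + r *\<^sub>R z))"
proof (rule sob_locI[OF p])
  let ?T = "\<lambda>z. a + r *\<^sub>R z" and ?U = "{z. a + r *\<^sub>R z \<in> U}"
  have cT: "continuous_on UNIV ?T" by (intro continuous_intros)
  have "open (?T -` U)" by (rule open_vimage[OF U cT])
  then show "open ?U" by (simp add: vimage_def)
  have mT: "?T \<in> measurable borel borel" using cT by (rule borel_measurable_continuous_onI)
  have mm: "(\<lambda>z. indicator U (?T z) * v (?T z)) \<in> borel_measurable borel" "(\<lambda>z. indicator U (?T z) *\<^sub>R g (?T z)) \<in> borel_measurable borel"
    using measurable_compose[OF mT, of "\<lambda>y. indicator U y * v y" borel] measurable_compose[OF mT, of "\<lambda>y. indicator U y *\<^sub>R g y" borel] s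
    by (auto simp: sob_loc_def)
  have "(\<lambda>z. c * (indicator U (?T z) * v (?T z))) \<in> borel_measurable borel" "(\<lambda>z. (c * r) *\<^sub>R (indicator U (?T z) *\<^sub>R g (?T z))) \<in> borel_measurable borel"
    by (rule borel_measurable_times[OF borel_measurable_const mm(1)], rule borel_measurable_scaleR[OF borel_measurable_const mm(2)])
  moreover have "(\<lambda>z. c * (indicator U (?T z) * v (?T z))) = (\<lambda>z. indicator ?U z * (c * v (?T z)))"
     "(\<lambda>z. (c * r) *\<^sub>R (indicator U (?T z) *\<^sub>R g (?T z))) = (\<lambda>z. indicator ?U z *\<^sub>R ((c * r) *\<^sub>R g (?T z)))"
    by (auto simp: fun_eq_iff indicator_def)
  ultimately show "(\<lambda>z. indicator ?U z * (c * v (?T z))) \<in> borel_measurable lborel" "(\<lambda>z. indicator ?U z *\<^sub>R ((c * r) *\<^sub>R g (?T z))) \<in> borel_measurable lborel"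
    by simp_all
  {
    fix K assume K: "compact K" "K \<subseteq> ?U"
    let ?K = "?T ` K"
    have K': "compact ?K" "?K \<subseteq> U" using compact_continuous_image[OF continuous_on_subset[OF cT] K(1)] K(2) by auto
    have iK: "indicator ?K (?T z) = indicator K z" for z using r by (auto simp: indicator_def image_iff)
    have main: "set_integrable lborel K (\<lambda>z. d * f (?T z))" if "set_integrable lborel ?K f" for d and f :: "'n pt \<Rightarrow> real"
    proof -
      have "integrable lborel (\<lambda>z. d * (indicator ?K (?T z) *\<^sub>R f (?T z)))"
        using integral_affine(1)[OF that[unfolded set_integrable_def] r, of a] by (rule integrable_mult_right)
      then show ?thesis unfolding set_integrable_def iK by (simp add: mult.left_commute)
    qed
    have "\<bar>c * v (?T z)\<bar> powr p = c powr p * \<bar>v (?T z)\<bar> powr p" for z using c by (simp add: abs_mult powr_mult)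
    then show "set_integrable lborel K (\<lambda>z. \<bar>c * v (?T z)\<bar> powr p)"
      using main[of "\<lambda>y. \<bar>v y\<bar> powr p" "c powr p"] s K' by (simp add: sob_loc_def)
    have "norm ((c * r) *\<^sub>R g (?T z)) powr p = (c * r) powr p * norm (g (?T z)) powr p" for z using c r by (simp add: abs_mult powr_mult)
    then show "set_integrable lborel K (\<lambda>z. norm ((c * r) *\<^sub>R g (?T z)) powr p)"
      using main[of "\<lambda>y. norm (g y) powr p" "(c * r) powr p"] s K' by (simp add: sob_loc_def)
  }
  fix \<phi> :: "'n pt \<Rightarrow> real" and i :: 'n assume t: "test_fun ?U \<phi>"
  obtain \<Phi> where \<Phi>: "test_fun U \<Phi>" "\<And>z. \<phi> z = \<Phi> (?T z)" "\<And>z. grad \<phi> z = r *\<^sub>R grad \<Phi> (?T z)" by (rule test_fun_affine[OF t r]) (rule that)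
  obtain K where K: "C1 \<Phi> (grad \<Phi>)" "compact K" "K \<subseteq> U" "\<And>z. z \<notin> K \<Longrightarrow> \<Phi> z = 0" by (rule test_fun_C1[OF \<Phi>(1)]) (rule that)
  note L = sob_locD[OF s p U]
  have int: "integrable lborel (\<lambda>y. (v y *\<^sub>R ex i) \<bullet> grad \<Phi> y + g y $ i * \<Phi> y)"
    by (rule integrable_test[OF locint_scaleR_right[OF L(1)] locint_component[OF L(2)] K(1-3)]) (rule K(4))
  have "(\<lambda>z. ((c * v (?T z)) *\<^sub>R ex i) \<bullet> grad \<phi> z + ((c * r) *\<^sub>R g (?T z)) $ i * \<phi> z)
      = (\<lambda>z. (c * r) * ((v (?T z) *\<^sub>R ex i) \<bullet> grad \<Phi> (?T z) + g (?T z) $ i * \<Phi> (?T z)))"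
    unfolding \<Phi>(3) inner_scaleR_left inner_scaleR_right by (simp add: \<Phi>(2) fun_eq_iff algebra_simps)
  then show "(LINT z|lborel. ((c * v (?T z)) *\<^sub>R ex i) \<bullet> grad \<phi> z + ((c * r) *\<^sub>R g (?T z)) $ i * \<phi> z) = 0"
    using integral_affine(2)[OF int r, of a] L(7)[OF \<Phi>(1), of i] by simp
qed

lemma plap_affine:
  fixes v :: "'n::finite pt \<Rightarrow> real"
  assumes p: "p > 2" and U: "open U" and r: "r > 0" and c: "c > 0" and cr: "c powr (p - 2) * r powr (p - 1) = 1"
    and s: "sob_loc p U v g" and t: "test_fun {z. a + r *\<^sub>R z \<in> U} \<phi>"
  obtains \<Phi> where "test_fun U \<Phi>" "\<And>z. \<phi> z = \<Phi> (a + r *\<^sub>R z)"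
    "(LINT z|lborel. (flux p ((c * r) *\<^sub>R g (a + r *\<^sub>R z)), - (c * v (a + r *\<^sub>R z))) \<bullet> grad \<phi> z + 0 * \<phi> z)
      = (c * r) * ((LINT y|lborel. (flux p (g y), - v y) \<bullet> grad \<Phi> y + 0 * \<Phi> y) / r ^ DIM('n pt))"
proof -
  let ?T = "\<lambda>z. a + r *\<^sub>R z"
  obtain \<Phi> where \<Phi>: "test_fun U \<Phi>" "\<And>z. \<phi> z = \<Phi> (?T z)" "\<And>z. grad \<phi> z = r *\<^sub>R grad \<Phi> (?T z)" by (rule test_fun_affine[OF t r]) (rule that)
  obtain K where K: "C1 \<Phi> (grad \<Phi>)" "compact K" "K \<subseteq> U" "\<And>z. z \<notin> K \<Longrightarrow> \<Phi> z = 0" by (rule test_fun_C1[OF \<Phi>(1)]) (rule that)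
  have int: "integrable lborel (\<lambda>y. (flux p (g y), - v y) \<bullet> grad \<Phi> y + 0 * \<Phi> y)"
    by (rule integrable_test[OF locint_flux[OF s p U] locint_0 K(1-3)]) (rule K(4))
  have "(c * r) powr (p - 1) = c * (c powr (p - 2) * r powr (p - 1))"
    using c r powr_add[of c "p - 2" 1] by (simp add: powr_mult)
  then have cc: "(c * r) powr (p - 1) = c" using cr by simp
  have fl: "flux p ((c * r) *\<^sub>R x) = c *\<^sub>R flux p x" for x :: "real^'n" using flux_scale[of "c * r" p x] c r cc by simp
  have "(\<lambda>z. (flux p ((c * r) *\<^sub>R g (?T z)), - (c * v (?T z))) \<bullet> grad \<phi> z + 0 * \<phi> z)
      = (\<lambda>z. (c * r) * ((flux p (g (?T z)), - v (?T z)) \<bullet> grad \<Phi> (?T z) + 0 * \<Phi> (?T z)))"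
    unfolding \<Phi>(3) fl by (simp add: inner_prod_def fun_eq_iff algebra_simps)
  then show ?thesis using integral_affine(2)[OF int r, of a] by (intro that[OF \<Phi>(1,2)]) simp
qed

lemma weak_supersol_affine:
  fixes v :: "'n::finite pt \<Rightarrow> real"
  assumes p: "p > 2" and U: "open U" and r: "r > 0" and c: "c > 0" and cr: "c powr (p - 2) * r powr (p - 1) = 1"
    and s: "weak_supersol p U v"
  shows "weak_supersol p {z. a + r *\<^sub>R z \<in> U} (\<lambda>z. c * v (a + r *\<^sub>R z))"
proof -
  obtain g where g: "sob_loc p U v g" "wineq U (\<lambda>z. (flux p (g z), - v z)) (\<lambda>z. 0)" using s unfolding weak_supersol_iff by blast
  let ?g = "\<lambda>z. (c * r) *\<^sub>R g (a + r *\<^sub>R z)"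
  have "wineq {z. a + r *\<^sub>R z \<in> U} (\<lambda>z. (flux p (?g z), - (c * v (a + r *\<^sub>R z)))) (\<lambda>z. 0)"
    unfolding wineq_def
  proof (intro allI impI)
    fix \<phi> assume t: "test_fun {z. a + r *\<^sub>R z \<in> U} \<phi> \<and> (\<forall>z. 0 \<le> \<phi> z)"
    obtain \<Phi> where \<Phi>: "test_fun U \<Phi>" "\<And>z. \<phi> z = \<Phi> (a + r *\<^sub>R z)"
      "(LINT z|lborel. (flux p (?g z), - (c * v (a + r *\<^sub>R z))) \<bullet> grad \<phi> z + 0 * \<phi> z)
        = (c * r) * ((LINT y|lborel. (flux p (g y), - v y) \<bullet> grad \<Phi> y + 0 * \<Phi> y) / r ^ DIM('n pt))"
      by (rule plap_affine[OF p U r c cr g(1) conjunct1[OF t]]) (rule that)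
    have "0 \<le> \<Phi> y" for y
    proof -
      have "y = a + r *\<^sub>R (inverse r *\<^sub>R (y - a))" using r by simp
      then show ?thesis using t \<Phi>(2) by metis
    qed
    then have "0 \<le> (LINT y|lborel. (flux p (g y), - v y) \<bullet> grad \<Phi> y + 0 * \<Phi> y)" using g(2) \<Phi>(1) unfolding wineq_def by blast
    then show "0 \<le> (LINT z|lborel. (flux p (?g z), - (c * v (a + r *\<^sub>R z))) \<bullet> grad \<phi> z + 0 * \<phi> z)"
      unfolding \<Phi>(3) using c r by (intro mult_nonneg_nonneg divide_nonneg_nonneg) auto
  qed
  then show ?thesis unfolding weak_supersol_iff using sob_loc_affine[OF p U r c g(1)] by blast
qed

lemma weak_sol_affine:
  fixes v :: "'n::finite pt \<Rightarrow> real"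
  assumes p: "p > 2" and U: "open U" and r: "r > 0" and c: "c > 0" and cr: "c powr (p - 2) * r powr (p - 1) = 1"
    and s: "weak_sol p U v"
  shows "weak_sol p {z. a + r *\<^sub>R z \<in> U} (\<lambda>z. c * v (a + r *\<^sub>R z))"
proof -
  obtain g where g: "sob_loc p U v g" "\<And>\<phi>. test_fun U \<phi> \<Longrightarrow> (LINT z|lborel. (flux p (g z), - v z) \<bullet> grad \<phi> z + 0 * \<phi> z) = 0"
    using s unfolding weak_sol_iff by blast
  let ?g = "\<lambda>z. (c * r) *\<^sub>R g (a + r *\<^sub>R z)"
  have "(LINT z|lborel. (flux p (?g z), - (c * v (a + r *\<^sub>R z))) \<bullet> grad \<phi> z + 0 * \<phi> z) = 0" if t: "test_fun {z. a + r *\<^sub>R z \<in> U} \<phi>" for \<phi>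
  proof -
    obtain \<Phi> where \<Phi>: "test_fun U \<Phi>" "\<And>z. \<phi> z = \<Phi> (a + r *\<^sub>R z)"
      "(LINT z|lborel. (flux p (?g z), - (c * v (a + r *\<^sub>R z))) \<bullet> grad \<phi> z + 0 * \<phi> z)
        = (c * r) * ((LINT y|lborel. (flux p (g y), - v y) \<bullet> grad \<Phi> y + 0 * \<Phi> y) / r ^ DIM('n pt))"
      by (rule plap_affine[OF p U r c cr g(1) t]) (rule that)
    show ?thesis unfolding \<Phi>(3) g(2)[OF \<Phi>(1)] by simp
  qed
  then show ?thesis unfolding weak_sol_iff using sob_loc_affine[OF p U r c g(1)] by blast
qed

lemma sob_loc_add_C1:
  fixes u :: "'n::finite pt \<Rightarrow> real"
  assumes p: "p > 2" and U: "open U" and s: "sob_loc p U u g" and f: "C1 f df"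
  shows "sob_loc p U (\<lambda>z. u z + f z) (\<lambda>z. g z + fst (df z))"
proof -
  have cdf: "continuous_on UNIV df" using f by (simp add: C1_def)
  note cf = C1_continuous[OF f, of UNIV]
  have cfd: "continuous_on UNIV (\<lambda>z. fst (df z))" using cdf by (intro continuous_intros)
  have mU: "U \<in> sets borel" using U by simp
  have mi: "(indicator U :: 'n pt \<Rightarrow> real) \<in> borel_measurable lborel" using mU by simp
  have mf: "f \<in> borel_measurable lborel" "(\<lambda>z. fst (df z)) \<in> borel_measurable lborel"
    using borel_measurable_continuous_onI[OF cf] borel_measurable_continuous_onI[OF cfd] by auto
  have ms: "(\<lambda>z. indicator U z * u z) \<in> borel_measurable lborel" "(\<lambda>z. indicator U z *\<^sub>R g z) \<in> borel_measurable lborel"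
    using s by (auto simp: sob_loc_def)
  have m1: "(\<lambda>z. indicator U z * (u z + f z)) \<in> borel_measurable lborel"
    unfolding distrib_left by (rule borel_measurable_add[OF ms(1) borel_measurable_times[OF mi mf(1)]])
  have m2: "(\<lambda>z. indicator U z *\<^sub>R (g z + fst (df z))) \<in> borel_measurable lborel"
    unfolding scaleR_add_right by (rule borel_measurable_add[OF ms(2) borel_measurable_scaleR[OF mi mf(2)]])
  have bd: "set_integrable lborel K (\<lambda>z. norm (a z + b z) powr p)"
    if K: "compact K" "K \<subseteq> U" and a: "set_integrable lborel K (\<lambda>z. norm (a z) powr p)" and b: "continuous_on UNIV b"
      and m: "(\<lambda>z. indicator U z *\<^sub>R (a z + b z)) \<in> borel_measurable lborel" for K and a b :: "'n pt \<Rightarrow> real^'n"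
    unfolding set_integrable_def
  proof (rule Bochner_Integration.integrable_bound)
    have mK: "(indicator K :: 'n pt \<Rightarrow> real) \<in> borel_measurable lborel" using K(1) by (simp add: compact_imp_closed)
    have "continuous_on K (\<lambda>z. norm (b z) powr p)"
      using continuous_on_subset[OF b, of K] p by (intro continuous_on_powr' continuous_intros) auto
    then have "integrable lborel (\<lambda>z. indicator K z *\<^sub>R (norm (b z) powr p))" by (rule borel_integrable_compact[OF K(1)])
    then show "integrable lborel (\<lambda>z. 2 powr p * (indicator K z *\<^sub>R norm (a z) powr p + indicator K z *\<^sub>R (norm (b z) powr p)))"
      using a unfolding set_integrable_def by (intro integrable_mult_right Bochner_Integration.integrable_add)
    have "(\<lambda>z. indicator K z *\<^sub>R (norm (indicator U z *\<^sub>R (a z + b z)) powr p)) \<in> borel_measurable lborel"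
      by (rule borel_measurable_scaleR[OF mK measurable_compose[OF m]]) measurable
    moreover have "(\<lambda>z. indicator K z *\<^sub>R (norm (indicator U z *\<^sub>R (a z + b z)) powr p)) = (\<lambda>z. indicator K z *\<^sub>R norm (a z + b z) powr p)"
      using K(2) by (auto simp: fun_eq_iff indicator_def)
    ultimately show "(\<lambda>z. indicator K z *\<^sub>R norm (a z + b z) powr p) \<in> borel_measurable lborel" by simp
    show "AE z in lborel. norm (indicator K z *\<^sub>R norm (a z + b z) powr p)
        \<le> norm (2 powr p * (indicator K z *\<^sub>R norm (a z) powr p + indicator K z *\<^sub>R (norm (b z) powr p)))"
    proof (intro AE_I2)
      fix z
      have "norm (a z + b z) powr p \<le> (norm (a z) + norm (b z)) powr p" using p by (intro powr_mono2 norm_triangle_ineq) auto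
      also have "\<dots> \<le> 2 powr p * (norm (a z) powr p + norm (b z) powr p)" by (rule powr_add_le) (use p in auto)
      finally show "norm (indicator K z *\<^sub>R norm (a z + b z) powr p)
        \<le> norm (2 powr p * (indicator K z *\<^sub>R norm (a z) powr p + indicator K z *\<^sub>R (norm (b z) powr p)))"
        by (cases "z \<in> K") (auto simp: abs_mult intro: order_trans[OF _ abs_ge_self])
    qed
  qed
  show ?thesis
  proof (rule sob_locI[OF p U m1 m2])
    fix K assume K: "compact K" "K \<subseteq> U"
    show "set_integrable lborel K (\<lambda>z. norm (g z + fst (df z)) powr p)"
      by (rule bd[OF K _ cfd m2]) (use s K in \<open>auto simp: sob_loc_def\<close>)
    have "set_integrable lborel K (\<lambda>z. norm (u z + f z) powr p)"
    proof -
      have ci: "continuous_on K (\<lambda>z. \<bar>f z\<bar> powr p)"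
        using continuous_on_subset[OF cf, of K] p by (intro continuous_on_powr' continuous_intros) auto
      show ?thesis unfolding set_integrable_def
      proof (rule Bochner_Integration.integrable_bound)
        have mK: "(indicator K :: 'n pt \<Rightarrow> real) \<in> borel_measurable lborel" using K(1) by (simp add: compact_imp_closed)
        have "integrable lborel (\<lambda>z. indicator K z *\<^sub>R (\<bar>f z\<bar> powr p))" by (rule borel_integrable_compact[OF K(1) ci])
        moreover have "integrable lborel (\<lambda>z. indicator K z *\<^sub>R \<bar>u z\<bar> powr p)" using s K unfolding sob_loc_def set_integrable_def by blast
        ultimately show "integrable lborel (\<lambda>z. 2 powr p * (indicator K z *\<^sub>R \<bar>u z\<bar> powr p + indicator K z *\<^sub>R (\<bar>f z\<bar> powr p)))"
          by (intro integrable_mult_right Bochner_Integration.integrable_add)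
        have "(\<lambda>z. indicator K z *\<^sub>R (norm (indicator U z * (u z + f z)) powr p)) \<in> borel_measurable lborel"
          by (rule borel_measurable_scaleR[OF mK measurable_compose[OF m1]]) measurable
        moreover have "(\<lambda>z. indicator K z *\<^sub>R (norm (indicator U z * (u z + f z)) powr p)) = (\<lambda>z. indicator K z *\<^sub>R norm (u z + f z) powr p)"
          using K(2) by (auto simp: fun_eq_iff indicator_def)
        ultimately show "(\<lambda>z. indicator K z *\<^sub>R norm (u z + f z) powr p) \<in> borel_measurable lborel" by simp
        show "AE z in lborel. norm (indicator K z *\<^sub>R norm (u z + f z) powr p)
            \<le> norm (2 powr p * (indicator K z *\<^sub>R \<bar>u z\<bar> powr p + indicator K z *\<^sub>R (\<bar>f z\<bar> powr p)))"
        proof (intro AE_I2)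
          fix z
          have "norm (u z + f z) powr p \<le> (\<bar>u z\<bar> + \<bar>f z\<bar>) powr p" using p by (intro powr_mono2) auto
          also have "\<dots> \<le> 2 powr p * (\<bar>u z\<bar> powr p + \<bar>f z\<bar> powr p)" by (rule powr_add_le) (use p in auto)
          finally show "norm (indicator K z *\<^sub>R norm (u z + f z) powr p)
            \<le> norm (2 powr p * (indicator K z *\<^sub>R \<bar>u z\<bar> powr p + indicator K z *\<^sub>R (\<bar>f z\<bar> powr p)))"
            by (cases "z \<in> K") (auto simp: abs_mult intro: order_trans[OF _ abs_ge_self])
        qed
      qed
    qed
    then show "set_integrable lborel K (\<lambda>z. \<bar>u z + f z\<bar> powr p)" by simp
  next
    fix \<phi> :: "'n pt \<Rightarrow> real" and i :: 'n assume t: "test_fun U \<phi>"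
    obtain K where K: "C1 \<phi> (grad \<phi>)" "compact K" "K \<subseteq> U" "\<And>z. z \<notin> K \<Longrightarrow> \<phi> z = 0" by (rule test_fun_C1[OF t]) (rule that)
    note L = sob_locD[OF s p U]
    have cg: "continuous_on UNIV (grad \<phi>)" "continuous_on UNIV \<phi>" using K(1) C1_continuous[OF K(1)] by (auto simp: C1_def)
    have g0: "grad \<phi> z = 0" if "z \<notin> K" for z using C1_support[OF K(1) compact_imp_closed[OF K(2)] K(4) that] .
    have i0: "integrable lborel (\<lambda>z. (u z *\<^sub>R ex i) \<bullet> grad \<phi> z + g z $ i * \<phi> z)"
      by (rule integrable_test[OF locint_scaleR_right[OF L(1)] locint_component[OF L(2)] K(1-3)]) (rule K(4))
    have i1: "integrable lborel (\<lambda>z. f z * (grad \<phi> z \<bullet> ex i))"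
      by (rule integrable_continuous_compact_support[OF _ K(2)]) (use cf cg g0 in \<open>auto intro!: continuous_intros\<close>)
    have i2: "integrable lborel (\<lambda>z. \<phi> z * (df z \<bullet> ex i))"
      by (rule integrable_continuous_compact_support[OF _ K(2)]) (use cdf cg K(4) in \<open>auto intro!: continuous_intros\<close>)
    have ibp: "(LINT z|lborel. f z * (grad \<phi> z \<bullet> ex i)) = - (LINT z|lborel. \<phi> z * (df z \<bullet> ex i))"
      by (rule integral_by_parts[OF K(1,2) _ f]) (rule K(4))
    have "(\<lambda>z. ((u z + f z) *\<^sub>R ex i) \<bullet> grad \<phi> z + (g z + fst (df z)) $ i * \<phi> z)
       = (\<lambda>z. ((u z *\<^sub>R ex i) \<bullet> grad \<phi> z + g z $ i * \<phi> z) + (f z * (grad \<phi> z \<bullet> ex i) + \<phi> z * (df z \<bullet> ex i)))"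
    proof (rule ext)
      fix z
      have "df z \<bullet> ex i = fst (df z) $ i" by (simp add: inner_prod_def inner_axis)
      then show "((u z + f z) *\<^sub>R ex i) \<bullet> grad \<phi> z + (g z + fst (df z)) $ i * \<phi> z
       = ((u z *\<^sub>R ex i) \<bullet> grad \<phi> z + g z $ i * \<phi> z) + (f z * (grad \<phi> z \<bullet> ex i) + \<phi> z * (df z \<bullet> ex i))"
        unfolding inner_scaleR_swap by (simp only: vector_add_component) (simp add: algebra_simps)
    qed
    then show "(LINT z|lborel. ((u z + f z) *\<^sub>R ex i) \<bullet> grad \<phi> z + (g z + fst (df z)) $ i * \<phi> z) = 0"
      using i0 i1 i2 ibp L(7)[OF t, of i] by simp
  qed
qed

lemma sob_loc_zero: assumes "p > 2" "open U" shows "sob_loc p U (\<lambda>z. 0) (\<lambda>z. 0)"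
  unfolding sob_loc_def using assms by (auto simp: set_integrable_def)

lemma sob_loc_C1: "p > 2 \<Longrightarrow> open U \<Longrightarrow> C1 f df \<Longrightarrow> sob_loc p U f (\<lambda>z. fst (df z))"
  using sob_loc_add_C1[OF _ _ sob_loc_zero, of p U f df] by simp

lemma weak_sol_const: assumes p: "p > 2" and U: "open U" shows "weak_sol p U (\<lambda>z. c)"
  unfolding weak_sol_iff
proof (intro exI conjI allI impI)
  show "sob_loc p U (\<lambda>z. c) (\<lambda>z. 0)" using sob_loc_C1[OF p U C1_const, of c] by simp
  fix \<phi> assume t: "test_fun U \<phi>"
  obtain K where K: "C1 \<phi> (grad \<phi>)" "compact K" "K \<subseteq> U" "\<And>z. z \<notin> K \<Longrightarrow> \<phi> z = 0" by (rule test_fun_C1[OF t]) (rule that)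
  have "(LINT z|lborel. grad \<phi> z \<bullet> (flux p 0, - c)) = 0" by (rule integral_GDERIV_eq_0[OF K(1,2)]) (rule K(4))
  then show "(LINT z|lborel. (flux p 0, - c) \<bullet> grad \<phi> z + 0 * \<phi> z) = 0" by (simp add: inner_commute)
qed

lemma weak_sol_uminus: assumes "weak_sol p U v" shows "weak_sol p U (\<lambda>z. - v z)"
proof -
  obtain g where g: "sob_loc p U v g" "\<And>\<phi>. test_fun U \<phi> \<Longrightarrow> (LINT z|lborel. (flux p (g z), - v z) \<bullet> grad \<phi> z + 0 * \<phi> z) = 0"
    using assms unfolding weak_sol_iff by blast
  have "sob_loc p U (\<lambda>z. - v z) (\<lambda>z. - g z)" using g(1) unfolding sob_loc_def by auto
  moreover have "(LINT z|lborel. (flux p (- g z), - (- v z)) \<bullet> grad \<phi> z + 0 * \<phi> z) = - (LINT z|lborel. (flux p (g z), - v z) \<bullet> grad \<phi> z + 0 * \<phi> z)" for \<phi>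
    by (subst integral_minus[symmetric]) (simp add: flux_def inner_prod_def)
  ultimately show ?thesis unfolding weak_sol_iff using g(2) by (intro exI[of _ "\<lambda>z. - g z"]) simp
qed

lemma supersol_add_time:
  fixes u :: "'n::finite pt \<Rightarrow> real"
  assumes p: "p > 2" and U: "open U" and u: "weak_supersol p U u"
    and h: "\<And>s. (h has_real_derivative h' s) (at s)" "continuous_on UNIV h'" "\<And>s. 0 \<le> h' s"
  shows "weak_supersol p U (\<lambda>z. u z + h (snd z))"
proof -
  obtain g where g: "sob_loc p U u g" "wineq U (\<lambda>z. (flux p (g z), - u z)) (\<lambda>z. 0)" using u unfolding weak_supersol_iff by blast
  have C: "C1 (\<lambda>z::'n pt. h (snd z)) (\<lambda>z. h' (snd z) *\<^sub>R (0, 1))" by (rule C1_comp[OF C1_snd h(1,2)])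
  have s: "sob_loc p U (\<lambda>z. u z + h (snd z)) g" using sob_loc_add_C1[OF p U g(1) C] by simp
  have "wineq U (\<lambda>z. (flux p (g z), - (u z + h (snd z)))) (\<lambda>z. 0)"
    unfolding wineq_def
  proof (intro allI impI)
    fix \<phi> assume t: "test_fun U \<phi> \<and> (\<forall>z. 0 \<le> \<phi> z)"
    obtain K where K: "C1 \<phi> (grad \<phi>)" "compact K" "K \<subseteq> U" "\<And>z. z \<notin> K \<Longrightarrow> \<phi> z = 0" by (rule test_fun_C1[OF conjunct1[OF t]]) (rule that)
    have cg: "continuous_on UNIV (grad \<phi>)" "continuous_on UNIV \<phi>" "continuous_on UNIV (\<lambda>z::'n pt. h (snd z))"
      using K(1) C1_continuous[OF K(1)] C1_continuous[OF C] by (auto simp: C1_def)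
    have g0: "grad \<phi> z = 0" if "z \<notin> K" for z using C1_support[OF K(1) compact_imp_closed[OF K(2)] K(4) that] .
    have i0: "integrable lborel (\<lambda>z. (flux p (g z), - u z) \<bullet> grad \<phi> z + 0 * \<phi> z)"
      by (rule integrable_test[OF locint_flux[OF g(1) p U] locint_0 K(1-3)]) (rule K(4))
    have i1: "integrable lborel (\<lambda>z. h (snd z) * (grad \<phi> z \<bullet> (0, 1)))"
      by (rule integrable_continuous_compact_support[OF _ K(2)]) (use cg g0 in \<open>auto intro!: continuous_intros\<close>)
    have ibp: "(LINT z|lborel. h (snd z) * (grad \<phi> z \<bullet> (0, 1))) = - (LINT z|lborel. \<phi> z * ((h' (snd z) *\<^sub>R (0, 1)) \<bullet> (0::real^'n, 1::real)))"
      by (rule integral_by_parts[OF K(1,2) _ C]) (rule K(4))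
    have "0 \<le> (LINT z|lborel. \<phi> z * ((h' (snd z) *\<^sub>R (0, 1)) \<bullet> (0::real^'n, 1::real)))"
      by (rule Bochner_Integration.integral_nonneg) (use t h(3) in auto)
    moreover have "0 \<le> (LINT z|lborel. (flux p (g z), - u z) \<bullet> grad \<phi> z + 0 * \<phi> z)" using g(2) t unfolding wineq_def by blast
    moreover have "(\<lambda>z. (flux p (g z), - (u z + h (snd z))) \<bullet> grad \<phi> z + 0 * \<phi> z)
        = (\<lambda>z. ((flux p (g z), - u z) \<bullet> grad \<phi> z + 0 * \<phi> z) - h (snd z) * (grad \<phi> z \<bullet> (0, 1)))"
      by (simp add: fun_eq_iff inner_prod_def algebra_simps)
    ultimately show "0 \<le> (LINT z|lborel. (flux p (g z), - (u z + h (snd z))) \<bullet> grad \<phi> z + 0 * \<phi> z)"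
      using i0 i1 ibp by (simp add: Bochner_Integration.integral_diff)
  qed
  then show ?thesis unfolding weak_supersol_iff using s by blast
qed

lemma supersol_add_const: "p > 2 \<Longrightarrow> open U \<Longrightarrow> weak_supersol p U u \<Longrightarrow> weak_supersol p U (\<lambda>z. u z + c)"
  by (rule supersol_add_time[where h="\<lambda>s. c" and h'="\<lambda>s. 0"]) auto

section \<open>Barriers\<close>

lemma GDERIV_norm_powr:
  fixes y :: "'a::real_inner" assumes q: "q > 1"
  shows "GDERIV (\<lambda>y. norm y powr q) y :> (q * norm y powr (q - 2)) *\<^sub>R y"
proof (cases "y = 0")
  case False
  have "GDERIV (\<lambda>y. norm y powr q) y :> (q * norm y powr (q - 1)) *\<^sub>R sgn y"
    by (rule GDERIV_DERIV_compose[OF GDERIV_norm[OF False]]) (use False in \<open>auto intro!: derivative_eq_intros\<close>)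
  moreover have "(q * norm y powr (q - 1)) *\<^sub>R sgn y = (q * norm y powr (q - 2)) *\<^sub>R y"
  proof -
    have "norm y powr (q - 1) = norm y powr (q - 2) * norm y" using False powr_add[of "norm y" "q - 2" 1] by simp
    then show ?thesis using False by (simp add: sgn_div_norm)
  qed
  ultimately show ?thesis by simp
next
  case True
  have "((\<lambda>y::'a. norm y powr q) has_derivative (\<lambda>h. 0)) (at 0)"
    unfolding has_derivative_at_alt
  proof (intro conjI allI impI)
    fix e :: real assume e: "e > 0"
    define d where "d = e powr (1 / (q - 1))"
    have d: "d > 0" using e by (simp add: d_def)
    have "norm x powr q \<le> e * norm x" if "norm x < d" for x :: 'a
    proof -
      have "norm x powr (q - 1) \<le> d powr (q - 1)" using that q by (intro powr_mono2) auto
      also have "\<dots> = e" using e q by (simp add: d_def powr_powr)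
      finally have "norm x powr (q - 1) * norm x \<le> e * norm x" by (rule mult_right_mono) simp
      moreover have "norm x powr (q - 1) * norm x = norm x powr q" using powr_add[of "norm x" "q - 1" 1] by (cases "x = 0") auto
      ultimately show ?thesis by simp
    qed
    then show "\<exists>d>0. \<forall>y::'a. norm (y - 0) < d \<longrightarrow> norm (norm y powr q - norm (0::'a) powr q - 0) \<le> e * norm (y - 0)"
      using d by (intro exI[of _ d]) auto
  qed simp
  then show ?thesis using True by (simp add: gderiv_def)
qed

lemma continuous_norm_powr_scaleR:
  assumes q: "q > 1" shows "continuous_on UNIV (\<lambda>y::'a::real_inner. norm y powr (q - 2) *\<^sub>R y)"
proof (rule continuous_at_imp_continuous_on, rule ballI)
  fix y :: 'a
  show "isCont (\<lambda>y. norm y powr (q - 2) *\<^sub>R y) y"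
  proof (cases "y = 0")
    case False
    then show ?thesis by (intro continuous_intros) auto
  next
    case True
    have eq: "norm (norm x powr (q - 2) *\<^sub>R x) = norm x powr (q - 1)" for x :: 'a
      using powr_add[of "norm x" "q - 2" 1] by (cases "x = 0") auto
    have "((\<lambda>x::'a. norm x powr (q - 1)) \<longlongrightarrow> 0 powr (q - 1)) (at 0)"
      by (rule tendsto_powr') (use q in \<open>auto intro!: tendsto_eq_intros\<close>)
    then have "((\<lambda>x::'a. norm (norm x powr (q - 2) *\<^sub>R x)) \<longlongrightarrow> 0) (at 0)" unfolding eq by simp
    then have "((\<lambda>x::'a. norm x powr (q - 2) *\<^sub>R x) \<longlongrightarrow> 0) (at 0)" by (rule tendsto_norm_zero_cancel)
    then show ?thesis using True by (simp add: isCont_def)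
  qed
qed

lemma C1_norm_powr:
  fixes x0 :: "real^'n::finite" assumes q: "q > 1"
  shows "C1 (\<lambda>z::'n pt. norm (fst z - x0) powr q) (\<lambda>z. ((q * norm (fst z - x0) powr (q - 2)) *\<^sub>R (fst z - x0), 0))"
  unfolding C1_def
proof (intro conjI allI)
  fix z :: "'n pt"
  let ?G = "(q * norm (fst z - x0) powr (q - 2)) *\<^sub>R (fst z - x0)"
  have "((\<lambda>y. norm y powr q) has_derivative (\<lambda>h. h \<bullet> ?G)) (at (fst z - x0))" using GDERIV_norm_powr[OF q, of "fst z - x0"] by (simp add: gderiv_def)
  then have "((\<lambda>z. norm (fst z - x0) powr q) has_derivative (\<lambda>h. fst h \<bullet> ?G)) (at z)"
    by (rule has_derivative_compose[where f="\<lambda>z. fst z - x0" and g="\<lambda>y. norm y powr q", rotated]) (auto intro!: derivative_eq_intros)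
  then show "GDERIV (\<lambda>z. norm (fst z - x0) powr q) z :> (?G, 0)" by (simp add: gderiv_def inner_prod_def)
next
  have "continuous_on UNIV (\<lambda>z::'n pt. norm (fst z - x0) powr (q - 2) *\<^sub>R (fst z - x0))"
    by (rule continuous_on_compose2[OF continuous_norm_powr_scaleR[OF q]]) (auto intro!: continuous_intros)
  then have "continuous_on UNIV (\<lambda>z::'n pt. (q *\<^sub>R (norm (fst z - x0) powr (q - 2) *\<^sub>R (fst z - x0)), 0::real))"
    by (rule continuous_on_Pair[OF continuous_on_scaleR[OF continuous_on_const] continuous_on_const])
  then show "continuous_on UNIV (\<lambda>z::'n pt. ((q * norm (fst z - x0) powr (q - 2)) *\<^sub>R (fst z - x0), 0::real))" by simp
qed

lemma C1_fst_component: "C1 (\<lambda>z::'n::finite pt. fst z $ i - c) (\<lambda>z. ex i)"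
proof -
  have eq: "(\<lambda>z::'n pt. fst z $ i - c) = (\<lambda>z. z \<bullet> ex i - c)" by (simp add: fun_eq_iff inner_prod_def inner_axis)
  show ?thesis unfolding C1_def gderiv_def eq by (auto intro!: derivative_eq_intros continuous_intros)
qed

text \<open>With \<open>q = p / (p - 1)\<close> the flux of \<open>|x|\<^sup>q\<close> is a multiple of \<open>x\<close>, so its divergence is a positive
  constant that can absorb the time derivative even where the gradient vanishes.\<close>
lemma barrier_supersol:
  fixes x0 :: "real^'n::finite"
  assumes p: "p > 2" and U: "open U" and UT: "\<And>z. z \<in> U \<Longrightarrow> snd z \<le> T" and t0: "0 \<le> t0"
    and M: "M > 0" and N: "N \<ge> 0" and MN: "2 * N * T \<le> (M * (p / (p - 1))) powr (p - 1)"
  shows "weak_supersol p U (\<lambda>z. - (b + M * norm (fst z - x0) powr (p / (p - 1)) + N * (snd z - t0)\<^sup>2))"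
proof -
  define q where "q = p / (p - 1)"
  have q: "q > 1" using p by (simp add: q_def field_simps)
  have qp: "(q - 1) * (p - 1) = 1" using p by (simp add: q_def field_simps)
  define \<kappa> where "\<kappa> = (M * q) powr (p - 1)"
  have Ct: "C1 (\<lambda>z::'n pt. (snd z - t0)\<^sup>2) (\<lambda>z. (2 * (snd z - t0)) *\<^sub>R (0, 1))"
    by (rule C1_comp[OF C1_snd, of "\<lambda>s. (s - t0)\<^sup>2" "\<lambda>s. 2 * (s - t0)"]) (auto intro!: derivative_eq_intros continuous_intros)
  define s where "s z = b + M * norm (fst z - x0) powr q + N * (snd z - t0)\<^sup>2" for z :: "'n pt"
  define ds where "ds z = ((M * q * norm (fst z - x0) powr (q - 2)) *\<^sub>R (fst z - x0), 2 * N * (snd z - t0))" for z :: "'n pt"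
  have "C1 (\<lambda>z::'n pt. (b + M * norm (fst z - x0) powr q) + N * (snd z - t0)\<^sup>2)
     (\<lambda>z. (0 + (M *\<^sub>R ((q * norm (fst z - x0) powr (q - 2)) *\<^sub>R (fst z - x0), 0) + norm (fst z - x0) powr q *\<^sub>R 0)) + (N *\<^sub>R ((2 * (snd z - t0)) *\<^sub>R (0, 1)) + (snd z - t0)\<^sup>2 *\<^sub>R 0))"
    by (intro C1_add C1_mult C1_const C1_norm_powr[OF q] Ct)
  then have Cs: "C1 s ds" unfolding s_def[abs_def] ds_def[abs_def] by (simp add: mult.assoc mult.left_commute)
  have CS: "C1 (\<lambda>z. - s z) (\<lambda>z. - ds z)" using C1_diff[OF C1_const[of 0] Cs] by simp
  have sob: "sob_loc p U (\<lambda>z. - s z) (\<lambda>z. fst (- ds z))" by (rule sob_loc_C1[OF p U CS])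
  have fl: "flux p (fst (- ds z)) = - (\<kappa> *\<^sub>R (fst z - x0))" for z
  proof (cases "fst z = x0")
    case True
    then show ?thesis by (simp add: ds_def flux_def)
  next
    case False
    define r where "r = norm (fst z - x0)"
    have r: "r > 0" using False by (simp add: r_def)
    have q0: "q > 0" using q by simp
    then have Mq: "M * q > 0" using M by simp
    have nr: "norm (fst (- ds z)) = M * q * r powr (q - 1)"
      using M q0 r powr_add[of r "q - 2" 1] by (simp add: ds_def r_def[symmetric] abs_mult)
    have "norm (fst (- ds z)) powr (p - 2) * (M * q * r powr (q - 2)) = \<kappa>"
    proof -
      have "norm (fst (- ds z)) powr (p - 2) * (M * q * r powr (q - 2)) = (M * q) powr (p - 2) * (M * q) * (r powr ((q - 1) * (p - 2)) * r powr (q - 2))"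
        unfolding nr using Mq r by (simp add: powr_mult powr_powr)
      also have "(M * q) powr (p - 2) * (M * q) = \<kappa>" using Mq powr_add[of "M * q" "p - 2" 1] by (simp add: \<kappa>_def)
      also have "r powr ((q - 1) * (p - 2)) * r powr (q - 2) = r powr ((q - 1) * (p - 2) + (q - 2))" by (rule powr_add[symmetric])
      also have "(q - 1) * (p - 2) + (q - 2) = 0" using qp by (simp add: algebra_simps)
      finally show ?thesis using r by simp
    qed
    then show ?thesis unfolding flux_def by (simp add: ds_def r_def)
  qed
  have "wineq U (\<lambda>z. (flux p (fst (- ds z)), - (- s z))) (\<lambda>z. 0)"
    unfolding wineq_def fl
  proof (intro allI impI)
    fix \<phi> assume t: "test_fun U \<phi> \<and> (\<forall>z. 0 \<le> \<phi> z)"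
    obtain K where K: "C1 \<phi> (grad \<phi>)" "compact K" "K \<subseteq> U" "\<And>z. z \<notin> K \<Longrightarrow> \<phi> z = 0" by (rule test_fun_C1[OF conjunct1[OF t]]) (rule that)
    have cg: "continuous_on UNIV (grad \<phi>)" "continuous_on UNIV \<phi>" "continuous_on UNIV s" "continuous_on UNIV ds"
      using K(1) C1_continuous[OF K(1)] C1_continuous[OF Cs] Cs by (auto simp: C1_def)
    have g0: "grad \<phi> z = 0" if "z \<notin> K" for z using C1_support[OF K(1) compact_imp_closed[OF K(2)] K(4) that] .
    have i1: "integrable lborel (\<lambda>z. (fst z $ i - x0 $ i) * (grad \<phi> z \<bullet> ex i))" for i
      by (rule integrable_continuous_compact_support[OF _ K(2)])
         (use cg g0 C1_continuous[OF C1_fst_component[of i "x0 $ i"], of UNIV] in \<open>auto intro!: continuous_intros\<close>)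
    have i2: "integrable lborel (\<lambda>z. s z * (grad \<phi> z \<bullet> (0, 1)))"
      by (rule integrable_continuous_compact_support[OF _ K(2)]) (use cg g0 in \<open>auto intro!: continuous_intros\<close>)
    have i3: "integrable lborel \<phi>" by (rule integrable_continuous_compact_support[OF cg(2) K(2)]) (rule K(4))
    have i4: "integrable lborel (\<lambda>z. \<phi> z * (ds z \<bullet> (0, 1)))"
      by (rule integrable_continuous_compact_support[OF _ K(2)]) (use cg K(4) in \<open>auto intro!: continuous_intros\<close>)
    have b1: "(LINT z|lborel. (fst z $ i - x0 $ i) * (grad \<phi> z \<bullet> ex i)) = - (LINT z|lborel. \<phi> z)" for i
    proof -
      have "(LINT z|lborel. (fst z $ i - x0 $ i) * (grad \<phi> z \<bullet> ex i)) = - (LINT z|lborel. \<phi> z * (ex i \<bullet> ex i))"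
        by (rule integral_by_parts[OF K(1,2) _ C1_fst_component]) (rule K(4))
      then show ?thesis by (simp add: inner_axis_axis)
    qed
    have b2: "(LINT z|lborel. s z * (grad \<phi> z \<bullet> (0, 1))) = - (LINT z|lborel. \<phi> z * (ds z \<bullet> (0, 1)))"
      by (rule integral_by_parts[OF K(1,2) _ Cs]) (rule K(4))
    have "(\<lambda>z. (- (\<kappa> *\<^sub>R (fst z - x0)), - (- s z)) \<bullet> grad \<phi> z + 0 * \<phi> z)
       = (\<lambda>z. - \<kappa> * (\<Sum>i\<in>UNIV. (fst z $ i - x0 $ i) * (grad \<phi> z \<bullet> ex i)) + s z * (grad \<phi> z \<bullet> (0, 1)))"
    proof (rule ext)
      fix z
      have "(fst z - x0) \<bullet> fst (grad \<phi> z) = (\<Sum>i\<in>UNIV. (fst z $ i - x0 $ i) * (grad \<phi> z \<bullet> ex i))"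
      proof -
        have e: "grad \<phi> z \<bullet> ex i = fst (grad \<phi> z) $ i" for i by (simp add: inner_prod_def inner_axis)
        show ?thesis unfolding e by (simp add: inner_vec_def)
      qed
      then show "(- (\<kappa> *\<^sub>R (fst z - x0)), - (- s z)) \<bullet> grad \<phi> z + 0 * \<phi> z
         = - \<kappa> * (\<Sum>i\<in>UNIV. (fst z $ i - x0 $ i) * (grad \<phi> z \<bullet> ex i)) + s z * (grad \<phi> z \<bullet> (0, 1))"
        by (simp add: inner_prod_def)
    qed
    then have "(LINT z|lborel. (- (\<kappa> *\<^sub>R (fst z - x0)), - (- s z)) \<bullet> grad \<phi> z + 0 * \<phi> z)
      = - \<kappa> * (\<Sum>i\<in>UNIV. LINT z|lborel. (fst z $ i - x0 $ i) * (grad \<phi> z \<bullet> ex i)) + (LINT z|lborel. s z * (grad \<phi> z \<bullet> (0, 1)))"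
      using i1 i2 by (simp add: Bochner_Integration.integral_add Bochner_Integration.integral_sum)
    also have "\<dots> = \<kappa> * real CARD('n) * (LINT z|lborel. \<phi> z) - (LINT z|lborel. \<phi> z * (ds z \<bullet> (0, 1)))"
      unfolding b1 b2 by simp
    also have "\<dots> = (LINT z|lborel. \<kappa> * real CARD('n) * \<phi> z - \<phi> z * (ds z \<bullet> (0, 1)))" using i3 i4 by simp
    also have "\<dots> \<ge> 0"
    proof (rule Bochner_Integration.integral_nonneg)
      fix z
      show "0 \<le> \<kappa> * real CARD('n) * \<phi> z - \<phi> z * (ds z \<bullet> (0, 1))"
      proof (cases "z \<in> K")
        case True
        then have "snd z \<le> T" using K(3) UT by blast
        then have "N * (snd z - t0) \<le> N * T" using t0 N by (intro mult_left_mono) auto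
        then have "2 * N * (snd z - t0) \<le> 2 * N * T" by simp
        also have "\<dots> \<le> \<kappa>" using MN by (simp add: \<kappa>_def q_def)
        also have "\<dots> \<le> \<kappa> * real CARD('n)"
        proof -
          have "1 \<le> real CARD('n)" by (simp add: Suc_leI)
          moreover have "0 \<le> \<kappa>" by (simp add: \<kappa>_def)
          ultimately show ?thesis using mult_left_mono[of 1 "real CARD('n)" \<kappa>] by simp
        qed
        finally have "ds z \<bullet> (0, 1) \<le> \<kappa> * real CARD('n)" by (simp add: ds_def)
        moreover have "0 \<le> \<phi> z" using t by blast
        ultimately show ?thesis using mult_right_mono[of "ds z \<bullet> (0, 1)" "\<kappa> * real CARD('n)" "\<phi> z"] by (simp add: mult.commute)
      qed (simp add: K(4))
    qed
    finally show "0 \<le> (LINT z|lborel. (- (\<kappa> *\<^sub>R (fst z - x0)), - (- s z)) \<bullet> grad \<phi> z + 0 * \<phi> z)" .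
  qed
  then have "weak_supersol p U (\<lambda>z. - s z)" unfolding weak_supersol_iff using sob by blast
  then show ?thesis by (simp add: s_def q_def)
qed

lemma AE_le_open:
  fixes f g :: "'a::euclidean_space \<Rightarrow> real"
  assumes A: "open A" and c: "continuous_on A f" "continuous_on A g" and ae: "AE z in lborel. z \<in> A \<longrightarrow> f z \<le> g z" and z: "z \<in> A"
  shows "f z \<le> g z"
proof (rule ccontr)
  assume "\<not> f z \<le> g z"
  let ?S = "A \<inter> (\<lambda>z. f z - g z) -` {0<..}"
  have "open ?S" by (rule continuous_open_preimage[OF _ A]) (use c in \<open>auto intro!: continuous_intros\<close>)
  moreover have "?S \<noteq> {}" using z \<open>\<not> f z \<le> g z\<close> by auto
  ultimately have "\<not> negligible ?S" by (rule open_not_negligible)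
  moreover have "emeasure lborel ?S = 0"
  proof -
    have "AE z in lborel. z \<notin> ?S" using ae by eventually_elim auto
    moreover have "?S \<in> sets lborel" using \<open>open ?S\<close> by simp
    ultimately show ?thesis using AE_iff_null_sets[of ?S lborel] by (simp add: null_setsD1)
  qed
  ultimately show False using \<open>open ?S\<close> by (simp add: negligible_iff_emeasure0)
qed

lemma comparison_continuous:
  fixes u v :: "'n::finite pt \<Rightarrow> real"
  assumes p: "p > 2" and Q: "open Q" "Q \<subseteq> C" and C: "compact C" and \<tau>: "\<And>z. z \<in> Q \<Longrightarrow> snd z < \<tau>"
    and bd: "\<And>z. z \<in> C \<Longrightarrow> z \<notin> Q \<Longrightarrow> snd z = \<tau> \<or> v z \<le> u z"
    and c: "continuous_on C u" "continuous_on C v" and v: "weak_sol p Q v" and u: "weak_supersol p Q u" and z: "z \<in> Q"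
  shows "v z \<le> u z"
proof (rule field_le_epsilon)
  fix e :: real assume e: "e > 0"
  define s where "s = (snd z + \<tau>) / 2"
  have s: "snd z < s" "s < \<tau>" using \<tau>[OF z] by (auto simp: s_def)
  let ?F = "{z \<in> C. snd z \<le> s \<and> u z + e \<le> v z}"
  have "closedin (top_of_set C) (C \<inter> (\<lambda>z. snd z - s) -` {..0} \<inter> (C \<inter> (\<lambda>z. u z + e - v z) -` {..0}))"
    by (intro closedin_Int continuous_closedin_preimage closed_atMost continuous_intros c)
  then have "closed (C \<inter> (\<lambda>z. snd z - s) -` {..0} \<inter> (C \<inter> (\<lambda>z. u z + e - v z) -` {..0}))"
    by (rule closedin_closed_trans[OF _ compact_imp_closed[OF C]])
  moreover have "C \<inter> (\<lambda>z. snd z - s) -` {..0} \<inter> (C \<inter> (\<lambda>z. u z + e - v z) -` {..0}) = ?F" by auto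
  ultimately have "closed ?F" by simp
  have "compact (C \<inter> ?F)" by (rule compact_Int_closed[OF C \<open>closed ?F\<close>])
  moreover have "C \<inter> ?F = ?F" by auto
  ultimately have F: "compact ?F" by simp
  have FQ: "?F \<subseteq> Q"
  proof
    fix y assume y: "y \<in> ?F"
    show "y \<in> Q" using bd[of y] y s e by force
  qed
  have ae: "AE z in lborel. z \<in> Q \<and> snd z < s \<longrightarrow> v z \<le> u z + e"
    by (rule comparison[OF p Q(1) v supersol_add_const[OF p Q(1) u] F FQ]) (use Q(2) in auto)
  have o: "open (Q \<inter> snd -` {..<s})" by (intro open_Int Q open_vimage continuous_intros open_lessThan)
  have sub: "Q \<inter> snd -` {..<s} \<subseteq> C" using Q(2) by blast
  show "v z \<le> u z + e"
  proof (rule AE_le_open[OF o])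
    show "continuous_on (Q \<inter> snd -` {..<s}) v" by (rule continuous_on_subset[OF c(2) sub])
    show "continuous_on (Q \<inter> snd -` {..<s}) (\<lambda>z. u z + e)" by (rule continuous_on_subset[OF _ sub]) (intro continuous_intros c(1))
    show "AE z in lborel. z \<in> Q \<inter> snd -` {..<s} \<longrightarrow> v z \<le> u z + e" using ae by eventually_elim auto
  qed (use z s in auto)
qed

lemma supersol_add_ramp:
  fixes u :: "'n::finite pt \<Rightarrow> real"
  assumes p: "p > 2" and U: "open U" and u: "weak_supersol p U u" and R: "R \<ge> 0"
  shows "weak_supersol p U (\<lambda>z. u z + R * (max 0 (snd z - t1))\<^sup>2)"
proof (rule supersol_add_time[OF p U u, where h="\<lambda>t. R * (max 0 (t - t1))\<^sup>2" and h'="\<lambda>s. R * (2 * max 0 (s - t1))"])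
  fix s
  have "((\<lambda>t. (max 0 (t - t1))\<^sup>2) has_real_derivative 2 * max 0 (s - t1) * 1) (at s)"
    by (rule DERIV_chain2[where f="\<lambda>s. (max 0 s)\<^sup>2" and g="\<lambda>t. t - t1", OF DERIV_max_sq]) (auto intro!: derivative_eq_intros)
  then show "((\<lambda>t. R * (max 0 (t - t1))\<^sup>2) has_real_derivative R * (2 * max 0 (s - t1))) (at s)"
    by (intro DERIV_cmult) simp
  show "0 \<le> R * (2 * max 0 (s - t1))" using R by simp
qed (intro continuous_intros)

section \<open>The obstacle problem\<close>

lemma Qcyl_open: "open (Qcyl p r z)"
  unfolding Qcyl_def by (intro open_Times) auto

lemma Qcyl_centre: "r > 0 \<Longrightarrow> z \<in> Qcyl p r z"
  unfolding Qcyl_def by (simp add: mem_Times_iff)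

lemma Qcyl_small:
  assumes p: "p > 1" and d: "\<delta> > 0"
  shows "\<exists>r>0. Qcyl p r z \<subseteq> ball z \<delta>"
proof -
  define r where "r = min 1 (\<delta> / 2)"
  have r: "r > 0" "r \<le> 1" "r \<le> \<delta> / 2" using d by (auto simp: r_def)
  have rp: "r powr p \<le> r" using powr_mono'[of 1 p r] r p by simp
  have "y \<in> ball z \<delta>" if y: "y \<in> Qcyl p r z" for y
  proof -
    have a: "dist (fst z) (fst y) < r" "\<bar>snd y - snd z\<bar> < r powr p" using y by (auto simp: Qcyl_def mem_Times_iff)
    have "dist z y \<le> dist (fst z) (fst y) + dist (snd z) (snd y)"
      unfolding dist_prod_def using sqrt_sum_squares_le_sum[of "dist (fst z) (fst y)" "dist (snd z) (snd y)"] by simp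
    then show ?thesis using a rp r(3) by (simp add: dist_real_def abs_minus_commute)
  qed
  then show ?thesis using r(1) by blast
qed

lemma ess_liminf_reg_ge:
  assumes p: "p > 1" and lim: "\<And>e. e > 0 \<Longrightarrow> \<exists>\<delta>>0. \<forall>y\<in>D. dist z y < \<delta> \<longrightarrow> c - e < v y"
    and f: "AE y in lborel. y \<in> D \<longrightarrow> ereal (v y) \<le> f y"
  shows "ereal c \<le> ess_liminf_reg p D f z"
proof (rule ereal_le_epsilon2)
  fix e :: real assume e: "0 < e"
  obtain \<delta> where \<delta>: "\<delta> > 0" "\<And>y. y \<in> D \<Longrightarrow> dist z y < \<delta> \<Longrightarrow> c - e < v y" using lim[OF e] by blast
  obtain r where r: "r > 0" "Qcyl p r z \<subseteq> ball z \<delta>" using Qcyl_small[OF p \<delta>(1)] by blast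
  have "AE y in lborel. y \<in> Qcyl p r z \<inter> D \<longrightarrow> ereal (c - e) \<le> f y"
    using f
  proof eventually_elim
    case (elim y)
    show ?case
    proof
      assume y: "y \<in> Qcyl p r z \<inter> D"
      then have "ereal (c - e) \<le> ereal (v y)" using \<delta>(2)[of y] r(2) by fastforce
      also have "\<dots> \<le> f y" using elim y by blast
      finally show "ereal (c - e) \<le> f y" .
    qed
  qed
  then have "ereal (c - e) \<le> ess_inf_on (Qcyl p r z \<inter> D) f" unfolding ess_inf_on_def by (intro Sup_upper) simp
  also have "\<dots> \<le> ess_liminf_reg p D f z" unfolding ess_liminf_reg_def by (rule SUP_upper) (use r in simp)
  finally have "ereal (c - e) + ereal e \<le> ess_liminf_reg p D f z + ereal e" by (rule add_right_mono)
  then show "ereal c \<le> ess_liminf_reg p D f z + ereal e" by simp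
qed

lemma ess_liminf_reg_le:
  fixes z :: "'n::finite pt"
  assumes D: "open D" and z: "z \<in> closure D" and lim: "\<And>e. e > 0 \<Longrightarrow> \<exists>\<delta>>0. \<forall>y\<in>D. dist z y < \<delta> \<longrightarrow> v y < c + e"
    and f: "\<And>y. y \<in> D \<Longrightarrow> f y \<le> ereal (v y)"
  shows "ess_liminf_reg p D f z \<le> ereal c"
  unfolding ess_liminf_reg_def
proof (rule SUP_least)
  fix r :: real assume "r \<in> {0<..}"
  then have r: "r > 0" by simp
  show "ess_inf_on (Qcyl p r z \<inter> D) f \<le> ereal c"
    unfolding ess_inf_on_def
  proof (rule Sup_least)
    fix a assume "a \<in> {a. AE y in lborel. y \<in> Qcyl p r z \<inter> D \<longrightarrow> a \<le> f y}"
    then have a: "AE y in lborel. y \<in> Qcyl p r z \<inter> D \<longrightarrow> a \<le> f y" by simp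
    show "a \<le> ereal c"
    proof (rule ereal_le_epsilon2)
      fix e :: real assume e: "0 < e"
      obtain \<delta> where \<delta>: "\<delta> > 0" "\<And>y. y \<in> D \<Longrightarrow> dist z y < \<delta> \<Longrightarrow> v y < c + e" using lim[OF e] by blast
      let ?G = "Qcyl p r z \<inter> ball z \<delta> \<inter> D"
      have o: "open ?G" by (intro open_Int Qcyl_open open_ball D)
      have "open (Qcyl p r z \<inter> ball z \<delta>)" "z \<in> Qcyl p r z \<inter> ball z \<delta>" using open_Int[OF Qcyl_open open_ball] Qcyl_centre[OF r, of z p] \<delta>(1) by simp_all
      then have "?G \<noteq> {}" using z by (metis closure_iff_nhds_not_empty inf_commute order_refl)
      then have "\<not> negligible ?G" using o by (intro open_not_negligible)
      then have "emeasure lborel ?G \<noteq> 0" using o by (simp add: negligible_iff_emeasure0)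
      moreover have "?G \<in> sets lborel" using o by simp
      ultimately have "\<not> (AE y in lborel. y \<notin> ?G)" using AE_iff_null_sets[of ?G lborel] by auto
      then have "\<exists>y. y \<in> ?G \<and> a \<le> f y"
      proof (rule contrapos_np)
        assume n: "\<nexists>y. y \<in> ?G \<and> a \<le> f y"
        show "AE y in lborel. y \<notin> ?G" using a by (rule eventually_mono) (use n in blast)
      qed
      then obtain y where y: "y \<in> ?G" "a \<le> f y" by blast
      have "a \<le> ereal (v y)" using y f[of y] by (auto intro: order_trans)
      also have "\<dots> \<le> ereal (c + e)" using \<delta>(2)[of y] y by auto
      finally show "a \<le> ereal c + ereal e" by simp
    qed
  qed
qed

locale obstacle_problem =
  fixes p T L :: real and \<Omega> :: "(real^'n::finite) set" and \<psi> :: "'n pt \<Rightarrow> real"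
  assumes p: "p > 2" and T: "T > 0"
    and \<Omega>: "open \<Omega>" "bounded \<Omega>" "\<Omega> \<noteq> {}"
    and reg: "regular_cyl p \<Omega> T"
    and \<psi>c: "continuous_on (closure (cyl \<Omega> T)) \<psi>"
    and \<psi>b: "\<And>z. z \<in> closure (cyl \<Omega> T) \<Longrightarrow> 0 \<le> \<psi> z \<and> \<psi> z \<le> L"
begin

abbreviation D :: "'n pt set" where "D \<equiv> cyl \<Omega> T"

lemma D_open: "open D"
  unfolding cyl_def using \<Omega>(1) by (intro open_Times) auto

lemma closure_D: "closure D = closure \<Omega> \<times> {0..T}"
  unfolding cyl_def closure_Times using T by (simp add: closure_greaterThanLessThan)

lemma D_closure: "D \<subseteq> closure D"
  by (rule closure_subset)

lemma compact_closure_D: "compact (closure D)"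
  unfolding closure_D using \<Omega>(2) by (intro compact_Times compact_Icc) (simp add: compact_closure)

lemma D_nonempty: "D \<noteq> {}"
  using \<Omega>(3) T by (auto simp: cyl_def)

lemma D_time: "z \<in> D \<Longrightarrow> 0 < snd z \<and> snd z < T"
  by (auto simp: cyl_def)

lemma bdry_cases: "z \<in> closure D \<Longrightarrow> z \<notin> D \<Longrightarrow> z \<in> par_bdry \<Omega> T \<or> snd z = T"
  using \<Omega>(1) unfolding closure_D by (auto simp: cyl_def par_bdry_def frontier_def interior_open)

lemma par_bdry_closure: "par_bdry \<Omega> T \<subseteq> closure D"
  unfolding closure_D using T by (auto simp: par_bdry_def frontier_def)

lemma compact_par_bdry: "compact (par_bdry \<Omega> T)"
proof -
  have "compact (closure \<Omega>)" "compact (frontier \<Omega>)"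
    using \<Omega>(2) by (simp_all add: compact_closure compact_frontier_bounded)
  then show ?thesis unfolding par_bdry_def by (intro compact_Un compact_Times) auto
qed

lemma L_nonneg: "0 \<le> L"
proof -
  obtain z where "z \<in> D" using D_nonempty by blast
  then show ?thesis using \<psi>b[of z] D_closure by force
qed

definition Sc :: "('n pt \<Rightarrow> real) set" where
  "Sc = {u. continuous_on D u \<and> weak_supersol p D u \<and> (\<forall>z\<in>D. \<psi> z \<le> u z)}"

lemma Sc_const: "(\<lambda>z. L) \<in> Sc"
  unfolding Sc_def using weak_sol_imp_supersol[OF weak_sol_const[OF p D_open]] \<psi>b D_closure by auto

lemma Sc_min: "u1 \<in> Sc \<Longrightarrow> u2 \<in> Sc \<Longrightarrow> (\<lambda>z. min (u1 z) (u2 z)) \<in> Sc"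
  unfolding Sc_def using weak_supersol_min[OF p D_open] by (auto intro: continuous_on_min)

lemma Sc_finite_min:
  assumes "finite A" "A \<subseteq> Sc"
  shows "\<exists>u\<in>Sc. (\<forall>z\<in>D. u z \<le> L) \<and> (\<forall>a\<in>A. \<forall>z\<in>D. u z \<le> a z)"
  using assms
proof (induction A rule: finite_induct)
  case empty
  then show ?case using Sc_const by auto
next
  case (insert b A)
  then obtain u where u: "u \<in> Sc" "\<forall>z\<in>D. u z \<le> L" "\<forall>a\<in>A. \<forall>z\<in>D. u z \<le> a z" by auto
  have "(\<lambda>z. min (u z) (b z)) \<in> Sc" using Sc_min[OF u(1)] insert.prems by auto
  moreover have "\<forall>z\<in>D. min (u z) (b z) \<le> L" using u(2) by (auto intro: min.coboundedI1)
  moreover have "\<forall>a\<in>insert b A. \<forall>z\<in>D. min (u z) (b z) \<le> a z" using u(3) by (auto intro: min.coboundedI1)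
  ultimately show ?case by (intro bexI[of _ "\<lambda>z. min (u z) (b z)"] conjI)
qed

lemma barrier:
  assumes y: "y \<in> par_bdry \<Omega> T" and e: "e > 0"
  shows "\<exists>h\<in>Sc. continuous_on (closure D) h \<and> h y = \<psi> y + e"
proof -
  obtain x0 t0 where yx: "y = (x0, t0)" by fastforce
  have yD: "y \<in> closure D" using y par_bdry_closure by blast
  then have t0: "0 \<le> t0" "t0 \<le> T" unfolding closure_D yx by auto
  obtain \<delta> where \<delta>: "\<delta> > 0" "\<And>z. z \<in> closure D \<Longrightarrow> dist z y < \<delta> \<Longrightarrow> dist (\<psi> z) (\<psi> y) < e"
    using \<psi>c yD e unfolding continuous_on_iff by blast
  define q where "q = p / (p - 1)"
  have q: "q > 1" using p by (simp add: q_def field_simps)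
  define N where "N = L / (\<delta>/2)\<^sup>2"
  have N: "N \<ge> 0" using L_nonneg by (simp add: N_def)
  define M where "M = L / (\<delta>/2) powr q + 1 + (2 * N * T) powr (1 / (p - 1))"
  have M: "M > 0" using L_nonneg by (simp add: M_def add_nonneg_pos add_pos_nonneg)
  have NT: "0 \<le> 2 * N * T" using N T by simp
  have MN: "2 * N * T \<le> (M * (p / (p - 1))) powr (p - 1)"
  proof -
    have "2 * N * T = ((2 * N * T) powr (1 / (p - 1))) powr (p - 1)" using NT p by (cases "2 * N * T = 0") (auto simp: powr_powr)
    also have "\<dots> \<le> (M * q) powr (p - 1)"
    proof (rule powr_mono2)
      have "(2 * N * T) powr (1 / (p - 1)) \<le> M" using L_nonneg by (simp add: M_def)
      also have "M \<le> M * q" using M q by simp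
      finally show "(2 * N * T) powr (1 / (p - 1)) \<le> M * q" .
    qed (use p in auto)
    finally show ?thesis by (simp add: q_def)
  qed
  define b where "b = \<psi> y + e"
  define s where "s z = b + M * norm (fst z - x0) powr (p / (p - 1)) + N * (snd z - t0)\<^sup>2" for z :: "'n pt"
  have sup: "weak_supersol p D (\<lambda>z. - s z)"
    unfolding s_def by (rule barrier_supersol[OF p D_open _ t0(1) M N MN]) (use D_time in force)
  have sc: "continuous_on A s" for A
  proof -
    have c: "continuous_on UNIV (\<lambda>z::'n pt. norm (fst z - x0) powr q)" by (rule C1_continuous[OF C1_norm_powr[OF q]])
    have "continuous_on UNIV s" unfolding s_def q_def[symmetric]
      by (intro continuous_on_add continuous_on_mult continuous_on_const c continuous_on_power continuous_on_diff continuous_on_snd continuous_on_id)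
    then show ?thesis by (rule continuous_on_subset) simp
  qed
  have s\<psi>: "\<psi> z \<le> s z" if z: "z \<in> closure D" for z
  proof -
    have pos: "0 \<le> M * norm (fst z - x0) powr q" "0 \<le> N * (snd z - t0)\<^sup>2" using M N by auto
    show ?thesis
    proof (cases "dist z y < \<delta>")
      case True
      then have "\<psi> z \<le> b" using \<delta>(2)[OF z] by (simp add: b_def dist_real_def)
      then show ?thesis using pos unfolding s_def q_def[symmetric] by linarith
    next
      case False
      have "dist z y \<le> dist (fst z) (fst y) + dist (snd z) (snd y)"
        unfolding dist_prod_def using sqrt_sum_squares_le_sum[of "dist (fst z) (fst y)" "dist (snd z) (snd y)"] by simp
      then have "\<delta> / 2 \<le> norm (fst z - x0) \<or> \<delta> / 2 \<le> \<bar>snd z - t0\<bar>" using False by (auto simp: yx dist_norm)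
      then have "L \<le> M * norm (fst z - x0) powr q \<or> L \<le> N * (snd z - t0)\<^sup>2"
      proof
        assume a: "\<delta> / 2 \<le> norm (fst z - x0)"
        have pw: "(\<delta>/2) powr q > 0" using \<delta>(1) by simp
        have "L = L / (\<delta>/2) powr q * (\<delta>/2) powr q" using pw by (simp add: field_simps)
        also have "\<dots> \<le> M * (\<delta>/2) powr q" using pw by (intro mult_right_mono) (auto simp: M_def)
        also have "\<dots> \<le> M * norm (fst z - x0) powr q" using a \<delta>(1) M q by (intro mult_left_mono powr_mono2) auto
        finally show ?thesis by simp
      next
        assume a: "\<delta> / 2 \<le> \<bar>snd z - t0\<bar>"
        have "(\<delta>/2)\<^sup>2 \<le> \<bar>snd z - t0\<bar>\<^sup>2" using a \<delta>(1) by (intro power_mono) auto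
        then have "N * (\<delta>/2)\<^sup>2 \<le> N * (snd z - t0)\<^sup>2" using N by (intro mult_left_mono) auto
        moreover have "N * (\<delta>/2)\<^sup>2 = L" using \<delta>(1) by (simp add: N_def)
        ultimately show ?thesis by simp
      qed
      moreover have "\<psi> z \<le> L" "0 \<le> b" using \<psi>b[OF z] \<psi>b[OF yD] e by (auto simp: b_def)
      ultimately show ?thesis using pos unfolding s_def q_def[symmetric] by linarith
    qed
  qed
  obtain h where h: "continuous_on (closure D) h" "p_parabolic p D h" "\<And>z. z \<in> par_bdry \<Omega> T \<Longrightarrow> h z = s z"
    using reg sc[of "closure D"] unfolding regular_cyl_def by blast
  have hsol: "weak_sol p D h" using h(2) by (simp add: p_parabolic_def)
  have "s z \<le> h z" if z: "z \<in> D" for z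
  proof -
    have "- h z \<le> - s z"
    proof (rule comparison_continuous[OF p D_open D_closure compact_closure_D, where \<tau>=T and u="\<lambda>z. - s z" and v="\<lambda>z. - h z"])
      show "snd z < T" if "z \<in> D" for z using D_time[OF that] by simp
      show "snd z = T \<or> - h z \<le> - s z" if "z \<in> closure D" "z \<notin> D" for z using bdry_cases[OF that] h(3)[of z] by auto
      show "continuous_on (closure D) (\<lambda>z. - s z)" "continuous_on (closure D) (\<lambda>z. - h z)" using sc h(1) by (auto intro!: continuous_intros)
      show "weak_sol p D (\<lambda>z. - h z)" by (rule weak_sol_uminus[OF hsol])
    qed (use sup z in auto)
    then show ?thesis by simp
  qed
  then have "\<psi> z \<le> h z" if "z \<in> D" for z using order_trans[OF s\<psi>[OF subsetD[OF D_closure that]]] that by blast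
  then have "h \<in> Sc" unfolding Sc_def using continuous_on_subset[OF h(1) D_closure] weak_sol_imp_supersol[OF hsol] by auto
  moreover have "h y = \<psi> y + e" using h(3)[OF y] q by (simp add: s_def yx b_def)
  ultimately show ?thesis using h(1) by blast
qed

lemma near_boundary:
  assumes e: "e > 0"
  shows "\<exists>u\<in>Sc. (\<forall>z\<in>D. u z \<le> L) \<and> (\<exists>\<delta>>0. \<forall>z\<in>D. \<forall>y\<in>par_bdry \<Omega> T. dist y z < \<delta> \<longrightarrow> u z < \<psi> z + e)"
proof -
  have "\<exists>h r. h \<in> Sc \<and> r > 0 \<and> (\<forall>z\<in>D. dist y z < r \<longrightarrow> h z < \<psi> z + e)" if y: "y \<in> par_bdry \<Omega> T" for y
  proof -
    obtain h where h: "h \<in> Sc" "continuous_on (closure D) h" "h y = \<psi> y + e/2" using barrier[OF y, of "e/2"] e by auto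
    have yD: "y \<in> closure D" using y par_bdry_closure by blast
    have "continuous_on (closure D) (\<lambda>z. h z - \<psi> z)" using h(2) \<psi>c by (rule continuous_on_diff)
    then obtain r where r: "r > 0" "\<And>z. z \<in> closure D \<Longrightarrow> dist z y < r \<Longrightarrow> dist (h z - \<psi> z) (h y - \<psi> y) < e/2"
      using yD e unfolding continuous_on_iff by (meson half_gt_zero)
    have "h z < \<psi> z + e" if "z \<in> D" "dist y z < r" for z
    proof -
      have "z \<in> closure D" using that D_closure by blast
      then have "\<bar>h z - \<psi> z - e/2\<bar> < e/2" using r(2)[of z] that h(3) by (simp add: dist_real_def dist_commute)
      then show ?thesis by linarith
    qed
    then show ?thesis using h(1) r(1) by blast
  qed
  then obtain h r where hr: "\<And>y. y \<in> par_bdry \<Omega> T \<Longrightarrow> h y \<in> Sc \<and> r y > 0 \<and> (\<forall>z\<in>D. dist y z < r y \<longrightarrow> h y z < \<psi> z + e)" by metis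
  have "par_bdry \<Omega> T \<subseteq> (\<Union>y\<in>par_bdry \<Omega> T. ball y (r y))" using hr by auto
  then obtain Y where Y: "Y \<subseteq> par_bdry \<Omega> T" "finite Y" "par_bdry \<Omega> T \<subseteq> (\<Union>y\<in>Y. ball y (r y))"
    by (rule compactE_image[OF compact_par_bdry, rotated]) auto
  obtain \<delta> where \<delta>: "\<delta> > 0" "\<And>x. x \<in> par_bdry \<Omega> T \<Longrightarrow> \<exists>G\<in>(\<lambda>y. ball y (r y)) ` Y. ball x \<delta> \<subseteq> G"
    by (rule Heine_Borel_lemma[OF compact_par_bdry Y(3)]) auto
  obtain u where u: "u \<in> Sc" "\<forall>z\<in>D. u z \<le> L" "\<forall>a\<in>h ` Y. \<forall>z\<in>D. u z \<le> a z"
    using Sc_finite_min[of "h ` Y"] Y(1,2) hr by blast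
  have "u z < \<psi> z + e" if z: "z \<in> D" and y: "y \<in> par_bdry \<Omega> T" "dist y z < \<delta>" for z y
  proof -
    obtain y' where y': "y' \<in> Y" "ball y \<delta> \<subseteq> ball y' (r y')" using \<delta>(2)[OF y(1)] by blast
    then have "dist y' z < r y'" using y(2) by auto
    then have "h y' z < \<psi> z + e" using hr[of y'] y' Y(1) z by blast
    moreover have "u z \<le> h y' z" using u(3) y'(1) z by blast
    ultimately show ?thesis by linarith
  qed
  then show ?thesis using u(1,2) \<delta>(1) by blast
qed

text \<open>The ramp exceeds \<open>L\<close> before the translated competitor ceases to be defined at the top of the cylinder.\<close>
lemma translate:
  assumes e: "e > 0"
  shows "\<exists>\<delta>>0. \<forall>z\<in>D. \<forall>z'\<in>D. dist z z' < \<delta> \<longrightarrow> (\<forall>u\<in>Sc. \<exists>m\<in>Sc. m z \<le> u z' + e)"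
proof -
  obtain u0 \<delta>1 where u0: "u0 \<in> Sc" "\<And>z. z \<in> D \<Longrightarrow> u0 z \<le> L" "\<delta>1 > 0"
    "\<And>z y. z \<in> D \<Longrightarrow> y \<in> par_bdry \<Omega> T \<Longrightarrow> dist y z < \<delta>1 \<Longrightarrow> u0 z < \<psi> z + e/2"
  proof -
    have "e/2 > 0" using e by simp
    then have "\<exists>u\<in>Sc. (\<forall>z\<in>D. u z \<le> L) \<and> (\<exists>\<delta>>0. \<forall>z\<in>D. \<forall>y\<in>par_bdry \<Omega> T. dist y z < \<delta> \<longrightarrow> u z < \<psi> z + e/2)"
      by (rule near_boundary)
    then obtain u0 \<delta>1 where h: "u0 \<in> Sc" "\<forall>z\<in>D. u0 z \<le> L" "\<delta>1 > 0"
      "\<forall>z\<in>D. \<forall>y\<in>par_bdry \<Omega> T. dist y z < \<delta>1 \<longrightarrow> u0 z < \<psi> z + e/2" by blast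
    show ?thesis by (rule that[of u0 \<delta>1]) (use h in blast)+
  qed
  have u0c: "continuous_on D u0" "weak_supersol p D u0" "\<And>z. z \<in> D \<Longrightarrow> \<psi> z \<le> u0 z" using u0(1) by (auto simp: Sc_def)
  have "uniformly_continuous_on (closure D) \<psi>" by (rule compact_uniformly_continuous[OF \<psi>c compact_closure_D])
  moreover have "e/2 > 0" using e by simp
  ultimately obtain \<delta>2 where \<delta>2: "\<delta>2 > 0" "\<And>x x'. x \<in> closure D \<Longrightarrow> x' \<in> closure D \<Longrightarrow> dist x' x < \<delta>2 \<Longrightarrow> dist (\<psi> x') (\<psi> x) < e/2"
    by (rule uniformly_continuous_onE) (rule that)
  define \<delta> where "\<delta> = min \<delta>1 \<delta>2"
  have \<delta>: "\<delta> > 0" using u0(3) \<delta>2(1) by (simp add: \<delta>_def)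
  have "\<exists>m\<in>Sc. m z \<le> u z' + e" if zz: "z \<in> D" "z' \<in> D" "dist z z' < \<delta>" and uS: "u \<in> Sc" for z z' u
  proof -
    define k where "k = z' - z"
    have nk: "norm k < \<delta>" using zz(3) by (simp add: k_def dist_norm norm_minus_commute)
    have u: "continuous_on D u" "weak_supersol p D u" "\<And>z. z \<in> D \<Longrightarrow> \<psi> z \<le> u z" using uS by (auto simp: Sc_def)
    let ?V0 = "{y. k + 1 *\<^sub>R y \<in> D}"
    define V where "V = D \<inter> ?V0"
    have V0: "open ?V0"
    proof -
      have "open ((\<lambda>y. k + 1 *\<^sub>R y) -` D)" by (rule open_vimage[OF D_open]) (intro continuous_intros)
      then show ?thesis by (simp add: vimage_def)
    qed
    have V: "open V" "V \<subseteq> D" "V \<subseteq> ?V0" using V0 D_open by (auto simp: V_def)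
    define t1 where "t1 = snd z"
    have gap: "T - snd k - t1 > 0" using D_time[OF zz(2)] by (simp add: k_def t1_def)
    define R where "R = (L + 1) / (T - snd k - t1)\<^sup>2"
    have R: "R > 0" using L_nonneg gap by (simp add: R_def add_nonneg_pos)
    define h where "h t = R * (max 0 (t - t1))\<^sup>2" for t
    have hc: "continuous_on UNIV h" unfolding h_def by (intro continuous_intros)
    have h0: "0 \<le> h t" "h t1 = 0" for t using R by (auto simp: h_def)
    define u2 where "u2 y = (u (k + y) + e) + h (snd y)" for y
    have s1: "weak_supersol p ?V0 (\<lambda>y. 1 * u (k + 1 *\<^sub>R y))"
      by (rule weak_supersol_affine[OF p D_open _ _ _ u(2)]) auto
    have s2: "weak_supersol p V (\<lambda>y. u (k + y))" using weak_supersol_subset[OF s1 V(3,1)] by simp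
    have s3: "weak_supersol p V u2"
      unfolding u2_def h_def using supersol_add_ramp[OF p V(1) supersol_add_const[OF p V(1) s2]] R by simp
    have Vk: "k + y \<in> D" "y \<in> D" if "y \<in> V" for y using that by (auto simp: V_def)
    have c2: "continuous_on V u2"
    proof -
      have "continuous_on V (\<lambda>y. u (k + y))"
        by (rule continuous_on_compose2[OF u(1)]) (use Vk in \<open>auto intro!: continuous_intros\<close>)
      moreover have "continuous_on V (\<lambda>y. h (snd y))"
        by (rule continuous_on_compose2[OF hc]) (auto intro!: continuous_intros)
      ultimately show ?thesis unfolding u2_def by (intro continuous_intros)
    qed
    have \<psi>k: "\<psi> y \<le> \<psi> (k + y) + e/2" if "y \<in> V" for y
    proof -
      have "y \<in> closure D" "k + y \<in> closure D" using Vk[OF that] D_closure by blast+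
      then have "dist (\<psi> y) (\<psi> (k + y)) < e/2" using \<delta>2(2)[of "k + y" y] nk by (simp add: \<delta>_def dist_norm norm_minus_commute)
      then show ?thesis unfolding dist_real_def by linarith
    qed
    have u2ge: "\<psi> y + e/2 + h (snd y) \<le> u2 y" if "y \<in> V" for y
      using \<psi>k[OF that] u(3)[OF Vk(1)[OF that]] unfolding u2_def by linarith
    let ?G1 = "D \<inter> (\<Union>b\<in>par_bdry \<Omega> T. ball b \<delta>1)" and ?G2 = "D \<inter> (\<lambda>y. h (snd y)) -` {L<..}"
      and ?P = "V \<inter> (\<lambda>y. u2 y - u0 y) -` {0<..}"
    have oG: "open ?G1" "open ?G2" "open ?P"
    proof -
      show "open ?G1" using D_open by auto
      have "continuous_on D (\<lambda>y. h (snd y))" by (rule continuous_on_compose2[OF hc]) (auto intro!: continuous_intros)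
      then show "open ?G2" by (rule continuous_open_preimage[OF _ D_open open_greaterThan])
      have "continuous_on V (\<lambda>y. u2 y - u0 y)" using c2 continuous_on_subset[OF u0c(1) V(2)] by (rule continuous_on_diff)
      then show "open ?P" by (rule continuous_open_preimage[OF _ V(1) open_greaterThan])
    qed
    have cover: "y \<in> V \<or> y \<in> ?G1 \<or> y \<in> ?G2" if y: "y \<in> D" for y
    proof (rule ccontr)
      assume n: "\<not> (y \<in> V \<or> y \<in> ?G1 \<or> y \<in> ?G2)"
      then have "k + y \<notin> D" using y by (auto simp: V_def)
      then have "closed_segment y (k + y) \<inter> frontier D \<noteq> {}"
        using y by (intro connected_Int_frontier convex_connected convex_closed_segment) auto
      then obtain b where b: "b \<in> closed_segment y (k + y)" "b \<in> frontier D" by blast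
      then obtain \<theta> where \<theta>: "0 \<le> \<theta>" "\<theta> \<le> 1" "b = (1 - \<theta>) *\<^sub>R y + \<theta> *\<^sub>R (k + y)" by (auto simp: closed_segment_def)
      then have b': "b = y + \<theta> *\<^sub>R k" by (simp add: algebra_simps)
      have "dist b y \<le> norm k" using \<theta>(1,2) by (simp add: b' dist_norm mult_left_le_one_le)
      then have "dist b y < \<delta>1" using nk by (simp add: \<delta>_def)
      then have "b \<notin> par_bdry \<Omega> T" using n y by auto
      moreover have "b \<in> closure D" "b \<notin> D" using b(2) D_open by (auto simp: frontier_def interior_open)
      ultimately have "snd b = T" using bdry_cases by blast
      then have eqT: "snd y + \<theta> * snd k = T" by (simp add: b')
      have "snd y < T" using D_time[OF y] by simp
      then have "0 < \<theta> * snd k" using eqT by linarith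
      then have "0 < snd k" using \<theta>(1) by (metis mult_nonneg_nonpos not_le)
      then have "\<theta> * snd k \<le> snd k" using \<theta>(2) by simp
      then have ty: "T - snd k - t1 \<le> snd y - t1" using eqT by linarith
      have "(T - snd k - t1)\<^sup>2 \<le> (max 0 (snd y - t1))\<^sup>2" using ty gap by (intro power_mono) auto
      then have "R * (T - snd k - t1)\<^sup>2 \<le> h (snd y)" unfolding h_def using R by (intro mult_left_mono) auto
      moreover have "R * (T - snd k - t1)\<^sup>2 = L + 1" using gap by (simp add: R_def)
      ultimately have "y \<in> ?G2" using y by auto
      then show False using n by blast
    qed
    let ?C = "{y \<in> V. u2 y \<le> u0 y}"
    have G1C: "y \<notin> ?C" if yG: "y \<in> ?G1" for y
    proof
      assume y: "y \<in> ?C"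
      obtain b where "b \<in> par_bdry \<Omega> T" "dist b y < \<delta>1" using yG by auto
      then have "u0 y < \<psi> y + e/2" using u0(4) yG by blast
      then show False using y u2ge[of y] h0(1)[of "snd y"] by auto
    qed
    have G2C: "y \<notin> ?C" if "y \<in> ?G2" for y
    proof
      assume y: "y \<in> ?C"
      then have "y \<in> V" "y \<in> D" using V(2) by auto
      then have "u0 y \<le> L" "0 \<le> \<psi> y" using u0(2) \<psi>b D_closure by blast+
      moreover have "L < h (snd y)" using that by auto
      ultimately show False using y u2ge[OF \<open>y \<in> V\<close>] e by auto
    qed
    have "D - ?C = ?P \<union> ?G1 \<union> ?G2"
    proof (intro equalityI subsetI)
      fix y assume y: "y \<in> D - ?C"
      then show "y \<in> ?P \<union> ?G1 \<union> ?G2" using cover[of y] by force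
    next
      fix y assume y: "y \<in> ?P \<union> ?G1 \<union> ?G2"
      then have "y \<in> D" using V(2) by blast
      moreover have "y \<notin> ?C" using y G1C[of y] G2C[of y] by fastforce
      ultimately show "y \<in> D - ?C" by blast
    qed
    then have "open (D - ?C)" using oG by auto
    moreover have "?C \<subseteq> D" using V(2) by blast
    ultimately have cl: "closedin (top_of_set D) ?C" using D_open by (simp add: closedin_def openin_open_eq)
    define m where "m y = (if y \<in> V then min (u0 y) (u2 y) else u0 y)" for y
    have m: "weak_supersol p D m" "continuous_on D m"
      using supersol_paste[OF p D_open V(1,2) u0c(2) s3 u0c(1) c2 cl] unfolding m_def[abs_def] by auto
    have "\<psi> y \<le> m y" if y: "y \<in> D" for y
      using u0c(3)[OF y] u2ge[of y] h0(1)[of "snd y"] e unfolding m_def by auto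
    then have "m \<in> Sc" using m unfolding Sc_def by blast
    moreover have "z \<in> V" using zz by (simp add: V_def k_def)
    then have "m z \<le> u2 z" by (simp add: m_def)
    then have "m z \<le> u z' + e" using h0(2) by (simp add: u2_def k_def t1_def)
    ultimately show ?thesis by blast
  qed
  then show ?thesis using \<delta> by blast
qed

definition w :: "'n pt \<Rightarrow> real" where "w z = Inf ((\<lambda>u. u z) ` Sc)"

lemma Sc_ge: "u \<in> Sc \<Longrightarrow> z \<in> D \<Longrightarrow> \<psi> z \<le> u z"
  by (simp add: Sc_def)

lemma w_le: "u \<in> Sc \<Longrightarrow> z \<in> D \<Longrightarrow> w z \<le> u z"
  unfolding w_def by (rule cInf_lower) (auto intro!: bdd_belowI[of _ "\<psi> z"] Sc_ge)

lemma w_ge: "(\<And>u. u \<in> Sc \<Longrightarrow> c \<le> u z) \<Longrightarrow> c \<le> w z"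
  unfolding w_def using Sc_const by (intro cInf_greatest) auto

lemma w_approx: "e > 0 \<Longrightarrow> \<exists>u\<in>Sc. u z < w z + e"
  unfolding w_def using cInf_lessD[of "(\<lambda>u. u z) ` Sc" "Inf ((\<lambda>u. u z) ` Sc) + e"] Sc_const by auto

lemma w_psi: "z \<in> D \<Longrightarrow> \<psi> z \<le> w z"
  by (rule w_ge) (rule Sc_ge)

lemma w_L: "z \<in> D \<Longrightarrow> w z \<le> L"
  using w_le[OF Sc_const] .

lemma w_uniformly_continuous: "uniformly_continuous_on D w"
  unfolding uniformly_continuous_on_def
proof (intro allI impI)
  fix e :: real assume e: "e > 0"
  then have "e/2 > 0" by simp
  from translate[OF this] obtain \<delta> where \<delta>: "\<delta> > 0"
    "\<And>z z' u. z \<in> D \<Longrightarrow> z' \<in> D \<Longrightarrow> dist z z' < \<delta> \<Longrightarrow> u \<in> Sc \<Longrightarrow> \<exists>m\<in>Sc. m z \<le> u z' + e/2" by blast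
  have le: "w z \<le> w z' + e/2" if zz: "z \<in> D" "z' \<in> D" "dist z z' < \<delta>" for z z'
  proof -
    have "w z - e/2 \<le> w z'"
    proof (rule w_ge)
      fix u assume "u \<in> Sc"
      then obtain m where "m \<in> Sc" "m z \<le> u z' + e/2" using \<delta>(2)[OF zz] by blast
      then show "w z - e/2 \<le> u z'" using w_le[of m z] zz(1) by simp
    qed
    then show ?thesis by simp
  qed
  show "\<exists>d>0. \<forall>x\<in>D. \<forall>x'\<in>D. dist x' x < d \<longrightarrow> dist (w x') (w x) < e"
  proof (intro exI[of _ \<delta>] conjI ballI impI \<delta>(1))
    fix x x' assume x: "x \<in> D" "x' \<in> D" "dist x' x < \<delta>"
    then show "dist (w x') (w x) < e" using le[of x x'] le[of x' x] e by (simp add: dist_real_def dist_commute abs_less_iff)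
  qed
qed

lemma w_continuous: "continuous_on D w"
  by (rule uniformly_continuous_imp_continuous[OF w_uniformly_continuous])

lemma w_dini:
  assumes K: "compact K" "K \<subseteq> D" and e: "e > 0"
  shows "\<exists>u\<in>Sc. \<forall>z\<in>K. u z < w z + e"
proof -
  have "\<forall>z. \<exists>u. u \<in> Sc \<and> u z < w z + e" using w_approx[OF e] by blast
  from choice[OF this] obtain U where U: "\<And>z. U z \<in> Sc" "\<And>z. U z z < w z + e" by blast
  define G where "G z = D \<inter> (\<lambda>y. w y + e - U z y) -` {0<..}" for z
  have "open (G z)" for z
  proof -
    have "continuous_on D (\<lambda>y. w y + e - U z y)" using w_continuous U(1)[of z] by (auto simp: Sc_def intro!: continuous_intros)
    then show ?thesis unfolding G_def by (rule continuous_open_preimage[OF _ D_open open_greaterThan])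
  qed
  moreover have "z \<in> G z" if "z \<in> K" for z using U(2)[of z] that K(2) by (auto simp: G_def)
  ultimately obtain Y where Y: "Y \<subseteq> K" "finite Y" "K \<subseteq> (\<Union>z\<in>Y. G z)"
    by (rule_tac compactE_image[OF K(1), of K G]) auto
  obtain u where u: "u \<in> Sc" "\<forall>a\<in>U ` Y. \<forall>z\<in>D. u z \<le> a z" using Sc_finite_min[of "U ` Y"] Y(2) U(1) by blast
  have "u z < w z + e" if z: "z \<in> K" for z
  proof -
    obtain y where y: "y \<in> Y" "z \<in> G y" using Y(3) z by blast
    then have "U y z < w z + e" by (simp add: G_def)
    moreover have "u z \<le> U y z" using u(2) y(1) z K(2) by blast
    ultimately show ?thesis by linarith
  qed
  then show ?thesis using u(1) by blast
qed

end

lemma continuous_on_sandwich: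
  fixes f :: "'a::metric_space \<Rightarrow> real"
  assumes f: "continuous_on A f" and z: "z \<in> A" and D: "D \<subseteq> A" and e: "e > 0"
  shows "\<exists>\<delta>>0. \<forall>y\<in>D. dist z y < \<delta> \<longrightarrow> f z - e < f y \<and> f y < f z + e"
proof -
  obtain \<delta> where \<delta>: "\<delta> > 0" "\<And>y. y \<in> A \<Longrightarrow> dist y z < \<delta> \<Longrightarrow> dist (f y) (f z) < e" using f z e unfolding continuous_on_iff by blast
  have "f z - e < f y \<and> f y < f z + e" if "y \<in> D" "dist z y < \<delta>" for y
    using \<delta>(2)[of y] that D by (auto simp: dist_commute dist_real_def abs_less_iff)
  then show ?thesis using \<delta>(1) by blast
qed

lemma ess_liminf_reg_continuous:
  fixes v :: "'n::finite pt \<Rightarrow> real"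
  assumes p: "p > 1" and D: "open D" "D \<subseteq> A" "A \<subseteq> closure D" and v: "continuous_on A v" and z: "z \<in> A"
    and f: "\<And>y. y \<in> D \<Longrightarrow> f y = ereal (v y)"
  shows "ess_liminf_reg p D f z = ereal (v z)"
proof (rule antisym)
  note s = continuous_on_sandwich[OF v z D(2)]
  show "ess_liminf_reg p D f z \<le> ereal (v z)"
  proof (rule ess_liminf_reg_le[OF D(1), where v=v])
    show "z \<in> closure D" using z D(3) by blast
    show "\<exists>\<delta>>0. \<forall>y\<in>D. dist z y < \<delta> \<longrightarrow> v y < v z + e" if "e > 0" for e using s[OF that] by meson
    show "f y \<le> ereal (v y)" if "y \<in> D" for y using f[OF that] by simp
  qed
  show "ereal (v z) \<le> ess_liminf_reg p D f z"
  proof (rule ess_liminf_reg_ge[OF p, where v=v])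
    show "\<exists>\<delta>>0. \<forall>y\<in>D. dist z y < \<delta> \<longrightarrow> v z - e < v y" if "e > 0" for e using s[OF that] by meson
  qed (use f in simp)
qed

context obstacle_problem
begin

lemma w_extension:
  obtains v where "continuous_on (closure D) v" "\<And>z. z \<in> D \<Longrightarrow> v z = w z" "\<And>z. z \<in> par_bdry \<Omega> T \<Longrightarrow> v z = \<psi> z"
proof -
  obtain v where v: "uniformly_continuous_on (closure D) v" "\<And>z. z \<in> D \<Longrightarrow> w z = v z"
    by (rule uniformly_continuous_on_extension_on_closure[OF w_uniformly_continuous]) (rule that)
  have vc: "continuous_on (closure D) v" by (rule uniformly_continuous_imp_continuous[OF v(1)])
  have d: "continuous_on (closure D) (\<lambda>z. \<psi> z - v z)" "continuous_on (closure D) (\<lambda>z. v z - \<psi> z)"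
    using vc \<psi>c by (auto intro!: continuous_intros)
  have eq: "v y = \<psi> y" if y: "y \<in> par_bdry \<Omega> T" for y
  proof (rule antisym)
    have yD: "y \<in> closure D" using y par_bdry_closure by blast
    have "\<psi> y - v y \<le> 0" by (rule continuous_le_on_closure[OF d(1) yD]) (use w_psi v(2) in force)
    then show "\<psi> y \<le> v y" by simp
    have "v y - \<psi> y \<le> 0"
    proof (rule field_le_epsilon)
      fix e :: real assume "e > 0"
      from near_boundary[OF this] obtain u \<delta> where u: "u \<in> Sc" "\<delta> > 0"
        "\<And>z y. z \<in> D \<Longrightarrow> y \<in> par_bdry \<Omega> T \<Longrightarrow> dist y z < \<delta> \<Longrightarrow> u z < \<psi> z + e" by blast
      have "y \<in> closure (ball y \<delta> \<inter> D)" using open_Int_closure_subset[OF open_ball, of y \<delta> D] yD u(2) by auto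
      moreover have "continuous_on (closure (ball y \<delta> \<inter> D)) (\<lambda>z. v z - \<psi> z)"
        by (rule continuous_on_subset[OF d(2)]) (intro closure_mono, blast)
      moreover have "v z - \<psi> z \<le> e" if "z \<in> ball y \<delta> \<inter> D" for z
      proof -
        have z: "z \<in> D" "dist y z < \<delta>" using that by auto
        show ?thesis using u(3)[OF z(1) y z(2)] w_le[OF u(1) z(1)] v(2)[OF z(1)] by linarith
      qed
      ultimately show "v y - \<psi> y \<le> 0 + e" using continuous_le_on_closure[of "ball y \<delta> \<inter> D" "\<lambda>z. v z - \<psi> z" y e] by simp
    qed
    then show "v y \<le> \<psi> y" by simp
  qed
  show ?thesis by (rule that[OF vc _ eq]) (simp_all add: v(2))
qed

lemma small_cylinder:
  assumes z0: "z0 \<in> D" and \<delta>: "\<delta> > 0" "ball z0 \<delta> \<subseteq> D"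
  obtains Q C \<tau> h where "open Q" "Q \<subseteq> C" "compact C" "C \<subseteq> ball z0 \<delta>" "z0 \<in> Q" "\<And>y. y \<in> Q \<Longrightarrow> snd y < \<tau>"
    "\<And>y. y \<in> C \<Longrightarrow> y \<notin> Q \<Longrightarrow> snd y = \<tau> \<or> h y = w y" "continuous_on C h" "weak_sol p Q h"
proof -
  obtain x1 where x1: "x1 \<in> D" using z0 by blast
  obtain B where B: "B > 0" "\<And>x. x \<in> closure D \<Longrightarrow> norm x \<le> B"
    using compact_imp_bounded[OF compact_closure_D] unfolding bounded_pos by blast
  define R where "R = 2 * B / \<delta> + 1"
  have R: "R > 0" "2 * B < R * \<delta>" using B(1) \<delta>(1) by (auto simp: R_def field_simps add_pos_pos)
  define b where "b = x1 - R *\<^sub>R z0"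
  define \<Phi> where "\<Phi> y = b + R *\<^sub>R y" for y
  define \<Psi> where "\<Psi> c = z0 + (1 / R) *\<^sub>R (c - x1)" for c
  have \<Phi>\<Psi>: "\<Phi> (\<Psi> c) = c" for c using R(1) by (simp add: \<Phi>_def \<Psi>_def b_def scaleR_add_right)
  have \<Psi>\<Phi>: "\<Psi> (\<Phi> y) = y" for y using R(1) by (simp add: \<Phi>_def \<Psi>_def b_def scaleR_add_right algebra_simps)
  have \<Phi>c: "continuous_on A \<Phi>" and \<Psi>c: "continuous_on A \<Psi>" for A
    unfolding \<Phi>_def \<Psi>_def by (intro continuous_intros)+
  define Q where "Q = {y. b + R *\<^sub>R y \<in> D}"
  define C where "C = \<Psi> ` closure D"
  have Q\<Phi>: "y \<in> Q \<longleftrightarrow> \<Phi> y \<in> D" for y by (simp add: Q_def \<Phi>_def)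
  have C\<Phi>: "\<Phi> y \<in> closure D" if "y \<in> C" for y using that \<Phi>\<Psi> by (auto simp: C_def)
  have "open (\<Phi> -` D)" by (rule open_vimage[OF D_open \<Phi>c])
  then have Qo: "open Q" by (simp add: vimage_def Q\<Phi>[symmetric])
  have QC: "Q \<subseteq> C"
  proof
    fix y assume "y \<in> Q"
    then have "\<Phi> y \<in> closure D" using Q\<Phi> D_closure by blast
    then have "\<Psi> (\<Phi> y) \<in> C" unfolding C_def by (rule imageI)
    then show "y \<in> C" by (simp only: \<Psi>\<Phi>)
  qed
  have Cc: "compact C" unfolding C_def by (rule compact_continuous_image[OF \<Psi>c compact_closure_D])
  have Cb: "C \<subseteq> ball z0 \<delta>"
  proof
    fix y assume "y \<in> C"
    then obtain c where c: "c \<in> closure D" "y = \<Psi> c" by (auto simp: C_def)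
    have "norm (c - x1) \<le> norm c + norm x1" by (rule norm_triangle_ineq4)
    also have "\<dots> \<le> 2 * B" using B(2)[OF c(1)] B(2)[OF subsetD[OF D_closure x1]] by simp
    also have "\<dots> < R * \<delta>" by (rule R)
    finally have "norm (c - x1) / R < \<delta>" using R(1) by (simp add: field_simps)
    then show "y \<in> ball z0 \<delta>" using R(1) by (simp add: c(2) \<Psi>_def dist_norm)
  qed
  have z0Q: "z0 \<in> Q" using x1 by (simp add: Q_def b_def)
  define \<kappa> where "\<kappa> = R powr (- (p - 1) / (p - 2))"
  have \<kappa>: "\<kappa> > 0" "\<kappa> powr (p - 2) * R powr (p - 1) = 1"
  proof -
    show "\<kappa> > 0" using R by (simp add: \<kappa>_def)
    have "\<kappa> powr (p - 2) = R powr (- (p - 1))" using p by (simp add: \<kappa>_def powr_powr)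
    then show "\<kappa> powr (p - 2) * R powr (p - 1) = 1" using R by (simp add: powr_add[symmetric])
  qed
  have "continuous_on (closure D) (\<lambda>c. (1 / \<kappa>) * w (\<Psi> c))"
    by (intro continuous_on_mult continuous_on_const continuous_on_compose2[OF w_continuous \<Psi>c])
      (use Cb \<delta>(2) in \<open>auto simp: C_def\<close>)
  then obtain h0 where h0: "continuous_on (closure D) h0" "p_parabolic p D h0" "\<And>z. z \<in> par_bdry \<Omega> T \<Longrightarrow> h0 z = (1 / \<kappa>) * w (\<Psi> z)"
    using reg unfolding regular_cyl_def by blast
  define h where "h y = \<kappa> * h0 (b + R *\<^sub>R y)" for y
  have hs: "weak_sol p Q h"
    unfolding h_def Q_def by (rule weak_sol_affine[OF p D_open R(1) \<kappa>]) (use h0(2) in \<open>simp add: p_parabolic_def\<close>)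
  have hc: "continuous_on C h"
    unfolding h_def \<Phi>_def[symmetric]
    by (intro continuous_on_mult continuous_on_const continuous_on_compose2[OF h0(1) \<Phi>c]) (use C\<Phi> in auto)
  define \<tau> where "\<tau> = (T - snd b) / R"
  have "snd y < \<tau>" if "y \<in> Q" for y
    using D_time[of "\<Phi> y"] that R(1) unfolding Q\<Phi> by (simp add: \<Phi>_def \<tau>_def field_simps)
  moreover have "snd y = \<tau> \<or> h y = w y" if y: "y \<in> C" "y \<notin> Q" for y
  proof -
    from bdry_cases[of "\<Phi> y"] y C\<Phi> Q\<Phi> consider "\<Phi> y \<in> par_bdry \<Omega> T" | "snd (\<Phi> y) = T" by blast
    then show ?thesis
    proof cases
      case 1
      then have "h y = w (\<Psi> (\<Phi> y))" using h0(3)[OF 1] \<kappa>(1) by (simp add: h_def \<Phi>_def)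
      then show ?thesis by (simp add: \<Psi>\<Phi>)
    next
      case 2
      then show ?thesis using R(1) by (simp add: \<Phi>_def \<tau>_def field_simps)
    qed
  qed
  ultimately show ?thesis by (rule that[OF Qo QC Cc Cb z0Q _ _ hc hs])
qed

lemma local_solution:
  assumes z0: "z0 \<in> D" "\<psi> z0 < w z0"
  shows "\<exists>Q. open Q \<and> z0 \<in> Q \<and> Q \<subseteq> {z \<in> D. \<psi> z < w z} \<and> weak_sol p Q w"
proof -
  define c0 where "c0 = (\<psi> z0 + w z0) / 2"
  have c0: "\<psi> z0 < c0" "c0 < w z0" using z0(2) by (auto simp: c0_def)
  let ?G = "(D \<inter> \<psi> -` {..<c0}) \<inter> (D \<inter> w -` {c0<..})"
  have "open ?G"
    by (intro open_Int continuous_open_preimage D_open open_lessThan open_greaterThan w_continuous continuous_on_subset[OF \<psi>c D_closure])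
  moreover have "z0 \<in> ?G" using z0(1) c0 by simp
  ultimately obtain \<delta> where \<delta>: "\<delta> > 0" "ball z0 \<delta> \<subseteq> ?G" using open_contains_ball by blast
  have bD: "ball z0 \<delta> \<subseteq> D" using \<delta>(2) by blast
  obtain Q C \<tau> h where Q: "open Q" "Q \<subseteq> C" "compact C" "C \<subseteq> ball z0 \<delta>" "z0 \<in> Q" and \<tau>: "\<And>y. y \<in> Q \<Longrightarrow> snd y < \<tau>"
    and bd: "\<And>y. y \<in> C \<Longrightarrow> y \<notin> Q \<Longrightarrow> snd y = \<tau> \<or> h y = w y" and h: "continuous_on C h" "weak_sol p Q h"
    by (rule small_cylinder[OF z0(1) \<delta>(1) bD]) (rule that)
  have CD: "C \<subseteq> D" and QD: "Q \<subseteq> D" using Q bD by auto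
  have Cw: "\<psi> y < c0" "c0 < w y" if "y \<in> C" for y using that Q(4) \<delta>(2) by auto
  have low: "c0 \<le> h y" if y: "y \<in> Q" for y
  proof (rule comparison_continuous[OF p Q(1-3) \<tau> _ h(1) continuous_on_const weak_sol_const[OF p Q(1)] weak_sol_imp_supersol[OF h(2)] y])
    show "snd y = \<tau> \<or> c0 \<le> h y" if "y \<in> C" "y \<notin> Q" for y using bd[OF that] Cw(2)[OF that(1)] by auto
  qed
  have up: "h y \<le> w y" if y: "y \<in> Q" for y
  proof (rule w_ge)
    fix u assume u: "u \<in> Sc"
    then have u': "continuous_on C u" "weak_supersol p Q u"
      using continuous_on_subset[OF _ CD] weak_supersol_subset[OF _ QD Q(1)] by (auto simp: Sc_def)
    show "h y \<le> u y"
    proof (rule comparison_continuous[OF p Q(1-3) \<tau> _ u'(1) h u'(2) y])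
      show "snd y = \<tau> \<or> h y \<le> u y" if "y \<in> C" "y \<notin> Q" for y using bd[OF that] w_le[OF u subsetD[OF CD that(1)]] by auto
    qed
  qed
  obtain B where B: "B > 0" "\<And>y. y \<in> C \<Longrightarrow> \<bar>h y\<bar> \<le> B"
    using compact_imp_bounded[OF compact_continuous_image[OF h(1) Q(3)]] unfolding bounded_pos by auto
  have "w y0 \<le> h y0" if y0: "y0 \<in> Q" for y0
  proof (rule field_le_epsilon)
    fix e :: real assume e: "e > 0"
    obtain u where uS: "u \<in> Sc" and ue: "\<And>z. z \<in> C \<Longrightarrow> u z < w z + e" using w_dini[OF Q(3) CD e] by blast
    then have u: "continuous_on D u" "weak_supersol p D u" by (auto simp: Sc_def)
    define M where "M = (L + 1 + B) / (\<tau> - snd y0)\<^sup>2"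
    have M: "M \<ge> 0" "M * (\<tau> - snd y0)\<^sup>2 = L + 1 + B" using L_nonneg B(1) \<tau>[OF y0] by (auto simp: M_def)
    define u2 where "u2 y = (h y + e) + M * (max 0 (snd y - snd y0))\<^sup>2" for y
    have u2h: "h y + e \<le> u2 y" for y using M(1) by (simp add: u2_def)
    have s2: "weak_supersol p Q u2"
      unfolding u2_def by (rule supersol_add_ramp[OF p Q(1) supersol_add_const[OF p Q(1) weak_sol_imp_supersol[OF h(2)]] M(1)])
    have c2: "continuous_on C u2" unfolding u2_def by (intro continuous_intros h(1))
    have out: "u y < u2 y" if y: "y \<in> C" "y \<notin> Q" for y
      using bd[OF y]
    proof
      assume "snd y = \<tau>"
      then have "u2 y = h y + e + (L + 1 + B)" using M(2) \<tau>[OF y0] by (simp add: u2_def)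
      then show ?thesis using B(2)[OF y(1)] ue[OF y(1)] w_L[OF subsetD[OF CD y(1)]] by linarith
    next
      assume "h y = w y"
      then show ?thesis using u2h[of y] ue[OF y(1)] by linarith
    qed
    have "closedin (top_of_set C) (C \<inter> (\<lambda>y. u2 y - u y) -` {..0})"
      by (intro continuous_closedin_preimage closed_atMost continuous_on_diff c2 continuous_on_subset[OF u(1) CD])
    then have "closed (C \<inter> (\<lambda>y. u2 y - u y) -` {..0})" by (rule closedin_closed_trans[OF _ compact_imp_closed[OF Q(3)]])
    moreover have "C \<inter> (\<lambda>y. u2 y - u y) -` {..0} = {y \<in> Q. u2 y \<le> u y}"
      using out Q(2) by fastforce
    ultimately have "closed {y \<in> Q. u2 y \<le> u y}" by simp
    then have cl: "closedin (top_of_set D) {y \<in> Q. u2 y \<le> u y}" using QD by (intro closed_subset) auto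
    define m where "m y = (if y \<in> Q then min (u y) (u2 y) else u y)" for y
    have m: "weak_supersol p D m" "continuous_on D m"
      using supersol_paste[OF p D_open Q(1) QD u(2) s2 u(1) continuous_on_subset[OF c2 Q(2)] cl] unfolding m_def[abs_def] by auto
    have "\<psi> y \<le> m y" if y: "y \<in> D" for y
    proof (cases "y \<in> Q")
      case True
      then have "\<psi> y \<le> u2 y" using u2h[of y] low[OF True] Cw(1)[OF subsetD[OF Q(2) True]] e by linarith
      then show ?thesis using Sc_ge[OF uS y] by (simp add: m_def)
    qed (use Sc_ge[OF uS y] in \<open>simp add: m_def\<close>)
    then have "m \<in> Sc" using m unfolding Sc_def by blast
    then have "w y0 \<le> m y0" using w_le QD y0 by blast
    also have "m y0 \<le> u2 y0" using y0 by (simp add: m_def)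
    also have "u2 y0 = h y0 + e" by (simp add: u2_def)
    finally show "w y0 \<le> h y0 + e" .
  qed
  then have "weak_sol p Q w" using up by (intro weak_sol_cong[OF p Q(1) h(2)]) (auto intro: antisym)
  moreover have "Q \<subseteq> {z \<in> D. \<psi> z < w z}" using less_trans[OF Cw] Q(2) QD by blast
  ultimately show ?thesis using Q(1,5) by blast
qed

lemma noncontact_open: "open {z \<in> D. \<psi> z < w z}"
proof -
  have "open (D \<inter> (\<lambda>z. w z - \<psi> z) -` {0<..})"
    by (intro continuous_open_preimage D_open open_greaterThan continuous_on_diff w_continuous continuous_on_subset[OF \<psi>c D_closure])
  moreover have "D \<inter> (\<lambda>z. w z - \<psi> z) -` {0<..} = {z \<in> D. \<psi> z < w z}" by auto
  ultimately show ?thesis by simp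
qed

lemma w_solution: "weak_sol p {z \<in> D. \<psi> z < w z} w"
  by (rule weak_sol_local[OF p]) (use local_solution in blast)

lemma w_le_supersol_AE:
  assumes u: "weak_supersol p D u" and ae: "AE z in lborel. z \<in> D \<longrightarrow> \<psi> z \<le> u z"
  shows "AE z in lborel. z \<in> D \<longrightarrow> w z \<le> u z"
proof -
  let ?W = "{z \<in> D. \<psi> z < w z}"
  obtain v where v: "continuous_on (closure D) v" "\<And>z. z \<in> D \<Longrightarrow> v z = w z" "\<And>z. z \<in> par_bdry \<Omega> T \<Longrightarrow> v z = \<psi> z"
    by (rule w_extension) (rule that)
  have "AE z in lborel. z \<in> ?W \<and> snd z < T - e \<longrightarrow> w z \<le> u z + e" if e: "e > 0" for e
  proof -
    let ?F = "closure D \<inter> (\<lambda>z. snd z - (T - e)) -` {..0} \<inter> (closure D \<inter> (\<lambda>z. \<psi> z + e - v z) -` {..0})"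
    have "closedin (top_of_set (closure D)) ?F"
      by (intro closedin_Int continuous_closedin_preimage closed_atMost continuous_intros \<psi>c v(1))
    then have F: "compact ?F" using closedin_compact[OF compact_closure_D] by blast
    have FW: "?F \<subseteq> ?W"
    proof
      fix z assume z: "z \<in> ?F"
      then have z': "z \<in> closure D" "snd z \<le> T - e" "\<psi> z + e \<le> v z" by simp_all
      have "z \<in> D" using bdry_cases[OF z'(1)] z'(2,3) v(3)[of z] e by force
      then show "z \<in> ?W" using z'(3) v(2)[of z] e by simp
    qed
    show ?thesis
    proof (rule comparison[OF p noncontact_open w_solution _ F FW])
      show "weak_supersol p ?W (\<lambda>z. u z + e)"
        by (rule supersol_add_const[OF p noncontact_open weak_supersol_subset[OF u _ noncontact_open]]) blast
      show "AE z in lborel. z \<in> ?W \<and> snd z \<le> T - e \<and> u z + e < w z \<longrightarrow> z \<in> ?F"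
        using ae
      proof eventually_elim
        case (elim z)
        show ?case
        proof
          assume z: "z \<in> ?W \<and> snd z \<le> T - e \<and> u z + e < w z"
          then have zD: "z \<in> D" by simp
          then show "z \<in> ?F" using z elim v(2)[OF zD] subsetD[OF D_closure zD] by simp
        qed
      qed
    qed
  qed
  then have "AE z in lborel. \<forall>n. z \<in> ?W \<and> snd z < T - inverse (real (Suc n)) \<longrightarrow> w z \<le> u z + inverse (real (Suc n))"
    unfolding AE_all_countable by simp
  then show ?thesis using ae
  proof eventually_elim
    case (elim z)
    show ?case
    proof
      assume zD: "z \<in> D"
      show "w z \<le> u z"
      proof (cases "\<psi> z < w z")
        case True
        show ?thesis
        proof (rule field_le_epsilon)
          fix e :: real assume "e > 0"
          then have "0 < min e (T - snd z)" using D_time[OF zD] by simp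
          then obtain n where "inverse (real (Suc n)) < min e (T - snd z)" using reals_Archimedean by blast
          then have n: "inverse (real (Suc n)) < e" "snd z < T - inverse (real (Suc n))" by simp_all
          have "z \<in> ?W" using zD True by simp
          then have "w z \<le> u z + inverse (real (Suc n))" using elim(1) n(2) by blast
          then show "w z \<le> u z + e" using n(1) by linarith
        qed
      next
        case False
        then show ?thesis using elim(2) zD by force
      qed
    qed
  qed
qed

lemma w_le_S_obst:
  assumes u: "u \<in> S_obst p \<Omega> T \<psi>" and z: "z \<in> D"
  shows "ereal (w z) \<le> u z"
proof -
  obtain u' where u': "AE z in lborel. z \<in> D \<longrightarrow> u z = ereal (u' z)" "weak_supersol p D u'"
    using u by (auto simp: S_obst_def weak_supersol_e_def)
  have r: "u z = ess_liminf_reg p D u z" and ae: "AE z in lborel. z \<in> D \<longrightarrow> ereal (\<psi> z) \<le> u z"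
    using u z unfolding S_obst_def by blast+
  have "AE z in lborel. z \<in> D \<longrightarrow> \<psi> z \<le> u' z" using ae u'(1) by eventually_elim simp
  from w_le_supersol_AE[OF u'(2) this] u'(1) have "AE z in lborel. z \<in> D \<longrightarrow> ereal (w z) \<le> u z" by eventually_elim simp
  then have "ereal (w z) \<le> ess_liminf_reg p D u z"
  proof (rule ess_liminf_reg_ge[rotated 2, where v=w])
    show "p > 1" using p by simp
    show "\<exists>\<delta>>0. \<forall>y\<in>D. dist z y < \<delta> \<longrightarrow> w z - e < w y" if "e > 0" for e
      using continuous_on_sandwich[OF w_continuous z subset_refl that] by meson
  qed
  then show ?thesis by (simp only: r[symmetric])
qed

lemma Sc_S_obst: "u \<in> Sc \<Longrightarrow> (\<lambda>z. ereal (u z)) \<in> S_obst p \<Omega> T \<psi>"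
  unfolding S_obst_def weak_supersol_e_def
  using ess_liminf_reg_continuous[of p D D u _ "\<lambda>z. ereal (u z)"] D_open D_closure p by (auto simp: Sc_def)

lemma Inf_S_obst:
  assumes z: "z \<in> D"
  shows "Inf {u z | u. u \<in> S_obst p \<Omega> T \<psi>} = ereal (w z)"
proof (rule antisym)
  show "ereal (w z) \<le> Inf {u z | u. u \<in> S_obst p \<Omega> T \<psi>}" by (rule Inf_greatest) (use w_le_S_obst z in blast)
  show "Inf {u z | u. u \<in> S_obst p \<Omega> T \<psi>} \<le> ereal (w z)"
  proof (rule ereal_le_epsilon2)
    fix e :: real assume "0 < e"
    from w_approx[OF this] obtain u where u: "u \<in> Sc" "u z < w z + e" by blast
    have "Inf {u z | u. u \<in> S_obst p \<Omega> T \<psi>} \<le> ereal (u z)" 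
      by (intro Inf_lower CollectI exI[of _ "\<lambda>z. ereal (u z)"] conjI Sc_S_obst[OF u(1)]) simp
    also have "\<dots> \<le> ereal (w z) + ereal e" using u(2) by simp
    finally show "Inf {u z | u. u \<in> S_obst p \<Omega> T \<psi>} \<le> ereal (w z) + ereal e" .
  qed
qed

lemma least_sol_properties:
  "\<exists>v. continuous_on (closure D) v \<and> (\<forall>z\<in>closure D. least_sol p \<Omega> T \<psi> z = ereal (v z))
    \<and> (\<forall>z\<in>par_bdry \<Omega> T. v z = \<psi> z) \<and> p_parabolic p {z \<in> D. v z > \<psi> z} v"
proof -
  obtain v where v: "continuous_on (closure D) v" "\<And>z. z \<in> D \<Longrightarrow> v z = w z" "\<And>z. z \<in> par_bdry \<Omega> T \<Longrightarrow> v z = \<psi> z"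
    by (rule w_extension) (rule that)
  have "least_sol p \<Omega> T \<psi> z = ereal (v z)" if z: "z \<in> closure D" for z
    unfolding least_sol_def
    by (rule ess_liminf_reg_continuous[OF _ D_open D_closure subset_refl v(1) z]) (use p v(2) Inf_S_obst in simp_all)
  moreover have "{z \<in> D. v z > \<psi> z} = {z \<in> D. \<psi> z < w z}" using v(2) by (intro Collect_cong conj_cong refl) simp
  moreover have "weak_sol p {z \<in> D. \<psi> z < w z} v" by (rule weak_sol_cong[OF p noncontact_open w_solution]) (use v(2) in simp)
  moreover have "continuous_on {z \<in> D. \<psi> z < w z} v" by (rule continuous_on_subset[OF v(1)]) (use D_closure in blast)
  ultimately show ?thesis using v(1,3) by (intro exI[of _ v]) (simp add: p_parabolic_def)
qed

end

theorem theorem3p2: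
  fixes p T L :: real and \<Omega> :: "(real^'n::finite) set" and \<psi> :: "'n pt \<Rightarrow> real"
  assumes "p > 2" and "T > 0"
    and "open \<Omega>" and "connected \<Omega>" and "bounded \<Omega>" and "\<Omega> \<noteq> {}"
    and "regular_cyl p \<Omega> T"
    and "continuous_on (closure (cyl \<Omega> T)) \<psi>"
    and "\<And>z. z \<in> closure (cyl \<Omega> T) \<Longrightarrow> 0 \<le> \<psi> z \<and> \<psi> z \<le> L"
  shows "\<exists>v. continuous_on (closure (cyl \<Omega> T)) v
           \<and> (\<forall>z\<in>closure (cyl \<Omega> T). least_sol p \<Omega> T \<psi> z = ereal (v z))
           \<and> (\<forall>z\<in>par_bdry \<Omega> T. v z = \<psi> z)
           \<and> p_parabolic p {z\<in>cyl \<Omega> T. v z > \<psi> z} v"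
proof -
  interpret obstacle_problem p T L \<Omega> \<psi> by unfold_locales (use assms in auto)
  show ?thesis by (rule least_sol_properties)
qed

end
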